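(* Let $G=(V,E)$ and $G'=(V',E')$ be directed graphs. The following are equivalent: (1) $G$ and $G'$ are isomorphic directed graphs. (2) $X(G)$ and $X(G')$ are unitarily isomorphic $C^*$-correspondences. (3) $\mathcal{T}_+(G)$ and $\mathcal{T}_+(G')$ are graded completely isometrically isomorphic. (4) $\mathcal{T}(G)$ and $\mathcal{T}(G')$ are base-preserving graded *-isomorphic (there is a single *-isomorphism that is both base-preserving and graded).
   Context: A directed graph $G=(V,E,r,s)$ has vertex set $V$, edge set $E$ and range and source maps $r,s:E\to V$. Graph correspondence: on finitely supported functions $c_f(E)$ define, for $x,y\in c_f(E)$, $a\in c_0(V)$, $(x\cdot a)(e)=x(e)a(s(e))$, $\langle x,y\rangle(v)=\sum_{e\in s^{-1}(v)}\overline{x(e)}y(e)$, and left action $(\phi(a)x)(e)=a(r(e))x(e)$. $X(G)$ is the completion; it is a $C^*$-correspondence over $c_0(V)$ (a right Hilbert $c_0(V)$-module with a *-homomorphism $c_0(V)\to\mathcal{L}(X(G))$). Unitary isomorphism: $C^*$-correspondences $X$ over $\mathcal{A}$ and $Y$ over $\mathcal{B}$ are unitarily isomorphic if there are a surjective isometric linear map $U:X\to Y$ and a *-isomorphism $\rho:\mathcal{A}\to\mathcal{B}$ with $U(a\xi b)=\rho(a)U(\xi)\rho(b)$ for all $a,b\in\mathcal{A}$, $\xi\in X$. For a $C^*$-correspondence $X$ over $\mathcal{A}$, let $\mathcal{F}(X)=\bigoplus_{n\ge 0}X^{\otimes n}$ (interior tensor powers, $X^{\otimes 0}=\mathcal{A}$),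 $\iota=\phi_{\mathcal{F}(X)}:\mathcal{A}\to\mathcal{L}(\mathcal{F}(X))$ (injective), $T_\xi(a)=\xi a$, $T_\xi(\xi_1\otimes\dots\otimes\xi_n)=\xi\otimes\xi_1\otimes\dots\otimes\xi_n$. $\mathcal{T}(X)$ is the $C^*$-algebra, and $\mathcal{T}_+(X)$ the norm-closed operator algebra, generated by $\iota(\mathcal{A})$ and $\{T_\xi\}_{\xi\in X}$. There is a circle action $\gamma$ with $\gamma_z(\iota(a))=\iota(a)$, $\gamma_z(T_\xi)=zT_\xi$; $\mathcal{T}(X)_n=\{x\in\mathcal{T}(X):\gamma_z(x)=z^nx\ \forall z\in\mathbb{T}\}$ for $n\in\mathbb{Z}$ and $\mathcal{T}_+(X)_n=\mathcal{T}(X)_n\cap\mathcal{T}_+(X)$ for $n\ge 0$. Put $\mathcal{T}(G)=\mathcal{T}(X(G))$ and $\mathcal{T}_+(G)=\mathcal{T}_+(X(G))$. ($\mathcal{T}(G)$ is the universal $C^*$-algebra of Toeplitz–Cuntz–Krieger families of $G$.) A *-isomorphism $\mathcal{T}(G)\to\mathcal{T}(G')$ is base-preserving if it maps $c_0(V)$ (identified with $\iota(c_0(V))$) onto $c_0(V')$, and graded if it maps $\mathcal{T}(G)_n$ onto $\mathcal{T}(G')_n$ for all $n\in\mathbb{Z}$. A completely isometric isomorphism $\mathcal{T}_+(G)\to\mathcal{T}_+(G')$ is graded if it maps $\mathcal{T}_+(G)_n$ onto $\mathcal{T}_+(G')_n$ for all $n\ge 0$. *)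

theory Defs
  imports Complex_Main "HOL-Library.FuncSet" "HOL-Library.Poly_Mapping"
    "HOL-Library.Function_Algebras" "Graph_Theory.Digraph_Isomorphism"
begin

section \<open>C*-algebras of coefficients and C*-correspondences\<close>

text \<open>
  A coefficient algebra is a subset of a type of class \<open>ring\<close>; sums and products are those of the
  ring, the remaining structure is explicit. In a correspondence \<open>X\<close> over \<open>coeff X\<close>,
  \<open>Xright X x a\<close> is \<open>x \<cdot> a\<close>, \<open>Xleft X a x\<close> is \<open>\<phi>(a) x\<close>, and \<open>Xinner\<close> is conjugate
  linear in the first variable.
\<close>

record 'a coeff_alg =
  Acar :: "'a set"
  Ascale :: "complex \<Rightarrow> 'a \<Rightarrow> 'a"
  Astar :: "'a \<Rightarrow> 'a"
  Anorm :: "'a \<Rightarrow> real"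

record ('a, 'x) corr =
  coeff :: "'a coeff_alg"
  Xcar :: "'x set"
  Xzero :: 'x
  Xadd :: "'x \<Rightarrow> 'x \<Rightarrow> 'x"
  Xscale :: "complex \<Rightarrow> 'x \<Rightarrow> 'x"
  Xright :: "'x \<Rightarrow> 'a \<Rightarrow> 'x"
  Xleft :: "'a \<Rightarrow> 'x \<Rightarrow> 'x"
  Xinner :: "'x \<Rightarrow> 'x \<Rightarrow> 'a"

definition Xnorm :: "('a, 'x) corr \<Rightarrow> 'x \<Rightarrow> real" where
  "Xnorm X x = sqrt (Anorm (coeff X) (Xinner X x x))"

definition Xdist :: "('a, 'x) corr \<Rightarrow> 'x \<Rightarrow> 'x \<Rightarrow> real" where
  "Xdist X x y = Xnorm X (Xadd X x (Xscale X (- 1) y))"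

primrec Xsum :: "('a, 'x) corr \<Rightarrow> (nat \<Rightarrow> 'x) \<Rightarrow> nat \<Rightarrow> 'x" where
  "Xsum X f 0 = Xzero X"
| "Xsum X f (Suc n) = Xadd X (Xsum X f n) (f n)"

definition coeff_iso :: "'a::ring coeff_alg \<Rightarrow> 'b::ring coeff_alg \<Rightarrow> ('a \<Rightarrow> 'b) \<Rightarrow> bool" where
  "coeff_iso A B \<rho> \<longleftrightarrow> bij_betw \<rho> (Acar A) (Acar B) \<and>
     (\<forall>a\<in>Acar A. \<forall>b\<in>Acar A. \<rho> (a + b) = \<rho> a + \<rho> b \<and> \<rho> (a * b) = \<rho> a * \<rho> b) \<and>
     (\<forall>a\<in>Acar A. (\<forall>c. \<rho> (Ascale A c a) = Ascale B c (\<rho> a)) \<and> \<rho> (Astar A a) = Astar B (\<rho> a))"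

definition unitarily_isomorphic ::
    "('a::ring, 'x) corr \<Rightarrow> ('b::ring, 'y) corr \<Rightarrow> bool" where
  "unitarily_isomorphic X Y \<longleftrightarrow> (\<exists>U \<rho>.
     U ` Xcar X = Xcar Y \<and>
     (\<forall>x\<in>Xcar X. Xnorm Y (U x) = Xnorm X x) \<and>
     (\<forall>x\<in>Xcar X. \<forall>y\<in>Xcar X. U (Xadd X x y) = Xadd Y (U x) (U y)) \<and>
     (\<forall>x\<in>Xcar X. \<forall>c. U (Xscale X c x) = Xscale Y c (U x)) \<and>
     coeff_iso (coeff X) (coeff Y) \<rho> \<and>
     (\<forall>a\<in>Acar (coeff X). \<forall>b\<in>Acar (coeff X). \<forall>x\<in>Xcar X.
        U (Xright X (Xleft X a x) b) = Xright Y (Xleft Y (\<rho> a) (U x)) (\<rho> b)))"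


section \<open>Completion of a semi-inner-product correspondence\<close>

text \<open>
  The completion consists of the Cauchy sequences modulo null sequences; in particular vectors of
  length zero are divided out.
\<close>

definition cauchy_seqs :: "('a, 'x) corr \<Rightarrow> (nat \<Rightarrow> 'x) set" where
  "cauchy_seqs P = {x. (\<forall>n. x n \<in> Xcar P) \<and>
     (\<forall>\<epsilon>>0. \<exists>N. \<forall>m\<ge>N. \<forall>n\<ge>N. Xdist P (x m) (x n) < \<epsilon>)}"

definition cauchy_class :: "('a, 'x) corr \<Rightarrow> (nat \<Rightarrow> 'x) \<Rightarrow> (nat \<Rightarrow> 'x) set" where
  "cauchy_class P x = {y \<in> cauchy_seqs P. (\<lambda>n. Xdist P (x n) (y n)) \<longlonglongrightarrow> 0}"

text \<open>Extension of a bounded linear map to the completion, termwise on Cauchy sequences.\<close>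

definition extend ::
    "('a, 'x) corr \<Rightarrow> ('x \<Rightarrow> 'x) \<Rightarrow> (nat \<Rightarrow> 'x) set \<Rightarrow> (nat \<Rightarrow> 'x) set" where
  "extend P h S = (\<Union>x\<in>S. cauchy_class P (\<lambda>n. h (x n)))"

definition completion :: "('a::ring, 'x) corr \<Rightarrow> ('a, (nat \<Rightarrow> 'x) set) corr" where
  "completion P = \<lparr>
     coeff = coeff P,
     Xcar = cauchy_class P ` cauchy_seqs P,
     Xzero = cauchy_class P (\<lambda>_. Xzero P),
     Xadd = (\<lambda>S T. \<Union>x\<in>S. \<Union>y\<in>T. cauchy_class P (\<lambda>n. Xadd P (x n) (y n))),
     Xscale = (\<lambda>c. extend P (Xscale P c)),
     Xright = (\<lambda>S a. extend P (\<lambda>x. Xright P x a) S),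
     Xleft = (\<lambda>a. extend P (Xleft P a)),
     Xinner = (\<lambda>S T. THE a. a \<in> Acar (coeff P) \<and>
       (\<forall>x\<in>S. \<forall>y\<in>T. (\<lambda>n. Anorm (coeff P) (Xinner P (x n) (y n) - a)) \<longlonglongrightarrow> 0)) \<rparr>"


section \<open>The graph correspondence\<close>

text \<open>
  Graphs are those of \<^theory>\<open>Graph_Theory.Digraph\<close>, with source map \<^const>\<open>tail\<close> and range map
  \<^const>\<open>head\<close>. Multiple edges and loops are allowed, and there are no cardinality restrictions.
  Functions on the vertex set are extended by 0 to the whole type. The element 0 is adjoined to
  the supremum only to give the norm its correct value when there are no vertices.
\<close>

definition c0 :: "'v set \<Rightarrow> ('v \<Rightarrow> complex) coeff_alg" where
  "c0 V = \<lparr>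
     Acar = {a. (\<forall>v. v \<notin> V \<longrightarrow> a v = 0) \<and> (\<forall>\<epsilon>>0. finite {v\<in>V. \<epsilon> \<le> cmod (a v)})},
     Ascale = (\<lambda>c a v. c * a v),
     Astar = (\<lambda>a v. cnj (a v)),
     Anorm = (\<lambda>a. Sup (insert 0 ((\<lambda>v. cmod (a v)) ` V))) \<rparr>"

definition graph_precorr ::
    "('v, 'e) pre_digraph \<Rightarrow> ('v \<Rightarrow> complex, 'e \<Rightarrow>\<^sub>0 complex) corr" where
  "graph_precorr G = \<lparr>
     coeff = c0 (verts G),
     Xcar = {x. Poly_Mapping.keys x \<subseteq> arcs G},
     Xzero = 0,
     Xadd = (+),
     Xscale = (\<lambda>c. Poly_Mapping.mapp (\<lambda>_ z. c * z)),
     Xright = (\<lambda>x a. Poly_Mapping.mapp (\<lambda>e z. z * a (tail G e)) x),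
     Xleft = (\<lambda>a. Poly_Mapping.mapp (\<lambda>e z. a (head G e) * z)),
     Xinner = (\<lambda>x y v.
       \<Sum>e | e \<in> Poly_Mapping.keys x \<and> tail G e = v.
         cnj (Poly_Mapping.lookup x e) * Poly_Mapping.lookup y e) \<rparr>"

definition graph_corr ::
    "('v, 'e) pre_digraph \<Rightarrow> ('v \<Rightarrow> complex, (nat \<Rightarrow> 'e \<Rightarrow>\<^sub>0 complex) set) corr" where
  "graph_corr G = completion (graph_precorr G)"


section \<open>The Fock correspondence\<close>

text \<open>
  The Fock correspondence is the completion of the space of formal finite linear combinations of
  elements of the coefficient algebra (tensor degree 0) and of elementary tensors
  \<open>\<xi>\<^sub>1 \<otimes> \<dots> \<otimes> \<xi>\<^sub>n\<close>, \<open>n \<ge> 1\<close>, which are written \<open>Tensor \<xi>\<^sub>1 [\<xi>\<^sub>2, \<dots>, \<xi>\<^sub>n]\<close>. Different degrees are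
  orthogonal, and within a degree the semi-inner product is that of the interior tensor product,
  \<open>\<langle>\<xi> \<otimes> u, \<eta> \<otimes> v\<rangle> = \<langle>u, \<phi>(\<langle>\<xi>, \<eta>\<rangle>) v\<rangle>\<close>. Multilinearity and the balancing relations
  \<open>\<xi> a \<otimes> \<eta> = \<xi> \<otimes> \<phi>(a) \<eta>\<close> hold modulo vectors of length zero, hence in the completion.
\<close>

datatype ('a, 'x) fock_gen = Coeff 'a | Tensor 'x "'x list"

definition fock_gens :: "('a, 'x) corr \<Rightarrow> ('a, 'x) fock_gen set" where
  "fock_gens X = Coeff ` Acar (coeff X) \<union> {Tensor \<xi> \<xi>s |\<xi> \<xi>s. \<xi> \<in> Xcar X \<and> set \<xi>s \<subseteq> Xcar X}"

fun gen_left :: "('a::ring, 'x) corr \<Rightarrow> 'a \<Rightarrow> ('a, 'x) fock_gen \<Rightarrow> ('a, 'x) fock_gen" where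
  "gen_left X a (Coeff b) = Coeff (a * b)"
| "gen_left X a (Tensor \<xi> \<xi>s) = Tensor (Xleft X a \<xi>) \<xi>s"

fun gen_right :: "('a::ring, 'x) corr \<Rightarrow> ('a, 'x) fock_gen \<Rightarrow> 'a \<Rightarrow> ('a, 'x) fock_gen" where
  "gen_right X (Coeff b) a = Coeff (b * a)"
| "gen_right X (Tensor \<xi> []) a = Tensor (Xright X \<xi> a) []"
| "gen_right X (Tensor \<xi> (\<eta> # \<xi>s)) a =
     Tensor \<xi> (butlast (\<eta> # \<xi>s) @ [Xright X (last (\<eta> # \<xi>s)) a])"

fun gen_create :: "('a, 'x) corr \<Rightarrow> 'x \<Rightarrow> ('a, 'x) fock_gen \<Rightarrow> ('a, 'x) fock_gen" where
  "gen_create X \<xi> (Coeff a) = Tensor (Xright X \<xi> a) []"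
| "gen_create X \<xi> (Tensor \<eta> \<eta>s) = Tensor \<xi> (\<eta> # \<eta>s)"

fun tensor_inner :: "('a::ring, 'x) corr \<Rightarrow> 'x list \<Rightarrow> 'x list \<Rightarrow> 'a" where
  "tensor_inner X [\<xi>] [\<eta>] = Xinner X \<xi> \<eta>"
| "tensor_inner X (\<xi> # \<xi>' # \<xi>s) (\<eta> # \<eta>' # \<eta>s) =
     tensor_inner X (\<xi>' # \<xi>s) (Xleft X (Xinner X \<xi> \<eta>) \<eta>' # \<eta>s)"
| "tensor_inner X _ _ = 0"

fun gen_inner :: "('a::ring, 'x) corr \<Rightarrow> ('a, 'x) fock_gen \<Rightarrow> ('a, 'x) fock_gen \<Rightarrow> 'a" where
  "gen_inner X (Coeff a) (Coeff b) = Astar (coeff X) a * b"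
| "gen_inner X (Tensor \<xi> \<xi>s) (Tensor \<eta> \<eta>s) = tensor_inner X (\<xi> # \<xi>s) (\<eta> # \<eta>s)"
| "gen_inner X _ _ = 0"

text \<open>Linear extension of a map between generators to formal linear combinations.\<close>

definition linear_ext :: "('g \<Rightarrow> 'h) \<Rightarrow> ('g \<Rightarrow>\<^sub>0 complex) \<Rightarrow> ('h \<Rightarrow>\<^sub>0 complex)" where
  "linear_ext h f = (\<Sum>w\<in>Poly_Mapping.keys f. Poly_Mapping.single (h w) (Poly_Mapping.lookup f w))"

definition fock_precorr ::
    "('a::ring, 'x) corr \<Rightarrow> ('a, ('a, 'x) fock_gen \<Rightarrow>\<^sub>0 complex) corr" where
  "fock_precorr X = \<lparr>
     coeff = coeff X,
     Xcar = {f. Poly_Mapping.keys f \<subseteq> fock_gens X},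
     Xzero = 0,
     Xadd = (+),
     Xscale = (\<lambda>c. Poly_Mapping.mapp (\<lambda>_ z. c * z)),
     Xright = (\<lambda>f a. linear_ext (\<lambda>w. gen_right X w a) f),
     Xleft = (\<lambda>a. linear_ext (gen_left X a)),
     Xinner = (\<lambda>f g. \<Sum>w\<in>Poly_Mapping.keys f. \<Sum>w'\<in>Poly_Mapping.keys g.
       Ascale (coeff X) (cnj (Poly_Mapping.lookup f w) * Poly_Mapping.lookup g w') (gen_inner X w w')) \<rparr>"

type_synonym ('a, 'x) fock = "(nat \<Rightarrow> ('a, 'x) fock_gen \<Rightarrow>\<^sub>0 complex) set"

definition fock_corr :: "('a::ring, 'x) corr \<Rightarrow> ('a, ('a, 'x) fock) corr" where
  "fock_corr X = completion (fock_precorr X)"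


section \<open>Adjointable operators\<close>

text \<open>Operators are extensional functions on the carrier, so equality is equality of operators.
  Adjointable maps are automatically linear and bounded.\<close>

definition is_adjoint :: "('a, 'x) corr \<Rightarrow> ('x \<Rightarrow> 'x) \<Rightarrow> ('x \<Rightarrow> 'x) \<Rightarrow> bool" where
  "is_adjoint X T S \<longleftrightarrow> (\<forall>x\<in>Xcar X. \<forall>y\<in>Xcar X. Xinner X (T x) y = Xinner X x (S y))"

definition adjointable :: "('a, 'x) corr \<Rightarrow> ('x \<Rightarrow> 'x) set" where
  "adjointable X = {T \<in> Xcar X \<rightarrow>\<^sub>E Xcar X. \<exists>S \<in> Xcar X \<rightarrow>\<^sub>E Xcar X. is_adjoint X T S}"

definition op_adj :: "('a, 'x) corr \<Rightarrow> ('x \<Rightarrow> 'x) \<Rightarrow> ('x \<Rightarrow> 'x)" where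
  "op_adj X T = (THE S. S \<in> Xcar X \<rightarrow>\<^sub>E Xcar X \<and> is_adjoint X T S)"

definition op_add :: "('a, 'x) corr \<Rightarrow> ('x \<Rightarrow> 'x) \<Rightarrow> ('x \<Rightarrow> 'x) \<Rightarrow> ('x \<Rightarrow> 'x)" where
  "op_add X S T = (\<lambda>x\<in>Xcar X. Xadd X (S x) (T x))"

definition op_scale :: "('a, 'x) corr \<Rightarrow> complex \<Rightarrow> ('x \<Rightarrow> 'x) \<Rightarrow> ('x \<Rightarrow> 'x)" where
  "op_scale X c T = (\<lambda>x\<in>Xcar X. Xscale X c (T x))"

definition op_mult :: "('a, 'x) corr \<Rightarrow> ('x \<Rightarrow> 'x) \<Rightarrow> ('x \<Rightarrow> 'x) \<Rightarrow> ('x \<Rightarrow> 'x)" where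
  "op_mult X S T = compose (Xcar X) S T"

definition op_norm :: "('a, 'x) corr \<Rightarrow> ('x \<Rightarrow> 'x) \<Rightarrow> real" where
  "op_norm X T = Inf {C. 0 \<le> C \<and> (\<forall>x\<in>Xcar X. Xnorm X (T x) \<le> C * Xnorm X x)}"

definition closed_subalgebra :: "('a, 'x) corr \<Rightarrow> ('x \<Rightarrow> 'x) set \<Rightarrow> bool" where
  "closed_subalgebra X B \<longleftrightarrow> B \<subseteq> adjointable X \<and>
     (\<forall>S\<in>B. \<forall>T\<in>B. op_add X S T \<in> B \<and> op_mult X S T \<in> B) \<and>
     (\<forall>T\<in>B. \<forall>c. op_scale X c T \<in> B) \<and>
     (\<forall>t. \<forall>T\<in>adjointable X. (\<forall>n::nat. t n \<in> B) \<and>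
        (\<lambda>n. op_norm X (op_add X (t n) (op_scale X (- 1) T))) \<longlonglongrightarrow> 0 \<longrightarrow> T \<in> B)"

definition closed_star_subalgebra :: "('a, 'x) corr \<Rightarrow> ('x \<Rightarrow> 'x) set \<Rightarrow> bool" where
  "closed_star_subalgebra X B \<longleftrightarrow> closed_subalgebra X B \<and> (\<forall>T\<in>B. op_adj X T \<in> B)"

definition generated_algebra :: "('a, 'x) corr \<Rightarrow> ('x \<Rightarrow> 'x) set \<Rightarrow> ('x \<Rightarrow> 'x) set" where
  "generated_algebra X S = \<Inter> {B. closed_subalgebra X B \<and> S \<subseteq> B}"

definition generated_cstar :: "('a, 'x) corr \<Rightarrow> ('x \<Rightarrow> 'x) set \<Rightarrow> ('x \<Rightarrow> 'x) set" where
  "generated_cstar X S = \<Inter> {B. closed_star_subalgebra X B \<and> S \<subseteq> B}"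

definition algebra_iso :: "('a, 'x) corr \<Rightarrow> ('x \<Rightarrow> 'x) set \<Rightarrow> ('b, 'y) corr \<Rightarrow> ('y \<Rightarrow> 'y) set
    \<Rightarrow> (('x \<Rightarrow> 'x) \<Rightarrow> ('y \<Rightarrow> 'y)) \<Rightarrow> bool" where
  "algebra_iso X B Y C \<psi> \<longleftrightarrow> bij_betw \<psi> B C \<and>
     (\<forall>S\<in>B. \<forall>T\<in>B. \<psi> (op_add X S T) = op_add Y (\<psi> S) (\<psi> T) \<and>
        \<psi> (op_mult X S T) = op_mult Y (\<psi> S) (\<psi> T)) \<and>
     (\<forall>T\<in>B. \<forall>c. \<psi> (op_scale X c T) = op_scale Y c (\<psi> T))"

definition star_iso :: "('a, 'x) corr \<Rightarrow> ('x \<Rightarrow> 'x) set \<Rightarrow> ('b, 'y) corr \<Rightarrow> ('y \<Rightarrow> 'y) set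
    \<Rightarrow> (('x \<Rightarrow> 'x) \<Rightarrow> ('y \<Rightarrow> 'y)) \<Rightarrow> bool" where
  "star_iso X B Y C \<psi> \<longleftrightarrow> algebra_iso X B Y C \<psi> \<and> (\<forall>T\<in>B. \<psi> (op_adj X T) = op_adj Y (\<psi> T))"

text \<open>The norm of a \<open>k \<times> k\<close> matrix of operators is its norm as an operator on the direct sum of \<open>k\<close>
  copies of \<open>X\<close>.\<close>

definition amplification :: "nat \<Rightarrow> ('a::ring, 'x) corr \<Rightarrow> ('a, nat \<Rightarrow> 'x) corr" where
  "amplification k X = \<lparr>
     coeff = coeff X,
     Xcar = {..<k} \<rightarrow>\<^sub>E Xcar X,
     Xzero = (\<lambda>i\<in>{..<k}. Xzero X),
     Xadd = (\<lambda>x y. \<lambda>i\<in>{..<k}. Xadd X (x i) (y i)),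
     Xscale = (\<lambda>c x. \<lambda>i\<in>{..<k}. Xscale X c (x i)),
     Xright = (\<lambda>x a. \<lambda>i\<in>{..<k}. Xright X (x i) a),
     Xleft = (\<lambda>a x. \<lambda>i\<in>{..<k}. Xleft X a (x i)),
     Xinner = (\<lambda>x y. \<Sum>i<k. Xinner X (x i) (y i)) \<rparr>"

definition matrix_op ::
    "nat \<Rightarrow> ('a::ring, 'x) corr \<Rightarrow> (nat \<Rightarrow> nat \<Rightarrow> 'x \<Rightarrow> 'x) \<Rightarrow> (nat \<Rightarrow> 'x) \<Rightarrow> (nat \<Rightarrow> 'x)" where
  "matrix_op k X M =
     (\<lambda>x \<in> Xcar (amplification k X). \<lambda>i\<in>{..<k}. Xsum X (\<lambda>j. M i j (x j)) k)"

definition completely_isometric_iso ::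
    "('a::ring, 'x) corr \<Rightarrow> ('x \<Rightarrow> 'x) set \<Rightarrow> ('b::ring, 'y) corr \<Rightarrow> ('y \<Rightarrow> 'y) set
      \<Rightarrow> (('x \<Rightarrow> 'x) \<Rightarrow> ('y \<Rightarrow> 'y)) \<Rightarrow> bool" where
  "completely_isometric_iso X B Y C \<psi> \<longleftrightarrow> algebra_iso X B Y C \<psi> \<and>
     (\<forall>k M. (\<forall>i<k. \<forall>j<k. M i j \<in> B) \<longrightarrow>
        op_norm (amplification k Y) (matrix_op k Y (\<lambda>i j. \<psi> (M i j))) =
        op_norm (amplification k X) (matrix_op k X M))"


section \<open>Toeplitz and tensor algebras\<close>

definition fock_iota :: "('a::ring, 'x) corr \<Rightarrow> 'a \<Rightarrow> ('a, 'x) fock \<Rightarrow> ('a, 'x) fock" where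
  "fock_iota X a = (\<lambda>u \<in> Xcar (fock_corr X). Xleft (fock_corr X) a u)"

definition creation :: "('a::ring, 'x) corr \<Rightarrow> 'x \<Rightarrow> ('a, 'x) fock \<Rightarrow> ('a, 'x) fock" where
  "creation X \<xi> =
     (\<lambda>u \<in> Xcar (fock_corr X). extend (fock_precorr X) (linear_ext (gen_create X \<xi>)) u)"

definition base_alg :: "('a::ring, 'x) corr \<Rightarrow> (('a, 'x) fock \<Rightarrow> ('a, 'x) fock) set" where
  "base_alg X = fock_iota X ` Acar (coeff X)"

definition toeplitz :: "('a::ring, 'x) corr \<Rightarrow> (('a, 'x) fock \<Rightarrow> ('a, 'x) fock) set" where
  "toeplitz X = generated_cstar (fock_corr X) (base_alg X \<union> creation X ` Xcar X)"

definition tensor_alg :: "('a::ring, 'x) corr \<Rightarrow> (('a, 'x) fock \<Rightarrow> ('a, 'x) fock) set" where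
  "tensor_alg X = generated_algebra (fock_corr X) (base_alg X \<union> creation X ` Xcar X)"

text \<open>The gauge action is determined on the Toeplitz algebra by its values on generators. This also
  makes it a group action.\<close>

definition is_gauge_action :: "('a::ring, 'x) corr
    \<Rightarrow> (complex \<Rightarrow> (('a, 'x) fock \<Rightarrow> ('a, 'x) fock) \<Rightarrow> (('a, 'x) fock \<Rightarrow> ('a, 'x) fock)) \<Rightarrow> bool" where
  "is_gauge_action X \<gamma> \<longleftrightarrow> (\<forall>z. cmod z = 1 \<longrightarrow>
     star_iso (fock_corr X) (toeplitz X) (fock_corr X) (toeplitz X) (\<gamma> z) \<and>
     (\<forall>a \<in> Acar (coeff X). \<gamma> z (fock_iota X a) = fock_iota X a) \<and>
     (\<forall>\<xi> \<in> Xcar X. \<gamma> z (creation X \<xi>) = op_scale (fock_corr X) z (creation X \<xi>)))"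

definition gauge_action :: "('a::ring, 'x) corr
    \<Rightarrow> complex \<Rightarrow> (('a, 'x) fock \<Rightarrow> ('a, 'x) fock) \<Rightarrow> (('a, 'x) fock \<Rightarrow> ('a, 'x) fock)" where
  "gauge_action X = (SOME \<gamma>. is_gauge_action X \<gamma>)"

definition toeplitz_degree ::
    "('a::ring, 'x) corr \<Rightarrow> int \<Rightarrow> (('a, 'x) fock \<Rightarrow> ('a, 'x) fock) set" where
  "toeplitz_degree X n = {T \<in> toeplitz X. \<forall>z. cmod z = 1 \<longrightarrow>
     gauge_action X z T = op_scale (fock_corr X) (z powi n) T}"

definition tensor_degree ::
    "('a::ring, 'x) corr \<Rightarrow> nat \<Rightarrow> (('a, 'x) fock \<Rightarrow> ('a, 'x) fock) set" where
  "tensor_degree X n = toeplitz_degree X (int n) \<inter> tensor_alg X"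

definition graded_completely_isometric ::
    "('a::ring, 'x) corr \<Rightarrow> ('b::ring, 'y) corr \<Rightarrow> bool" where
  "graded_completely_isometric X Y \<longleftrightarrow> (\<exists>\<psi>.
     completely_isometric_iso (fock_corr X) (tensor_alg X) (fock_corr Y) (tensor_alg Y) \<psi> \<and>
     (\<forall>n. \<psi> ` tensor_degree X n = tensor_degree Y n))"

definition base_preserving_graded_isomorphic ::
    "('a::ring, 'x) corr \<Rightarrow> ('b::ring, 'y) corr \<Rightarrow> bool" where
  "base_preserving_graded_isomorphic X Y \<longleftrightarrow> (\<exists>\<psi>.
     star_iso (fock_corr X) (toeplitz X) (fock_corr Y) (toeplitz Y) \<psi> \<and>
     \<psi> ` base_alg X = base_alg Y \<and>
     (\<forall>n. \<psi> ` toeplitz_degree X n = toeplitz_degree Y n))"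

end

theory Submission
  imports Defs "HOL-Analysis.Infinite_Sum" "HOL-Analysis.L2_Norm"
begin

text \<open>
  In the path basis, the Fock correspondence of \<open>G\<close> is the \<open>c\<^sub>0\<close>-direct sum over \<open>v\<close> of the Hilbert
  spaces \<open>\<ell>\<^sup>2\<close> of paths starting at \<open>v\<close>, and an isomorphism of graphs permutes paths; this gives (2),
  (3) and (4) from (1). Conversely, each of the three isomorphisms carries the projections \<open>\<delta>\<^sub>v\<close>
  to such projections, because they are the minimal idempotents of the base algebra; for (3) the
  base algebra is replaced by the degree 0 part of \<open>\<T>\<^sub>+\<close>, whose elements are diagonal. This gives a
  bijection \<open>\<sigma>\<close> of the vertices. The image of \<open>\<delta>\<^sub>e\<close> (respectively of \<open>T\<^sub>e\<close>, applied to \<open>\<delta>\<^sub>\<sigma>\<^sub>v\<close>) for the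
  edges \<open>e\<close> from \<open>v\<close> to \<open>w\<close> is an orthonormal family in the \<open>\<ell>\<^sup>2\<close> space of edges from \<open>\<sigma> v\<close> to
  \<open>\<sigma> w\<close>. Orthonormality comes from the norm for (2), from \<open>T\<^sub>\<xi>\<^sup>*T\<^sub>\<xi>\<close> for (4), and for (3) from the fact
  that an element of degree 1 in \<open>\<T>\<^sub>+\<close> starting at \<open>v\<close> is some \<open>T\<^sub>\<eta>\<close> and so has norm \<open>\<parallel>\<eta>\<parallel>\<close>. Hence the
  edges inject both ways, and Schroeder-Bernstein matches them. The gauge action is unique because
  star-isomorphisms are contractive, so it is the one implemented by \<open>z\<^bsup>n\<^esup>\<close> on paths of length \<open>n\<close>.
\<close>

section \<open>Square summable functions\<close>

text \<open>Boundedness is nowhere part of the data: an operator is any map that has an adjoint, and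
  its norm is an infimum that says nothing if no constant is admissible. A uniform boundedness
  argument for these modules must therefore come before any use of norm limits. The gauge action is
  a choice among all actions with the right values on generators, and degrees become computable only
  when that choice is pinned down. The contractivity behind this is reached without spectral theory,
  by a square root built inside the algebra, which may lack a unit. The tensor algebra is not closed
  under adjoints. Commutation with creation on the right takes their place: it makes degree 0
  diagonal, whereas the degree 0 part of the Toeplitz algebra contains all
  \<open>T\<^sub>e T\<^sub>f\<^sup>*\<close>, and it makes the norm of a degree 1 element with
  source \<open>v\<close> attained at the single vector \<open>\<delta>\<^sub>v\<close>. As edge
  sets may have any cardinality, only an injection is extracted at a time, and orthonormality is
  used as an identity for the norms of all finite combinations.\<close>

definition l2 :: "'i set \<Rightarrow> ('i \<Rightarrow> complex) set" where
  "l2 S = {x. (\<lambda>i. (cmod (x i))\<^sup>2) summable_on S}"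

definition l2n :: "'i set \<Rightarrow> ('i \<Rightarrow> complex) \<Rightarrow> real" where
  "l2n S x = sqrt (\<Sum>\<^sub>\<infinity>i\<in>S. (cmod (x i))\<^sup>2)"

definition l2ip :: "'i set \<Rightarrow> ('i \<Rightarrow> complex) \<Rightarrow> ('i \<Rightarrow> complex) \<Rightarrow> complex" where
  "l2ip S x y = (\<Sum>\<^sub>\<infinity>i\<in>S. cnj (x i) * y i)"

lemma l2n_nonneg [simp]: "0 \<le> l2n S x"
  by (simp add: l2n_def infsum_nonneg)

lemma l2n_sq: "(l2n S x)\<^sup>2 = (\<Sum>\<^sub>\<infinity>i\<in>S. (cmod (x i))\<^sup>2)"
  by (simp add: l2n_def infsum_nonneg)

lemma L2_set_le_l2n:
  assumes "x \<in> l2 S" "finite F" "F \<subseteq> S"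
  shows "L2_set (\<lambda>i. cmod (x i)) F \<le> l2n S x"
  unfolding L2_set_def l2n_def using assms
  by (auto intro!: real_sqrt_le_mono finite_sum_le_infsum simp: l2_def)

text \<open>The finite sums of a nonnegative family decide both its summability and its sum. This
  reduces estimates in \<open>l2\<close> to \<open>L2_set\<close>, for which Minkowski and
  Cauchy-Schwarz are available.\<close>

lemma l2_boundI:
  assumes "\<And>F. finite F \<Longrightarrow> F \<subseteq> S \<Longrightarrow> L2_set (\<lambda>i. cmod (x i)) F \<le> C"
  shows "x \<in> l2 S" "l2n S x \<le> C"
proof -
  have C: "0 \<le> C" using assms[of "{}"] by simp
  have *: "(\<Sum>i\<in>F. (cmod (x i))\<^sup>2) \<le> C\<^sup>2" if "finite F" "F \<subseteq> S" for F
    using assms[OF that] C by (simp add: L2_set_def sqrt_le_D)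
  show "x \<in> l2 S" unfolding l2_def mem_Collect_eq
    by (rule nonneg_bdd_above_summable_on) (auto intro!: bdd_aboveI2[where M="C\<^sup>2"] *)
  then have "(\<Sum>\<^sub>\<infinity>i\<in>S. (cmod (x i))\<^sup>2) \<le> C\<^sup>2"
    by (intro infsum_le_finite_sums *) (auto simp: l2_def)
  then show "l2n S x \<le> C" using C unfolding l2n_def by (rule real_le_lsqrt[rotated])
qed

lemma l2_dominated:
  assumes "x \<in> l2 S" "\<And>i. i \<in> S \<Longrightarrow> cmod (y i) \<le> C * cmod (x i)" "0 \<le> C"
  shows "y \<in> l2 S" "l2n S y \<le> C * l2n S x"
proof -
  have "L2_set (\<lambda>i. cmod (y i)) F \<le> C * l2n S x" if F: "finite F" "F \<subseteq> S" for F
  proof -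
    have "L2_set (\<lambda>i. cmod (y i)) F \<le> L2_set (\<lambda>i. C * cmod (x i)) F"
      using F by (intro L2_set_mono) (auto intro!: assms)
    also have "\<dots> = C * L2_set (\<lambda>i. cmod (x i)) F"
      using assms(3) by (simp add: L2_set_right_distrib)
    also have "\<dots> \<le> C * l2n S x"
      using assms F by (intro mult_left_mono L2_set_le_l2n) auto
    finally show ?thesis .
  qed
  note * = this
  show "y \<in> l2 S" by (rule l2_boundI(1), rule *)
  show "l2n S y \<le> C * l2n S x" by (rule l2_boundI(2), rule *)
qed

lemma l2_scale:
  assumes "x \<in> l2 S"
  shows "(\<lambda>i. c * x i) \<in> l2 S" "l2n S (\<lambda>i. c * x i) = cmod c * l2n S x"
proof -
  show "(\<lambda>i. c * x i) \<in> l2 S"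
    by (rule l2_dominated[OF assms, of _ "cmod c"]) (auto simp: norm_mult)
  have "(\<Sum>\<^sub>\<infinity>i\<in>S. (cmod (c * x i))\<^sup>2) = (cmod c)\<^sup>2 * (\<Sum>\<^sub>\<infinity>i\<in>S. (cmod (x i))\<^sup>2)"
    by (simp add: norm_mult power_mult_distrib infsum_cmult_right')
  then show "l2n S (\<lambda>i. c * x i) = cmod c * l2n S x"
    by (simp add: l2n_def real_sqrt_mult)
qed

lemma l2_add:
  assumes "x \<in> l2 S" "y \<in> l2 S"
  shows "(\<lambda>i. x i + y i) \<in> l2 S" "l2n S (\<lambda>i. x i + y i) \<le> l2n S x + l2n S y"
proof -
  have "L2_set (\<lambda>i. cmod (x i + y i)) F \<le> l2n S x + l2n S y" if F: "finite F" "F \<subseteq> S" for F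
  proof -
    have "L2_set (\<lambda>i. cmod (x i + y i)) F \<le> L2_set (\<lambda>i. cmod (x i) + cmod (y i)) F"
      using F by (intro L2_set_mono) (auto intro: norm_triangle_ineq)
    also have "\<dots> \<le> L2_set (\<lambda>i. cmod (x i)) F + L2_set (\<lambda>i. cmod (y i)) F"
      by (rule L2_set_triangle_ineq)
    also have "\<dots> \<le> l2n S x + l2n S y"
      using assms F by (intro add_mono L2_set_le_l2n) auto
    finally show ?thesis .
  qed
  note * = this
  show "(\<lambda>i. x i + y i) \<in> l2 S" by (rule l2_boundI(1), rule *)
  show "l2n S (\<lambda>i. x i + y i) \<le> l2n S x + l2n S y" by (rule l2_boundI(2), rule *)
qed

lemma l2_diff:
  assumes "x \<in> l2 S" "y \<in> l2 S"
  shows "(\<lambda>i. x i - y i) \<in> l2 S" "l2n S (\<lambda>i. x i - y i) \<le> l2n S x + l2n S y"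
  using l2_add[OF assms(1) l2_scale(1)[OF assms(2), of "-1"]] l2_scale(2)[OF assms(2), of "-1"]
  by simp_all

lemma l2_coord_le: "x \<in> l2 S \<Longrightarrow> i \<in> S \<Longrightarrow> cmod (x i) \<le> l2n S x"
  using L2_set_le_l2n[of x S "{i}"] by (simp add: L2_set_def)

text \<open>Fatou's lemma in the form needed for completeness: each finite partial norm is
  continuous in the coordinates, so the bound passes to the pointwise limit. It is asked for only
  from \<open>N\<close> on, which fits a Cauchy sequence.\<close>

lemma l2_limit:
  assumes "\<And>i. i \<in> S \<Longrightarrow> (\<lambda>n. x n i) \<longlonglongrightarrow> y i"
    and "\<And>n::nat. n \<ge> N \<Longrightarrow> x n \<in> l2 S \<and> l2n S (x n) \<le> C"
  shows "y \<in> l2 S" "l2n S y \<le> C"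
proof -
  have "L2_set (\<lambda>i. cmod (y i)) F \<le> C" if F: "finite F" "F \<subseteq> S" for F
  proof (rule LIMSEQ_le_const2)
    show "(\<lambda>n. L2_set (\<lambda>i. cmod (x n i)) F) \<longlonglongrightarrow> L2_set (\<lambda>i. cmod (y i)) F"
      unfolding L2_set_def using F by (auto intro!: tendsto_intros assms(1))
    show "\<exists>N. \<forall>n\<ge>N. L2_set (\<lambda>i. cmod (x n i)) F \<le> C"
      using order_trans[OF L2_set_le_l2n[OF _ F]] assms(2) by (intro exI[of _ N]) auto
  qed
  note * = this
  show "y \<in> l2 S" by (rule l2_boundI(1), rule *)
  show "l2n S y \<le> C" by (rule l2_boundI(2), rule *)
qed

lemma l2_finite_support:
  assumes "finite {i \<in> S. x i \<noteq> 0}"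
  shows "x \<in> l2 S" "(l2n S x)\<^sup>2 = (\<Sum>i | i \<in> S \<and> x i \<noteq> 0. (cmod (x i))\<^sup>2)"
proof -
  have "((\<lambda>i. (cmod (x i))\<^sup>2) has_sum (\<Sum>i | i \<in> S \<and> x i \<noteq> 0. (cmod (x i))\<^sup>2)) S"
    by (rule has_sum_finite_neutralI[OF assms]) auto
  then show "x \<in> l2 S" "(l2n S x)\<^sup>2 = (\<Sum>i | i \<in> S \<and> x i \<noteq> 0. (cmod (x i))\<^sup>2)"
    by (auto simp: l2_def l2n_sq summable_on_def infsumI)
qed

text \<open>The square norm of the remainder is the total minus a finite sum, and the finite sums
  converge to the total.\<close>

lemma l2_tail:
  assumes x: "x \<in> l2 S" and e: "0 < e"
  obtains F where "finite F" "F \<subseteq> S" "l2n S (\<lambda>i. if i \<in> F then 0 else x i) \<le> e"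
proof -
  let ?f = "\<lambda>i. (cmod (x i))\<^sup>2"
  have s: "?f summable_on S" using x by (simp add: l2_def)
  obtain F where F: "finite F" "F \<subseteq> S" and d: "norm (infsum ?f S - sum ?f F) \<le> e\<^sup>2"
  proof -
    have "(sum ?f \<longlongrightarrow> infsum ?f S) (finite_subsets_at_top S)"
      using s by (simp add: has_sum_def[symmetric])
    then have "\<forall>\<^sub>F F in finite_subsets_at_top S. dist (sum ?f F) (infsum ?f S) < e\<^sup>2"
      using e by (intro tendstoD) auto
    then obtain F where "finite F" "F \<subseteq> S" "dist (sum ?f F) (infsum ?f S) < e\<^sup>2"
      unfolding eventually_finite_subsets_at_top by blast
    then show ?thesis using that by (simp add: dist_norm norm_minus_commute)
  qed
  have "infsum (\<lambda>i. (cmod (if i \<in> F then 0 else x i))\<^sup>2) S = infsum ?f (S - F)"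
    by (rule infsum_cong_neutral) auto
  also have "\<dots> = infsum ?f S - sum ?f F"
    using F s by (subst infsum_Diff) auto
  finally have "(l2n S (\<lambda>i. if i \<in> F then 0 else x i))\<^sup>2 \<le> e\<^sup>2"
    using d by (simp add: l2n_sq)
  then have "l2n S (\<lambda>i. if i \<in> F then 0 else x i) \<le> e"
    using e by (simp add: power2_le_iff_abs_le)
  then show ?thesis using that F by blast
qed

lemma l2_abs_summable:
  assumes "x \<in> l2 S" "y \<in> l2 S"
  shows "(\<lambda>i. cnj (x i) * y i) abs_summable_on S"
proof -
  have "cmod (cnj (x i) * y i) \<le> (cmod (x i))\<^sup>2 + (cmod (y i))\<^sup>2" for i
  proof -
    have "0 \<le> cmod (x i) * cmod (y i)" by simp
    then show ?thesis
      using sum_squares_bound[of "cmod (x i)" "cmod (y i)"]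
      unfolding norm_mult complex_mod_cnj by linarith
  qed
  moreover have "(\<lambda>i. (cmod (x i))\<^sup>2 + (cmod (y i))\<^sup>2) summable_on S"
    using assms by (intro summable_on_add) (auto simp: l2_def)
  ultimately show ?thesis by (intro abs_summable_on_comparison_test') auto
qed

lemma l2ip_summable:
  "x \<in> l2 S \<Longrightarrow> y \<in> l2 S \<Longrightarrow> (\<lambda>i. cnj (x i) * y i) summable_on S"
  by (rule abs_summable_summable[OF l2_abs_summable])

lemma l2ip_self:
  assumes "x \<in> l2 S"
  shows "l2ip S x x = of_real ((l2n S x)\<^sup>2)"
proof -
  have "l2ip S x x = (\<Sum>\<^sub>\<infinity>i\<in>S. of_real ((cmod (x i))\<^sup>2))"
    unfolding l2ip_def by (rule infsum_cong) (metis complex_norm_square mult.commute)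
  also have "\<dots> = of_real ((l2n S x)\<^sup>2)"
    using assms unfolding l2n_sq l2_def
    by (intro infsumI has_sum_of_real has_sum_infsum) simp
  finally show ?thesis .
qed

lemma l2ip_cnj: "cnj (l2ip S x y) = l2ip S y x"
  unfolding l2ip_def infsum_cnj[symmetric] by (rule infsum_cong) simp

lemma l2ip_add_right:
  "x \<in> l2 S \<Longrightarrow> y \<in> l2 S \<Longrightarrow> z \<in> l2 S \<Longrightarrow>
   l2ip S x (\<lambda>i. y i + z i) = l2ip S x y + l2ip S x z"
  unfolding l2ip_def by (simp add: distrib_left infsum_add l2ip_summable)

lemma l2ip_scale_right: "l2ip S x (\<lambda>i. c * y i) = c * l2ip S x y"
  unfolding l2ip_def by (simp add: infsum_cmult_right' mult.left_commute)

lemma l2ip_diff_right: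
  "x \<in> l2 S \<Longrightarrow> y \<in> l2 S \<Longrightarrow> z \<in> l2 S \<Longrightarrow>
   l2ip S x (\<lambda>i. y i - z i) = l2ip S x y - l2ip S x z"
  using l2ip_add_right[of x S y "\<lambda>i. (-1) * z i"] l2_scale(1)[of z S "-1"]
    l2ip_scale_right[of S x "-1" z] by simp

lemma l2ip_add_left:
  assumes "x \<in> l2 S" "y \<in> l2 S" "z \<in> l2 S"
  shows "l2ip S (\<lambda>i. y i + z i) x = l2ip S y x + l2ip S z x"
  using arg_cong[OF l2ip_add_right[OF assms], of cnj] by (simp add: l2ip_cnj)

lemma l2ip_scale_left: "l2ip S (\<lambda>i. c * y i) x = cnj c * l2ip S y x"
  using arg_cong[OF l2ip_scale_right[of S x c y], of cnj] by (simp add: l2ip_cnj)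

lemma l2ip_diff_left:
  assumes "x \<in> l2 S" "y \<in> l2 S" "z \<in> l2 S"
  shows "l2ip S (\<lambda>i. y i - z i) x = l2ip S y x - l2ip S z x"
  using arg_cong[OF l2ip_diff_right[OF assms], of cnj] by (simp add: l2ip_cnj)

lemma l2_Cauchy_Schwarz:
  assumes "x \<in> l2 S" "y \<in> l2 S"
  shows "cmod (l2ip S x y) \<le> l2n S x * l2n S y"
proof -
  have "cmod (l2ip S x y) \<le> (\<Sum>\<^sub>\<infinity>i\<in>S. norm (cnj (x i) * y i))"
    unfolding l2ip_def by (rule norm_infsum_bound[OF l2_abs_summable[OF assms]])
  also have "\<dots> \<le> l2n S x * l2n S y"
  proof (rule infsum_le_finite_sums[OF l2_abs_summable[OF assms]])
    fix F assume F: "finite F" "F \<subseteq> S"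
    have "(\<Sum>i\<in>F. norm (cnj (x i) * y i)) \<le>
        L2_set (\<lambda>i. cmod (x i)) F * L2_set (\<lambda>i. cmod (y i)) F"
      using L2_set_mult_ineq[of "\<lambda>i. cmod (x i)" "\<lambda>i. cmod (y i)" F] by (simp add: norm_mult)
    also have "\<dots> \<le> l2n S x * l2n S y"
      using assms F by (intro mult_mono L2_set_le_l2n) auto
    finally show "(\<Sum>i\<in>F. norm (cnj (x i) * y i)) \<le> l2n S x * l2n S y" .
  qed
  finally show ?thesis .
qed

lemma l2n_eq_0_iff:
  assumes "x \<in> l2 S"
  shows "l2n S x = 0 \<longleftrightarrow> (\<forall>i\<in>S. x i = 0)"
proof
  assume "l2n S x = 0"
  then show "\<forall>i\<in>S. x i = 0" using l2_coord_le[OF assms] by simp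
next
  assume "\<forall>i\<in>S. x i = 0"
  then have "infsum (\<lambda>i. (cmod (x i))\<^sup>2) S = 0" by (intro infsum_0) simp
  then show "l2n S x = 0" by (simp add: l2n_def)
qed

lemma l2ip_single: "i \<in> S \<Longrightarrow> l2ip S (\<lambda>j. if j = i then 1 else 0) x = x i"
proof -
  assume "i \<in> S"
  then have "infsum (\<lambda>j. cnj (if j = i then 1 else 0) * x j) S = infsum (\<lambda>j. x j) {i}"
    by (intro infsum_cong_neutral) auto
  then show ?thesis by (simp add: l2ip_def)
qed

section \<open>The algebra of functions vanishing at infinity\<close>

lemma c0_simps [simp]:
  "Ascale (c0 V) = (\<lambda>c a v. c * a v)" "Astar (c0 V) = (\<lambda>a v. cnj (a v))"
  by (simp_all add: c0_def)

lemma in_c0_iff: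
  "a \<in> Acar (c0 V) \<longleftrightarrow> (\<forall>v. v \<notin> V \<longrightarrow> a v = 0) \<and> (\<forall>\<epsilon>>0. finite {v\<in>V. \<epsilon> \<le> cmod (a v)})"
  by (simp add: c0_def)

lemma c0_outside: "a \<in> Acar (c0 V) \<Longrightarrow> v \<notin> V \<Longrightarrow> a v = 0"
  by (simp add: in_c0_iff)

lemma c0_bounded:
  assumes "a \<in> Acar (c0 V)"
  obtains C where "0 \<le> C" "\<And>v. cmod (a v) \<le> C"
proof -
  \<comment> \<open>Only finitely many entries have modulus at least 1; their sum, plus 1 for all
    the others, is a bound.\<close>
  let ?F = "{v\<in>V. 1 \<le> cmod (a v)}"
  have fin: "finite ?F" using assms by (auto simp: in_c0_iff)
  have "cmod (a v) \<le> 1 + (\<Sum>v\<in>?F. cmod (a v))" for v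
  proof (cases "v \<in> ?F")
    case True
    then have "cmod (a v) \<le> (\<Sum>v\<in>?F. cmod (a v))" using fin by (intro member_le_sum) auto
    then show ?thesis by simp
  next
    case False
    then have "cmod (a v) \<le> 1" using c0_outside[OF assms, of v] by force
    then show ?thesis by (simp add: add_increasing2 sum_nonneg)
  qed
  then show ?thesis using that[of "1 + (\<Sum>v\<in>?F. cmod (a v))"] by (simp add: sum_nonneg add_increasing)
qed

text \<open>The condition \<open>0 \<le> C\<close> comes from the 0 adjoined to the supremum and
  decides the case of an empty \<open>V\<close>.\<close>

lemma c0_norm_le_iff:
  assumes "a \<in> Acar (c0 V)"
  shows "Anorm (c0 V) a \<le> C \<longleftrightarrow> 0 \<le> C \<and> (\<forall>v\<in>V. cmod (a v) \<le> C)"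
proof -
  obtain M where M: "0 \<le> M" "\<And>v. cmod (a v) \<le> M" using c0_bounded[OF assms] by blast
  have bdd: "bdd_above (insert 0 ((\<lambda>v. cmod (a v)) ` V))"
    using M by (auto intro!: bdd_aboveI[where M=M])
  show ?thesis unfolding c0_def by (simp add: cSup_le_iff[OF _ bdd])
qed

lemma c0_norm_nonneg: "a \<in> Acar (c0 V) \<Longrightarrow> 0 \<le> Anorm (c0 V) a"
  using c0_norm_le_iff[of a V "Anorm (c0 V) a"] by simp

lemma c0_norm_ge: "a \<in> Acar (c0 V) \<Longrightarrow> cmod (a v) \<le> Anorm (c0 V) a"
  using c0_norm_le_iff[of a V "Anorm (c0 V) a"] c0_outside[of a V v] by (cases "v \<in> V") auto

text \<open>Closure under scalars, products and conjugation reduces to this domination; sums need a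
  splitting of \<epsilon> instead.\<close>

lemma c0_dominated:
  assumes "a \<in> Acar (c0 V)" "\<And>v. cmod (b v) \<le> C * cmod (a v)"
  shows "b \<in> Acar (c0 V)"
proof -
  have "finite {v\<in>V. \<epsilon> \<le> cmod (b v)}" if "\<epsilon> > 0" for \<epsilon>
  proof (rule finite_subset)
    \<comment> \<open>The constant \<open>C\<close> carries no sign; this replacement is positive
      and may be divided by.\<close>
    have p: "0 < \<bar>C\<bar> + 1" by simp
    have "\<epsilon> / (\<bar>C\<bar> + 1) \<le> cmod (a v)" if "\<epsilon> \<le> cmod (b v)" for v
    proof -
      have "\<epsilon> \<le> C * cmod (a v)" using that assms(2)[of v] by simp
      also have "\<dots> \<le> (\<bar>C\<bar> + 1) * cmod (a v)" by (intro mult_right_mono) auto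
      finally show ?thesis using p by (simp add: pos_divide_le_eq mult.commute)
    qed
    then show "{v\<in>V. \<epsilon> \<le> cmod (b v)} \<subseteq> {v\<in>V. \<epsilon> / (\<bar>C\<bar> + 1) \<le> cmod (a v)}" by auto
    have "0 < \<epsilon> / (\<bar>C\<bar> + 1)" using that p by (rule divide_pos_pos)
    then show "finite {v\<in>V. \<epsilon> / (\<bar>C\<bar> + 1) \<le> cmod (a v)}"
      using assms(1) by (auto simp: in_c0_iff)
  qed
  moreover have "b v = 0" if "v \<notin> V" for v
    using assms(2)[of v] c0_outside[OF assms(1) that] by simp
  ultimately show ?thesis by (auto simp: in_c0_iff)
qed

lemma c0_zero: "0 \<in> Acar (c0 V)"
  by (auto simp: in_c0_iff)

lemma c0_add:
  assumes "a \<in> Acar (c0 V)" "b \<in> Acar (c0 V)"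
  shows "a + b \<in> Acar (c0 V)"
proof -
  have "finite {v\<in>V. \<epsilon> \<le> cmod (a v + b v)}" if "\<epsilon> > 0" for \<epsilon>
  proof (rule finite_subset)
    have "\<epsilon>/2 \<le> cmod (a v) \<or> \<epsilon>/2 \<le> cmod (b v)" if "\<epsilon> \<le> cmod (a v + b v)" for v
      using that norm_triangle_ineq[of "a v" "b v"] by linarith
    then show "{v\<in>V. \<epsilon> \<le> cmod (a v + b v)}
        \<subseteq> {v\<in>V. \<epsilon>/2 \<le> cmod (a v)} \<union> {v\<in>V. \<epsilon>/2 \<le> cmod (b v)}" by blast
    show "finite ({v\<in>V. \<epsilon>/2 \<le> cmod (a v)} \<union> {v\<in>V. \<epsilon>/2 \<le> cmod (b v)})"
      using assms half_gt_zero[OF that] unfolding in_c0_iff by blast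
  qed
  then show ?thesis using assms by (auto simp: in_c0_iff)
qed

lemma c0_scale: "a \<in> Acar (c0 V) \<Longrightarrow> (\<lambda>v. c * a v) \<in> Acar (c0 V)"
  by (rule c0_dominated[of a V _ "cmod c"]) (auto simp: norm_mult)

lemma c0_uminus: "a \<in> Acar (c0 V) \<Longrightarrow> - a \<in> Acar (c0 V)"
  by (rule c0_dominated[of a V _ 1]) auto

lemma c0_diff: "a \<in> Acar (c0 V) \<Longrightarrow> b \<in> Acar (c0 V) \<Longrightarrow> a - b \<in> Acar (c0 V)"
  using c0_add[OF _ c0_uminus, of a V b] by simp

lemma c0_mult:
  assumes "a \<in> Acar (c0 V)" "b \<in> Acar (c0 V)"
  shows "a * b \<in> Acar (c0 V)"
proof -
  obtain C where "0 \<le> C" "\<And>v. cmod (a v) \<le> C" using c0_bounded[OF assms(1)] by blast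
  then show ?thesis
    by (intro c0_dominated[OF assms(2), of _ C]) (auto simp: norm_mult intro!: mult_right_mono)
qed

lemma c0_star: "a \<in> Acar (c0 V) \<Longrightarrow> (\<lambda>v. cnj (a v)) \<in> Acar (c0 V)"
  by (rule c0_dominated[of a V _ 1]) auto

definition delta :: "'i \<Rightarrow> 'i \<Rightarrow> complex" where
  "delta i = (\<lambda>j. if j = i then 1 else 0)"

lemma delta_apply: "delta i j = (if j = i then 1 else 0)"
  by (simp add: delta_def)

lemma c0_finite_support:
  assumes "finite {v. a v \<noteq> 0}" "{v. a v \<noteq> 0} \<subseteq> V"
  shows "a \<in> Acar (c0 V)"
  unfolding in_c0_iff using assms by (auto intro: finite_subset[OF _ assms(1)])

lemma c0_delta: "v \<in> V \<Longrightarrow> delta v \<in> Acar (c0 V)"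
  by (rule c0_finite_support) (auto simp: delta_def)


lemma coeff_iso_inv:
  assumes "coeff_iso (c0 V) B \<rho>"
  shows "coeff_iso B (c0 V) (inv_into (Acar (c0 V)) \<rho>)"
proof -
  let ?i = "inv_into (Acar (c0 V)) \<rho>"
  have b: "bij_betw \<rho> (Acar (c0 V)) (Acar B)" using assms by (simp add: coeff_iso_def)
  have i: "?i a \<in> Acar (c0 V)" "\<rho> (?i a) = a" if "a \<in> Acar B" for a
    using b that by (auto simp: bij_betw_def inv_into_into f_inv_into_f)
  have hom: "?i b = a" if "a \<in> Acar (c0 V)" "\<rho> a = b" for a b
    using b that by (auto simp: bij_betw_def)
  show ?thesis unfolding coeff_iso_def
  proof (intro conjI ballI allI)
    show "bij_betw ?i (Acar B) (Acar (c0 V))" by (rule bij_betw_inv_into[OF b])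
    fix x y assume "x \<in> Acar B" "y \<in> Acar B"
    note x = i[OF this(1)] and y = i[OF this(2)]
    show "?i (x + y) = ?i x + ?i y" "?i (x * y) = ?i x * ?i y"
      by (rule hom[OF c0_add[OF x(1) y(1)]] hom[OF c0_mult[OF x(1) y(1)]],
          use assms x y in \<open>simp add: coeff_iso_def\<close>)+
  next
    fix x c assume "x \<in> Acar B"
    note x = i[OF this]
    show "?i (Ascale B c x) = Ascale (c0 V) c (?i x)" "?i (Astar B x) = Astar (c0 V) (?i x)"
      by (rule hom, use assms x in \<open>simp_all add: coeff_iso_def c0_scale c0_star\<close>)+
  qed
qed

text \<open>The image \<open>q\<close> of \<open>\<delta>\<^sub>v\<close> is a nonzero idempotent,
  hence the indicator of a nonempty set. A product of \<open>\<delta>\<^sub>v\<close> with an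
  element of the algebra is a multiple of \<open>\<delta>\<^sub>v\<close>, so every multiple of
  \<open>q\<close> within the algebra is a scalar one. Multiplying by
  \<open>\<delta>\<^sub>w\<close> for a point \<open>w\<close> of the set leaves only
  \<open>w\<close>.\<close>

lemma coeff_iso_delta:
  assumes "coeff_iso (c0 V) (c0 V') \<rho>" and v: "v \<in> V"
  shows "\<exists>w\<in>V'. \<rho> (delta v) = delta w"
proof -
  have b: "bij_betw \<rho> (Acar (c0 V)) (Acar (c0 V'))"
    and mult: "\<And>a b. a \<in> Acar (c0 V) \<Longrightarrow> b \<in> Acar (c0 V) \<Longrightarrow> \<rho> (a * b) = \<rho> a * \<rho> b"
    and scale: "\<And>a c. a \<in> Acar (c0 V) \<Longrightarrow> \<rho> (\<lambda>v. c * a v) = (\<lambda>v. c * \<rho> a v)"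
    using assms(1) by (simp_all add: coeff_iso_def)
  define q where "q = \<rho> (delta v)"
  note d = c0_delta[OF v]
  have dd: "delta v * delta v = (delta v :: _ \<Rightarrow> complex)" by (auto simp: delta_apply fun_eq_iff)
  have q: "q \<in> Acar (c0 V')" unfolding q_def by (rule bij_betw_apply[OF b d])
  have "q * q = q" using mult[OF d d] by (simp add: q_def dd)
  then have "q w * q w = q w" for w by (metis times_fun_apply)
  then have idem: "q w = 0 \<or> q w = 1" for w by (metis mult_cancel_right1)
  have "\<exists>w. q w \<noteq> 0"
  proof (rule ccontr)
    assume "\<not> ?thesis"
    then have "\<rho> (\<lambda>u. 0 * delta v u) = q" using scale[OF d, of 0] by (auto simp: q_def)
    then have "(\<lambda>u. 0 * delta v u) = delta v"
      unfolding q_def by (rule inj_onD[OF bij_betw_imp_inj_on[OF b] _ c0_scale[OF d] d])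
    from fun_cong[OF this, of v] show False by (simp add: delta_apply)
  qed
  then obtain w where w: "q w = 1" using idem by blast
  have wV: "w \<in> V'" using c0_outside[OF q] w by force
  obtain s where s: "s \<in> Acar (c0 V)" "\<rho> s = delta w"
    using b c0_delta[OF wV] unfolding bij_betw_def by (metis imageE)
  have "delta v * s = (\<lambda>u. s v * delta v u)" by (auto simp: delta_apply fun_eq_iff)
  then have "q * delta w = (\<lambda>u. s v * q u)" using mult[OF d s(1)] scale[OF d] s(2) by (simp add: q_def)
  then have e: "q u * delta w u = s v * q u" for u by (metis times_fun_apply)
  have "s v = 1" using e[of w] w by (simp add: delta_apply)
  then have "q u = delta w u" for u using e[of u] w by (auto simp: delta_apply)
  then show ?thesis using wV unfolding q_def by blast
qed

section \<open>Fibred Hilbert modules\<close>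

text \<open>For an index set \<open>I\<close> fibred over \<open>V\<close> by \<open>s\<close>, this is the \<open>c\<^sub>0\<close>-direct sum of the Hilbert
  spaces of square summable functions on the fibres, regarded as a module over \<open>c\<^sub>0(V)\<close>. Both the
  graph correspondence and its Fock correspondence are of this form.\<close>

definition fib :: "'i set \<Rightarrow> ('i \<Rightarrow> 'v) \<Rightarrow> 'v \<Rightarrow> 'i set" where
  "fib I s v = {i\<in>I. s i = v}"

definition hcar :: "'v set \<Rightarrow> 'i set \<Rightarrow> ('i \<Rightarrow> 'v) \<Rightarrow> ('i \<Rightarrow> complex) set" where
  "hcar V I s = {x. (\<forall>i. i \<notin> I \<longrightarrow> x i = 0) \<and> (\<forall>v\<in>V. x \<in> l2 (fib I s v)) \<and>
     (\<forall>\<epsilon>>0. finite {v\<in>V. \<epsilon> \<le> l2n (fib I s v) x})}"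

definition hmod :: "'v set \<Rightarrow> 'i set \<Rightarrow> ('i \<Rightarrow> 'v) \<Rightarrow> ('i \<Rightarrow> 'v) \<Rightarrow>
    ('v \<Rightarrow> complex, 'i \<Rightarrow> complex) corr" where
  "hmod V I s r = \<lparr>
     coeff = c0 V,
     Xcar = hcar V I s,
     Xzero = (\<lambda>_. 0),
     Xadd = (\<lambda>x y i. x i + y i),
     Xscale = (\<lambda>c x i. c * x i),
     Xright = (\<lambda>x a i. x i * a (s i)),
     Xleft = (\<lambda>a x i. a (r i) * x i),
     Xinner = (\<lambda>x y v. l2ip (fib I s v) x y) \<rparr>"

lemma hmod_simps [simp]:
  "coeff (hmod V I s r) = c0 V" "Xcar (hmod V I s r) = hcar V I s"
  "Xzero (hmod V I s r) = (\<lambda>_. 0)" "Xadd (hmod V I s r) = (\<lambda>x y i. x i + y i)"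
  "Xscale (hmod V I s r) = (\<lambda>c x i. c * x i)"
  "Xright (hmod V I s r) = (\<lambda>x a i. x i * a (s i))"
  "Xleft (hmod V I s r) = (\<lambda>a x i. a (r i) * x i)"
  "Xinner (hmod V I s r) = (\<lambda>x y v. l2ip (fib I s v) x y)"
  by (simp_all add: hmod_def)

locale fibred =
  fixes V :: "'v set" and I :: "'i set" and s r :: "'i \<Rightarrow> 'v"
  assumes s_in: "i \<in> I \<Longrightarrow> s i \<in> V"
begin

abbreviation "H \<equiv> hmod V I s r"
abbreviation "K \<equiv> hcar V I s"
abbreviation "fb \<equiv> fib I s"
abbreviation "hn \<equiv> Xnorm H"

lemma fb_outside: "v \<notin> V \<Longrightarrow> fb v = {}"
  using s_in by (auto simp: fib_def)

lemma in_fb: "i \<in> I \<Longrightarrow> i \<in> fb (s i)"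
  by (simp add: fib_def)

lemma K_l2: "x \<in> K \<Longrightarrow> x \<in> l2 (fb v)"
  by (cases "v \<in> V") (auto simp: hcar_def fb_outside l2_def)

lemma K_outside: "x \<in> K \<Longrightarrow> i \<notin> I \<Longrightarrow> x i = 0"
  by (simp add: hcar_def)

text \<open>Decay of the fibre norms is rephrased as membership in \<open>c\<^sub>0(V)\<close>, so
  that the closure properties of the module can be inherited from those of the coefficient
  algebra.\<close>

lemma K_iff: "x \<in> K \<longleftrightarrow> (\<forall>i. i \<notin> I \<longrightarrow> x i = 0) \<and> (\<forall>v\<in>V. x \<in> l2 (fb v)) \<and>
    (\<lambda>v. complex_of_real (l2n (fb v) x)) \<in> Acar (c0 V)"
  by (auto simp: hcar_def in_c0_iff fb_outside l2n_def[of "{}"])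

lemma K_norm_c0: "x \<in> K \<Longrightarrow> (\<lambda>v. complex_of_real (l2n (fb v) x)) \<in> Acar (c0 V)"
  by (simp add: K_iff)

lemma K_dominated:
  assumes x: "x \<in> K" and "\<And>i. i \<notin> I \<Longrightarrow> y i = 0" "\<And>v. v \<in> V \<Longrightarrow> y \<in> l2 (fb v)"
    and le: "\<And>v. v \<in> V \<Longrightarrow> l2n (fb v) y \<le> C * l2n (fb v) x"
  shows "y \<in> K"
proof -
  have "(\<lambda>v. complex_of_real (l2n (fb v) y)) \<in> Acar (c0 V)"
  proof (rule c0_dominated[OF K_norm_c0[OF x]])
    show "cmod (complex_of_real (l2n (fb v) y)) \<le> C * cmod (complex_of_real (l2n (fb v) x))" for v
      using le[of v] by (cases "v \<in> V") (simp_all add: fb_outside l2n_def[of "{}"])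
  qed
  then show ?thesis using assms by (simp add: K_iff)
qed

lemma K_pointwise_dominated:
  assumes x: "x \<in> K" and "\<And>i. i \<in> I \<Longrightarrow> cmod (y i) \<le> C * cmod (x i)"
    and "\<And>i. i \<notin> I \<Longrightarrow> y i = 0" "0 \<le> C"
  shows "y \<in> K"
proof (rule K_dominated[OF x, of _ C])
  fix v
  have *: "\<And>i. i \<in> fb v \<Longrightarrow> cmod (y i) \<le> C * cmod (x i)" using assms by (auto simp: fib_def)
  show "y \<in> l2 (fb v)" by (rule l2_dominated(1)[OF K_l2[OF x] * assms(4)])
  show "l2n (fb v) y \<le> C * l2n (fb v) x" by (rule l2_dominated(2)[OF K_l2[OF x] * assms(4)])
qed (use assms in auto)

lemma K_zero: "(\<lambda>_. 0) \<in> K"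
  by (auto simp: hcar_def l2_def l2n_def)

lemma K_add:
  assumes "x \<in> K" "y \<in> K"
  shows "(\<lambda>i. x i + y i) \<in> K"
proof -
  have "(\<lambda>v. complex_of_real (l2n (fb v) x)) + (\<lambda>v. complex_of_real (l2n (fb v) y)) \<in> Acar (c0 V)"
    using assms by (intro c0_add K_norm_c0)
  then have "(\<lambda>v. complex_of_real (l2n (fb v) (\<lambda>i. x i + y i))) \<in> Acar (c0 V)"
  proof (rule c0_dominated[of _ _ _ 1])
    fix v
    have "l2n (fb v) (\<lambda>i. x i + y i) \<le> l2n (fb v) x + l2n (fb v) y"
      using assms by (intro l2_add K_l2)
    also have "\<dots> = cmod (complex_of_real (l2n (fb v) x + l2n (fb v) y))"
      by (simp del: of_real_add)
    finally show "cmod (complex_of_real (l2n (fb v) (\<lambda>i. x i + y i))) \<le> 1 * cmod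
      (((\<lambda>v. complex_of_real (l2n (fb v) x)) + (\<lambda>v. complex_of_real (l2n (fb v) y))) v)" by simp
  qed
  then show ?thesis using assms by (simp add: K_iff l2_add)
qed

lemma K_scale: "x \<in> K \<Longrightarrow> (\<lambda>i. c * x i) \<in> K"
  by (rule K_pointwise_dominated[of x _ "cmod c"]) (auto simp: norm_mult K_outside)

lemma K_diff: "x \<in> K \<Longrightarrow> y \<in> K \<Longrightarrow> (\<lambda>i. x i - y i) \<in> K"
  using K_add[OF _ K_scale, of x y "-1"] by simp

lemma K_mult_bounded:
  assumes "x \<in> K" "\<And>i. i \<in> I \<Longrightarrow> cmod (b i) \<le> C" "0 \<le> C"
  shows "(\<lambda>i. b i * x i) \<in> K"
  using assms
  by (intro K_pointwise_dominated[OF assms(1), of _ C])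
     (auto simp: norm_mult K_outside intro!: mult_right_mono)

lemma K_right: "x \<in> K \<Longrightarrow> a \<in> Acar (c0 V) \<Longrightarrow> (\<lambda>i. x i * a (s i)) \<in> K"
  by (rule c0_bounded, assumption) (subst mult.commute, rule K_mult_bounded)

lemma K_left: "x \<in> K \<Longrightarrow> a \<in> Acar (c0 V) \<Longrightarrow> (\<lambda>i. a (r i) * x i) \<in> K"
  by (rule c0_bounded, assumption) (rule K_mult_bounded)

lemma K_finite_support:
  assumes "finite {i. x i \<noteq> 0}" "{i. x i \<noteq> 0} \<subseteq> I"
  shows "x \<in> K"
proof -
  have fin: "finite {i \<in> fb v. x i \<noteq> 0}" for v by (rule finite_subset[OF _ assms(1)]) auto
  have "{v. complex_of_real (l2n (fb v) x) \<noteq> 0} \<subseteq> s ` {i. x i \<noteq> 0}"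
  proof
    fix v assume "v \<in> {v. complex_of_real (l2n (fb v) x) \<noteq> 0}"
    then have "\<not> (\<forall>i\<in>fb v. x i = 0)" using l2n_eq_0_iff[OF l2_finite_support(1)[OF fin]] by auto
    then show "v \<in> s ` {i. x i \<noteq> 0}" by (auto simp: fib_def)
  qed
  then have "(\<lambda>v. complex_of_real (l2n (fb v) x)) \<in> Acar (c0 V)"
    using assms s_in by (intro c0_finite_support) (blast intro: finite_subset finite_imageI)+
  then show ?thesis using assms l2_finite_support(1)[OF fin] by (auto simp: K_iff)
qed

lemma K_delta: "i \<in> I \<Longrightarrow> delta i \<in> K"
  by (rule K_finite_support) (auto simp: delta_def)

lemma inner_c0:
  assumes "x \<in> K" "y \<in> K"
  shows "(\<lambda>v. l2ip (fb v) x y) \<in> Acar (c0 V)"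
proof -
  have "(\<lambda>v. complex_of_real (l2n (fb v) x)) * (\<lambda>v. complex_of_real (l2n (fb v) y)) \<in> Acar (c0 V)"
    using assms by (intro c0_mult K_norm_c0)
  then show ?thesis
    by (rule c0_dominated[of _ _ _ 1])
       (use l2_Cauchy_Schwarz[OF K_l2 K_l2, OF assms] in \<open>auto simp: norm_mult\<close>)
qed

text \<open>The inner product of \<open>x\<close> with itself takes the value
  \<open>(l2n (fb v) x)\<^sup>2\<close> at \<open>v\<close>, so the module norm is the supremum of
  the fibre norms. Norm estimates are checked fibre by fibre through this equivalence.\<close>

lemma hn_le_iff:
  assumes "x \<in> K"
  shows "hn x \<le> C \<longleftrightarrow> 0 \<le> C \<and> (\<forall>v\<in>V. l2n (fb v) x \<le> C)"
proof (cases "0 \<le> C")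
  case True
  have "hn x \<le> C \<longleftrightarrow> Anorm (c0 V) (\<lambda>v. l2ip (fb v) x x) \<le> C\<^sup>2"
    using True real_sqrt_le_iff[of _ "C\<^sup>2"] by (simp add: Xnorm_def)
  also have "\<dots> \<longleftrightarrow> (\<forall>v\<in>V. (l2n (fb v) x)\<^sup>2 \<le> C\<^sup>2)"
    using c0_norm_le_iff[OF inner_c0[OF assms assms]]
    by (simp add: l2ip_self K_l2[OF assms] norm_power del: of_real_power)
  finally show ?thesis using True by (simp add: power2_le_iff_abs_le)
next
  case False
  have "0 \<le> hn x" using c0_norm_nonneg[OF inner_c0[OF assms assms]] by (simp add: Xnorm_def)
  then show ?thesis using False by linarith
qed

lemma hn_nonneg: "x \<in> K \<Longrightarrow> 0 \<le> hn x"
  using hn_le_iff[of x "hn x"] by simp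

lemma l2n_le_hn: "x \<in> K \<Longrightarrow> l2n (fb v) x \<le> hn x"
  using hn_le_iff[of x "hn x"] by (cases "v \<in> V") (auto simp: fb_outside l2n_def[of "{}"])

lemma coord_le_hn: "x \<in> K \<Longrightarrow> cmod (x i) \<le> hn x"
  using l2_coord_le[OF K_l2 in_fb, of x i] l2n_le_hn[of x "s i"] hn_nonneg[of x] K_outside[of x i]
  by (cases "i \<in> I") auto

lemma hn_triangle: "x \<in> K \<Longrightarrow> y \<in> K \<Longrightarrow> hn (\<lambda>i. x i + y i) \<le> hn x + hn y"
  by (subst hn_le_iff)
     (auto intro!: K_add add_nonneg_nonneg hn_nonneg order_trans[OF l2_add(2)] K_l2 add_mono l2n_le_hn)

lemma hn_scale:
  assumes "x \<in> K" shows "hn (\<lambda>i. c * x i) = cmod c * hn x"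
proof (cases "c = 0")
  case True
  have "hn (\<lambda>i. 0) \<le> 0" by (subst hn_le_iff[OF K_zero]) (simp add: l2n_def)
  then show ?thesis using True hn_nonneg[OF K_zero] by simp
next
  case False
  have le: "hn (\<lambda>i. c * x i) \<le> cmod c * hn x" if "x \<in> K" for c x
    using that by (subst hn_le_iff)
     (auto intro!: K_scale mult_nonneg_nonneg hn_nonneg mult_left_mono l2n_le_hn simp: l2_scale K_l2)
  \<comment> \<open>The lower bound is the upper bound \<open>le\<close> for the scalar
    \<open>inverse c\<close>, applied to the multiple of \<open>x\<close> by
    \<open>c\<close>.\<close>
  have "cmod c * hn x = cmod c * hn (\<lambda>i. inverse c * (c * x i))"
    using False by (simp add: mult.assoc[symmetric])
  also have "\<dots> \<le> cmod c * (cmod (inverse c) * hn (\<lambda>i. c * x i))"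
    using assms by (intro mult_left_mono le K_scale) auto
  also have "\<dots> = hn (\<lambda>i. c * x i)" using False by (simp add: norm_inverse)
  finally show ?thesis using le[OF assms, of c] by linarith
qed

lemma hn_zero: "hn (\<lambda>_. 0) = 0"
  using hn_scale[OF K_zero, of 0] by simp

lemma hn_minus: "x \<in> K \<Longrightarrow> hn (\<lambda>i. - x i) = hn x"
  using hn_scale[of x "-1"] by simp

lemma hn_diff_commute: "x \<in> K \<Longrightarrow> y \<in> K \<Longrightarrow> hn (\<lambda>i. x i - y i) = hn (\<lambda>i. y i - x i)"
  using hn_minus[OF K_diff, of x y] by simp

lemma hn_eq_0: "x \<in> K \<Longrightarrow> hn x = 0 \<Longrightarrow> x = (\<lambda>_. 0)"
  using coord_le_hn[of x] by fastforce

lemma hn_dominated: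
  assumes "x \<in> K" "y \<in> K" "\<And>v. v \<in> V \<Longrightarrow> l2n (fb v) y \<le> C * l2n (fb v) x" "0 \<le> C"
  shows "hn y \<le> C * hn x"
  using assms hn_nonneg[of x]
  by (subst hn_le_iff) (auto intro: order_trans[OF assms(3)] mult_left_mono l2n_le_hn)

text \<open>The pointwise limit of a Cauchy sequence is its limit in norm.\<close>

lemma K_complete:
  assumes x: "\<And>n::nat. x n \<in> K"
    and cauchy: "\<And>\<epsilon>. \<epsilon> > 0 \<Longrightarrow> \<exists>N. \<forall>m\<ge>N. \<forall>n\<ge>N. hn (\<lambda>i. x m i - x n i) < \<epsilon>"
  shows "\<exists>y\<in>K. (\<lambda>n. hn (\<lambda>i. x n i - y i)) \<longlonglongrightarrow> 0"
proof -
  have "Cauchy (\<lambda>n. x n i)" for i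
  proof (rule CauchyI)
    fix e :: real assume "0 < e"
    then obtain N where N: "\<forall>m\<ge>N. \<forall>n\<ge>N. hn (\<lambda>i. x m i - x n i) < e" using cauchy by blast
    have "cmod (x m i - x n i) \<le> hn (\<lambda>i. x m i - x n i)" for m n
      using coord_le_hn[OF K_diff[OF x x]] .
    then show "\<exists>M. \<forall>m\<ge>M. \<forall>n\<ge>M. norm (x m i - x n i) < e" using N by (meson le_less_trans)
  qed
  then have "\<forall>i. \<exists>l. (\<lambda>n. x n i) \<longlonglongrightarrow> l"
    using Cauchy_convergent_iff convergent_def by blast
  then obtain y where y: "\<And>i. (\<lambda>n. x n i) \<longlonglongrightarrow> y i" by metis
  have lim: "(\<lambda>i. x n i - y i) \<in> l2 (fb v) \<and> l2n (fb v) (\<lambda>i. x n i - y i) \<le> e"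
    if N: "\<forall>m\<ge>N. \<forall>n\<ge>N. hn (\<lambda>i. x m i - x n i) < e" and n: "n \<ge> N" for N n e v
  proof -
    have 1: "(\<lambda>m. x n i - x m i) \<longlonglongrightarrow> x n i - y i" for i by (intro tendsto_intros y)
    have 2: "(\<lambda>i. x n i - x m i) \<in> l2 (fb v) \<and> l2n (fb v) (\<lambda>i. x n i - x m i) \<le> e" if "m \<ge> N" for m
      using N n that l2n_le_hn[OF K_diff[OF x x], of v n m] K_l2[OF K_diff[OF x x]]
      by force
    show ?thesis using l2_limit[of "fb v", OF 1 2] by blast
  qed
  obtain N where N: "\<forall>m\<ge>N. \<forall>n\<ge>N. hn (\<lambda>i. x m i - x n i) < 1" using cauchy[of 1] by auto
  have yl2: "y \<in> l2 (fb v)" for v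
    using l2_diff(1)[OF K_l2[OF x[of N], of v] conjunct1[OF lim[OF N order_refl, of v]]] by simp
  have "y \<in> K" unfolding hcar_def
  proof (intro CollectI conjI allI impI ballI)
    fix i assume "i \<notin> I"
    then have "(\<lambda>n. x n i) = (\<lambda>_. 0)" using x K_outside by blast
    then show "y i = 0" using LIMSEQ_unique[OF y[of i]] tendsto_const[of 0] by simp
  next
    fix e :: real assume e: "0 < e"
    then obtain N where N: "\<forall>m\<ge>N. \<forall>n\<ge>N. hn (\<lambda>i. x m i - x n i) < e/2" using cauchy[of "e/2"] by auto
    have "e/2 \<le> l2n (fb v) (x N)" if "e \<le> l2n (fb v) y" for v
      using l2_diff(2)[OF K_l2[OF x[of N], of v] conjunct1[OF lim[OF N order_refl, of v]]]
        lim[OF N order_refl, of v] that by simp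
    then have "{v\<in>V. e \<le> l2n (fb v) y} \<subseteq> {v\<in>V. e/2 \<le> l2n (fb v) (x N)}" by blast
    moreover have "finite {v\<in>V. e/2 \<le> l2n (fb v) (x N)}"
      using x[of N] half_gt_zero[OF e] unfolding hcar_def by blast
    ultimately show "finite {v\<in>V. e \<le> l2n (fb v) y}" by (rule finite_subset)
  qed (rule yl2)
  moreover have "(\<lambda>n. hn (\<lambda>i. x n i - y i)) \<longlonglongrightarrow> 0"
  proof (rule LIMSEQ_I)
    fix e :: real assume e: "0 < e"
    then obtain N where N: "\<forall>m\<ge>N. \<forall>n\<ge>N. hn (\<lambda>i. x m i - x n i) < e/2" using cauchy[of "e/2"] by auto
    have "norm (hn (\<lambda>i. x n i - y i) - 0) < e" if "n \<ge> N" for n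
    proof -
      have k: "(\<lambda>i. x n i - y i) \<in> K" using \<open>y \<in> K\<close> x by (intro K_diff)
      then have "hn (\<lambda>i. x n i - y i) \<le> e/2"
        using lim[OF N that] e by (subst hn_le_iff) auto
      then show ?thesis using hn_nonneg[OF k] e by simp
    qed
    then show "\<exists>no. \<forall>n\<ge>no. norm (hn (\<lambda>i. x n i - y i) - 0) < e" by blast
  qed
  ultimately show ?thesis by blast
qed

text \<open>Only finitely many fibres have norm at least \<open>e\<close>. A finite set is cut out
  of each of these, and the remaining fibres are small already.\<close>

lemma K_dense:
  assumes x: "x \<in> K" and e: "0 < e"
  obtains F where "finite F" "F \<subseteq> I" "hn (\<lambda>i. if i \<in> F then 0 else x i) \<le> e"
proof -
  let ?W = "{v\<in>V. e \<le> l2n (fb v) x}"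
  have W: "finite ?W" using x e by (auto simp: hcar_def)
  have "\<exists>F. finite F \<and> F \<subseteq> fb v \<and> l2n (fb v) (\<lambda>i. if i \<in> F then 0 else x i) \<le> e" for v
    using l2_tail[OF K_l2[OF x] e] by metis
  then obtain F where F: "\<And>v. finite (F v)" "\<And>v. F v \<subseteq> fb v"
    "\<And>v. l2n (fb v) (\<lambda>i. if i \<in> F v then 0 else x i) \<le> e" by metis
  let ?F = "\<Union>v\<in>?W. F v"
  have sub: "?F \<subseteq> I" using F(2) by (auto simp: fib_def)
  have k: "(\<lambda>i. if i \<in> ?F then 0 else x i) \<in> K"
    by (rule K_pointwise_dominated[OF x, of _ 1]) (auto simp: K_outside[OF x])
  have "hn (\<lambda>i. if i \<in> ?F then 0 else x i) \<le> e"
  proof (subst hn_le_iff[OF k], intro conjI ballI)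
    fix v assume v: "v \<in> V"
    show "l2n (fb v) (\<lambda>i. if i \<in> ?F then 0 else x i) \<le> e"
    proof (cases "v \<in> ?W")
      case True
      have "l2n (fb v) (\<lambda>i. if i \<in> ?F then 0 else x i) \<le> 1 * l2n (fb v) (\<lambda>i. if i \<in> F v then 0 else x i)"
        using True by (intro l2_dominated(2) l2_dominated(1)[OF K_l2[OF x], of _ _ 1]) auto
      then show ?thesis using F(3)[of v] by simp
    next
      case False
      have "l2n (fb v) (\<lambda>i. if i \<in> ?F then 0 else x i) \<le> 1 * l2n (fb v) x"
        by (rule l2_dominated(2)[OF K_l2[OF x]]) auto
      then show ?thesis using False v by auto
    qed
  qed (use e in auto)
  moreover have "finite ?F" using W F(1) by blast
  ultimately show ?thesis using that sub by blast
qed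

lemma inner_delta: "i \<in> I \<Longrightarrow> l2ip (fb (s i)) (delta i) x = x i"
  unfolding delta_def by (rule l2ip_single) (simp add: fib_def)

lemma inner_nondegenerate:
  assumes "x \<in> K" "y \<in> K" "\<And>z. z \<in> K \<Longrightarrow> Xinner H z x = Xinner H z y"
  shows "x = y"
proof
  fix i
  show "x i = y i"
  proof (cases "i \<in> I")
    case True
    then show ?thesis using fun_cong[OF assms(3)[OF K_delta[OF True]], of "s i"] by (simp add: inner_delta)
  qed (simp add: K_outside assms)
qed

lemma inner_le_hn:
  assumes "x \<in> K" "y \<in> K"
  shows "cmod (l2ip (fb v) x y) \<le> hn x * hn y"
proof -
  have "cmod (l2ip (fb v) x y) \<le> l2n (fb v) x * l2n (fb v) y"
    using assms by (intro l2_Cauchy_Schwarz K_l2)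
  also have "\<dots> \<le> hn x * hn y" using assms by (intro mult_mono l2n_le_hn hn_nonneg) auto
  finally show ?thesis .
qed

end

section \<open>Isomorphisms of correspondences\<close>

text \<open>A \<open>corr\<close> record carries no axioms, so closure of the carrier under the
  operations and nondegeneracy of the inner product are assumed for \<open>X\<close> and transported
  to \<open>Y\<close>. Preservation of the inner product and of the coefficient norm is built in,
  which is more than a unitary isomorphism asks for.\<close>

locale corr_iso =
  fixes X :: "('a::ring, 'x) corr" and Y :: "('b::ring, 'y) corr" and W :: "'x \<Rightarrow> 'y" and \<rho> :: "'a \<Rightarrow> 'b"
  assumes bij: "bij_betw W (Xcar X) (Xcar Y)"
    and coeff: "coeff_iso (coeff X) (coeff Y) \<rho>"
    and norm: "a \<in> Acar (coeff X) \<Longrightarrow> Anorm (coeff Y) (\<rho> a) = Anorm (coeff X) a"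
    and coeff_zero_in: "0 \<in> Acar (coeff X)"
    and coeff_add_in: "a \<in> Acar (coeff X) \<Longrightarrow> b \<in> Acar (coeff X) \<Longrightarrow> a + b \<in> Acar (coeff X)"
    and inner_in: "x \<in> Xcar X \<Longrightarrow> y \<in> Xcar X \<Longrightarrow> Xinner X x y \<in> Acar (coeff X)"
    and zero_in: "Xzero X \<in> Xcar X"
    and add_in: "x \<in> Xcar X \<Longrightarrow> y \<in> Xcar X \<Longrightarrow> Xadd X x y \<in> Xcar X"
    and scale_in: "x \<in> Xcar X \<Longrightarrow> Xscale X c x \<in> Xcar X"
    and right_in: "x \<in> Xcar X \<Longrightarrow> a \<in> Acar (coeff X) \<Longrightarrow> Xright X x a \<in> Xcar X"
    and left_in: "x \<in> Xcar X \<Longrightarrow> a \<in> Acar (coeff X) \<Longrightarrow> Xleft X a x \<in> Xcar X"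
    and nondegenerate: "x \<in> Xcar X \<Longrightarrow> y \<in> Xcar X \<Longrightarrow>
      (\<And>z. z \<in> Xcar X \<Longrightarrow> Xinner X z x = Xinner X z y) \<Longrightarrow> x = y"
    and inner: "x \<in> Xcar X \<Longrightarrow> y \<in> Xcar X \<Longrightarrow> Xinner Y (W x) (W y) = \<rho> (Xinner X x y)"
    and map_zero: "W (Xzero X) = Xzero Y"
    and map_add: "x \<in> Xcar X \<Longrightarrow> y \<in> Xcar X \<Longrightarrow> W (Xadd X x y) = Xadd Y (W x) (W y)"
    and map_scale: "x \<in> Xcar X \<Longrightarrow> W (Xscale X c x) = Xscale Y c (W x)"
    and map_right: "x \<in> Xcar X \<Longrightarrow> a \<in> Acar (coeff X) \<Longrightarrow> W (Xright X x a) = Xright Y (W x) (\<rho> a)"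
    and map_left: "x \<in> Xcar X \<Longrightarrow> a \<in> Acar (coeff X) \<Longrightarrow> W (Xleft X a x) = Xleft Y (\<rho> a) (W x)"
begin

lemma W_in: "x \<in> Xcar X \<Longrightarrow> W x \<in> Xcar Y"
  using bij by (auto simp: bij_betw_def)

lemma W_inj: "x \<in> Xcar X \<Longrightarrow> y \<in> Xcar X \<Longrightarrow> W x = W y \<longleftrightarrow> x = y"
  using bij by (auto simp: bij_betw_def inj_on_eq_iff)

lemma W_surj: "y \<in> Xcar Y \<Longrightarrow> \<exists>x\<in>Xcar X. y = W x"
  using bij by (auto simp: bij_betw_def)

lemma rho_bij: "bij_betw \<rho> (Acar (coeff X)) (Acar (coeff Y))"
  using coeff by (simp add: coeff_iso_def)

lemma rho_in: "a \<in> Acar (coeff X) \<Longrightarrow> \<rho> a \<in> Acar (coeff Y)"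
  using rho_bij by (auto simp: bij_betw_def)

lemma rho_inj: "a \<in> Acar (coeff X) \<Longrightarrow> b \<in> Acar (coeff X) \<Longrightarrow> \<rho> a = \<rho> b \<longleftrightarrow> a = b"
  using rho_bij by (auto simp: bij_betw_def inj_on_eq_iff)

lemma rho_surj: "b \<in> Acar (coeff Y) \<Longrightarrow> \<exists>a\<in>Acar (coeff X). b = \<rho> a"
  using rho_bij by (auto simp: bij_betw_def)

lemma rho_add: "a \<in> Acar (coeff X) \<Longrightarrow> b \<in> Acar (coeff X) \<Longrightarrow> \<rho> (a + b) = \<rho> a + \<rho> b"
  using coeff by (simp add: coeff_iso_def)

lemma rho_zero: "\<rho> 0 = 0"
  using rho_add[OF coeff_zero_in coeff_zero_in] by simp

lemma Xnorm_W: "x \<in> Xcar X \<Longrightarrow> Xnorm Y (W x) = Xnorm X x"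
  by (simp add: Xnorm_def inner norm inner_in)

abbreviation "W' \<equiv> inv_into (Xcar X) W"
abbreviation "\<rho>' \<equiv> inv_into (Acar (coeff X)) \<rho>"

lemma W'_W [simp]: "x \<in> Xcar X \<Longrightarrow> W' (W x) = x"
  using bij by (auto simp: bij_betw_def)

lemma W_W' [simp]: "y \<in> Xcar Y \<Longrightarrow> W (W' y) = y"
  using bij by (auto simp: bij_betw_def f_inv_into_f)

lemma W'_in: "y \<in> Xcar Y \<Longrightarrow> W' y \<in> Xcar X"
  using bij by (auto simp: bij_betw_def inv_into_into)

lemma rho'_rho: "a \<in> Acar (coeff X) \<Longrightarrow> \<rho>' (\<rho> a) = a"
  using rho_bij by (auto simp: bij_betw_def)

end

text \<open>The coefficient algebras of interest are of the form \<open>c\<^sub>0(V)\<close>, so that being closed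
  under the algebra operations need not be assumed.\<close>

lemma corr_iso_sym:
  fixes X :: "('v \<Rightarrow> complex, 'x) corr"
  assumes "corr_iso X Y W \<rho>" and cX: "coeff X = c0 V"
  shows "corr_iso Y X (inv_into (Xcar X) W) (inv_into (Acar (coeff X)) \<rho>)"
proof -
  interpret corr_iso X Y W \<rho> by fact
  show ?thesis
  proof
    show "bij_betw W' (Xcar Y) (Xcar X)" by (rule bij_betw_inv_into[OF bij])
    show "coeff_iso (coeff Y) (coeff X) \<rho>'"
      using coeff_iso_inv[of V "coeff Y" \<rho>] coeff by (simp add: cX)
    show "0 \<in> Acar (coeff Y)" using rho_in[OF coeff_zero_in] by (simp add: rho_zero)
    show "Xzero Y \<in> Xcar Y" using W_in[OF zero_in] by (simp add: map_zero)
    show "W' (Xzero Y) = Xzero X" using W'_W[OF zero_in] by (simp add: map_zero)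
  next
    fix a assume "a \<in> Acar (coeff Y)"
    then obtain a' where "a' \<in> Acar (coeff X)" "a = \<rho> a'" using rho_surj by metis
    then show "Anorm (coeff X) (\<rho>' a) = Anorm (coeff Y) a" by (simp add: rho'_rho norm)
  next
    fix a b assume "a \<in> Acar (coeff Y)" "b \<in> Acar (coeff Y)"
    then obtain a' b' where "a' \<in> Acar (coeff X)" "b' \<in> Acar (coeff X)" "a = \<rho> a'" "b = \<rho> b'"
      using rho_surj by metis
    then show "a + b \<in> Acar (coeff Y)" by (metis coeff_add_in rho_add rho_in)
  next
    fix x y assume "x \<in> Xcar Y" "y \<in> Xcar Y"
    then obtain x' y' where *: "x' \<in> Xcar X" "x = W x'" "y' \<in> Xcar X" "y = W y'"
      using W_surj by metis
    then show "Xinner Y x y \<in> Acar (coeff Y)" by (simp add: inner rho_in inner_in)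
    show "Xinner X (W' x) (W' y) = \<rho>' (Xinner Y x y)"
      using * by (simp add: inner rho'_rho inner_in)
    show "Xadd Y x y \<in> Xcar Y" using * by (metis W_in add_in map_add)
    show "W' (Xadd Y x y) = Xadd X (W' x) (W' y)"
      using * by (simp add: map_add[symmetric] add_in)
    show "x = y" if "\<And>z. z \<in> Xcar Y \<Longrightarrow> Xinner Y z x = Xinner Y z y"
    proof -
      have "x' = y'"
      proof (rule nondegenerate)
        fix z assume "z \<in> Xcar X"
        then show "Xinner X z x' = Xinner X z y'"
          using that[OF W_in[of z]] * by (simp add: inner inner_in rho_inj)
      qed (use * in auto)
      then show ?thesis using * by simp
    qed
  next
    fix x assume "x \<in> Xcar Y"
    then obtain x' where *: "x' \<in> Xcar X" "x = W x'" using W_surj by metis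
    show "Xscale Y c x \<in> Xcar Y" for c using * by (metis W_in scale_in map_scale)
    show "W' (Xscale Y c x) = Xscale X c (W' x)" for c
      using * by (simp add: map_scale[symmetric] scale_in)
    fix a assume "a \<in> Acar (coeff Y)"
    then obtain a' where a: "a' \<in> Acar (coeff X)" "a = \<rho> a'" using rho_surj by metis
    show "Xright Y x a \<in> Xcar Y" using * a by (metis W_in right_in map_right)
    show "Xleft Y a x \<in> Xcar Y" using * a by (metis W_in left_in map_left)
    show "W' (Xright Y x a) = Xright X (W' x) (\<rho>' a)"
      using * a by (simp add: map_right[symmetric] right_in rho'_rho)
    show "W' (Xleft Y a x) = Xleft X (\<rho>' a) (W' x)"
      using * a by (simp add: map_left[symmetric] left_in rho'_rho)
  qed
qed

lemma corr_iso_trans: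
  assumes "corr_iso X Y W \<rho>" and "corr_iso Y Z W2 \<rho>2"
  shows "corr_iso X Z (W2 \<circ> W) (\<rho>2 \<circ> \<rho>)"
proof -
  interpret one: corr_iso X Y W \<rho> by fact
  interpret two: corr_iso Y Z W2 \<rho>2 by fact
  have "coeff_iso (coeff X) (coeff Z) (\<rho>2 \<circ> \<rho>)"
    using one.coeff two.coeff one.rho_in unfolding coeff_iso_def
    by (auto intro: bij_betw_trans)
  then show ?thesis
    by unfold_locales
      (auto simp: one.W_in one.rho_in one.norm two.norm one.inner two.inner one.map_zero two.map_zero
        one.map_add two.map_add one.map_scale two.map_scale one.map_right two.map_right
        one.map_left two.map_left one.inner_in one.coeff_zero_in one.coeff_add_in one.zero_in
        one.add_in one.scale_in one.right_in one.left_in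
        intro: bij_betw_trans[OF one.bij two.bij] one.nondegenerate)
qed

lemma corr_iso_imp_unitarily_isomorphic:
  assumes "corr_iso X Y W \<rho>"
  shows "unitarily_isomorphic X Y"
proof -
  interpret corr_iso X Y W \<rho> by fact
  show ?thesis unfolding unitarily_isomorphic_def
    using bij coeff
    by (intro exI[of _ W] exI[of _ \<rho>])
      (auto simp: bij_betw_def Xnorm_W map_add map_scale map_right map_left left_in)
qed


section \<open>Completions in coordinates\<close>

text \<open>\<open>P\<close> carries only a semi-inner product and \<open>c\<close> may have a
  kernel, as for formal combinations of tensors. Since \<open>c\<close> preserves the inner product
  and reaches all point masses, its range is dense in \<open>K\<close>, and the completion of
  \<open>P\<close> becomes the whole module.\<close>

locale coords = fibred V I s r
  for V :: "'v set" and I :: "'i set" and s r :: "'i \<Rightarrow> 'v" +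
  fixes P :: "('v \<Rightarrow> complex, 'x) corr" and c :: "'x \<Rightarrow> 'i \<Rightarrow> complex"
  assumes coeff_P: "coeff P = c0 V"
    and c_in: "x \<in> Xcar P \<Longrightarrow> c x \<in> K"
    and inner_P: "x \<in> Xcar P \<Longrightarrow> y \<in> Xcar P \<Longrightarrow> Xinner P x y = (\<lambda>v. l2ip (fb v) (c x) (c y))"
    and zero_P: "Xzero P \<in> Xcar P" "c (Xzero P) = (\<lambda>_. 0)"
    and add_P: "x \<in> Xcar P \<Longrightarrow> y \<in> Xcar P \<Longrightarrow> Xadd P x y \<in> Xcar P"
      "x \<in> Xcar P \<Longrightarrow> y \<in> Xcar P \<Longrightarrow> c (Xadd P x y) = (\<lambda>i. c x i + c y i)"
    and scale_P: "x \<in> Xcar P \<Longrightarrow> Xscale P z x \<in> Xcar P"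
      "x \<in> Xcar P \<Longrightarrow> c (Xscale P z x) = (\<lambda>i. z * c x i)"
    and right_P: "x \<in> Xcar P \<Longrightarrow> a \<in> Acar (c0 V) \<Longrightarrow> Xright P x a \<in> Xcar P"
      "x \<in> Xcar P \<Longrightarrow> a \<in> Acar (c0 V) \<Longrightarrow> c (Xright P x a) = (\<lambda>i. c x i * a (s i))"
    and left_P: "x \<in> Xcar P \<Longrightarrow> a \<in> Acar (c0 V) \<Longrightarrow> Xleft P a x \<in> Xcar P"
      "x \<in> Xcar P \<Longrightarrow> a \<in> Acar (c0 V) \<Longrightarrow> c (Xleft P a x) = (\<lambda>i. a (r i) * c x i)"
    and delta_P: "i \<in> I \<Longrightarrow> \<exists>x\<in>Xcar P. c x = delta i"
begin

definition cls :: "('i \<Rightarrow> complex) \<Rightarrow> (nat \<Rightarrow> 'x) set" where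
  "cls \<xi> = {x. (\<forall>n. x n \<in> Xcar P) \<and> (\<lambda>n. hn (\<lambda>i. c (x n) i - \<xi> i)) \<longlonglongrightarrow> 0}"

lemma Xdist_P: "x \<in> Xcar P \<Longrightarrow> y \<in> Xcar P \<Longrightarrow> Xdist P x y = hn (\<lambda>i. c x i - c y i)"
  by (simp add: Xdist_def Xnorm_def add_P scale_P inner_P coeff_P)

lemma finite_support_P:
  assumes "finite F" "F \<subseteq> I"
  shows "\<exists>x\<in>Xcar P. c x = (\<lambda>i. if i \<in> F then \<xi> i else 0)"
  using assms
proof (induction F)
  case empty
  then show ?case using zero_P by auto
next
  case (insert j F)
  obtain x where x: "x \<in> Xcar P" "c x = (\<lambda>i. if i \<in> F then \<xi> i else 0)" using insert by auto
  obtain y where y: "y \<in> Xcar P" "c y = delta j" using delta_P insert by auto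
  have "c (Xadd P x (Xscale P (\<xi> j) y)) = (\<lambda>i. if i \<in> insert j F then \<xi> i else 0)"
    using insert.hyps by (auto simp: add_P scale_P x y delta_def fun_eq_iff)
  then show ?case using x y add_P(1) scale_P(1) by blast
qed

text \<open>Truncations of \<xi> to finite sets of indices lie in the range of \<open>c\<close>, and
  they can be taken within \<open>1 / (n + 1)\<close> of \<xi>.\<close>

lemma cls_nonempty:
  assumes "\<xi> \<in> K"
  shows "\<exists>x. x \<in> cls \<xi>"
proof -
  have "\<exists>x\<in>Xcar P. hn (\<lambda>i. c x i - \<xi> i) \<le> inverse (real (Suc n))" for n
  proof -
    obtain F where F: "finite F" "F \<subseteq> I" "hn (\<lambda>i. if i \<in> F then 0 else \<xi> i) \<le> inverse (real (Suc n))"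
      using K_dense[OF assms, of "inverse (real (Suc n))"] by auto
    obtain x where x: "x \<in> Xcar P" "c x = (\<lambda>i. if i \<in> F then \<xi> i else 0)"
      using finite_support_P[OF F(1,2)] by blast
    have "(\<lambda>i. if i \<in> F then 0 else \<xi> i) = (\<lambda>i. \<xi> i - c x i)" using x(2) by auto
    then have "hn (\<lambda>i. c x i - \<xi> i) \<le> inverse (real (Suc n))"
      using F(3) hn_diff_commute[OF assms c_in[OF x(1)]] by simp
    then show ?thesis using x(1) by blast
  qed
  then obtain x where x: "\<And>n. x n \<in> Xcar P" "\<And>n. hn (\<lambda>i. c (x n) i - \<xi> i) \<le> inverse (real (Suc n))"
    by metis
  have "(\<lambda>n. hn (\<lambda>i. c (x n) i - \<xi> i)) \<longlonglongrightarrow> 0"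
    by (rule tendsto_sandwich[OF _ _ tendsto_const LIMSEQ_inverse_real_of_nat])
       (auto intro!: always_eventually x(2) hn_nonneg K_diff c_in x(1) assms simp del: of_nat_Suc)
  then show ?thesis using x(1) by (auto simp: cls_def)
qed

lemma hn_diff_triangle:
  "x \<in> K \<Longrightarrow> y \<in> K \<Longrightarrow> z \<in> K \<Longrightarrow> hn (\<lambda>i. x i - z i) \<le> hn (\<lambda>i. x i - y i) + hn (\<lambda>i. y i - z i)"
  using hn_triangle[of "\<lambda>i. x i - y i" "\<lambda>i. y i - z i"] by (simp add: K_diff)

lemma cls_unique:
  assumes "\<xi> \<in> K" "\<eta> \<in> K" "x \<in> cls \<xi>" "x \<in> cls \<eta>"
  shows "\<xi> = \<eta>"
proof -
  have x: "c (x n) \<in> K" for n using assms(3) by (auto simp: cls_def c_in)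
  have l: "(\<lambda>n. hn (\<lambda>i. c (x n) i - \<xi> i) + hn (\<lambda>i. c (x n) i - \<eta> i)) \<longlonglongrightarrow> 0 + 0"
    using assms(3,4) by (intro tendsto_add) (auto simp: cls_def)
  have "hn (\<lambda>i. \<xi> i - \<eta> i) \<le> 0 + 0"
  proof (rule LIMSEQ_le_const[OF l], intro exI allI impI)
    fix n
    show "hn (\<lambda>i. \<xi> i - \<eta> i) \<le> hn (\<lambda>i. c (x n) i - \<xi> i) + hn (\<lambda>i. c (x n) i - \<eta> i)"
      using hn_diff_triangle[OF assms(1) x assms(2), of n] hn_diff_commute[OF assms(1) x, of n] by simp
  qed
  then have "(\<lambda>i. \<xi> i - \<eta> i) = (\<lambda>_. 0)"
    using hn_nonneg[OF K_diff[OF assms(1,2)]] by (intro hn_eq_0 K_diff assms) auto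
  then show ?thesis by (auto simp: fun_eq_iff)
qed

text \<open>Being equivalent to a sequence with limit \<xi> means having the limit \<xi>. A point of
  the completion is thus the set of all sequences converging to one element of
  \<open>K\<close>.\<close>

lemma cauchy_class_eq:
  assumes "\<xi> \<in> K" "x \<in> cls \<xi>"
  shows "cauchy_class P x = cls \<xi>"
proof -
  have x: "x n \<in> Xcar P" "c (x n) \<in> K" for n using assms(2) by (auto simp: cls_def c_in)
  have cauchy: "y \<in> cauchy_seqs P" if y: "y \<in> cls \<xi>" for y
    unfolding cauchy_seqs_def
  proof (intro CollectI conjI allI impI)
    show yc: "y n \<in> Xcar P" for n using y by (simp add: cls_def)
    fix e :: real assume "0 < e"
    then have "\<forall>\<^sub>F n in sequentially. hn (\<lambda>i. c (y n) i - \<xi> i) < e/2"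
      using y by (intro order_tendstoD) (auto simp: cls_def)
    then obtain N where N: "\<And>n. n \<ge> N \<Longrightarrow> hn (\<lambda>i. c (y n) i - \<xi> i) < e/2"
      by (auto simp: eventually_sequentially)
    show "\<exists>N. \<forall>m\<ge>N. \<forall>n\<ge>N. Xdist P (y m) (y n) < e"
    proof (intro exI allI impI)
      fix m n assume "m \<ge> N" "n \<ge> N"
      then show "Xdist P (y m) (y n) < e"
        using N[of m] N[of n] hn_diff_triangle[OF c_in[OF yc] assms(1) c_in[OF yc], of m n]
          hn_diff_commute[OF assms(1) c_in[OF yc], of n]
        by (simp add: Xdist_P yc)
    qed
  qed
  show ?thesis
  proof (intro equalityI subsetI)
    fix y assume "y \<in> cauchy_class P x"
    then have y: "y n \<in> Xcar P" "(\<lambda>n. hn (\<lambda>i. c (x n) i - c (y n) i)) \<longlonglongrightarrow> 0" for n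
      using x(1) by (auto simp: cauchy_class_def cauchy_seqs_def Xdist_P)
    have yk: "c (y n) \<in> K" for n using y(1) by (rule c_in)
    have l: "(\<lambda>n. hn (\<lambda>i. c (x n) i - c (y n) i) + hn (\<lambda>i. c (x n) i - \<xi> i)) \<longlonglongrightarrow> 0"
      using tendsto_add[OF y(2), of _ 0] assms(2) by (simp add: cls_def)
    have "(\<lambda>n. hn (\<lambda>i. c (y n) i - \<xi> i)) \<longlonglongrightarrow> 0"
    proof (rule tendsto_sandwich[OF _ _ tendsto_const l]; intro always_eventually allI)
      fix n
      show "hn (\<lambda>i. c (y n) i - \<xi> i) \<le> hn (\<lambda>i. c (x n) i - c (y n) i) + hn (\<lambda>i. c (x n) i - \<xi> i)"
        using hn_diff_triangle[OF yk x(2) assms(1), of n n] hn_diff_commute[OF yk x(2), of n n] by simp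
      show "0 \<le> hn (\<lambda>i. c (y n) i - \<xi> i)" by (intro hn_nonneg K_diff yk assms)
    qed
    then show "y \<in> cls \<xi>" using y(1) by (simp add: cls_def)
  next
    fix y assume y: "y \<in> cls \<xi>"
    then have yc: "y n \<in> Xcar P" "c (y n) \<in> K" for n by (auto simp: cls_def c_in)
    have l: "(\<lambda>n. hn (\<lambda>i. c (x n) i - \<xi> i) + hn (\<lambda>i. c (y n) i - \<xi> i)) \<longlonglongrightarrow> 0"
      using tendsto_add[of "\<lambda>n. hn (\<lambda>i. c (x n) i - \<xi> i)" 0 sequentially "\<lambda>n. hn (\<lambda>i. c (y n) i - \<xi> i)" 0]
        assms(2) y by (simp add: cls_def)
    have "(\<lambda>n. Xdist P (x n) (y n)) \<longlonglongrightarrow> 0"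
    proof (rule tendsto_sandwich[OF _ _ tendsto_const l]; intro always_eventually allI)
      fix n
      show "Xdist P (x n) (y n) \<le> hn (\<lambda>i. c (x n) i - \<xi> i) + hn (\<lambda>i. c (y n) i - \<xi> i)"
        using hn_diff_triangle[OF x(2) assms(1) yc(2), of n n] hn_diff_commute[OF assms(1) yc(2), of n]
        by (simp add: Xdist_P x yc)
      show "0 \<le> Xdist P (x n) (y n)" using hn_nonneg[OF K_diff[OF x(2) yc(2)]] by (simp add: Xdist_P x yc)
    qed
    then show "y \<in> cauchy_class P x" using cauchy[OF y] by (simp add: cauchy_class_def)
  qed
qed

lemma cauchy_seqs_cls:
  assumes "x \<in> cauchy_seqs P"
  shows "\<exists>\<xi>\<in>K. x \<in> cls \<xi>"
proof -
  have x: "x n \<in> Xcar P" for n using assms by (simp add: cauchy_seqs_def)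
  have "\<exists>N. \<forall>m\<ge>N. \<forall>n\<ge>N. hn (\<lambda>i. c (x m) i - c (x n) i) < e" if "e > 0" for e
    using assms that by (simp add: cauchy_seqs_def Xdist_P x)
  from K_complete[OF c_in[OF x] this] show ?thesis using x by (auto simp: cls_def)
qed

lemma cls_cauchy_seqs: "\<xi> \<in> K \<Longrightarrow> x \<in> cls \<xi> \<Longrightarrow> x \<in> cauchy_seqs P"
  using cauchy_class_eq[of \<xi> x] unfolding cauchy_class_def by blast

lemma completion_carrier: "Xcar (completion P) = cls ` K"
proof -
  have "cauchy_class P ` cauchy_seqs P = cls ` K"
  proof (intro equalityI subsetI)
    fix S assume "S \<in> cauchy_class P ` cauchy_seqs P"
    then obtain x where "x \<in> cauchy_seqs P" "S = cauchy_class P x" by blast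
    then show "S \<in> cls ` K" using cauchy_seqs_cls[of x] cauchy_class_eq by auto
  next
    fix S assume "S \<in> cls ` K"
    then obtain \<xi> where "\<xi> \<in> K" "S = cls \<xi>" by blast
    moreover then obtain x where "x \<in> cls \<xi>" using cls_nonempty by blast
    ultimately show "S \<in> cauchy_class P ` cauchy_seqs P"
      using cauchy_class_eq[of \<xi> x] cls_cauchy_seqs[of \<xi> x] by blast
  qed
  then show ?thesis by (simp add: completion_def)
qed

lemma cls_inj: "inj_on cls K"
proof (rule inj_onI)
  fix \<xi> \<eta> assume *: "\<xi> \<in> K" "\<eta> \<in> K" "cls \<xi> = cls \<eta>"
  then obtain x where "x \<in> cls \<xi>" using cls_nonempty by blast
  then show "\<xi> = \<eta>" using * cls_unique by simp
qed

text \<open>A Lipschitz map on coordinates sends every sequence with limit \<xi> to one with limit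
  \<open>h' \<xi>\<close>, so all the sets united in \<open>extend\<close> coincide.\<close>

lemma extend_cls:
  assumes \<xi>: "\<xi> \<in> K"
    and h: "\<And>x. x \<in> Xcar P \<Longrightarrow> h x \<in> Xcar P" "\<And>x. x \<in> Xcar P \<Longrightarrow> c (h x) = h' (c x)"
    and h': "\<And>x. x \<in> K \<Longrightarrow> h' x \<in> K"
      "\<And>x y. x \<in> K \<Longrightarrow> y \<in> K \<Longrightarrow> hn (\<lambda>i. h' x i - h' y i) \<le> C * hn (\<lambda>i. x i - y i)"
  shows "extend P h (cls \<xi>) = cls (h' \<xi>)"
proof -
  have "(\<lambda>n. h (x n)) \<in> cls (h' \<xi>)" if x: "x \<in> cls \<xi>" for x
  proof -
    have xc: "x n \<in> Xcar P" for n using x by (simp add: cls_def)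
    have l: "(\<lambda>n. C * hn (\<lambda>i. c (x n) i - \<xi> i)) \<longlonglongrightarrow> 0"
      using x tendsto_mult_right_zero by (auto simp: cls_def)
    have "(\<lambda>n. hn (\<lambda>i. c (h (x n)) i - h' \<xi> i)) \<longlonglongrightarrow> 0"
      by (rule tendsto_sandwich[OF _ _ tendsto_const l]; intro always_eventually allI)
         (auto simp: h(2) xc intro!: h' hn_nonneg K_diff c_in \<xi>)
    then show ?thesis using xc h(1) by (simp add: cls_def)
  qed
  then have "cauchy_class P (\<lambda>n. h (x n)) = cls (h' \<xi>)" if "x \<in> cls \<xi>" for x
    using cauchy_class_eq[OF h'(1)[OF \<xi>]] that by blast
  then show ?thesis using cls_nonempty[OF \<xi>] unfolding extend_def by auto
qed

lemma completion_add:
  assumes "\<xi> \<in> K" "\<eta> \<in> K"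
  shows "Xadd (completion P) (cls \<xi>) (cls \<eta>) = cls (\<lambda>i. \<xi> i + \<eta> i)"
proof -
  have "cauchy_class P (\<lambda>n. Xadd P (x n) (y n)) = cls (\<lambda>i. \<xi> i + \<eta> i)"
    if x: "x \<in> cls \<xi>" and y: "y \<in> cls \<eta>" for x y
  proof (rule cauchy_class_eq[OF K_add[OF assms]])
    have xc: "x n \<in> Xcar P" "y n \<in> Xcar P" for n using x y by (auto simp: cls_def)
    have l: "(\<lambda>n. hn (\<lambda>i. c (x n) i - \<xi> i) + hn (\<lambda>i. c (y n) i - \<eta> i)) \<longlonglongrightarrow> 0"
      using x y tendsto_add[of _ 0 sequentially _ 0] by (auto simp: cls_def)
    have "(\<lambda>n. hn (\<lambda>i. c (Xadd P (x n) (y n)) i - (\<xi> i + \<eta> i))) \<longlonglongrightarrow> 0"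
    proof (rule tendsto_sandwich[OF _ _ tendsto_const l]; intro always_eventually allI)
      fix n
      have k: "(\<lambda>i. c (x n) i - \<xi> i) \<in> K" "(\<lambda>i. c (y n) i - \<eta> i) \<in> K"
        using xc assms by (auto intro!: K_diff c_in)
      have e: "(\<lambda>i. c (Xadd P (x n) (y n)) i - (\<xi> i + \<eta> i)) =
          (\<lambda>i. (c (x n) i - \<xi> i) + (c (y n) i - \<eta> i))"
        by (auto simp: add_P xc)
      show "hn (\<lambda>i. c (Xadd P (x n) (y n)) i - (\<xi> i + \<eta> i))
          \<le> hn (\<lambda>i. c (x n) i - \<xi> i) + hn (\<lambda>i. c (y n) i - \<eta> i)"
        unfolding e by (rule hn_triangle[OF k])
      show "0 \<le> hn (\<lambda>i. c (Xadd P (x n) (y n)) i - (\<xi> i + \<eta> i))"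
        unfolding e by (rule hn_nonneg[OF K_add[OF k]])
    qed
    then show "(\<lambda>n. Xadd P (x n) (y n)) \<in> cls (\<lambda>i. \<xi> i + \<eta> i)"
      using xc by (simp add: cls_def add_P)
  qed
  then show ?thesis
    using cls_nonempty[OF assms(1)] cls_nonempty[OF assms(2)] by (auto simp: completion_def)
qed

text \<open>The inner product of the completion is a definite description. Norm limits of the inner
  products of representatives are also pointwise limits, which makes the described element
  unique.\<close>

lemma completion_inner:
  assumes \<xi>: "\<xi> \<in> K" and \<eta>: "\<eta> \<in> K"
  shows "Xinner (completion P) (cls \<xi>) (cls \<eta>) = (\<lambda>v. l2ip (fb v) \<xi> \<eta>)"
proof -
  let ?a = "\<lambda>v. l2ip (fb v) \<xi> \<eta>"
  have conv: "(\<lambda>n. Anorm (c0 V) (Xinner P (x n) (y n) - ?a)) \<longlonglongrightarrow> 0"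
    if x: "x \<in> cls \<xi>" and y: "y \<in> cls \<eta>" for x y
  proof -
    have xc: "x n \<in> Xcar P" "y n \<in> Xcar P" "c (x n) \<in> K" "c (y n) \<in> K" for n
      using x y by (auto simp: cls_def c_in)
    let ?d = "\<lambda>n. hn (\<lambda>i. c (x n) i - \<xi> i)" and ?e = "\<lambda>n. hn (\<lambda>i. c (y n) i - \<eta> i)"
    have "(\<lambda>n. ?d n * (?e n + hn \<eta>) + hn \<xi> * ?e n) \<longlonglongrightarrow> 0 * (0 + hn \<eta>) + hn \<xi> * 0"
      using x y by (intro tendsto_intros) (auto simp: cls_def)
    then have l: "(\<lambda>n. ?d n * (?e n + hn \<eta>) + hn \<xi> * ?e n) \<longlonglongrightarrow> 0" by simp
    show ?thesis
    proof (rule tendsto_sandwich[OF _ _ tendsto_const l]; intro always_eventually allI)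
      fix n
      have k: "(\<lambda>i. c (x n) i - \<xi> i) \<in> K" "(\<lambda>i. c (y n) i - \<eta> i) \<in> K"
        using xc \<xi> \<eta> by (auto intro!: K_diff)
      have A: "Xinner P (x n) (y n) - ?a \<in> Acar (c0 V)"
        using inner_c0[OF xc(3,4)] inner_c0[OF \<xi> \<eta>] xc by (simp add: inner_P c0_diff)
      then show "0 \<le> Anorm (c0 V) (Xinner P (x n) (y n) - ?a)" by (rule c0_norm_nonneg)
      have hy: "hn (c (y n)) \<le> ?e n + hn \<eta>" using hn_triangle[OF k(2) \<eta>] by simp
      show "Anorm (c0 V) (Xinner P (x n) (y n) - ?a) \<le> ?d n * (?e n + hn \<eta>) + hn \<xi> * ?e n"
      proof (subst c0_norm_le_iff[OF A], intro conjI ballI)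
        show "0 \<le> ?d n * (?e n + hn \<eta>) + hn \<xi> * ?e n"
          by (intro add_nonneg_nonneg mult_nonneg_nonneg hn_nonneg k \<xi> \<eta>)
        fix v assume "v \<in> V"
        \<comment> \<open>Continuity of the inner product: the difference is \<langle>x - \<xi>,
          y\<rangle> + \<langle>\<xi>, y - \<eta>\<rangle>, and the norm of \<open>y n\<close> is
          afterwards absorbed by \<open>hy\<close>.\<close>
        have "(Xinner P (x n) (y n) - ?a) v = l2ip (fb v) (\<lambda>i. c (x n) i - \<xi> i) (c (y n))
            + l2ip (fb v) \<xi> (\<lambda>i. c (y n) i - \<eta> i)"
          using K_l2[OF \<xi>] K_l2[OF \<eta>] K_l2[OF xc(3)] K_l2[OF xc(4)]
          by (simp add: inner_P xc l2ip_diff_left l2ip_diff_right)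
        then have "cmod ((Xinner P (x n) (y n) - ?a) v) \<le> ?d n * hn (c (y n)) + hn \<xi> * ?e n"
          using inner_le_hn[OF k(1) xc(4), of v] inner_le_hn[OF \<xi> k(2), of v]
          by (auto intro: norm_triangle_le add_mono)
        also have "\<dots> \<le> ?d n * (?e n + hn \<eta>) + hn \<xi> * ?e n"
          using hy hn_nonneg[OF k(1)] by (intro add_right_mono mult_left_mono) auto
        finally show "cmod ((Xinner P (x n) (y n) - ?a) v) \<le> ?d n * (?e n + hn \<eta>) + hn \<xi> * ?e n" .
      qed
    qed
  qed
  have "(THE a. a \<in> Acar (c0 V) \<and> (\<forall>x\<in>cls \<xi>. \<forall>y\<in>cls \<eta>.
      (\<lambda>n. Anorm (c0 V) (Xinner P (x n) (y n) - a)) \<longlonglongrightarrow> 0)) = ?a"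
  proof (rule the_equality)
    show "?a \<in> Acar (c0 V) \<and> (\<forall>x\<in>cls \<xi>. \<forall>y\<in>cls \<eta>.
        (\<lambda>n. Anorm (c0 V) (Xinner P (x n) (y n) - ?a)) \<longlonglongrightarrow> 0)"
      using conv inner_c0[OF \<xi> \<eta>] by blast
    fix a assume a: "a \<in> Acar (c0 V) \<and> (\<forall>x\<in>cls \<xi>. \<forall>y\<in>cls \<eta>.
        (\<lambda>n. Anorm (c0 V) (Xinner P (x n) (y n) - a)) \<longlonglongrightarrow> 0)"
    obtain x y where xy: "x \<in> cls \<xi>" "y \<in> cls \<eta>" using cls_nonempty \<xi> \<eta> by metis
    have xc: "x n \<in> Xcar P" "y n \<in> Xcar P" for n using xy by (auto simp: cls_def)
    have inA: "Xinner P (x n) (y n) \<in> Acar (c0 V)" for n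
      using inner_c0[OF c_in[OF xc(1)] c_in[OF xc(2)]] xc by (simp add: inner_P)
    have pt: "(\<lambda>n. Xinner P (x n) (y n) v) \<longlonglongrightarrow> b v"
      if b: "b \<in> Acar (c0 V)" "(\<lambda>n. Anorm (c0 V) (Xinner P (x n) (y n) - b)) \<longlonglongrightarrow> 0" for b v
    proof (rule Lim_transform[OF tendsto_const[of "b v"]])
      show "(\<lambda>n. Xinner P (x n) (y n) v - b v) \<longlonglongrightarrow> 0"
        by (rule tendsto_norm_zero_cancel, rule tendsto_sandwich[OF _ _ tendsto_const b(2)];
            intro always_eventually allI)
           (use c0_norm_ge[OF c0_diff[OF inA b(1)]] in auto)
    qed
    show "a = ?a"
    proof
      fix v
      show "a v = ?a v"
        by (rule LIMSEQ_unique[OF pt pt[OF inner_c0[OF \<xi> \<eta>] conv[OF xy]]])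
           (use a xy in auto)
    qed
  qed
  then show ?thesis by (simp add: completion_def coeff_P)
qed

lemma coeff_completion: "coeff (completion P) = c0 V"
  by (simp add: completion_def coeff_P)

text \<open>Scalars and both actions of the coefficient algebra multiply coordinates by a bounded
  function. Such maps are Lipschitz, and \<open>lin\<close> is the estimate that feeds them to
  \<open>extend_cls\<close>.\<close>

lemma completion_iso: "corr_iso H (completion P) cls (\<lambda>a. a)"
proof -
  have lin: "hn (\<lambda>i. b i * x i - b i * y i) \<le> C * hn (\<lambda>i. x i - y i)"
    if "x \<in> K" "y \<in> K" "\<And>i. i \<in> I \<Longrightarrow> cmod (b i) \<le> C" "0 \<le> C" for x y b C
  proof (rule hn_dominated[OF K_diff])
    show "(\<lambda>i. b i * x i - b i * y i) \<in> K" using that by (intro K_diff K_mult_bounded)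
    fix v
    show "l2n (fb v) (\<lambda>i. b i * x i - b i * y i) \<le> C * l2n (fb v) (\<lambda>i. x i - y i)"
    proof (rule l2_dominated(2)[OF K_l2[OF K_diff[OF that(1,2)]] _ that(4)])
      fix i assume "i \<in> fb v"
      then have "cmod (b i) * cmod (x i - y i) \<le> C * cmod (x i - y i)"
        using that(3) by (intro mult_right_mono) (auto simp: fib_def)
      then show "cmod (b i * x i - b i * y i) \<le> C * cmod (x i - y i)"
        by (simp add: norm_mult right_diff_distrib[symmetric])
    qed
  qed (use that in auto)
  show ?thesis
  proof
    show "bij_betw cls (Xcar H) (Xcar (completion P))"
      by (simp add: completion_carrier bij_betw_def cls_inj)
    show "coeff_iso (coeff H) (coeff (completion P)) (\<lambda>a. a)"
      by (simp add: coeff_iso_def completion_def coeff_P bij_betw_def)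
    show "cls (Xzero H) = Xzero (completion P)"
    proof -
      have "(\<lambda>_. Xzero P) \<in> cls (\<lambda>_. 0)" by (simp add: cls_def zero_P hn_zero)
      then show ?thesis using cauchy_class_eq[OF K_zero] by (simp add: completion_def)
    qed
  next
    fix x c' assume x: "x \<in> Xcar H"
    then have "extend P (Xscale P c') (cls x) = cls (\<lambda>i. c' * x i)"
      by (intro extend_cls[where C="cmod c'"]) (auto simp: scale_P K_scale intro!: lin)
    then show "cls (Xscale H c' x) = Xscale (completion P) c' (cls x)" by (simp add: completion_def)
  next
    fix x a assume x: "x \<in> Xcar H" and a: "a \<in> Acar (coeff H)"
    obtain C where C: "0 \<le> C" "\<And>v. cmod (a v) \<le> C" using c0_bounded a by auto
    have "extend P (\<lambda>x. Xright P x a) (cls x) = cls (\<lambda>i. x i * a (s i))"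
      using x a C lin[of _ _ "\<lambda>i. a (s i)" C]
      by (intro extend_cls[where C=C]) (auto simp: right_P K_right mult.commute)
    then show "cls (Xright H x a) = Xright (completion P) (cls x) a" by (simp add: completion_def)
    have "extend P (Xleft P a) (cls x) = cls (\<lambda>i. a (r i) * x i)"
      using x a C lin[of _ _ "\<lambda>i. a (r i)" C]
      by (intro extend_cls[where C=C]) (auto simp: left_P K_left)
    then show "cls (Xleft H a x) = Xleft (completion P) a (cls x)" by (simp add: completion_def)
  next
    fix x y assume "x \<in> Xcar H" "y \<in> Xcar H" "\<And>z. z \<in> Xcar H \<Longrightarrow> Xinner H z x = Xinner H z y"
    then show "x = y" using inner_nondegenerate by simp
  qed (auto simp: completion_add completion_inner inner_c0 K_zero K_add K_scale K_right K_left
      coeff_completion c0_zero c0_add)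
qed

end

section \<open>Transport of operator algebras\<close>

definition conj_op :: "('a, 'x) corr \<Rightarrow> ('b, 'y) corr \<Rightarrow> ('x \<Rightarrow> 'y) \<Rightarrow> ('x \<Rightarrow> 'x) \<Rightarrow> ('y \<Rightarrow> 'y)" where
  "conj_op X Y W T = (\<lambda>y\<in>Xcar Y. W (T (inv_into (Xcar X) W y)))"

text \<open>The same constants are admissible for both operators, so the two infima agree, whatever
  they are.\<close>

lemma op_norm_transport:
  assumes "W ` Xcar X = Xcar Y" "\<And>x. x \<in> Xcar X \<Longrightarrow> Xnorm Y (W x) = Xnorm X x"
    and "\<And>x. x \<in> Xcar X \<Longrightarrow> T x \<in> Xcar X" "\<And>x. x \<in> Xcar X \<Longrightarrow> S (W x) = W (T x)"
  shows "op_norm Y S = op_norm X T"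
proof -
  have "(\<forall>y\<in>Xcar Y. Xnorm Y (S y) \<le> C * Xnorm Y y) \<longleftrightarrow> (\<forall>x\<in>Xcar X. Xnorm X (T x) \<le> C * Xnorm X x)" for C
    using assms unfolding assms(1)[symmetric] by simp
  then show ?thesis by (simp add: op_norm_def)
qed

lemma generated_algebra_least: "closed_subalgebra X B \<Longrightarrow> S \<subseteq> B \<Longrightarrow> generated_algebra X S \<subseteq> B"
  by (auto simp: generated_algebra_def)

lemma generated_cstar_least: "closed_star_subalgebra X B \<Longrightarrow> S \<subseteq> B \<Longrightarrow> generated_cstar X S \<subseteq> B"
  by (auto simp: generated_cstar_def)

lemma generated_algebra_base: "S \<subseteq> generated_algebra X S"
  by (auto simp: generated_algebra_def)

lemma generated_cstar_base: "S \<subseteq> generated_cstar X S"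
  by (auto simp: generated_cstar_def)

lemma closed_subalgebra_limit:
  assumes "closed_subalgebra X B" "T \<in> adjointable X" "\<And>n::nat. t n \<in> B"
    "(\<lambda>n. op_norm X (op_add X (t n) (op_scale X (- 1) T))) \<longlonglongrightarrow> 0"
  shows "T \<in> B"
proof -
  have "\<forall>t. \<forall>T\<in>adjointable X. (\<forall>n::nat. t n \<in> B) \<and>
      (\<lambda>n. op_norm X (op_add X (t n) (op_scale X (- 1) T))) \<longlonglongrightarrow> 0 \<longrightarrow> T \<in> B"
    using assms(1) by (simp add: closed_subalgebra_def)
  from bspec[OF spec[OF this, of t] assms(2)] show ?thesis using assms(3,4) by simp
qed

lemma closed_subalgebraD:
  assumes "closed_subalgebra X B"
  shows "B \<subseteq> adjointable X"
    and "S \<in> B \<Longrightarrow> T \<in> B \<Longrightarrow> op_add X S T \<in> B"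
    and "S \<in> B \<Longrightarrow> T \<in> B \<Longrightarrow> op_mult X S T \<in> B"
    and "T \<in> B \<Longrightarrow> op_scale X c T \<in> B"
  using assms by (simp_all add: closed_subalgebra_def)

lemma closed_subalgebra_Inter:
  assumes "\<B> \<noteq> {}" and cl: "\<And>B. B \<in> \<B> \<Longrightarrow> closed_subalgebra X B"
  shows "closed_subalgebra X (\<Inter>\<B>)"
  unfolding closed_subalgebra_def
proof (intro conjI ballI allI impI)
  obtain B where "B \<in> \<B>" using assms(1) by blast
  then show "\<Inter>\<B> \<subseteq> adjointable X" using closed_subalgebraD(1)[OF cl] by blast
next
  fix S T assume "S \<in> \<Inter>\<B>" "T \<in> \<Inter>\<B>"
  then show "op_add X S T \<in> \<Inter>\<B>" "op_mult X S T \<in> \<Inter>\<B>"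
    using closed_subalgebraD(2,3)[OF cl] by simp_all
next
  fix T c assume "T \<in> \<Inter>\<B>"
  then show "op_scale X c T \<in> \<Inter>\<B>" using closed_subalgebraD(4)[OF cl] by simp
next
  fix t :: "nat \<Rightarrow> _" and T assume T: "T \<in> adjointable X"
    and t: "(\<forall>n. t n \<in> \<Inter>\<B>) \<and> (\<lambda>n. op_norm X (op_add X (t n) (op_scale X (- 1) T))) \<longlonglongrightarrow> 0"
  show "T \<in> \<Inter>\<B>"
  proof (rule InterI)
    fix B assume B: "B \<in> \<B>"
    then have "t n \<in> B" for n using t by simp
    from closed_subalgebra_limit[OF cl[OF B] T this conjunct2[OF t]] show "T \<in> B" .
  qed
qed

text \<open>The algebra of all adjointable operators is itself one of the algebras intersected, so
  the family is not empty.\<close>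

lemma generated_algebra_closed:
  assumes "closed_subalgebra X (adjointable X)" "S \<subseteq> adjointable X"
  shows "closed_subalgebra X (generated_algebra X S)"
  unfolding generated_algebra_def
proof (rule closed_subalgebra_Inter)
  have "adjointable X \<in> {B. closed_subalgebra X B \<and> S \<subseteq> B}" using assms by simp
  then show "{B. closed_subalgebra X B \<and> S \<subseteq> B} \<noteq> {}" by blast
qed simp

lemma generated_cstar_closed:
  assumes "closed_star_subalgebra X (adjointable X)" "S \<subseteq> adjointable X"
  shows "closed_star_subalgebra X (generated_cstar X S)"
proof -
  have "closed_subalgebra X (generated_cstar X S)"
    unfolding generated_cstar_def
  proof (rule closed_subalgebra_Inter)
    have "adjointable X \<in> {B. closed_star_subalgebra X B \<and> S \<subseteq> B}" using assms by simp
    then show "{B. closed_star_subalgebra X B \<and> S \<subseteq> B} \<noteq> {}" by blast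
  qed (simp add: closed_star_subalgebra_def)
  moreover have "op_adj X T \<in> generated_cstar X S" if T: "T \<in> generated_cstar X S" for T
    unfolding generated_cstar_def
  proof (rule InterI)
    fix B assume B: "B \<in> {B. closed_star_subalgebra X B \<and> S \<subseteq> B}"
    then have "T \<in> B" using T unfolding generated_cstar_def by blast
    then show "op_adj X T \<in> B" using B by (simp add: closed_star_subalgebra_def)
  qed
  ultimately show ?thesis by (simp add: closed_star_subalgebra_def)
qed

lemma algebra_iso_trans:
  assumes "algebra_iso X B Y C \<psi>" "algebra_iso Y C Z D \<phi>"
  shows "algebra_iso X B Z D (\<phi> \<circ> \<psi>)"
proof -
  have "\<psi> T \<in> C" if "T \<in> B" for T using assms(1) that by (auto simp: algebra_iso_def bij_betw_def)
  then show ?thesis using assms unfolding algebra_iso_def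
    by (auto intro: bij_betw_trans)
qed

lemma star_iso_trans:
  assumes "star_iso X B Y C \<psi>" "star_iso Y C Z D \<phi>"
  shows "star_iso X B Z D (\<phi> \<circ> \<psi>)"
proof -
  have "\<psi> T \<in> C" if "T \<in> B" for T
    using assms(1) that by (auto simp: star_iso_def algebra_iso_def bij_betw_def)
  then show ?thesis using assms algebra_iso_trans[of X B Y C \<psi> Z D \<phi>] unfolding star_iso_def by auto
qed

lemma completely_isometric_iso_trans:
  assumes "completely_isometric_iso X B Y C \<psi>" "completely_isometric_iso Y C Z D \<phi>"
  shows "completely_isometric_iso X B Z D (\<phi> \<circ> \<psi>)"
proof -
  have "\<psi> T \<in> C" if "T \<in> B" for T
    using assms(1) that by (auto simp: completely_isometric_iso_def algebra_iso_def bij_betw_def)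
  then show ?thesis using assms unfolding completely_isometric_iso_def
    by (auto intro: algebra_iso_trans)
qed

context corr_iso
begin

abbreviation "Ad \<equiv> conj_op X Y W"

lemma Ad_apply: "x \<in> Xcar X \<Longrightarrow> Ad T (W x) = W (T x)"
  by (simp add: conj_op_def W_in)

lemma Ad_in:
  assumes "T \<in> Xcar X \<rightarrow>\<^sub>E Xcar X"
  shows "Ad T \<in> Xcar Y \<rightarrow>\<^sub>E Xcar Y"
  by (auto simp: conj_op_def intro!: W_in PiE_mem[OF assms] W'_in)

lemma op_eqI:
  assumes "S \<in> extensional (Xcar Y)" "T \<in> extensional (Xcar Y)" "\<And>x. x \<in> Xcar X \<Longrightarrow> S (W x) = T (W x)"
  shows "S = T"
proof (rule extensionalityI[OF assms(1,2)])
  fix y assume "y \<in> Xcar Y"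
  then obtain x where "x \<in> Xcar X" "y = W x" using W_surj by blast
  then show "S y = T y" using assms(3) by simp
qed

lemma Ad_ext: "Ad T \<in> extensional (Xcar Y)"
  by (simp add: conj_op_def)

lemma Ad_inj: "inj_on Ad (Xcar X \<rightarrow>\<^sub>E Xcar X)"
proof (rule inj_onI)
  fix S T assume ST: "S \<in> Xcar X \<rightarrow>\<^sub>E Xcar X" "T \<in> Xcar X \<rightarrow>\<^sub>E Xcar X" "Ad S = Ad T"
  show "S = T"
  proof (rule PiE_ext[OF ST(1,2)])
    fix x assume x: "x \<in> Xcar X"
    then show "S x = T x" using ST Ad_apply[of x S] Ad_apply[of x T] by (simp add: W_inj PiE_mem[OF ST(1)] PiE_mem[OF ST(2)])
  qed
qed

lemma Ad_surj:
  assumes "S \<in> Xcar Y \<rightarrow>\<^sub>E Xcar Y"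
  shows "\<exists>T \<in> Xcar X \<rightarrow>\<^sub>E Xcar X. S = Ad T"
proof (rule bexI)
  show "(\<lambda>x\<in>Xcar X. W' (S (W x))) \<in> Xcar X \<rightarrow>\<^sub>E Xcar X"
    by (auto simp: W_in W'_in PiE_mem[OF assms])
  have "S \<in> extensional (Xcar Y)" using assms by (simp add: PiE_def)
  then show "S = Ad (\<lambda>x\<in>Xcar X. W' (S (W x)))"
    by (rule op_eqI[OF _ Ad_ext]) (simp add: Ad_apply W_in PiE_mem[OF assms])
qed

lemma Ad_sym: "T \<in> Xcar X \<rightarrow>\<^sub>E Xcar X \<Longrightarrow> conj_op Y X W' (Ad T) = T"
proof (rule extensionalityI[of _ "Xcar X"])
  fix x assume x: "x \<in> Xcar X" and T: "T \<in> Xcar X \<rightarrow>\<^sub>E Xcar X"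
  have "inv_into (Xcar Y) W' x = W x"
    using inv_into_inv_into_eq[OF bij x] .
  then show "conj_op Y X W' (Ad T) x = T x"
    using x T by (simp add: conj_op_def W_in PiE_mem[OF T])
qed (auto simp: conj_op_def PiE_def)

lemma Ad_add:
  assumes "S \<in> Xcar X \<rightarrow>\<^sub>E Xcar X" "T \<in> Xcar X \<rightarrow>\<^sub>E Xcar X"
  shows "Ad (op_add X S T) = op_add Y (Ad S) (Ad T)"
  by (rule op_eqI) (auto simp: Ad_ext op_add_def Ad_apply W_in map_add PiE_mem[OF assms(1)] PiE_mem[OF assms(2)])

lemma Ad_mult:
  assumes "S \<in> Xcar X \<rightarrow>\<^sub>E Xcar X" "T \<in> Xcar X \<rightarrow>\<^sub>E Xcar X"
  shows "Ad (op_mult X S T) = op_mult Y (Ad S) (Ad T)"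
  by (rule op_eqI) (auto simp: Ad_ext op_mult_def compose_def Ad_apply W_in PiE_mem[OF assms(2)])

lemma Ad_scale:
  assumes "T \<in> Xcar X \<rightarrow>\<^sub>E Xcar X"
  shows "Ad (op_scale X c T) = op_scale Y c (Ad T)"
  by (rule op_eqI) (auto simp: Ad_ext op_scale_def Ad_apply W_in map_scale PiE_mem[OF assms])

lemma Ad_is_adjoint:
  assumes "S \<in> Xcar X \<rightarrow>\<^sub>E Xcar X" "T \<in> Xcar X \<rightarrow>\<^sub>E Xcar X"
  shows "is_adjoint Y (Ad T) (Ad S) \<longleftrightarrow> is_adjoint X T S"
proof -
  have "Xcar Y = W ` Xcar X" using bij by (simp add: bij_betw_def)
  then show ?thesis unfolding is_adjoint_def
    by (simp add: Ad_apply inner rho_inj inner_in PiE_mem[OF assms(1)] PiE_mem[OF assms(2)])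
qed

lemma Ad_adjointable:
  assumes "T \<in> adjointable X"
  shows "Ad T \<in> adjointable Y"
proof -
  obtain S where "S \<in> Xcar X \<rightarrow>\<^sub>E Xcar X" "is_adjoint X T S" "T \<in> Xcar X \<rightarrow>\<^sub>E Xcar X"
    using assms by (auto simp: adjointable_def)
  then show ?thesis unfolding adjointable_def using Ad_in Ad_is_adjoint by blast
qed

lemma Ad_adjointable_surj:
  assumes "S \<in> adjointable Y"
  shows "\<exists>T\<in>adjointable X. S = Ad T"
proof -
  obtain S' where S: "S \<in> Xcar Y \<rightarrow>\<^sub>E Xcar Y" "S' \<in> Xcar Y \<rightarrow>\<^sub>E Xcar Y" "is_adjoint Y S S'"
    using assms by (auto simp: adjointable_def)
  obtain T T' where "T \<in> Xcar X \<rightarrow>\<^sub>E Xcar X" "S = Ad T" "T' \<in> Xcar X \<rightarrow>\<^sub>E Xcar X" "S' = Ad T'"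
    using Ad_surj[OF S(1)] Ad_surj[OF S(2)] by blast
  then show ?thesis using S(3) Ad_is_adjoint by (auto simp: adjointable_def)
qed

lemma adjoint_unique:
  assumes "S \<in> Xcar X \<rightarrow>\<^sub>E Xcar X" "S' \<in> Xcar X \<rightarrow>\<^sub>E Xcar X" "is_adjoint X T S" "is_adjoint X T S'"
  shows "S = S'"
proof (rule PiE_ext[OF assms(1,2)])
  fix x assume x: "x \<in> Xcar X"
  show "S x = S' x"
  proof (rule nondegenerate)
    fix z assume "z \<in> Xcar X"
    then have "Xinner X (T z) x = Xinner X z (S x)" "Xinner X (T z) x = Xinner X z (S' x)"
      using assms(3,4) x by (simp_all add: is_adjoint_def)
    then show "Xinner X z (S x) = Xinner X z (S' x)" by simp
  qed (use x assms PiE_mem in auto)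
qed

lemma op_adj_eqI:
  assumes "S \<in> Xcar X \<rightarrow>\<^sub>E Xcar X" "is_adjoint X T S"
  shows "op_adj X T = S"
  unfolding op_adj_def
proof (rule the_equality)
  show "S \<in> Xcar X \<rightarrow>\<^sub>E Xcar X \<and> is_adjoint X T S" using assms by (rule conjI)
  fix S' assume S': "S' \<in> Xcar X \<rightarrow>\<^sub>E Xcar X \<and> is_adjoint X T S'"
  show "S' = S" by (rule adjoint_unique[OF conjunct1[OF S'] assms(1) conjunct2[OF S'] assms(2)])
qed

lemma op_adj_is_adjoint:
  assumes "T \<in> adjointable X"
  shows "op_adj X T \<in> Xcar X \<rightarrow>\<^sub>E Xcar X" "is_adjoint X T (op_adj X T)"
proof -
  obtain S where "S \<in> Xcar X \<rightarrow>\<^sub>E Xcar X" "is_adjoint X T S" using assms by (auto simp: adjointable_def)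
  then show "op_adj X T \<in> Xcar X \<rightarrow>\<^sub>E Xcar X" "is_adjoint X T (op_adj X T)"
    using op_adj_eqI by simp_all
qed

text \<open>An adjoint is a definite description, so uniqueness is needed over \<open>Y\<close> as
  well. Every candidate there is a conjugate of an operator over \<open>X\<close>, where uniqueness
  is known.\<close>

lemma Ad_op_adj:
  assumes "T \<in> adjointable X"
  shows "Ad (op_adj X T) = op_adj Y (Ad T)"
proof -
  have T: "T \<in> Xcar X \<rightarrow>\<^sub>E Xcar X" using assms by (simp add: adjointable_def)
  note adj = op_adj_is_adjoint[OF assms]
  have "op_adj Y (Ad T) = Ad (op_adj X T)"
    unfolding op_adj_def[of Y]
  proof (rule the_equality)
    show "Ad (op_adj X T) \<in> Xcar Y \<rightarrow>\<^sub>E Xcar Y \<and> is_adjoint Y (Ad T) (Ad (op_adj X T))"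
      using adj T by (simp add: Ad_in Ad_is_adjoint)
    fix S assume S: "S \<in> Xcar Y \<rightarrow>\<^sub>E Xcar Y \<and> is_adjoint Y (Ad T) S"
    then obtain S' where S': "S' \<in> Xcar X \<rightarrow>\<^sub>E Xcar X" "S = Ad S'" using Ad_surj by blast
    then have "is_adjoint X T S'" using S Ad_is_adjoint[OF S'(1) T] by simp
    then show "S = Ad (op_adj X T)" using adjoint_unique[OF S'(1) adj(1) _ adj(2)] S'(2) by simp
  qed
  then show ?thesis by simp
qed

lemma Ad_op_norm:
  assumes "T \<in> Xcar X \<rightarrow>\<^sub>E Xcar X"
  shows "op_norm Y (Ad T) = op_norm X T"
  using bij assms by (intro op_norm_transport) (auto simp: bij_betw_def Xnorm_W Ad_apply)

text \<open>For norm closedness the limit is written as a conjugate of an adjointable operator;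
  conjugation preserves the norm of the differences, so the sequence converges already over
  \<open>X\<close>.\<close>

lemma closed_subalgebra_Ad:
  assumes "closed_subalgebra X B"
  shows "closed_subalgebra Y (Ad ` B)"
proof -
  note adj = closed_subalgebraD(1)[OF assms]
  then have E: "T \<in> Xcar X \<rightarrow>\<^sub>E Xcar X" if "T \<in> B" for T using that by (auto simp: adjointable_def)
  show ?thesis unfolding closed_subalgebra_def
  proof (intro conjI ballI allI impI)
    show "Ad ` B \<subseteq> adjointable Y" using adj Ad_adjointable by blast
  next
    fix S T assume "S \<in> Ad ` B" "T \<in> Ad ` B"
    then obtain S' T' where "S' \<in> B" "T' \<in> B" "S = Ad S'" "T = Ad T'" by blast
    then show "op_add Y S T \<in> Ad ` B" "op_mult Y S T \<in> Ad ` B"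
      using closed_subalgebraD(2,3)[OF assms, of S' T'] E
      by (simp_all add: Ad_add[symmetric] Ad_mult[symmetric])
  next
    fix T c assume "T \<in> Ad ` B"
    then obtain T' where "T' \<in> B" "T = Ad T'" by blast
    then show "op_scale Y c T \<in> Ad ` B"
      using closed_subalgebraD(4)[OF assms, of T' c] E by (simp add: Ad_scale[symmetric])
  next
    fix t :: "nat \<Rightarrow> _" and T assume T: "T \<in> adjointable Y"
      and t: "(\<forall>n. t n \<in> Ad ` B) \<and> (\<lambda>n. op_norm Y (op_add Y (t n) (op_scale Y (- 1) T))) \<longlonglongrightarrow> 0"
    obtain T' where T': "T' \<in> adjointable X" "T = Ad T'" using Ad_adjointable_surj[OF T] by blast
    then have T'E: "T' \<in> Xcar X \<rightarrow>\<^sub>E Xcar X" by (simp add: adjointable_def)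
    have "\<forall>n. \<exists>u\<in>B. t n = Ad u" using t by blast
    then obtain u where u: "\<And>n. u n \<in> B" "\<And>n. t n = Ad (u n)" by metis
    have sE: "op_scale X (- 1) T' \<in> Xcar X \<rightarrow>\<^sub>E Xcar X"
      using T'E by (auto simp: op_scale_def scale_in PiE_mem[OF T'E])
    have aE: "op_add X (u n) (op_scale X (- 1) T') \<in> Xcar X \<rightarrow>\<^sub>E Xcar X" for n
      using E[OF u(1), of n] sE by (auto simp: op_add_def intro!: add_in)
    have "op_norm Y (op_add Y (t n) (op_scale Y (- 1) T)) = op_norm X (op_add X (u n) (op_scale X (- 1) T'))" for n
      unfolding T'(2) u(2) using Ad_op_norm[OF aE] by (simp add: Ad_scale T'E Ad_add sE E u)
    then have "(\<lambda>n. op_norm X (op_add X (u n) (op_scale X (- 1) T'))) \<longlonglongrightarrow> 0" using t by simp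
    with closed_subalgebra_limit[OF assms T'(1) u(1)] have "T' \<in> B" .
    then show "T \<in> Ad ` B" using T' by blast
  qed
qed

lemma closed_star_subalgebra_Ad:
  assumes "closed_star_subalgebra X B"
  shows "closed_star_subalgebra Y (Ad ` B)"
proof -
  have "op_adj Y (Ad T) \<in> Ad ` B" if "T \<in> B" for T
  proof -
    have "T \<in> adjointable X"
      using closed_subalgebraD(1) assms that unfolding closed_star_subalgebra_def by blast
    moreover have "op_adj X T \<in> B" using assms that by (simp add: closed_star_subalgebra_def)
    ultimately show ?thesis using imageI[of "op_adj X T" B Ad] by (simp add: Ad_op_adj)
  qed
  then show ?thesis using assms closed_subalgebra_Ad by (simp add: closed_star_subalgebra_def)
qed

lemma algebra_iso_Ad:
  assumes "B \<subseteq> Xcar X \<rightarrow>\<^sub>E Xcar X"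
  shows "algebra_iso X B Y (Ad ` B) Ad"
proof -
  have "T \<in> Xcar X \<rightarrow>\<^sub>E Xcar X" if "T \<in> B" for T using assms that by blast
  moreover have "bij_betw Ad B (Ad ` B)" using inj_on_subset[OF Ad_inj assms] by (simp add: bij_betw_def)
  ultimately show ?thesis unfolding algebra_iso_def by (simp add: Ad_add Ad_mult Ad_scale)
qed

lemma star_iso_Ad:
  assumes "B \<subseteq> adjointable X"
  shows "star_iso X B Y (Ad ` B) Ad"
proof -
  have "B \<subseteq> Xcar X \<rightarrow>\<^sub>E Xcar X" using assms by (auto simp: adjointable_def)
  moreover have "Ad (op_adj X T) = op_adj Y (Ad T)" if "T \<in> B" for T using assms that Ad_op_adj by blast
  ultimately show ?thesis using algebra_iso_Ad by (simp add: star_iso_def)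
qed

lemma Xsum_in: "(\<And>i. i < n \<Longrightarrow> f i \<in> Xcar X) \<Longrightarrow> Xsum X f n \<in> Xcar X"
  by (induction n) (auto simp: zero_in add_in)

lemma W_Xsum: "(\<And>i. i < n \<Longrightarrow> f i \<in> Xcar X) \<Longrightarrow> W (Xsum X f n) = Xsum Y (\<lambda>i. W (f i)) n"
  by (induction n) (auto simp: map_zero map_add Xsum_in)

lemma rho_sum:
  assumes "finite F" "\<And>i. i \<in> F \<Longrightarrow> f i \<in> Acar (coeff X)"
  shows "sum f F \<in> Acar (coeff X) \<and> \<rho> (sum f F) = (\<Sum>i\<in>F. \<rho> (f i))"
  using assms by (induction F) (auto simp: coeff_zero_in coeff_add_in rho_zero rho_add)

text \<open>Applying \<open>W\<close> to every entry maps the amplification of \<open>X\<close>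
  isometrically onto that of \<open>Y\<close> and intertwines the two matrices of operators.\<close>

lemma completely_isometric_iso_Ad:
  assumes B: "B \<subseteq> Xcar X \<rightarrow>\<^sub>E Xcar X"
  shows "completely_isometric_iso X B Y (Ad ` B) Ad"
  unfolding completely_isometric_iso_def
proof (intro conjI allI impI algebra_iso_Ad[OF B])
  fix k :: nat and M assume M: "\<forall>i<k. \<forall>j<k. M i j \<in> B"
  let ?Xk = "amplification k X" and ?Yk = "amplification k Y"
  let ?Wk = "\<lambda>x. \<lambda>i\<in>{..<k}. W (x i)"
  have car: "Xcar ?Xk = {..<k} \<rightarrow>\<^sub>E Xcar X" "Xcar ?Yk = {..<k} \<rightarrow>\<^sub>E Xcar Y"
    by (simp_all add: amplification_def)
  have Mx: "M i j (x j) \<in> Xcar X" if "x \<in> Xcar ?Xk" "i < k" "j < k" for i j x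
  proof -
    have "M i j \<in> Xcar X \<rightarrow>\<^sub>E Xcar X" using that M B by blast
    moreover have "x j \<in> Xcar X" using that by (auto simp: car)
    ultimately show ?thesis by (rule PiE_mem)
  qed
  show "op_norm ?Yk (matrix_op k Y (\<lambda>i j. Ad (M i j))) = op_norm ?Xk (matrix_op k X M)"
  proof (rule op_norm_transport[where W="?Wk"])
    show "?Wk ` Xcar ?Xk = Xcar ?Yk"
    proof (intro equalityI subsetI)
      fix y assume y: "y \<in> Xcar ?Yk"
      then have yi: "y i \<in> Xcar Y" if "i < k" for i using that by (auto simp: car)
      have "y \<in> extensional {..<k}" using y unfolding car PiE_def by simp
      then have "y = ?Wk (\<lambda>i\<in>{..<k}. W' (y i))"
        by (rule extensionalityI) (simp_all add: yi)
      moreover have "(\<lambda>i\<in>{..<k}. W' (y i)) \<in> Xcar ?Xk"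
        unfolding car by (rule PiE_I) (simp_all add: W'_in yi)
      ultimately show "y \<in> ?Wk ` Xcar ?Xk" by blast
    next
      fix y assume "y \<in> ?Wk ` Xcar ?Xk"
      then obtain x where x: "x \<in> {..<k} \<rightarrow>\<^sub>E Xcar X" "y = ?Wk x" unfolding car by blast
      show "y \<in> Xcar ?Yk" unfolding car x(2) by (rule PiE_I) (simp_all add: W_in PiE_mem[OF x(1)])
    qed
  next
    fix x assume x: "x \<in> Xcar ?Xk"
    then have xi: "x i \<in> Xcar X" if "i < k" for i using that by (auto simp: car)
    have s: "(\<Sum>i<k. Xinner X (x i) (x i)) \<in> Acar (coeff X) \<and>
      \<rho> (\<Sum>i<k. Xinner X (x i) (x i)) = (\<Sum>i<k. \<rho> (Xinner X (x i) (x i)))"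
      by (rule rho_sum) (auto simp: xi inner_in)
    show "Xnorm ?Yk (?Wk x) = Xnorm ?Xk x"
      using norm[OF conjunct1[OF s]] s by (simp add: Xnorm_def amplification_def inner xi)
    have mo: "matrix_op k X M x = (\<lambda>i\<in>{..<k}. Xsum X (\<lambda>j. M i j (x j)) k)"
      using x by (simp add: matrix_op_def)
    show "matrix_op k X M x \<in> Xcar ?Xk"
      unfolding mo car by (rule PiE_I) (simp_all add: Xsum_in Mx[OF x])
    have Wx: "?Wk x \<in> Xcar ?Yk" unfolding car by (rule PiE_I) (simp_all add: W_in xi)
    have "Xsum Y (\<lambda>j. Ad (M i j) (?Wk x j)) k = W (Xsum X (\<lambda>j. M i j (x j)) k)" if "i < k" for i
    proof -
      have "Xsum Y (\<lambda>j. Ad (M i j) (?Wk x j)) n = Xsum Y (\<lambda>j. W (M i j (x j))) n" if "n \<le> k" for n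
        using that by (induction n) (auto simp: Ad_apply xi)
      then show ?thesis using W_Xsum[of k "\<lambda>j. M i j (x j)"] Mx[OF x that] by simp
    qed
    then have "(\<lambda>i\<in>{..<k}. Xsum Y (\<lambda>j. Ad (M i j) (?Wk x j)) k) = ?Wk (matrix_op k X M x)"
      unfolding mo by (intro restrict_ext) simp
    then show "matrix_op k Y (\<lambda>i j. Ad (M i j)) (?Wk x) = ?Wk (matrix_op k X M x)"
      using Wx by (simp add: matrix_op_def)
  qed
qed

end

lemma Ad_trans:
  assumes "corr_iso X Y W \<rho>" "corr_iso Y Z W2 \<rho>2" "T \<in> Xcar X \<rightarrow>\<^sub>E Xcar X"
  shows "conj_op Y Z W2 (conj_op X Y W T) = conj_op X Z (W2 \<circ> W) T"
proof -
  interpret one: corr_iso X Y W \<rho> by fact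
  interpret two: corr_iso Y Z W2 \<rho>2 by fact
  interpret three: corr_iso X Z "W2 \<circ> W" "\<rho>2 \<circ> \<rho>" by (rule corr_iso_trans[OF assms(1,2)])
  show ?thesis
  proof (rule three.op_eqI[OF two.Ad_ext three.Ad_ext])
    fix x assume x: "x \<in> Xcar X"
    then show "conj_op Y Z W2 (conj_op X Y W T) ((W2 \<circ> W) x) = conj_op X Z (W2 \<circ> W) T ((W2 \<circ> W) x)"
      using three.Ad_apply[OF x, of T] two.Ad_apply[OF one.W_in[OF x], of "conj_op X Y W T"]
        one.Ad_apply[OF x, of T] by simp
  qed
qed

text \<open>One inclusion holds because the image is a closed algebra containing the generators. For
  the other, a competing algebra over \<open>Y\<close> is pulled back by the inverse isomorphism,
  and minimality over \<open>X\<close> applies.\<close>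

lemma generated_algebra_Ad:
  fixes X :: "('v \<Rightarrow> complex, 'x) corr"
  assumes "corr_iso X Y W \<rho>" "coeff X = c0 V" "closed_subalgebra X (adjointable X)" "S \<subseteq> adjointable X"
  shows "generated_algebra Y (conj_op X Y W ` S) = conj_op X Y W ` generated_algebra X S"
proof -
  interpret corr_iso X Y W \<rho> by fact
  interpret inv: corr_iso Y X W' \<rho>' by (rule corr_iso_sym[OF assms(1,2)])
  have SE: "S \<subseteq> Xcar X \<rightarrow>\<^sub>E Xcar X" using assms(4) by (auto simp: adjointable_def)
  note A = generated_algebra_closed[OF assms(3,4)]
  show ?thesis
  proof
    show "generated_algebra Y (Ad ` S) \<subseteq> Ad ` generated_algebra X S"
      by (intro generated_algebra_least closed_subalgebra_Ad A image_mono generated_algebra_base)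
  next
    have "Ad T \<in> B" if T: "T \<in> generated_algebra X S" and B: "closed_subalgebra Y B" "Ad ` S \<subseteq> B" for T B
    proof -
      have "S \<subseteq> inv.Ad ` B"
      proof
        fix U assume U: "U \<in> S"
        then have "U = inv.Ad (Ad U)" using SE Ad_sym by auto
        then show "U \<in> inv.Ad ` B" using U B(2) by blast
      qed
      then have "generated_algebra X S \<subseteq> inv.Ad ` B"
        by (intro generated_algebra_least inv.closed_subalgebra_Ad B)
      then obtain U where U: "U \<in> B" "T = inv.Ad U" using T by blast
      have UE: "U \<in> Xcar Y \<rightarrow>\<^sub>E Xcar Y" 
        using closed_subalgebraD(1)[OF B(1)] U(1) by (auto simp: adjointable_def)
      obtain T' where "T' \<in> Xcar X \<rightarrow>\<^sub>E Xcar X" "U = Ad T'" using Ad_surj[OF UE] by blast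
      then show ?thesis using U Ad_sym by auto
    qed
    then show "Ad ` generated_algebra X S \<subseteq> generated_algebra Y (Ad ` S)"
      unfolding generated_algebra_def[of Y] by blast
  qed
qed

lemma generated_cstar_Ad:
  fixes X :: "('v \<Rightarrow> complex, 'x) corr"
  assumes "corr_iso X Y W \<rho>" "coeff X = c0 V" "closed_star_subalgebra X (adjointable X)" "S \<subseteq> adjointable X"
  shows "generated_cstar Y (conj_op X Y W ` S) = conj_op X Y W ` generated_cstar X S"
proof -
  interpret corr_iso X Y W \<rho> by fact
  interpret inv: corr_iso Y X W' \<rho>' by (rule corr_iso_sym[OF assms(1,2)])
  have SE: "S \<subseteq> Xcar X \<rightarrow>\<^sub>E Xcar X" using assms(4) by (auto simp: adjointable_def)
  note A = generated_cstar_closed[OF assms(3,4)]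
  show ?thesis
  proof
    show "generated_cstar Y (Ad ` S) \<subseteq> Ad ` generated_cstar X S"
      by (intro generated_cstar_least closed_star_subalgebra_Ad A image_mono generated_cstar_base)
  next
    have "Ad T \<in> B" if T: "T \<in> generated_cstar X S" and B: "closed_star_subalgebra Y B" "Ad ` S \<subseteq> B" for T B
    proof -
      have "S \<subseteq> inv.Ad ` B"
      proof
        fix U assume U: "U \<in> S"
        then have "U = inv.Ad (Ad U)" using SE Ad_sym by auto
        then show "U \<in> inv.Ad ` B" using U B(2) by blast
      qed
      then have "generated_cstar X S \<subseteq> inv.Ad ` B"
        by (intro generated_cstar_least inv.closed_star_subalgebra_Ad B)
      then obtain U where U: "U \<in> B" "T = inv.Ad U" using T by blast
      have UE: "U \<in> Xcar Y \<rightarrow>\<^sub>E Xcar Y"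
        using closed_subalgebraD(1)[of Y B] B(1) U(1) unfolding closed_star_subalgebra_def adjointable_def by blast
      obtain T' where "T' \<in> Xcar X \<rightarrow>\<^sub>E Xcar X" "U = Ad T'" using Ad_surj[OF UE] by blast
      then show ?thesis using U Ad_sym by auto
    qed
    then show "Ad ` generated_cstar X S \<subseteq> generated_cstar Y (Ad ` S)"
      unfolding generated_cstar_def[of Y] by blast
  qed
qed

section \<open>Adjointable operators on fibred Hilbert modules\<close>

context fibred
begin

lemma id_iso: "corr_iso H H (\<lambda>x. x) (\<lambda>a. a)"
proof
  show "coeff_iso (coeff H) (coeff H) (\<lambda>a. a)" by (simp add: coeff_iso_def bij_betw_def)
  show "x = y" if "x \<in> Xcar H" "y \<in> Xcar H" "\<And>z. z \<in> Xcar H \<Longrightarrow> Xinner H z x = Xinner H z y" for x y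
    using inner_nondegenerate that by simp
qed (simp_all add: bij_betw_def inner_c0 K_zero K_add K_scale K_right K_left c0_zero c0_add)

interpretation idc: corr_iso H H "\<lambda>x. x" "\<lambda>a. a"
  by (rule id_iso)

lemma is_adjoint_iff:
  "is_adjoint H T S \<longleftrightarrow> (\<forall>x\<in>K. \<forall>y\<in>K. \<forall>v. l2ip (fb v) (T x) y = l2ip (fb v) x (S y))"
  by (simp add: is_adjoint_def fun_eq_iff)

lemma is_adjointD:
  "is_adjoint H T S \<Longrightarrow> x \<in> K \<Longrightarrow> y \<in> K \<Longrightarrow> l2ip (fb v) (T x) y = l2ip (fb v) x (S y)"
  by (simp add: is_adjoint_iff)

lemma is_adjoint_sym: "is_adjoint H T S \<Longrightarrow> is_adjoint H S T"
  unfolding is_adjoint_iff by (metis l2ip_cnj)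

lemma adjointable_E: "T \<in> adjointable H \<Longrightarrow> T \<in> K \<rightarrow>\<^sub>E K"
  by (simp add: adjointable_def)

lemma adjointable_K: "T \<in> adjointable H \<Longrightarrow> x \<in> K \<Longrightarrow> T x \<in> K"
  using PiE_mem[OF adjointable_E] by blast

lemma adjointableI:
  assumes "T \<in> K \<rightarrow>\<^sub>E K" "S \<in> K \<rightarrow>\<^sub>E K" "is_adjoint H T S"
  shows "T \<in> adjointable H"
  using assms by (auto simp: adjointable_def)

lemma adjointable_op_adj:
  assumes "T \<in> adjointable H"
  shows "op_adj H T \<in> adjointable H" "is_adjoint H T (op_adj H T)"
proof -
  have *: "op_adj H T \<in> K \<rightarrow>\<^sub>E K" "is_adjoint H T (op_adj H T)"
    using idc.op_adj_is_adjoint[OF assms] by simp_all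
  show "is_adjoint H T (op_adj H T)" by (rule *)
  show "op_adj H T \<in> adjointable H"
    by (rule adjointableI[OF *(1) adjointable_E[OF assms] is_adjoint_sym[OF *(2)]])
qed

lemma op_adj_eqI: "S \<in> K \<rightarrow>\<^sub>E K \<Longrightarrow> is_adjoint H T S \<Longrightarrow> op_adj H T = S"
  using idc.op_adj_eqI by simp

lemma op_simps:
  "x \<in> K \<Longrightarrow> op_add H S T x = (\<lambda>i. S x i + T x i)"
  "x \<in> K \<Longrightarrow> op_scale H c T x = (\<lambda>i. c * T x i)"
  "x \<in> K \<Longrightarrow> op_mult H S T x = S (T x)"
  by (simp_all add: op_add_def op_scale_def op_mult_def compose_def)

lemma op_in_E:
  assumes "S \<in> K \<rightarrow>\<^sub>E K" "T \<in> K \<rightarrow>\<^sub>E K"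
  shows "op_add H S T \<in> K \<rightarrow>\<^sub>E K" "op_scale H c T \<in> K \<rightarrow>\<^sub>E K" "op_mult H S T \<in> K \<rightarrow>\<^sub>E K"
proof -
  note m = PiE_mem[OF assms(1)] PiE_mem[OF assms(2)]
  show "op_add H S T \<in> K \<rightarrow>\<^sub>E K" by (rule PiE_I) (simp_all add: op_add_def K_add m)
  show "op_scale H c T \<in> K \<rightarrow>\<^sub>E K" by (rule PiE_I) (simp_all add: op_scale_def K_scale m)
  show "op_mult H S T \<in> K \<rightarrow>\<^sub>E K" by (rule PiE_I) (simp_all add: op_mult_def compose_def m)
qed

lemma op_ext:
  assumes "S \<in> K \<rightarrow>\<^sub>E K" "T \<in> K \<rightarrow>\<^sub>E K" "\<And>x. x \<in> K \<Longrightarrow> S x = T x"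
  shows "S = T"
  using PiE_ext[OF assms(1,2)] assms(3) by blast

lemma adjointable_ops:
  assumes "S \<in> adjointable H" "T \<in> adjointable H"
  shows "op_add H S T \<in> adjointable H" "op_scale H c T \<in> adjointable H" "op_mult H S T \<in> adjointable H"
    and "is_adjoint H (op_add H S T) (op_add H (op_adj H S) (op_adj H T))"
    and "is_adjoint H (op_scale H c T) (op_scale H (cnj c) (op_adj H T))"
    and "is_adjoint H (op_mult H S T) (op_mult H (op_adj H T) (op_adj H S))"
proof -
  note E = adjointable_E[OF assms(1)] adjointable_E[OF assms(2)]
  note S' = adjointable_op_adj[OF assms(1)] and T' = adjointable_op_adj[OF assms(2)]
  note E' = adjointable_E[OF S'(1)] adjointable_E[OF T'(1)]
  note m = adjointable_K[OF assms(1)] adjointable_K[OF assms(2)] adjointable_K[OF S'(1)] adjointable_K[OF T'(1)]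
  show 1: "is_adjoint H (op_add H S T) (op_add H (op_adj H S) (op_adj H T))"
    unfolding is_adjoint_iff
    by (simp add: op_simps l2ip_add_left l2ip_add_right K_l2 m is_adjointD[OF S'(2)] is_adjointD[OF T'(2)])
  show 2: "is_adjoint H (op_scale H c T) (op_scale H (cnj c) (op_adj H T))"
    unfolding is_adjoint_iff
    by (simp add: op_simps l2ip_scale_left l2ip_scale_right is_adjointD[OF T'(2)])
  show 3: "is_adjoint H (op_mult H S T) (op_mult H (op_adj H T) (op_adj H S))"
    unfolding is_adjoint_iff
    by (simp add: op_simps m is_adjointD[OF S'(2)] is_adjointD[OF T'(2)])
  show "op_add H S T \<in> adjointable H" "op_scale H c T \<in> adjointable H" "op_mult H S T \<in> adjointable H"
    using adjointableI[OF op_in_E(1)[OF E] op_in_E(1)[OF E'] 1]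
      adjointableI[OF op_in_E(2)[OF E] op_in_E(2)[OF E'] 2]
      adjointableI[OF op_in_E(3)[OF E] op_in_E(3)[OF E'(2,1)] 3] .
qed

lemma closed_star_adjointable: "closed_star_subalgebra H (adjointable H)"
  by (simp add: closed_star_subalgebra_def closed_subalgebra_def adjointable_ops adjointable_op_adj)

lemma closed_adjointable: "closed_subalgebra H (adjointable H)"
  using closed_star_adjointable by (simp add: closed_star_subalgebra_def)

text \<open>Moving the map to the other side of the inner product makes it linear against every test
  vector, and the inner product is nondegenerate.\<close>

lemma adjoint_linear:
  assumes "is_adjoint H T S" "T ` K \<subseteq> K" "S ` K \<subseteq> K" "x \<in> K" "y \<in> K"
  shows "T (\<lambda>i. x i + y i) = (\<lambda>i. T x i + T y i)" "T (\<lambda>i. c * x i) = (\<lambda>i. c * T x i)"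
proof -
  note a = is_adjointD[OF is_adjoint_sym[OF assms(1)], symmetric]
  have TK: "T x \<in> K" "S x \<in> K" if "x \<in> K" for x using assms(2,3) that by blast+
  show "T (\<lambda>i. x i + y i) = (\<lambda>i. T x i + T y i)"
  proof (rule inner_nondegenerate)
    fix z assume "z \<in> K"
    then show "Xinner H z (T (\<lambda>i. x i + y i)) = Xinner H z (\<lambda>i. T x i + T y i)"
      using assms by (simp add: a l2ip_add_right K_add K_l2 TK)
  qed (use assms in \<open>simp_all add: K_add TK\<close>)
  show "T (\<lambda>i. c * x i) = (\<lambda>i. c * T x i)"
  proof (rule inner_nondegenerate)
    fix z assume "z \<in> K"
    then show "Xinner H z (T (\<lambda>i. c * x i)) = Xinner H z (\<lambda>i. c * T x i)"
      using assms by (simp add: a l2ip_scale_right K_scale TK)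
  qed (use assms in \<open>simp_all add: K_scale TK\<close>)
qed

lemma adjointable_linear:
  assumes "T \<in> adjointable H" "x \<in> K" "y \<in> K"
  shows "T (\<lambda>i. x i + y i) = (\<lambda>i. T x i + T y i)" "T (\<lambda>i. c * x i) = (\<lambda>i. c * T x i)"
    "T (\<lambda>i. x i - y i) = (\<lambda>i. T x i - T y i)"
proof -
  have "T ` K \<subseteq> K" "op_adj H T ` K \<subseteq> K"
    using adjointable_K[OF assms(1)] adjointable_K[OF adjointable_op_adj(1)[OF assms(1)]] by blast+
  note l = adjoint_linear[OF adjointable_op_adj(2)[OF assms(1)] this]
  show "T (\<lambda>i. x i + y i) = (\<lambda>i. T x i + T y i)" "T (\<lambda>i. c * x i) = (\<lambda>i. c * T x i)"
    using assms by (simp_all add: l)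
  show "T (\<lambda>i. x i - y i) = (\<lambda>i. T x i - T y i)"
    using l(1)[OF assms(2) K_scale[OF assms(3), of "-1"]] l(2)[OF assms(3,3), of "-1"] by simp
qed

lemma adjointable_zero: "T \<in> adjointable H \<Longrightarrow> T (\<lambda>_. 0) = (\<lambda>_. 0)"
  using adjointable_linear(2)[of T "\<lambda>_. 0" "\<lambda>_. 0" 0] by (simp add: K_zero)

text \<open>The differences are summed as a geometric series. The explicit rate, not just
  convergence, is used both in the gliding hump and for the norm convergence of the square root
  iteration.\<close>

lemma geometric_limit:
  assumes x: "\<And>n::nat. x n \<in> K" and d: "\<And>n. hn (\<lambda>i. x (Suc n) i - x n i) \<le> C * q ^ n"
    and q: "0 \<le> q" "q < 1"
  shows "\<exists>y\<in>K. \<forall>n. hn (\<lambda>i. x n i - y i) \<le> C * q ^ n / (1 - q)"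
proof -
  have C: "0 \<le> C" using d[of 0] hn_nonneg[OF K_diff[OF x x], of 1 0] by simp
  have tri: "hn (\<lambda>i. a i - c i) \<le> hn (\<lambda>i. a i - b i) + hn (\<lambda>i. b i - c i)"
    if "a \<in> K" "b \<in> K" "c \<in> K" for a b c
    using hn_triangle[of "\<lambda>i. a i - b i" "\<lambda>i. b i - c i"] that by (simp add: K_diff)
  have step: "hn (\<lambda>i. x (n + k) i - x n i) \<le> C * q ^ n * (1 - q ^ k) / (1 - q)" for n k
  proof (induction k)
    case 0
    then show ?case by (simp add: hn_zero)
  next
    case (Suc k)
    have "hn (\<lambda>i. x (n + Suc k) i - x n i)
        \<le> hn (\<lambda>i. x (Suc (n + k)) i - x (n + k) i) + hn (\<lambda>i. x (n + k) i - x n i)"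
      using tri[OF x x x, of "Suc (n + k)" n "n + k"] by simp
    also have "\<dots> \<le> C * q ^ (n + k) + C * q ^ n * (1 - q ^ k) / (1 - q)"
      by (rule add_mono[OF d Suc.IH])
    also have "\<dots> = C * q ^ n * (1 - q ^ Suc k) / (1 - q)"
      using q by (simp add: field_simps power_add)
    finally show ?case .
  qed
  have bnd: "hn (\<lambda>i. x m i - x n i) \<le> C * q ^ n / (1 - q)" if "n \<le> m" for m n
  proof -
    have "hn (\<lambda>i. x m i - x n i) \<le> C * q ^ n * (1 - q ^ (m - n)) / (1 - q)"
      using step[of n "m - n"] that by simp
    also have "\<dots> \<le> C * q ^ n * 1 / (1 - q)"
      using C q by (intro divide_right_mono mult_left_mono mult_nonneg_nonneg) auto
    finally show ?thesis by simp
  qed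
  have lim0: "(\<lambda>n. C * q ^ n / (1 - q)) \<longlonglongrightarrow> C * 0 / (1 - q)"
    using q by (intro tendsto_intros LIMSEQ_power_zero) auto
  have "\<exists>N. \<forall>m\<ge>N. \<forall>n\<ge>N. hn (\<lambda>i. x m i - x n i) < e" if e: "0 < e" for e
  proof -
    have "\<forall>\<^sub>F n in sequentially. C * q ^ n / (1 - q) < e"
      using order_tendstoD(2)[OF lim0, of e] e by simp
    then obtain N where N: "\<And>n. n \<ge> N \<Longrightarrow> C * q ^ n / (1 - q) < e"
      unfolding eventually_sequentially by blast
    have "hn (\<lambda>i. x m i - x n i) < e" if "m \<ge> N" "n \<ge> N" for m n
    proof (cases "n \<le> m")
      case True
      then show ?thesis using bnd N[OF that(2)] by (meson le_less_trans)
    next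
      case False
      then have "hn (\<lambda>i. x n i - x m i) < e" using bnd[of m n] N[OF that(1)] by simp
      then show ?thesis using hn_diff_commute[OF x x, of m n] by simp
    qed
    then show ?thesis by blast
  qed
  from K_complete[OF x this] obtain y where y: "y \<in> K" "(\<lambda>n. hn (\<lambda>i. x n i - y i)) \<longlonglongrightarrow> 0" by blast
  have "hn (\<lambda>i. x n i - y i) \<le> C * q ^ n / (1 - q)" for n
  proof (rule LIMSEQ_le_const[of "\<lambda>m. C * q ^ n / (1 - q) + hn (\<lambda>i. x m i - y i)"])
    show "(\<lambda>m. C * q ^ n / (1 - q) + hn (\<lambda>i. x m i - y i)) \<longlonglongrightarrow> C * q ^ n / (1 - q)"
      using tendsto_add[OF tendsto_const y(2)] by simp
    have "hn (\<lambda>i. x n i - y i) \<le> C * q ^ n / (1 - q) + hn (\<lambda>i. x m i - y i)" if "m \<ge> n" for m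
      using tri[OF x x y(1), of n m] bnd[OF that] hn_diff_commute[OF x x, of n m] by simp
    then show "\<exists>N. \<forall>m\<ge>N. hn (\<lambda>i. x n i - y i) \<le> C * q ^ n / (1 - q) + hn (\<lambda>i. x m i - y i)" by blast
  qed
  then show ?thesis using y(1) by blast
qed

lemma l2ip_restrict_fibre:
  "l2ip (fb v) x (\<lambda>i. if s i = v then y i else 0) = l2ip (fb v) x y"
  unfolding l2ip_def by (rule infsum_cong) (simp add: fib_def)

lemma restrict_fibre:
  assumes x: "x \<in> K"
  shows "(\<lambda>i. if s i = v then x i else 0) \<in> K" "hn (\<lambda>i. if s i = v then x i else 0) \<le> l2n (fb v) x"
proof -
  show k: "(\<lambda>i. if s i = v then x i else 0) \<in> K"
    by (rule K_pointwise_dominated[OF x, of _ 1]) (auto simp: K_outside[OF x])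
  have "l2n (fb w) (\<lambda>i. if s i = v then x i else 0) \<le> l2n (fb v) x" for w
  proof (cases "w = v")
    case True
    have "l2n (fb v) (\<lambda>i. if s i = v then x i else 0) = l2n (fb v) x"
      unfolding l2n_def by (intro arg_cong[of _ _ sqrt] infsum_cong) (simp add: fib_def)
    then show ?thesis using True by simp
  next
    case False
    then have "l2n (fb w) (\<lambda>i. if s i = v then x i else 0) = 0"
      by (subst l2n_eq_0_iff[OF K_l2[OF k]]) (auto simp: fib_def)
    then show ?thesis by simp
  qed
  then show "hn (\<lambda>i. if s i = v then x i else 0) \<le> l2n (fb v) x" by (subst hn_le_iff[OF k]) simp
qed

text \<open>Hellinger--Toeplitz, by a gliding hump: were the adjoint \<open>S\<close> unbounded, one could build
  \<open>x\<close> as a geometric series along vectors \<open>S y\<^sub>n\<close> restricted to suitable fibres such that the inner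
  products of \<open>y\<^sub>n\<close> with \<open>T x\<close> are unbounded, although \<open>y\<^sub>n\<close> lies in the unit ball.\<close>

lemma adjoint_bounded:
  assumes adj: "is_adjoint H T S" and TK: "\<And>x. x \<in> K \<Longrightarrow> T x \<in> K" and SK: "\<And>x. x \<in> K \<Longrightarrow> S x \<in> K"
  shows "\<exists>C\<ge>0. \<forall>x\<in>K. hn (S x) \<le> C * hn x"
proof (rule ccontr)
  assume neg: "\<not> ?thesis"
  have "S ` K \<subseteq> K" "T ` K \<subseteq> K" using SK TK by blast+
  note lin = adjoint_linear[OF is_adjoint_sym[OF adj] this]
  \<comment> \<open>If no constant bounds \<open>S\<close>, some vector of the unit ball has an
    image larger than \<open>4 ^ n\<close> already in one fibre, because the norm is the supremum
    over fibres.\<close>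
  have "\<exists>y v. y \<in> K \<and> hn y \<le> 1 \<and> 4 ^ n < l2n (fb v) (S y)" for n :: nat
  proof -
    obtain y where y: "y \<in> K" "4 ^ n * hn y < hn (S y)"
      using neg by (meson not_le zero_le_power zero_le_numeral)
    then have "\<not> hn (S y) \<le> 4 ^ n * hn y" by simp
    then obtain v where v: "4 ^ n * hn y < l2n (fb v) (S y)"
      using hn_le_iff[OF SK[OF y(1)], of "4 ^ n * hn y"] hn_nonneg[OF y(1)] by (auto simp: not_le)
    have pos: "0 < hn y"
    proof (rule ccontr)
      assume "\<not> 0 < hn y"
      then have "y = (\<lambda>_. 0)" using hn_nonneg[OF y(1)] hn_eq_0[OF y(1)] by simp
      then have "S y = (\<lambda>_. 0)" using lin(2)[OF K_zero K_zero, of 0] by simp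
      then show False using y hn_zero mult_nonneg_nonneg[OF _ hn_nonneg[OF y(1)], of "4 ^ n"] by simp
    qed
    let ?c = "complex_of_real (inverse (hn y))"
    have c: "cmod ?c = inverse (hn y)" using pos by (simp add: norm_inverse)
    have "4 ^ n < inverse (hn y) * l2n (fb v) (S y)"
      using v pos by (simp add: field_simps)
    then have "4 ^ n < l2n (fb v) (S (\<lambda>i. ?c * y i))"
      using l2_scale(2)[OF K_l2[OF SK[OF y(1)]], of v ?c] by (simp only: lin(2)[OF y(1) y(1)] c)
    moreover have "hn (\<lambda>i. ?c * y i) \<le> 1" using pos hn_scale[OF y(1), of ?c] c by simp
    ultimately show ?thesis using K_scale[OF y(1)] by blast
  qed
  then obtain y v where y: "\<And>n. y n \<in> K" "\<And>n. hn (y n) \<le> 1" "\<And>n. 4 ^ n < l2n (fb (v n)) (S (y n))"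
    by metis
  define l where "l n = l2n (fb (v n)) (S (y n))" for n
  have l: "4 ^ n < l n" "0 < l n" for n
    using y(3)[of n] by (simp_all add: l_def) (meson less_trans zero_less_numeral zero_less_power)
  define f where "f n x = l2ip (fb (v n)) (S (y n)) x" for n x
  \<comment> \<open>The hump: it points along \<open>S (y n)\<close> in the fibre over
    \<open>v n\<close>, has norm at most \<open>(1/3) ^ Suc n\<close>, and the functional
    \<open>f n\<close> takes the value \<open>(1/3) ^ Suc n * l n\<close> on it. Since
    \<open>l n\<close> exceeds \<open>4 ^ n\<close>, these values grow although the norms are
    summable.\<close>
  define u where "u n = (\<lambda>i. complex_of_real ((1/3) ^ Suc n / l n) * (if s i = v n then S (y n) i else 0))" for n
  have uK: "u n \<in> K" for n unfolding u_def by (intro K_scale restrict_fibre SK y)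
  have fu: "cmod (f n (u n)) = (1/3) ^ Suc n * l n" for n
  proof -
    have "f n (u n) = complex_of_real ((1/3) ^ Suc n / l n * (l n)\<^sup>2)"
      unfolding f_def u_def l2ip_scale_right l2ip_restrict_fibre
      using l2ip_self[OF K_l2[OF SK[OF y(1)]]] by (simp add: l_def)
    also have "(1/3) ^ Suc n / l n * (l n)\<^sup>2 = (1/3) ^ Suc n * l n"
      using l(2)[of n] by (simp add: power2_eq_square)
    finally show ?thesis using l(2)[of n] by (simp only: norm_of_real) (simp add: abs_mult)
  qed
  have hu: "hn (u n) \<le> (1/3) ^ Suc n" for n
  proof -
    have "hn (u n) = (1/3) ^ Suc n / l n * hn (\<lambda>i. if s i = v n then S (y n) i else 0)"
      unfolding u_def using l(2)[of n] by (subst hn_scale[OF restrict_fibre(1)[OF SK[OF y(1)]]]) (simp add: norm_divide norm_power)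
    also have "\<dots> \<le> (1/3) ^ Suc n / l n * l n"
      using restrict_fibre(2)[OF SK[OF y(1)], of "v n" n] l(2)[of n]
      by (intro mult_left_mono) (simp_all add: l_def)
    finally show ?thesis using l(2)[of n] by simp
  qed
  have fsub: "f n (\<lambda>i. a i - b i) = f n a - f n b" if "a \<in> K" "b \<in> K" for n a b
    unfolding f_def using that by (intro l2ip_diff_right K_l2 SK y)
  have fadd: "f n (\<lambda>i. a i + b i) = f n a + f n b" if "a \<in> K" "b \<in> K" for n a b
    unfolding f_def using that by (intro l2ip_add_right K_l2 SK y)
  have fle: "cmod (f n a) \<le> l n * hn a" if a: "a \<in> K" for n a
  proof -
    have "cmod (f n a) \<le> l n * l2n (fb (v n)) a"
      unfolding f_def l_def by (rule l2_Cauchy_Schwarz[OF K_l2[OF SK[OF y(1)]] K_l2[OF a]])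
    also have "\<dots> \<le> l n * hn a" using l2n_le_hn[OF a] l(2)[of n] by (intro mult_left_mono) auto
    finally show ?thesis .
  qed
  \<comment> \<open>Partial sums with signs: of two numbers \<open>a + b\<close> and
    \<open>a - b\<close> one has modulus at least that of \<open>b\<close>, so the sign can be
    chosen such that \<open>f n\<close> is no smaller on the new sum than on
    \<open>u n\<close>.\<close>
  define x where "x = rec_nat (\<lambda>_. 0)
     (\<lambda>n a. if cmod (f n (u n)) \<le> cmod (f n (\<lambda>i. a i + u n i)) then (\<lambda>i. a i + u n i) else (\<lambda>i. a i - u n i))"
  have x0: "x 0 = (\<lambda>_. 0)" by (simp add: x_def)
  have xS: "x (Suc n) = (if cmod (f n (u n)) \<le> cmod (f n (\<lambda>i. x n i + u n i))
      then (\<lambda>i. x n i + u n i) else (\<lambda>i. x n i - u n i))" for n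
    by (simp add: x_def)
  have xK: "x n \<in> K" for n by (induction n) (simp_all add: x0 xS K_zero K_add K_diff uK)
  have fx: "cmod (f n (u n)) \<le> cmod (f n (x (Suc n)))" for n
  proof (cases "cmod (f n (u n)) \<le> cmod (f n (\<lambda>i. x n i + u n i))")
    case False
    have "2 * f n (u n) = (f n (x n) + f n (u n)) - (f n (x n) - f n (u n))" by simp
    then have "2 * cmod (f n (u n)) \<le> cmod (f n (x n) + f n (u n)) + cmod (f n (x n) - f n (u n))"
      by (metis norm_triangle_ineq4 norm_mult norm_numeral)
    then show ?thesis using False by (simp add: xS fadd fsub xK uK)
  qed (simp add: xS)
  have dx: "hn (\<lambda>i. x (Suc n) i - x n i) \<le> 1/3 * (1/3) ^ n" for n
    using hu[of n] hn_minus[OF uK, of n] by (simp add: xS)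
  obtain z where z: "z \<in> K" "\<And>n. hn (\<lambda>i. x n i - z i) \<le> 1/3 * (1/3) ^ n / (1 - 1/3)"
    using geometric_limit[of x, OF xK dx] by auto
  \<comment> \<open>The steps still to come have total norm at most
    \<open>(1/3) ^ Suc n / 2\<close>, so they spoil at most half of the value
    \<open>(1/3) ^ Suc n * l n\<close>. What is left is \<open>l n * (1/3) ^ n / 6\<close>, and
    \<open>4 > 3\<close> makes it unbounded.\<close>
  have lower: "(4/3) ^ n / 6 \<le> hn (T z)" for n :: nat
  proof -
    have "(1/3) ^ Suc n * l n \<le> cmod (f n (x (Suc n)))" using fx fu by simp
    also have "\<dots> \<le> cmod (f n z) + cmod (f n (\<lambda>i. x (Suc n) i - z i))"
      using norm_triangle_ineq[of "f n z" "f n (x (Suc n)) - f n z"] by (simp add: fsub xK z(1))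
    also have "cmod (f n (\<lambda>i. x (Suc n) i - z i)) \<le> l n * (1/3 * (1/3) ^ Suc n / (1 - 1/3))"
      using fle[OF K_diff[OF xK z(1)], of n "Suc n"] mult_left_mono[OF z(2)[of "Suc n"], of "l n"] l(2)[of n]
      by (meson less_imp_le order_trans)
    finally have "l n * (1/3) ^ n / 6 \<le> cmod (f n z)" by (simp add: field_simps)
    also have "f n z = l2ip (fb (v n)) (y n) (T z)"
      unfolding f_def by (rule is_adjointD[OF is_adjoint_sym[OF adj] y(1) z(1)])
    also have "cmod \<dots> \<le> hn (y n) * hn (T z)" by (rule inner_le_hn[OF y(1) TK[OF z(1)]])
    also have "\<dots> \<le> 1 * hn (T z)" using y(2) hn_nonneg[OF TK[OF z(1)]] by (rule mult_right_mono)
    finally have *: "l n * (1/3) ^ n / 6 \<le> hn (T z)" by simp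
    have "(4/3) ^ n / 6 = 4 ^ n * (1/3) ^ n / (6::real)" by (simp add: power_divide)
    also have "\<dots> \<le> l n * (1/3) ^ n / 6"
      using l(1)[of n] by (intro divide_right_mono mult_right_mono) auto
    finally show ?thesis using * by simp
  qed
  obtain n where "6 * hn (T z) < (4/3) ^ n" using real_arch_pow[of "4/3" "6 * hn (T z)"] by auto
  then show False using lower[of n] by simp
qed

lemma adjointable_bounded:
  assumes "T \<in> adjointable H"
  obtains C where "0 \<le> C" "\<And>x. x \<in> K \<Longrightarrow> hn (T x) \<le> C * hn x"
proof -
  note a = adjointable_op_adj[OF assms]
  show ?thesis
    using adjoint_bounded[OF is_adjoint_sym[OF a(2)] adjointable_K[OF a(1)] adjointable_K[OF assms]] that
    by blast
qed

text \<open>The infimum is itself an admissible constant; the boundedness just proved guarantees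
  that it is taken over a nonempty set.\<close>

lemma op_norm_nonneg_bound:
  assumes T: "T \<in> adjointable H"
  shows "0 \<le> op_norm H T" "x \<in> K \<Longrightarrow> hn (T x) \<le> op_norm H T * hn x"
proof -
  let ?M = "{C. 0 \<le> C \<and> (\<forall>x\<in>K. hn (T x) \<le> C * hn x)}"
  obtain C where "0 \<le> C" "\<And>x. x \<in> K \<Longrightarrow> hn (T x) \<le> C * hn x" using adjointable_bounded[OF T] by blast
  then have ne: "?M \<noteq> {}" by blast
  have on: "op_norm H T = Inf ?M" by (simp add: op_norm_def)
  show "0 \<le> op_norm H T" unfolding on by (rule cInf_greatest[OF ne]) simp
  show "hn (T x) \<le> op_norm H T * hn x" if x: "x \<in> K"
  proof (cases "hn x = 0")
    case True
    then have "x = (\<lambda>_. 0)" by (rule hn_eq_0[OF x])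
    then show ?thesis using adjointable_zero[OF T] hn_zero by simp
  next
    case False
    then have pos: "0 < hn x" using hn_nonneg[OF x] by simp
    have "hn (T x) / hn x \<le> Inf ?M"
      using x pos by (intro cInf_greatest[OF ne]) (simp add: pos_divide_le_eq)
    then show ?thesis unfolding on using pos by (simp add: pos_divide_le_eq)
  qed
qed

lemma op_norm_le:
  assumes "0 \<le> C" "\<And>x. x \<in> K \<Longrightarrow> hn (T x) \<le> C * hn x"
  shows "op_norm H T \<le> C"
  unfolding op_norm_def
  by (rule cInf_lower) (use assms in \<open>auto intro: bdd_belowI[of _ 0]\<close>)

text \<open>A coordinate is bounded by the norm. Identities between operators are carried to norm
  limits in this coordinatewise form.\<close>

lemma op_norm_limit_pointwise:
  assumes t: "\<And>n::nat. t n \<in> adjointable H" and T: "T \<in> adjointable H"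
    and lim: "(\<lambda>n. op_norm H (op_add H (t n) (op_scale H (- 1) T))) \<longlonglongrightarrow> 0" and x: "x \<in> K"
  shows "(\<lambda>n. t n x i) \<longlonglongrightarrow> T x i"
proof -
  have a: "op_add H (t n) (op_scale H (- 1) T) \<in> adjointable H" for n
    by (rule adjointable_ops(1)[OF t adjointable_ops(2)[OF T T]])
  have l: "(\<lambda>n. op_norm H (op_add H (t n) (op_scale H (- 1) T)) * hn x) \<longlonglongrightarrow> 0"
    using tendsto_mult_left_zero[OF lim] .
  have b: "norm (t n x i - T x i) \<le> op_norm H (op_add H (t n) (op_scale H (- 1) T)) * hn x" for n
  proof -
    have "t n x i - T x i = op_add H (t n) (op_scale H (- 1) T) x i"
      using x by (simp add: op_simps)
    then have "norm (t n x i - T x i) \<le> hn (op_add H (t n) (op_scale H (- 1) T) x)"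
      using coord_le_hn[OF adjointable_K[OF a x]] by simp
    then show ?thesis using op_norm_nonneg_bound(2)[OF a x] by (rule order_trans)
  qed
  have "(\<lambda>n. t n x i - T x i) \<longlonglongrightarrow> 0"
    by (rule tendsto_norm_zero_cancel, rule tendsto_sandwich[OF _ _ tendsto_const l])
       (simp_all add: b)
  then show ?thesis by (rule LIM_zero_cancel)
qed

text \<open>In each fibre \<open>\<parallel>S x\<parallel>\<^sup>2 = \<langle>T (S x),
  x\<rangle>\<close> is at most \<open>C \<parallel>x\<parallel> \<parallel>S x\<parallel>\<close>
  with module norms on the right. Passing to the supremum over fibres and cancelling one factor
  shows that an adjoint inherits every bound.\<close>

lemma adjoint_bound:
  assumes adj: "is_adjoint H T S" and TK: "\<And>x. x \<in> K \<Longrightarrow> T x \<in> K" and SK: "\<And>x. x \<in> K \<Longrightarrow> S x \<in> K"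
    and C: "\<And>x. x \<in> K \<Longrightarrow> hn (T x) \<le> C * hn x" and x: "x \<in> K" and "0 \<le> C"
  shows "hn (S x) \<le> C * hn x"
proof -
  let ?b = "sqrt (C * hn x * hn (S x))"
  have nn: "0 \<le> C * hn x * hn (S x)" using assms by (intro mult_nonneg_nonneg hn_nonneg SK)
  have "hn (S x) \<le> ?b"
  proof (subst hn_le_iff[OF SK[OF x]], intro conjI ballI)
    show "0 \<le> ?b" using nn by simp
    fix v
    have "(l2n (fb v) (S x))\<^sup>2 = cmod (l2ip (fb v) (S x) (S x))"
      using l2ip_self[OF K_l2[OF SK[OF x]]] by (simp add: norm_power)
    also have "l2ip (fb v) (S x) (S x) = l2ip (fb v) (T (S x)) x"
      using is_adjointD[OF adj SK[OF x] x] by simp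
    also have "cmod \<dots> \<le> hn (T (S x)) * hn x" by (rule inner_le_hn[OF TK[OF SK[OF x]] x])
    also have "\<dots> \<le> C * hn (S x) * hn x" using C[OF SK[OF x]] hn_nonneg[OF x] by (rule mult_right_mono)
    finally have "(l2n (fb v) (S x))\<^sup>2 \<le> C * hn x * hn (S x)"
      by (simp add: mult.assoc mult.commute mult.left_commute)
    then show "l2n (fb v) (S x) \<le> ?b" by (rule real_le_rsqrt)
  qed
  then have "(hn (S x))\<^sup>2 \<le> ?b\<^sup>2" using hn_nonneg[OF SK[OF x]] by (rule power_mono)
  then have "hn (S x) * hn (S x) \<le> C * hn x * hn (S x)" using nn by (simp add: power2_eq_square)
  then show ?thesis
  proof (cases "hn (S x) = 0")
    case True
    then show ?thesis using \<open>0 \<le> C\<close> hn_nonneg[OF x] by simp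
  next
    case False
    then have "0 < hn (S x)" using hn_nonneg[OF SK[OF x]] by simp
    then show ?thesis using \<open>hn (S x) * hn (S x) \<le> _\<close> by (simp add: mult_le_cancel_right)
  qed
qed

text \<open>The coordinate \<open>i\<close> of \<open>T x\<close> is the pairing of \<open>x\<close>
  with the adjoint applied to \<open>\<delta>\<^sub>i\<close>, that is, with a row of the matrix of
  \<open>T\<close>. An adjointable operator is therefore determined by its values on point masses,
  with no appeal to density.\<close>

lemma adjointable_matrix:
  assumes T: "T \<in> adjointable H" and x: "x \<in> K" and i: "i \<in> I"
  shows "T x i = l2ip (fb (s i)) (\<lambda>j. cnj (T (delta j) i)) x"
proof -
  note a = adjointable_op_adj[OF T]
  note d = K_delta[OF i]
  have "T x i = l2ip (fb (s i)) (delta i) (T x)" using i by (simp add: inner_delta)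
  also have "\<dots> = l2ip (fb (s i)) (op_adj H T (delta i)) x"
    by (rule is_adjointD[OF is_adjoint_sym[OF a(2)] d x, symmetric])
  also have "\<dots> = l2ip (fb (s i)) (\<lambda>j. cnj (T (delta j) i)) x"
    unfolding l2ip_def
  proof (rule infsum_cong)
    fix j assume "j \<in> fb (s i)"
    then have j: "j \<in> I" "s j = s i" by (auto simp: fib_def)
    have "op_adj H T (delta i) j = l2ip (fb (s j)) (delta j) (op_adj H T (delta i))"
      using inner_delta[OF j(1), of "op_adj H T (delta i)"] j(2) by simp
    also have "\<dots> = l2ip (fb (s i)) (T (delta j)) (delta i)"
      using is_adjointD[OF a(2) K_delta[OF j(1)] d] j by simp
    also have "\<dots> = cnj (T (delta j) i)"
      using l2ip_cnj[of "fb (s i)" "delta i" "T (delta j)"] i by (simp add: inner_delta)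
    finally show "cnj (op_adj H T (delta i) j) * x j = cnj (cnj (T (delta j) i)) * x j" by simp
  qed
  finally show ?thesis .
qed

lemma adjointable_eqI:
  assumes "S \<in> adjointable H" "T \<in> adjointable H" "\<And>i. i \<in> I \<Longrightarrow> S (delta i) = T (delta i)"
  shows "S = T"
proof (rule op_ext[OF adjointable_E adjointable_E, OF assms(1,2)])
  fix x assume x: "x \<in> K"
  show "S x = T x"
  proof
    fix i
    show "S x i = T x i"
    proof (cases "i \<in> I")
      case True
      have "l2ip (fb (s i)) (\<lambda>j. cnj (S (delta j) i)) x = l2ip (fb (s i)) (\<lambda>j. cnj (T (delta j) i)) x"
        unfolding l2ip_def using assms(3) by (intro infsum_cong) (simp add: fib_def)
      then show ?thesis using adjointable_matrix[OF _ x True] assms(1,2) by simp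
    next
      case False
      then show ?thesis
        using K_outside[OF adjointable_K[OF assms(1) x]] K_outside[OF adjointable_K[OF assms(2) x]] by simp
    qed
  qed
qed

end

section \<open>Automatic contractivity of *-homomorphisms\<close>

context fibred
begin

text \<open>The operator \<open>R = 1 - (1 - S)\<^bsup>1/2\<^esup>\<close>, as a fixed point of \<open>R \<mapsto> (S + R\<^sup>2) / 2\<close>.\<close>

lemma sqrt_fixed_point:
  assumes B: "closed_subalgebra H B" and S: "S \<in> B" and adj: "is_adjoint H S S"
    and bd: "\<And>x. x \<in> K \<Longrightarrow> hn (S x) \<le> \<sigma> * hn x" and \<sigma>: "0 \<le> \<sigma>" "\<sigma> < 1"
  shows "\<exists>R\<in>B. is_adjoint H R R \<and> R = op_scale H (1/2) (op_add H S (op_mult H R R))"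
proof -
  \<comment> \<open>The iteration starts at the zero operator, written as a multiple of
    \<open>S\<close> so that it visibly lies in \<open>B\<close>.\<close>
  define Rn where "Rn = rec_nat (op_scale H 0 S) (\<lambda>_ R. op_scale H (1/2) (op_add H S (op_mult H R R)))"
  have R0: "Rn 0 = op_scale H 0 S" by (simp add: Rn_def)
  have RS: "Rn (Suc n) = op_scale H (1/2) (op_add H S (op_mult H (Rn n) (Rn n)))" for n
    by (simp add: Rn_def)
  note cl = closed_subalgebraD[OF B]
  have RB: "Rn n \<in> B" for n
  proof (induction n)
    case 0
    show ?case unfolding R0 by (rule cl(4)[OF S])
  next
    case (Suc n)
    show ?case unfolding RS by (rule cl(4)[OF cl(2)[OF S cl(3)[OF Suc Suc]]])
  qed
  have SA: "S \<in> adjointable H" and RA: "Rn n \<in> adjointable H" for n using cl(1) S RB by blast+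
  note SK = adjointable_K[OF SA] and RK = adjointable_K[OF RA]
  have R0x: "Rn 0 x = (\<lambda>_. 0)" if "x \<in> K" for x using that by (simp add: R0 op_simps)
  have RSx: "Rn (Suc n) x = (\<lambda>i. (1/2) * (S x i + Rn n (Rn n x) i))" if x: "x \<in> K" for n x
    using x by (simp add: RS op_simps)
  have Radj: "is_adjoint H (Rn n) (Rn n)" for n
  proof (induction n)
    case 0
    show ?case unfolding is_adjoint_iff by (simp add: R0x l2ip_def)
  next
    case (Suc n)
    show ?case unfolding is_adjoint_iff
    proof (intro ballI allI)
      fix x y v assume x: "x \<in> K" and y: "y \<in> K"
      have k: "Rn n (Rn n x) \<in> K" "Rn n (Rn n y) \<in> K" using RK x y by blast+
      show "l2ip (fb v) (Rn (Suc n) x) y = l2ip (fb v) x (Rn (Suc n) y)"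
        unfolding RSx[OF x] RSx[OF y] l2ip_scale_left l2ip_scale_right
          l2ip_add_left[OF K_l2[OF y] K_l2[OF SK[OF x]] K_l2[OF k(1)]]
          l2ip_add_right[OF K_l2[OF x] K_l2[OF SK[OF y]] K_l2[OF k(2)]]
          is_adjointD[OF adj x y] is_adjointD[OF Suc RK[OF x] y] is_adjointD[OF Suc x RK[OF y]] by simp
    qed
  qed
  \<comment> \<open>The smaller root of \<open>2 r = \<sigma> + r\<^sup>2\<close>, hence the fixed
    point of the scalar iteration. It bounds the norms of all iterates, and it is below 1 because
    \<sigma> is.\<close>
  define r where "r = 1 - sqrt (1 - \<sigma>)"
  have r: "0 \<le> r" "r < 1" using \<sigma> by (simp_all add: r_def)
  have r2: "\<sigma> + r * r = 2 * r"
  proof -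
    have "r * r = 1 - 2 * sqrt (1 - \<sigma>) + (sqrt (1 - \<sigma>))\<^sup>2"
      by (simp add: r_def power2_eq_square algebra_simps)
    then show ?thesis using \<sigma> by (simp add: r_def)
  qed
  have half: "hn (\<lambda>i. (1/2) * (a i + b i)) \<le> (hn a + hn b) / 2" if "a \<in> K" "b \<in> K" for a b
    using hn_scale[OF K_add[OF that], of "1/2"] hn_triangle[OF that] by simp
  have Rbd: "hn (Rn n x) \<le> r * hn x" if x: "x \<in> K" for n x
    using x
  proof (induction n arbitrary: x)
    case 0
    then show ?case using r hn_nonneg by (simp add: R0x hn_zero)
  next
    case (Suc n)
    have k: "Rn n x \<in> K" "Rn n (Rn n x) \<in> K" using RK Suc.prems by blast+
    have "hn (Rn n (Rn n x)) \<le> r * (r * hn x)"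
      using Suc.IH[OF k(1)] mult_left_mono[OF Suc.IH[OF Suc.prems] r(1)] by (rule order_trans)
    then have "hn (Rn (Suc n) x) \<le> (\<sigma> * hn x + r * (r * hn x)) / 2"
      using half[OF SK[OF Suc.prems] k(2)] bd[OF Suc.prems]
      unfolding RSx[OF Suc.prems] by (elim order_trans) (intro divide_right_mono add_mono, simp_all)
    also have "\<dots> = (\<sigma> + r * r) * hn x / 2" by (simp add: algebra_simps)
    also have "\<dots> = r * hn x" unfolding r2 by simp
    finally show ?case .
  qed
  \<comment> \<open>The difference of two squares is split as \<open>R\<^sub>n\<^sub>+\<^sub>1
    (R\<^sub>n\<^sub>+\<^sub>1 - R\<^sub>n) + (R\<^sub>n\<^sub>+\<^sub>1 - R\<^sub>n)
    R\<^sub>n\<close>, which requires no commutation; each summand gains a factor \<open>r\<close>.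
    The induction hypothesis is used at \<open>x\<close> and at \<open>Rn n x\<close>, so
    \<open>x\<close> must vary in it.\<close>
  have dRn: "hn (\<lambda>i. Rn (Suc n) x i - Rn n x i) \<le> (\<sigma> * hn x) * r ^ n" if x: "x \<in> K" for n x
    using x
  proof (induction n arbitrary: x)
    case 0
    have "Rn (Suc 0) x = (\<lambda>i. (1/2) * S x i)"
      using R0x[OF SK[OF 0]] R0x[OF 0] by (simp add: RSx 0 R0x[OF K_zero])
    then have "hn (\<lambda>i. Rn (Suc 0) x i - Rn 0 x i) = hn (S x) / 2"
      using hn_scale[OF SK[OF 0], of "1/2"] by (simp add: R0x 0)
    then show ?case using bd[OF 0] \<sigma> hn_nonneg[OF 0] hn_nonneg[OF SK[OF 0]] by simp
  next
    case (Suc n)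
    let ?u = "Rn (Suc n) x" and ?w = "Rn n x"
    have k: "?u \<in> K" "?w \<in> K" using RK Suc.prems by auto
    have "(\<lambda>i. Rn (Suc (Suc n)) x i - ?u i) =
        (\<lambda>i. (1/2) * (Rn (Suc n) (\<lambda>i. ?u i - ?w i) i + (Rn (Suc n) ?w i - Rn n ?w i)))"
      unfolding adjointable_linear(3)[OF RA k] RSx[OF Suc.prems, of "Suc n"]
      using RSx[OF Suc.prems, of n] by (auto simp: fun_eq_iff algebra_simps)
    then have "hn (\<lambda>i. Rn (Suc (Suc n)) x i - ?u i)
        \<le> (hn (Rn (Suc n) (\<lambda>i. ?u i - ?w i)) + hn (\<lambda>i. Rn (Suc n) ?w i - Rn n ?w i)) / 2"
      using half[OF RK[OF K_diff[OF k]] K_diff[OF RK[OF k(2)] RK[OF k(2)]]] by simp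
    also have "\<dots> \<le> (r * ((\<sigma> * hn x) * r ^ n) + (\<sigma> * (r * hn x)) * r ^ n) / 2"
    proof (intro divide_right_mono add_mono)
      show "hn (Rn (Suc n) (\<lambda>i. ?u i - ?w i)) \<le> r * ((\<sigma> * hn x) * r ^ n)"
        using Rbd[OF K_diff[OF k], of "Suc n"] mult_left_mono[OF Suc.IH[OF Suc.prems] r(1)] by (rule order_trans)
      have "hn (\<lambda>i. Rn (Suc n) ?w i - Rn n ?w i) \<le> (\<sigma> * hn ?w) * r ^ n" by (rule Suc.IH[OF k(2)])
      also have "\<dots> \<le> (\<sigma> * (r * hn x)) * r ^ n"
        using \<sigma> r Rbd[OF Suc.prems] by (intro mult_right_mono mult_left_mono) auto
      finally show "hn (\<lambda>i. Rn (Suc n) ?w i - Rn n ?w i) \<le> (\<sigma> * (r * hn x)) * r ^ n" .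
    qed simp
    also have "\<dots> = (\<sigma> * hn x) * r ^ Suc n" by (simp add: algebra_simps)
    finally show ?case .
  qed
  have "\<exists>y\<in>K. \<forall>n. hn (\<lambda>i. Rn n x i - y i) \<le> (\<sigma> * hn x) * r ^ n / (1 - r)" if x: "x \<in> K" for x
    using geometric_limit[of "\<lambda>n. Rn n x", OF RK[OF x] dRn[OF x] r] .
  then obtain f where f: "\<And>x. x \<in> K \<Longrightarrow> f x \<in> K"
    "\<And>x n. x \<in> K \<Longrightarrow> hn (\<lambda>i. Rn n x i - f x i) \<le> (\<sigma> * hn x) * r ^ n / (1 - r)" by metis
  define R where "R = restrict f K"
  have RE: "R \<in> K \<rightarrow>\<^sub>E K" unfolding R_def by (rule PiE_I) (simp_all add: f)
  have RKx: "R x \<in> K" if "x \<in> K" for x using that f by (simp add: R_def)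
  have near: "hn (\<lambda>i. Rn n x i - R x i) \<le> (\<sigma> * hn x) * r ^ n / (1 - r)" if "x \<in> K" for x n
    using f(2)[OF that] that by (simp add: R_def)
  have null: "(\<lambda>n. C * r ^ n / (1 - r)) \<longlonglongrightarrow> 0" for C
  proof -
    have "(\<lambda>n. C * r ^ n / (1 - r)) \<longlonglongrightarrow> C * 0 / (1 - r)"
      using r by (intro tendsto_intros LIMSEQ_power_zero) auto
    then show ?thesis by simp
  qed
  have near0: "(\<lambda>n. hn (\<lambda>i. Rn n x i - R x i)) \<longlonglongrightarrow> 0" if x: "x \<in> K" for x
    by (rule tendsto_sandwich[OF _ _ tendsto_const null[of "\<sigma> * hn x"]])
       (simp_all add: near[OF x] hn_nonneg K_diff RK RKx x)
  have iplim: "(\<lambda>n. l2ip (fb v) (Rn n x) y) \<longlonglongrightarrow> l2ip (fb v) (R x) y" if x: "x \<in> K" and y: "y \<in> K" for x y v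
  proof -
    have l: "(\<lambda>n. hn (\<lambda>i. Rn n x i - R x i) * hn y) \<longlonglongrightarrow> 0"
      by (rule tendsto_mult_left_zero[OF near0[OF x]])
    have "(\<lambda>n. l2ip (fb v) (Rn n x) y - l2ip (fb v) (R x) y) \<longlonglongrightarrow> 0"
    proof (rule tendsto_norm_zero_cancel, rule tendsto_sandwich[OF _ _ tendsto_const l];
        intro always_eventually allI)
      fix n
      show "norm (l2ip (fb v) (Rn n x) y - l2ip (fb v) (R x) y) \<le> hn (\<lambda>i. Rn n x i - R x i) * hn y"
        using inner_le_hn[OF K_diff[OF RK[OF x] RKx[OF x]] y, of v n]
        by (simp add: l2ip_diff_left K_l2 y x RK RKx)
    qed simp
    then show ?thesis by (rule LIM_zero_cancel)
  qed
  have adjR: "is_adjoint H R R" unfolding is_adjoint_iff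
  proof (intro ballI allI)
    fix x y v assume x: "x \<in> K" and y: "y \<in> K"
    have "(\<lambda>n. cnj (l2ip (fb v) (Rn n y) x)) \<longlonglongrightarrow> cnj (l2ip (fb v) (R y) x)"
      by (intro tendsto_intros iplim x y)
    then have "(\<lambda>n. l2ip (fb v) (Rn n x) y) \<longlonglongrightarrow> l2ip (fb v) x (R y)"
      by (simp add: l2ip_cnj is_adjointD[OF Radj x y])
    then show "l2ip (fb v) (R x) y = l2ip (fb v) x (R y)"
      using LIMSEQ_unique[OF iplim[OF x y]] by blast
  qed
  have RAd: "R \<in> adjointable H" by (rule adjointableI[OF RE RE adjR])
  have "R \<in> B"
  proof (rule closed_subalgebra_limit[OF B RAd RB])
    have a: "op_add H (Rn n) (op_scale H (- 1) R) \<in> adjointable H" for n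
      by (rule adjointable_ops(1)[OF RA adjointable_ops(2)[OF RAd RAd]])
    show "(\<lambda>n. op_norm H (op_add H (Rn n) (op_scale H (- 1) R))) \<longlonglongrightarrow> 0"
    proof (rule tendsto_sandwich[OF _ _ tendsto_const null]; intro always_eventually allI)
      fix n
      show "0 \<le> op_norm H (op_add H (Rn n) (op_scale H (- 1) R))" by (rule op_norm_nonneg_bound(1)[OF a])
      show "op_norm H (op_add H (Rn n) (op_scale H (- 1) R)) \<le> \<sigma> * r ^ n / (1 - r)"
      proof (rule op_norm_le)
        show "0 \<le> \<sigma> * r ^ n / (1 - r)" using \<sigma> r by simp
        fix x assume x: "x \<in> K"
        then have "op_add H (Rn n) (op_scale H (- 1) R) x = (\<lambda>i. Rn n x i - R x i)" by (simp add: op_simps)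
        then show "hn (op_add H (Rn n) (op_scale H (- 1) R) x) \<le> \<sigma> * r ^ n / (1 - r) * hn x"
          using near[OF x, of n] by (simp add: mult.commute mult.left_commute)
      qed
    qed
  qed
  moreover have "R = op_scale H (1/2) (op_add H S (op_mult H R R))"
  proof (rule op_ext[OF RE])
    note SE = adjointable_E[OF SA]
    show "op_scale H (1/2) (op_add H S (op_mult H R R)) \<in> K \<rightarrow>\<^sub>E K"
      by (rule op_in_E(2)[OF RE op_in_E(1)[OF SE op_in_E(3)[OF RE RE]]])
    fix x assume x: "x \<in> K"
    have pt: "(\<lambda>n. Rn n x i) \<longlonglongrightarrow> R x i" if "x \<in> K" for x i
    proof -
      have "(\<lambda>n. Rn n x i - R x i) \<longlonglongrightarrow> 0"
        by (rule tendsto_norm_zero_cancel, rule tendsto_sandwich[OF _ _ tendsto_const near0[OF that]];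
            intro always_eventually allI)
           (use coord_le_hn[OF K_diff[OF RK[OF that] RKx[OF that]]] in simp_all)
      then show ?thesis by (rule LIM_zero_cancel)
    qed
    have pt2: "(\<lambda>n. Rn n (Rn n x) i) \<longlonglongrightarrow> R (R x) i" for i
    proof -
      have l: "(\<lambda>n. r * hn (\<lambda>i. Rn n x i - R x i)) \<longlonglongrightarrow> 0" by (rule tendsto_mult_right_zero[OF near0[OF x]])
      have "(\<lambda>n. Rn n (\<lambda>i. Rn n x i - R x i) i) \<longlonglongrightarrow> 0"
      proof (rule tendsto_norm_zero_cancel, rule tendsto_sandwich[OF _ _ tendsto_const l];
          intro always_eventually allI)
        fix n
        have k: "(\<lambda>i. Rn n x i - R x i) \<in> K" by (intro K_diff RK RKx x)
        show "norm (Rn n (\<lambda>i. Rn n x i - R x i) i) \<le> r * hn (\<lambda>i. Rn n x i - R x i)"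
          using coord_le_hn[OF RK[OF k]] Rbd[OF k] by (rule order_trans)
      qed simp
      then have "(\<lambda>n. Rn n (Rn n x) i - Rn n (R x) i) \<longlonglongrightarrow> 0"
        by (simp add: adjointable_linear(3)[OF RA RK[OF x] RKx[OF x]])
      from tendsto_add[OF this pt[OF RKx[OF x], of i]] show ?thesis by simp
    qed
    show "R x = op_scale H (1/2) (op_add H S (op_mult H R R)) x"
    proof
      fix i
      have "(\<lambda>n. Rn (Suc n) x i) \<longlonglongrightarrow> (1/2) * (S x i + R (R x) i)"
        unfolding RSx[OF x] by (intro tendsto_intros pt2)
      then have "R x i = (1/2) * (S x i + R (R x) i)"
        using LIMSEQ_unique LIMSEQ_Suc[OF pt[OF x]] by blast
      then show "R x i = op_scale H (1/2) (op_add H S (op_mult H R R)) x i"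
        using x RKx by (simp add: op_simps)
    qed
  qed
  ultimately show ?thesis using adjR by blast
qed

text \<open>For \<open>\<parallel>T\<parallel> < 1\<close>, \<open>1 - T\<^sup>*T\<close> is the square of \<open>1 - R\<close>, hence \<open>1 - \<psi>(T)\<^sup>*\<psi>(T)\<close> is the
  square of the self-adjoint \<open>1 - \<psi>(R)\<close> and so is positive.\<close>

lemma star_iso_contraction:
  assumes B: "closed_star_subalgebra H B" and C: "C \<subseteq> adjointable H" and \<psi>: "star_iso H B H C \<psi>"
    and T: "T \<in> B" and bd: "\<And>x. x \<in> K \<Longrightarrow> hn (T x) \<le> \<tau> * hn x" and \<tau>: "0 \<le> \<tau>" "\<tau> < 1" and x: "x \<in> K"
  shows "hn (\<psi> T x) \<le> hn x"
proof -
  have Bc: "closed_subalgebra H B" using B by (simp add: closed_star_subalgebra_def)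
  note cl = closed_subalgebraD[OF Bc]
  have \<psi>C: "\<psi> U \<in> adjointable H" if "U \<in> B" for U
    using \<psi> C that unfolding star_iso_def algebra_iso_def by (blast dest: bij_betwE)
  have hom: "\<psi> (op_add H U U') = op_add H (\<psi> U) (\<psi> U')" "\<psi> (op_mult H U U') = op_mult H (\<psi> U) (\<psi> U')"
    "\<psi> (op_scale H c U) = op_scale H c (\<psi> U)" "\<psi> (op_adj H U) = op_adj H (\<psi> U)"
    if "U \<in> B" "U' \<in> B" for U U' c
    using \<psi> that by (simp_all add: star_iso_def algebra_iso_def)
  have TA: "T \<in> adjointable H" using cl(1) T by blast
  note Ta = adjointable_op_adj[OF TA]
  have T'B: "op_adj H T \<in> B" using B T by (simp add: closed_star_subalgebra_def)
  define S where "S = op_mult H (op_adj H T) T"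
  have SB: "S \<in> B" unfolding S_def by (rule cl(3)[OF T'B T])
  have adjS: "is_adjoint H S S"
    unfolding S_def is_adjoint_iff
    by (simp add: op_simps is_adjointD[OF Ta(2)] is_adjointD[OF is_adjoint_sym[OF Ta(2)]]
        adjointable_K[OF TA] adjointable_K[OF Ta(1)])
  have bS: "hn (S y) \<le> \<tau> * \<tau> * hn y" if y: "y \<in> K" for y
  proof -
    have "hn (S y) \<le> \<tau> * hn (T y)" unfolding S_def op_simps(3)[OF y]
      by (rule adjoint_bound[OF Ta(2) adjointable_K[OF TA] adjointable_K[OF Ta(1)] bd adjointable_K[OF TA y] \<tau>(1)])
    also have "\<dots> \<le> \<tau> * (\<tau> * hn y)" by (rule mult_left_mono[OF bd[OF y] \<tau>(1)])
    finally show ?thesis by simp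
  qed
  have \<tau>2: "0 \<le> \<tau> * \<tau>" "\<tau> * \<tau> < 1" using \<tau> mult_strict_mono[of \<tau> 1 \<tau> 1] by simp_all
  obtain R where R: "R \<in> B" "is_adjoint H R R" "R = op_scale H (1/2) (op_add H S (op_mult H R R))"
    using sqrt_fixed_point[OF Bc SB adjS bS \<tau>2] by blast
  have RE: "R \<in> K \<rightarrow>\<^sub>E K" using cl(1) R(1) adjointable_E by blast
  have Rself: "op_adj H R = R" by (rule op_adj_eqI[OF RE R(2)])
  note RA = \<psi>C[OF R(1)] and TA' = \<psi>C[OF T]
  have adj': "is_adjoint H (\<psi> R) (\<psi> R)"
    using adjointable_op_adj(2)[OF RA] hom(4)[OF R(1,1)] Rself by simp
  have "\<psi> R = op_scale H (1/2) (op_add H (\<psi> S) (op_mult H (\<psi> R) (\<psi> R)))"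
    using arg_cong[OF R(3), of \<psi>] hom(3)[OF cl(2)[OF SB cl(3)[OF R(1,1)]] SB] hom(1)[OF SB cl(3)[OF R(1,1)]]
      hom(2)[OF R(1,1)] by simp
  then have "\<psi> R x = (\<lambda>i. (1/2) * (\<psi> S x i + \<psi> R (\<psi> R x) i))"
    using x by (metis (no_types, lifting) op_simps)
  \<comment> \<open>The algebra may have no unit, so \<open>1 - R\<close> is available only through
    its action on vectors; the fixed point equation is solved for \<open>\<psi> S\<close> before it
    is used.\<close>
  then have eq: "\<psi> S x = (\<lambda>i. 2 * \<psi> R x i - \<psi> R (\<psi> R x) i)"
    by (simp add: fun_eq_iff field_simps)
  have SS: "\<psi> S x = op_adj H (\<psi> T) (\<psi> T x)"
    unfolding S_def using hom(2)[OF T'B T] hom(4)[OF T T] x by (simp add: op_simps)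
  let ?y = "\<lambda>i. x i - \<psi> R x i"
  have k: "\<psi> R x \<in> K" "\<psi> R (\<psi> R x) \<in> K" "\<psi> T x \<in> K" using adjointable_K RA TA' x by blast+
  \<comment> \<open>This is \<open>1 = \<psi>(T)\<^sup>*\<psi>(T) + (1 - \<psi>(R))\<^sup>2\<close>
    evaluated at \<open>x\<close> in one fibre. The second square is then discarded.\<close>
  have "(l2n (fb v) (\<psi> T x))\<^sup>2 + (l2n (fb v) ?y)\<^sup>2 = (l2n (fb v) x)\<^sup>2" for v
  proof -
    note l = K_l2[OF x] K_l2[OF k(1)] K_l2[OF k(2)] K_l2[OF k(3)] K_l2[OF K_diff[OF x k(1)]]
    have "l2ip (fb v) (\<psi> T x) (\<psi> T x) = l2ip (fb v) x (\<psi> S x)"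
      unfolding SS by (rule is_adjointD[OF adjointable_op_adj(2)[OF TA'] x k(3)])
    also have "\<dots> = 2 * l2ip (fb v) x (\<psi> R x) - l2ip (fb v) x (\<psi> R (\<psi> R x))"
      unfolding eq using l2ip_diff_right[OF l(1) l2_scale(1)[OF l(2), of 2] l(3)]
        l2ip_scale_right[of "fb v" x 2 "\<psi> R x"] by simp
    finally have 1: "l2ip (fb v) (\<psi> T x) (\<psi> T x) = 2 * l2ip (fb v) x (\<psi> R x) - l2ip (fb v) x (\<psi> R (\<psi> R x))" .
    have "l2ip (fb v) ?y ?y = l2ip (fb v) x x - l2ip (fb v) x (\<psi> R x)
        - (l2ip (fb v) (\<psi> R x) x - l2ip (fb v) (\<psi> R x) (\<psi> R x))"
      by (simp add: l2ip_diff_left l2ip_diff_right l)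
    also have "\<dots> = l2ip (fb v) x x - 2 * l2ip (fb v) x (\<psi> R x) + l2ip (fb v) x (\<psi> R (\<psi> R x))"
      using is_adjointD[OF adj' x x] is_adjointD[OF adj' x k(1)] by simp
    finally have "l2ip (fb v) (\<psi> T x) (\<psi> T x) + l2ip (fb v) ?y ?y = l2ip (fb v) x x" using 1 by simp
    then have "complex_of_real ((l2n (fb v) (\<psi> T x))\<^sup>2 + (l2n (fb v) ?y)\<^sup>2) = complex_of_real ((l2n (fb v) x)\<^sup>2)"
      unfolding l2ip_self[OF l(4)] l2ip_self[OF l(5)] l2ip_self[OF l(1)] by simp
    then show ?thesis by (simp only: of_real_eq_iff)
  qed
  note py = this
  have "l2n (fb v) (\<psi> T x) \<le> l2n (fb v) x" for v
  proof (rule power2_le_imp_le)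
    show "(l2n (fb v) (\<psi> T x))\<^sup>2 \<le> (l2n (fb v) x)\<^sup>2"
      using py[of v] zero_le_power2[of "l2n (fb v) ?y"] by linarith
  qed simp
  then show ?thesis using hn_dominated[OF x k(3), of 1] by simp
qed

text \<open>The contraction needs a bound strictly below 1, so \<open>T\<close> is divided by its
  norm plus \<open>e\<close>, for arbitrary positive \<open>e\<close>.\<close>

lemma star_iso_op_norm_le:
  assumes B: "closed_star_subalgebra H B" and C: "C \<subseteq> adjointable H" and \<psi>: "star_iso H B H C \<psi>" and T: "T \<in> B"
  shows "op_norm H (\<psi> T) \<le> op_norm H T"
proof (rule field_le_epsilon)
  have Bc: "closed_subalgebra H B" using B by (simp add: closed_star_subalgebra_def)
  have TA: "T \<in> adjointable H" using closed_subalgebraD(1)[OF Bc] T by blast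
  have "\<psi> T \<in> adjointable H"
    using \<psi> C T unfolding star_iso_def algebra_iso_def by (blast dest: bij_betwE)
  fix e :: real assume e: "0 < e"
  define c where "c = op_norm H T + e"
  note on = op_norm_nonneg_bound[OF TA]
  have c: "0 < c" using on(1) e by (simp add: c_def)
  obtain d where cc: "cmod d = inverse c"
    using that[of "complex_of_real (inverse c)"] c by (simp add: norm_inverse)
  let ?U = "op_scale H d T"
  have UB: "?U \<in> B" by (rule closed_subalgebraD(4)[OF Bc T])
  have bd: "hn (?U x) \<le> op_norm H T / c * hn x" if x: "x \<in> K" for x
  proof -
    have "hn (?U x) = inverse c * hn (T x)"
      using hn_scale[OF adjointable_K[OF TA x], of d] x by (simp add: op_simps cc)
    then show ?thesis using on(2)[OF x] c by (simp add: field_simps)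
  qed
  have lt: "0 \<le> op_norm H T / c" "op_norm H T / c < 1" using on(1) c e by (simp_all add: c_def)
  have "hn (\<psi> T x) \<le> c * hn x" if x: "x \<in> K" for x
  proof -
    have "hn (\<psi> ?U x) \<le> hn x" by (rule star_iso_contraction[OF B C \<psi> UB bd lt x])
    moreover have "\<psi> ?U = op_scale H d (\<psi> T)"
      using \<psi> T by (simp add: star_iso_def algebra_iso_def)
    moreover have "hn (op_scale H d (\<psi> T) x) = inverse c * hn (\<psi> T x)"
      using hn_scale[OF adjointable_K[OF \<open>\<psi> T \<in> adjointable H\<close> x], of d] x
      by (simp add: op_simps cc)
    ultimately have "inverse c * hn (\<psi> T x) \<le> hn x" by simp
    then show ?thesis using c by (simp add: field_simps)
  qed
  then show "op_norm H (\<psi> T) \<le> op_norm H T + e" using op_norm_le[of c "\<psi> T"] c by (simp add: c_def)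
qed

end

section \<open>The path space and creation operators\<close>

text \<open>A path is a pair \<open>(v, [e\<^sub>1, \<dots>, e\<^sub>n])\<close> with \<open>tail e\<^sub>i = head e\<^sub>i\<^sub>+\<^sub>1\<close> and \<open>tail e\<^sub>n = v\<close>; it indexes the
  basis vector \<open>e\<^sub>1 \<otimes> \<dots> \<otimes> e\<^sub>n\<close> of the Fock space, and \<open>(v, [])\<close> indexes \<open>\<delta>\<^sub>v \<in> c\<^sub>0(V)\<close>.\<close>

fun prng :: "('v, 'e) pre_digraph \<Rightarrow> 'v \<times> 'e list \<Rightarrow> 'v" where
  "prng G (v, []) = v"
| "prng G (v, e # es) = head G e"

fun path_ok :: "('v, 'e) pre_digraph \<Rightarrow> 'v \<Rightarrow> 'e list \<Rightarrow> bool" where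
  "path_ok G v [] \<longleftrightarrow> v \<in> verts G"
| "path_ok G v (e # es) \<longleftrightarrow> e \<in> arcs G \<and> path_ok G v es \<and> tail G e = prng G (v, es)"

definition paths :: "('v, 'e) pre_digraph \<Rightarrow> ('v \<times> 'e list) set" where
  "paths G = {(v, es). path_ok G v es}"

definition cons_path :: "'v \<times> 'e list \<Rightarrow> 'e \<Rightarrow> 'v \<times> 'e list" where
  "cons_path p e = (fst p, e # snd p)"

lemma cons_path_simps [simp]:
  "cons_path (v, es) e = (v, e # es)" "fst (cons_path p e) = fst p" "prng G (cons_path p e) = head G e"
  "cons_path p e \<noteq> (v, [])" "snd (cons_path p e) = e # snd p"
  by (simp_all add: cons_path_def)

lemma path_ok_verts: "path_ok G v es \<Longrightarrow> v \<in> verts G"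
  by (induction es) auto

lemma paths_Nil [simp]: "(v, []) \<in> paths G \<longleftrightarrow> v \<in> verts G"
  by (simp add: paths_def)

lemma paths_Cons: "(v, e # es) \<in> paths G \<longleftrightarrow> e \<in> arcs G \<and> (v, es) \<in> paths G \<and> tail G e = prng G (v, es)"
  by (simp add: paths_def)

lemma cons_path_paths: "cons_path p e \<in> paths G \<longleftrightarrow> e \<in> arcs G \<and> p \<in> paths G \<and> tail G e = prng G p"
  by (cases p) (simp add: paths_Cons)

lemma path_cases:
  obtains v where "p = (v, [])" | q e where "p = cons_path q e"
proof (cases "snd p")
  case Nil
  then show ?thesis using that(1)[of "fst p"] by (simp add: prod_eq_iff)
next
  case (Cons e es)
  then show ?thesis using that(2)[of "(fst p, es)" e] by (simp add: prod_eq_iff)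
qed

text \<open>\<open>lcr \<xi>\<close> and \<open>lan \<xi>\<close> are \<open>T\<^sub>\<xi>\<close> and its adjoint in the path basis.\<close>

definition lcr :: "('v, 'e) pre_digraph \<Rightarrow> ('e \<Rightarrow> complex) \<Rightarrow> ('v \<times> 'e list \<Rightarrow> complex) \<Rightarrow> ('v \<times> 'e list \<Rightarrow> complex)" where
  "lcr G \<xi> y = (\<lambda>p. if p \<in> paths G \<and> snd p \<noteq> [] then \<xi> (hd (snd p)) * y (fst p, tl (snd p)) else 0)"

definition lan :: "('v, 'e) pre_digraph \<Rightarrow> ('e \<Rightarrow> complex) \<Rightarrow> ('v \<times> 'e list \<Rightarrow> complex) \<Rightarrow> ('v \<times> 'e list \<Rightarrow> complex)" where
  "lan G \<xi> y = (\<lambda>p. if p \<in> paths G then l2ip (fib (arcs G) (tail G) (prng G p)) \<xi> (\<lambda>e. y (cons_path p e)) else 0)"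

lemma lcr_Nil [simp]: "lcr G \<xi> y (v, []) = 0"
  by (simp add: lcr_def)

lemma lcr_cons: "cons_path p e \<in> paths G \<Longrightarrow> lcr G \<xi> y (cons_path p e) = \<xi> e * y p"
  by (simp add: lcr_def)

locale graph =
  fixes G :: "('v, 'e) pre_digraph"
  assumes tail_in: "e \<in> arcs G \<Longrightarrow> tail G e \<in> verts G"
    and head_in: "e \<in> arcs G \<Longrightarrow> head G e \<in> verts G"

sublocale graph \<subseteq> A: fibred "verts G" "arcs G" "tail G" "head G"
  by unfold_locales (rule tail_in)

sublocale graph \<subseteq> F: fibred "verts G" "paths G" fst "prng G"
  by unfold_locales (auto simp: paths_def dest: path_ok_verts)

context graph
begin

lemma prng_in: "p \<in> paths G \<Longrightarrow> prng G p \<in> verts G"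
  by (cases p rule: path_cases) (auto simp: cons_path_paths head_in)

abbreviation "ext v \<equiv> Sigma (F.fb v) (\<lambda>p. A.fb (prng G p))"

text \<open>A path of positive length is an edge prepended to a path whose range matches. Without
  the vacuum at \<open>v\<close>, a fibre of the path space is thus a dependent sum, and sums over
  it can be iterated.\<close>

lemma fib_paths_cons: "F.fb v - {(v, [])} = (\<lambda>(p, e). cons_path p e) ` ext v"
proof (intro equalityI subsetI)
  fix q assume q: "q \<in> F.fb v - {(v, [])}"
  then show "q \<in> (\<lambda>(p, e). cons_path p e) ` ext v"
  proof (cases q rule: path_cases)
    case (2 p e)
    then have "(p, e) \<in> ext v" using q by (auto simp: fib_def cons_path_paths)
    then show ?thesis using 2 by (intro image_eqI[of _ _ "(p, e)"]) auto
  qed (auto simp: fib_def)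
next
  fix q assume "q \<in> (\<lambda>(p, e). cons_path p e) ` ext v"
  then show "q \<in> F.fb v - {(v, [])}" by (auto simp: fib_def cons_path_paths paths_Cons)
qed

lemma inj_cons_path: "inj_on (\<lambda>(p, e). cons_path p e) X"
  by (auto simp: inj_on_def cons_path_def prod_eq_iff)

lemma has_sum_paths:
  fixes f :: "'v \<times> 'e list \<Rightarrow> 'b::{comm_monoid_add,topological_space}"
  assumes "f (v, []) = 0"
  shows "(f has_sum a) (F.fb v) \<longleftrightarrow> ((\<lambda>(p, e). f (cons_path p e)) has_sum a) (ext v)"
proof -
  have "(f has_sum a) (F.fb v) \<longleftrightarrow> (f has_sum a) (F.fb v - {(v, [])})"
    by (rule has_sum_cong_neutral) (use assms in auto)
  also have "\<dots> \<longleftrightarrow> ((f \<circ> (\<lambda>(p, e). cons_path p e)) has_sum a) (ext v)"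
    unfolding fib_paths_cons by (rule has_sum_reindex[OF inj_cons_path])
  also have "f \<circ> (\<lambda>(p, e). cons_path p e) = (\<lambda>(p, e). f (cons_path p e))" by auto
  finally show ?thesis .
qed

lemma summable_on_paths:
  fixes f :: "'v \<times> 'e list \<Rightarrow> 'b::{comm_monoid_add,topological_space}"
  assumes "f (v, []) = 0"
  shows "f summable_on F.fb v \<longleftrightarrow> (\<lambda>(p, e). f (cons_path p e)) summable_on ext v"
  unfolding summable_on_def has_sum_paths[of f v, OF assms] ..

lemma infsum_paths:
  fixes f :: "'v \<times> 'e list \<Rightarrow> 'b::{comm_monoid_add,t2_space}"
  assumes "f (v, []) = 0"
  shows "infsum f (F.fb v) = infsum (\<lambda>(p, e). f (cons_path p e)) (ext v)"
proof (cases "f summable_on F.fb v")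
  case True
  then have "(f has_sum infsum f (F.fb v)) (F.fb v)" by (rule has_sum_infsum)
  then show ?thesis unfolding has_sum_paths[of f v, OF assms] by (rule infsumI[symmetric])
next
  case False
  then show ?thesis using summable_on_paths[of f v, OF assms] by (simp add: infsum_not_exists)
qed

lemma ext_path: "p \<in> F.fb v \<Longrightarrow> e \<in> A.fb (prng G p) \<Longrightarrow> cons_path p e \<in> paths G"
  by (auto simp: fib_def cons_path_paths)

text \<open>Tonelli over \<open>ext v\<close>: for a fixed path \<open>p\<close> the squares of
  \<xi> add up to its square norm in the fibre over the range of \<open>p\<close>, which is at most
  the square of the module norm.\<close>

lemma lcr_l2:
  assumes \<xi>: "\<xi> \<in> A.K" and x: "x \<in> l2 (F.fb v)"
  shows "lcr G \<xi> x \<in> l2 (F.fb v)"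
    and "(l2n (F.fb v) (lcr G \<xi> x))\<^sup>2 = (\<Sum>\<^sub>\<infinity>p\<in>F.fb v. (l2n (A.fb (prng G p)) \<xi>)\<^sup>2 * (cmod (x p))\<^sup>2)"
    and "l2n (F.fb v) (lcr G \<xi> x) \<le> A.hn \<xi> * l2n (F.fb v) x"
proof -
  let ?f = "\<lambda>q. (cmod (lcr G \<xi> x q))\<^sup>2"
  let ?h = "\<lambda>(p, e). (cmod (\<xi> e))\<^sup>2 * (cmod (x p))\<^sup>2"
  let ?g = "\<lambda>p. (l2n (A.fb (prng G p)) \<xi>)\<^sup>2 * (cmod (x p))\<^sup>2"
  have f0: "?f (v, []) = 0" by simp
  have fh: "(\<lambda>(p, e). ?f (cons_path p e)) q = ?h q" if "q \<in> ext v" for q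
  proof -
    obtain p e where q: "q = (p, e)" by (cases q)
    then have "cons_path p e \<in> paths G" using that by (auto intro: ext_path)
    then show ?thesis by (simp add: q lcr_cons norm_mult power_mult_distrib)
  qed
  have inner: "((\<lambda>e. ?h (p, e)) has_sum ?g p) (A.fb (prng G p))" for p
  proof -
    have "((\<lambda>e. (cmod (\<xi> e))\<^sup>2) has_sum (l2n (A.fb (prng G p)) \<xi>)\<^sup>2) (A.fb (prng G p))"
      using A.K_l2[OF \<xi>] unfolding l2n_sq by (intro has_sum_infsum) (simp add: l2_def)
    from has_sum_cmult_left[OF this] show ?thesis by simp
  qed
  have gle: "?g p \<le> (A.hn \<xi>)\<^sup>2 * (cmod (x p))\<^sup>2" for p
    by (intro mult_right_mono power_mono A.l2n_le_hn \<xi>) auto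
  have xs: "(\<lambda>p. (A.hn \<xi>)\<^sup>2 * (cmod (x p))\<^sup>2) summable_on F.fb v"
    using x by (intro summable_on_cmult_right) (simp add: l2_def)
  have gs: "?g summable_on F.fb v"
    using abs_summable_on_comparison_test'[OF xs, of ?g] gle by simp
  have hs: "?h summable_on ext v"
    by (rule summable_on_SigmaI[OF inner gs]) auto
  have "(\<lambda>(p, e). ?f (cons_path p e)) summable_on ext v"
    by (rule summable_on_cong[THEN iffD2, OF fh hs])
  then show l2: "lcr G \<xi> x \<in> l2 (F.fb v)" using summable_on_paths[of ?f v, OF f0] by (simp add: l2_def)
  have "(l2n (F.fb v) (lcr G \<xi> x))\<^sup>2 = infsum ?h (ext v)"
    unfolding l2n_sq infsum_paths[of ?f v, OF f0] by (rule infsum_cong[OF fh])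
  also have "\<dots> = (\<Sum>\<^sub>\<infinity>p\<in>F.fb v. \<Sum>\<^sub>\<infinity>e\<in>A.fb (prng G p). ?h (p, e))"
    by (rule infsum_Sigma_banach[OF hs, symmetric])
  also have "\<dots> = infsum ?g (F.fb v)" by (intro infsum_cong infsumI inner)
  finally show eq: "(l2n (F.fb v) (lcr G \<xi> x))\<^sup>2 = infsum ?g (F.fb v)" .
  have "infsum ?g (F.fb v) \<le> (\<Sum>\<^sub>\<infinity>p\<in>F.fb v. (A.hn \<xi>)\<^sup>2 * (cmod (x p))\<^sup>2)"
    by (rule infsum_mono[OF gs xs gle])
  also have "\<dots> = (A.hn \<xi> * l2n (F.fb v) x)\<^sup>2"
    by (simp add: infsum_cmult_right' l2n_sq power_mult_distrib)
  finally show "l2n (F.fb v) (lcr G \<xi> x) \<le> A.hn \<xi> * l2n (F.fb v) x"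
    unfolding eq[symmetric] by (rule power2_le_imp_le) (simp add: A.hn_nonneg[OF \<xi>])
qed

lemma lcr_K:
  assumes "\<xi> \<in> A.K" "x \<in> F.K"
  shows "lcr G \<xi> x \<in> F.K" "F.hn (lcr G \<xi> x) \<le> A.hn \<xi> * F.hn x"
proof -
  show k: "lcr G \<xi> x \<in> F.K"
  proof (rule F.K_dominated[OF assms(2), of _ "A.hn \<xi>"])
    show "lcr G \<xi> x p = 0" if "p \<notin> paths G" for p using that by (simp add: lcr_def)
  qed (simp_all add: lcr_l2[OF assms(1) F.K_l2[OF assms(2)]])
  show "F.hn (lcr G \<xi> x) \<le> A.hn \<xi> * F.hn x"
    by (rule F.hn_dominated[OF assms(2) k]) (simp_all add: lcr_l2[OF assms(1) F.K_l2[OF assms(2)]] A.hn_nonneg assms)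
qed

text \<open>The square sum of \<open>y\<close> is regrouped by the path that remains after deletion
  of the first edge. The vacuum coordinate falls into no group, which leaves an inequality.\<close>

lemma fibre_square_sums:
  assumes y: "y \<in> l2 (F.fb v)"
  shows "p \<in> F.fb v \<Longrightarrow> (\<lambda>e. y (cons_path p e)) \<in> l2 (A.fb (prng G p))"
    and "(\<lambda>p. complex_of_real (l2n (A.fb (prng G p)) (\<lambda>e. y (cons_path p e)))) \<in> l2 (F.fb v)"
    and "l2n (F.fb v) (\<lambda>p. complex_of_real (l2n (A.fb (prng G p)) (\<lambda>e. y (cons_path p e)))) \<le> l2n (F.fb v) y"
proof -
  \<comment> \<open>The vacuum coordinate is set to 0 because the passage to pairs of a path and an
    edge requires it to vanish.\<close>
  define z where "z = (\<lambda>p. if p = (v, []) then 0 else y p)"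
  have z: "z \<in> l2 (F.fb v)" "l2n (F.fb v) z \<le> 1 * l2n (F.fb v) y"
    using l2_dominated[OF y, of z 1] by (simp_all add: z_def)
  have z0: "(cmod (z (v, [])))\<^sup>2 = 0" by (simp add: z_def)
  have zc: "z (cons_path p e) = y (cons_path p e)" for p e by (simp add: z_def)
  have s: "(\<lambda>(p, e). (cmod (y (cons_path p e)))\<^sup>2) summable_on ext v"
    using z(1) summable_on_paths[of "\<lambda>q. (cmod (z q))\<^sup>2", OF z0] by (simp add: l2_def zc)
  show "(\<lambda>e. y (cons_path p e)) \<in> l2 (A.fb (prng G p))" if "p \<in> F.fb v"
    unfolding l2_def mem_Collect_eq by (rule summable_on_SigmaD1[OF s that])
  have eq: "(cmod (complex_of_real (l2n (A.fb (prng G p)) (\<lambda>e. y (cons_path p e)))))\<^sup>2 =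
      (\<Sum>\<^sub>\<infinity>e\<in>A.fb (prng G p). (cmod (y (cons_path p e)))\<^sup>2)" for p
    by (simp add: l2n_sq)
  show "(\<lambda>p. complex_of_real (l2n (A.fb (prng G p)) (\<lambda>e. y (cons_path p e)))) \<in> l2 (F.fb v)"
    unfolding l2_def mem_Collect_eq eq using summable_on_Sigma_banach[OF s] .
  have "(l2n (F.fb v) (\<lambda>p. complex_of_real (l2n (A.fb (prng G p)) (\<lambda>e. y (cons_path p e)))))\<^sup>2 =
      infsum (\<lambda>(p, e). (cmod (y (cons_path p e)))\<^sup>2) (ext v)"
    unfolding l2n_sq[of "F.fb v"] eq using infsum_Sigma_banach[OF s] by simp
  also have "\<dots> = (l2n (F.fb v) z)\<^sup>2"
    unfolding l2n_sq infsum_paths[of "\<lambda>q. (cmod (z q))\<^sup>2", OF z0] zc ..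
  finally show "l2n (F.fb v) (\<lambda>p. complex_of_real (l2n (A.fb (prng G p)) (\<lambda>e. y (cons_path p e)))) \<le> l2n (F.fb v) y"
    using z(2) by (simp add: power2_eq_iff_nonneg)
qed

text \<open>Cauchy-Schwarz in the fibre over the range of \<open>p\<close> bounds the value at
  \<open>p\<close> by the norm of \<xi> times the norm of the group of \<open>y\<close> at
  \<open>p\<close>.\<close>

lemma lan_l2:
  assumes \<xi>: "\<xi> \<in> A.K" and y: "y \<in> l2 (F.fb v)"
  shows "lan G \<xi> y \<in> l2 (F.fb v)" "l2n (F.fb v) (lan G \<xi> y) \<le> A.hn \<xi> * l2n (F.fb v) y"
proof -
  let ?z = "\<lambda>p. complex_of_real (l2n (A.fb (prng G p)) (\<lambda>e. y (cons_path p e)))"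
  have b: "cmod (lan G \<xi> y p) \<le> A.hn \<xi> * cmod (?z p)" if p: "p \<in> F.fb v" for p
  proof -
    have "cmod (lan G \<xi> y p) \<le> l2n (A.fb (prng G p)) \<xi> * l2n (A.fb (prng G p)) (\<lambda>e. y (cons_path p e))"
      unfolding lan_def using l2_Cauchy_Schwarz[OF A.K_l2[OF \<xi>] fibre_square_sums(1)[OF y p]] by simp
    also have "\<dots> \<le> A.hn \<xi> * cmod (?z p)"
      using A.l2n_le_hn[OF \<xi>] by (simp add: mult_right_mono)
    finally show ?thesis .
  qed
  note d = l2_dominated[OF fibre_square_sums(2)[OF y] b A.hn_nonneg[OF \<xi>]]
  show "lan G \<xi> y \<in> l2 (F.fb v)" by (rule d(1))
  have "l2n (F.fb v) (lan G \<xi> y) \<le> A.hn \<xi> * l2n (F.fb v) ?z" by (rule d(2))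
  also have "\<dots> \<le> A.hn \<xi> * l2n (F.fb v) y"
    by (rule mult_left_mono[OF fibre_square_sums(3)[OF y] A.hn_nonneg[OF \<xi>]])
  finally show "l2n (F.fb v) (lan G \<xi> y) \<le> A.hn \<xi> * l2n (F.fb v) y" .
qed

lemma lan_K:
  assumes "\<xi> \<in> A.K" "y \<in> F.K"
  shows "lan G \<xi> y \<in> F.K"
proof (rule F.K_dominated[OF assms(2), of _ "A.hn \<xi>"])
  show "lan G \<xi> y p = 0" if "p \<notin> paths G" for p using that by (simp add: lan_def)
qed (simp_all add: lan_l2[OF assms(1) F.K_l2[OF assms(2)]])

text \<open>Fubini over \<open>ext v\<close>; summability of the double family is that of the inner
  product on the left, where both vectors are already known to be square summable.\<close>

lemma lcr_lan_adjoint: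
  assumes \<xi>: "\<xi> \<in> A.K" and x: "x \<in> l2 (F.fb v)" and y: "y \<in> l2 (F.fb v)"
  shows "l2ip (F.fb v) (lcr G \<xi> x) y = l2ip (F.fb v) x (lan G \<xi> y)"
proof -
  let ?f = "\<lambda>q. cnj (lcr G \<xi> x q) * y q"
  let ?h = "\<lambda>(p, e). cnj (\<xi> e * x p) * y (cons_path p e)"
  have f0: "?f (v, []) = 0" by simp
  have fh: "(\<lambda>(p, e). ?f (cons_path p e)) q = ?h q" if "q \<in> ext v" for q
  proof -
    obtain p e where q: "q = (p, e)" by (cases q)
    then have "cons_path p e \<in> paths G" using that by (auto intro: ext_path)
    then show ?thesis by (simp add: q lcr_cons)
  qed
  have "?f summable_on F.fb v" by (rule l2ip_summable[OF lcr_l2(1)[OF \<xi> x] y])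
  then have "(\<lambda>(p, e). ?f (cons_path p e)) summable_on ext v"
    unfolding summable_on_paths[of ?f v, OF f0] .
  moreover have "(\<lambda>(p, e). ?f (cons_path p e)) summable_on ext v \<longleftrightarrow> ?h summable_on ext v"
    by (rule summable_on_cong) (rule fh)
  ultimately have hs: "?h summable_on ext v" by (rule iffD1[rotated])
  have "l2ip (F.fb v) (lcr G \<xi> x) y = infsum ?h (ext v)"
    unfolding l2ip_def infsum_paths[of ?f v, OF f0] by (rule infsum_cong[OF fh])
  also have "\<dots> = (\<Sum>\<^sub>\<infinity>p\<in>F.fb v. \<Sum>\<^sub>\<infinity>e\<in>A.fb (prng G p). ?h (p, e))"
    by (rule infsum_Sigma_banach[OF hs, symmetric])
  also have "\<dots> = l2ip (F.fb v) x (lan G \<xi> y)"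
    unfolding l2ip_def
  proof (rule infsum_cong)
    fix p assume "p \<in> F.fb v"
    then have "lan G \<xi> y p = (\<Sum>\<^sub>\<infinity>e\<in>A.fb (prng G p). cnj (\<xi> e) * y (cons_path p e))"
      by (simp add: lan_def l2ip_def fib_def)
    then have "cnj (x p) * lan G \<xi> y p = (\<Sum>\<^sub>\<infinity>e\<in>A.fb (prng G p). cnj (x p) * (cnj (\<xi> e) * y (cons_path p e)))"
      by (simp add: infsum_cmult_right')
    then show "(\<Sum>\<^sub>\<infinity>e\<in>A.fb (prng G p). ?h (p, e)) = cnj (x p) * lan G \<xi> y p"
      by (simp add: mult.assoc mult.commute mult.left_commute)
  qed
  finally show ?thesis .
qed

text \<open>In coordinates this is the relation \<open>T\<^sub>\<xi>\<^sup>*T\<^sub>\<eta> =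
  \<iota>(\<langle>\<xi>, \<eta>\<rangle>)\<close>.\<close>

lemma lan_lcr:
  assumes p: "p \<in> paths G"
  shows "lan G \<xi> (lcr G \<eta> y) p = l2ip (A.fb (prng G p)) \<xi> \<eta> * y p"
proof -
  have "lan G \<xi> (lcr G \<eta> y) p = (\<Sum>\<^sub>\<infinity>e\<in>A.fb (prng G p). cnj (\<xi> e) * \<eta> e * y p)"
    unfolding lan_def l2ip_def using p
    by (auto simp: lcr_cons cons_path_paths fib_def intro!: infsum_cong)
  then show ?thesis by (simp add: l2ip_def infsum_cmult_left')
qed

lemma lcr_inner:
  assumes "\<xi> \<in> A.K" "\<eta> \<in> A.K" "x \<in> l2 (F.fb v)" "y \<in> l2 (F.fb v)"
  shows "l2ip (F.fb v) (lcr G \<xi> x) (lcr G \<eta> y) =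
    l2ip (F.fb v) x (\<lambda>p. l2ip (A.fb (prng G p)) \<xi> \<eta> * y p)"
  unfolding lcr_lan_adjoint[OF assms(1,3) lcr_l2(1)[OF assms(2,4)]]
  unfolding l2ip_def[of "F.fb v"] by (rule infsum_cong) (simp add: lan_lcr fib_def)

lemma lcr_linear:
  "lcr G \<xi> (\<lambda>p. x p + y p) = (\<lambda>p. lcr G \<xi> x p + lcr G \<xi> y p)"
  "lcr G \<xi> (\<lambda>p. c * y p) = (\<lambda>p. c * lcr G \<xi> y p)"
  "lcr G \<xi> (\<lambda>p. x p - y p) = (\<lambda>p. lcr G \<xi> x p - lcr G \<xi> y p)"
  by (auto simp: lcr_def fun_eq_iff algebra_simps)

end

section \<open>The graph correspondence and its Fock correspondence in coordinates\<close>

sublocale graph \<subseteq> C: coords "verts G" "arcs G" "tail G" "head G" "graph_precorr G" Poly_Mapping.lookup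
proof
  have car: "Xcar (graph_precorr G) = {x. Poly_Mapping.keys x \<subseteq> arcs G}" by (simp add: graph_precorr_def)
  have sub: "Poly_Mapping.keys (Poly_Mapping.mapp f x) \<subseteq> arcs G" if "Poly_Mapping.keys x \<subseteq> arcs G"
    for f :: "_ \<Rightarrow> complex \<Rightarrow> complex" and x
    using keys_mapp_subset[of f x] that by blast
  show "coeff (graph_precorr G) = c0 (verts G)" by (simp add: graph_precorr_def)
  show "Xzero (graph_precorr G) \<in> Xcar (graph_precorr G)" by (simp add: graph_precorr_def)
  show "Poly_Mapping.lookup (Xzero (graph_precorr G)) = (\<lambda>_. 0)" by (simp add: graph_precorr_def fun_eq_iff)
  show "\<exists>x\<in>Xcar (graph_precorr G). Poly_Mapping.lookup x = delta e" if "e \<in> arcs G" for e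
    using that by (intro bexI[of _ "Poly_Mapping.single e 1"])
      (auto simp: car delta_def fun_eq_iff lookup_single when_def)
  fix x assume x: "x \<in> Xcar (graph_precorr G)"
  then have k: "Poly_Mapping.keys x \<subseteq> arcs G" by (simp add: car)
  have fin: "finite {e. Poly_Mapping.lookup x e \<noteq> 0}" by simp
  show "Poly_Mapping.lookup x \<in> A.K"
    by (rule A.K_finite_support[OF fin]) (use k in \<open>auto simp: in_keys_iff\<close>)
  show "Xscale (graph_precorr G) z x \<in> Xcar (graph_precorr G)" for z
    using sub[OF k] by (simp add: car) (simp add: graph_precorr_def)
  show "Poly_Mapping.lookup (Xscale (graph_precorr G) z x) = (\<lambda>i. z * Poly_Mapping.lookup x i)" for z
    by (auto simp: graph_precorr_def fun_eq_iff lookup_mapp when_def in_keys_iff)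
  show "Xright (graph_precorr G) x a \<in> Xcar (graph_precorr G)" for a
    using sub[OF k] by (simp add: car) (simp add: graph_precorr_def)
  show "Poly_Mapping.lookup (Xright (graph_precorr G) x a) = (\<lambda>i. Poly_Mapping.lookup x i * a (tail G i))" for a
    by (auto simp: graph_precorr_def fun_eq_iff lookup_mapp when_def in_keys_iff)
  show "Xleft (graph_precorr G) a x \<in> Xcar (graph_precorr G)" for a
    using sub[OF k] by (simp add: car) (simp add: graph_precorr_def)
  show "Poly_Mapping.lookup (Xleft (graph_precorr G) a x) = (\<lambda>i. a (head G i) * Poly_Mapping.lookup x i)" for a
    by (auto simp: graph_precorr_def fun_eq_iff lookup_mapp when_def in_keys_iff)
  fix y assume y: "y \<in> Xcar (graph_precorr G)"
  then have ky: "Poly_Mapping.keys y \<subseteq> arcs G" by (simp add: car)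
  show "Xadd (graph_precorr G) x y \<in> Xcar (graph_precorr G)"
    using k ky keys_add[of x y] by (auto simp: graph_precorr_def)
  show "Poly_Mapping.lookup (Xadd (graph_precorr G) x y) = (\<lambda>i. Poly_Mapping.lookup x i + Poly_Mapping.lookup y i)"
    by (simp add: graph_precorr_def fun_eq_iff lookup_add)
  show "Xinner (graph_precorr G) x y = (\<lambda>v. l2ip (A.fb v) (Poly_Mapping.lookup x) (Poly_Mapping.lookup y))"
  proof
    fix v
    let ?f = "\<lambda>e. cnj (Poly_Mapping.lookup x e) * Poly_Mapping.lookup y e"
    let ?F = "{e. e \<in> Poly_Mapping.keys x \<and> tail G e = v}"
    have "l2ip (A.fb v) (Poly_Mapping.lookup x) (Poly_Mapping.lookup y) = infsum ?f ?F"
      unfolding l2ip_def by (rule infsum_cong_neutral) (use k in \<open>auto simp: fib_def in_keys_iff\<close>)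
    also have "\<dots> = sum ?f ?F" by (rule infsum_finite) (simp add: finite_subset[OF _ finite_keys[of x]])
    finally show "Xinner (graph_precorr G) x y v = l2ip (A.fb v) (Poly_Mapping.lookup x) (Poly_Mapping.lookup y)"
      by (simp add: graph_precorr_def)
  qed
qed

section \<open>Coordinates of vectors and of elementary tensors\<close>

context graph
begin

abbreviation "X \<equiv> graph_corr G"

lemma X_iso: "corr_iso A.H X C.cls (\<lambda>a. a)"
  using C.completion_iso by (simp add: graph_corr_def)

interpretation XI: corr_iso A.H X C.cls "\<lambda>a. a"
  by (rule X_iso)

lemma coeff_X [simp]: "coeff X = c0 (verts G)"
  using C.coeff_completion by (simp add: graph_corr_def)

definition vec :: "(nat \<Rightarrow> 'e \<Rightarrow>\<^sub>0 complex) set \<Rightarrow> 'e \<Rightarrow> complex" where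
  "vec = inv_into A.K C.cls"

lemma vec_cls [simp]: "\<xi> \<in> A.K \<Longrightarrow> vec (C.cls \<xi>) = \<xi>"
  using XI.W'_W by (simp add: vec_def)

lemma X_car: "\<xi> \<in> Xcar X \<longleftrightarrow> (\<exists>x\<in>A.K. \<xi> = C.cls x)"
  using C.completion_carrier by (auto simp: graph_corr_def)

lemma vec_K: "\<xi> \<in> Xcar X \<Longrightarrow> vec \<xi> \<in> A.K"
  by (auto simp: X_car)

lemma vec_inner: "\<xi> \<in> Xcar X \<Longrightarrow> \<eta> \<in> Xcar X \<Longrightarrow> Xinner X \<xi> \<eta> = (\<lambda>v. l2ip (A.fb v) (vec \<xi>) (vec \<eta>))"
  using XI.inner by (auto simp: X_car)

lemma vec_right:
  assumes "\<xi> \<in> Xcar X" "a \<in> Acar (c0 (verts G))"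
  shows "Xright X \<xi> a \<in> Xcar X" "vec (Xright X \<xi> a) = (\<lambda>e. vec \<xi> e * a (tail G e))"
proof -
  obtain x where x: "x \<in> A.K" "\<xi> = C.cls x" using assms X_car by blast
  have "Xright X \<xi> a = C.cls (\<lambda>e. x e * a (tail G e))"
    using XI.map_right[of x a] x assms by simp
  then show "Xright X \<xi> a \<in> Xcar X" "vec (Xright X \<xi> a) = (\<lambda>e. vec \<xi> e * a (tail G e))"
    using x assms A.K_right[OF x(1) assms(2)] by (auto simp: X_car)
qed

lemma vec_left:
  assumes "\<xi> \<in> Xcar X" "a \<in> Acar (c0 (verts G))"
  shows "Xleft X a \<xi> \<in> Xcar X" "vec (Xleft X a \<xi>) = (\<lambda>e. a (head G e) * vec \<xi> e)"
proof -
  obtain x where x: "x \<in> A.K" "\<xi> = C.cls x" using assms X_car by blast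
  have "Xleft X a \<xi> = C.cls (\<lambda>e. a (head G e) * x e)"
    using XI.map_left[of x a] x assms by simp
  then show "Xleft X a \<xi> \<in> Xcar X" "vec (Xleft X a \<xi>) = (\<lambda>e. a (head G e) * vec \<xi> e)"
    using x assms A.K_left[OF x(1) assms(2)] by (auto simp: X_car)
qed

text \<open>The vacuum \<open>vac\<close> is not in the Hilbert module when there are infinitely many vertices.\<close>

definition vac :: "'v \<times> 'e list \<Rightarrow> complex" where
  "vac = (\<lambda>p. if p \<in> paths G \<and> snd p = [] then 1 else 0)"

lemma vac_l2: "vac \<in> l2 (F.fb v)"
proof (rule l2_finite_support(1))
  show "finite {p \<in> F.fb v. vac p \<noteq> 0}"
    by (rule finite_subset[of _ "{(v, [])}"]) (auto simp: vac_def fib_def)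
qed

lemma vac_cons [simp]: "vac (cons_path p e) = 0"
  by (simp add: vac_def)

text \<open>An elementary tensor is produced from the vacuum by successive creation, so that the
  recursion for the inner product of tensors turns into \<open>lcr_inner\<close>.\<close>

primrec tcoord :: "(nat \<Rightarrow> 'e \<Rightarrow>\<^sub>0 complex) set list \<Rightarrow> 'v \<times> 'e list \<Rightarrow> complex" where
  "tcoord [] = vac"
| "tcoord (\<xi> # \<xi>s) = lcr G (vec \<xi>) (tcoord \<xi>s)"

lemma tcoord_l2: "set \<xi>s \<subseteq> Xcar X \<Longrightarrow> tcoord \<xi>s \<in> l2 (F.fb v)"
  by (induction \<xi>s) (auto simp: vac_l2 intro!: lcr_l2(1) vec_K)

lemma l2ip_vac:
  assumes "v \<in> verts G" shows "l2ip (F.fb v) vac f = f (v, [])"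
proof -
  have "l2ip (F.fb v) vac f = (\<Sum>\<^sub>\<infinity>p\<in>{(v, [])}. f p)"
    unfolding l2ip_def
    by (rule infsum_cong_neutral) (use assms in \<open>auto simp: fib_def vac_def prod_eq_iff\<close>)
  then show ?thesis by simp
qed

text \<open>The vacuum may lie outside the module, so boundedness of creation gives nothing here.
  Instead the norm of the result in the fibre over \<open>v\<close> is computed: it equals that of
  \<xi>, whose decay is inherited.\<close>

lemma lcr_vac_K:
  assumes "\<xi> \<in> A.K" shows "lcr G \<xi> vac \<in> F.K"
proof -
  have "l2n (F.fb v) (lcr G \<xi> vac) = l2n (A.fb v) \<xi>" if v: "v \<in> verts G" for v
  proof -
    have "complex_of_real ((l2n (F.fb v) (lcr G \<xi> vac))\<^sup>2) = complex_of_real ((l2n (A.fb v) \<xi>)\<^sup>2)"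
      unfolding l2ip_self[OF lcr_l2(1)[OF assms vac_l2], symmetric] l2ip_self[OF A.K_l2[OF assms], symmetric]
      by (subst lcr_inner[OF assms assms vac_l2 vac_l2])
        (use v in \<open>simp add: l2ip_vac\<close>, simp add: vac_def)
    then show ?thesis by (simp only: of_real_eq_iff) simp
  qed
  then have "{v \<in> verts G. \<epsilon> \<le> l2n (F.fb v) (lcr G \<xi> vac)} = {v \<in> verts G. \<epsilon> \<le> l2n (A.fb v) \<xi>}" for \<epsilon>
    by (intro Collect_cong) auto
  then show ?thesis using assms unfolding hcar_def
    by (auto simp: lcr_l2(1)[OF assms vac_l2]) (simp add: lcr_def)
qed

lemma tcoord_K: "\<xi> \<in> Xcar X \<Longrightarrow> set \<xi>s \<subseteq> Xcar X \<Longrightarrow> tcoord (\<xi> # \<xi>s) \<in> F.K"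
proof (induction \<xi>s arbitrary: \<xi>)
  case Nil
  then show ?case by (simp add: lcr_vac_K vec_K)
next
  case (Cons \<eta> \<xi>s)
  then have "tcoord (\<eta> # \<xi>s) \<in> F.K" by simp
  then show ?case using Cons.prems by (simp add: lcr_K vec_K)
qed

text \<open>Stripping off the first factors with \<open>lcr_inner\<close> leaves the left action of
  \<langle>\<xi>, \<eta>\<rangle> on the next factor, as in the interior tensor product. If one list
  ends before the other, the vacuum meets a function vanishing on empty paths, which gives
  orthogonality of different degrees.\<close>

lemma tensor_inner_coord:
  "\<xi> \<in> Xcar X \<Longrightarrow> \<eta> \<in> Xcar X \<Longrightarrow> set \<xi>s \<subseteq> Xcar X \<Longrightarrow> set \<eta>s \<subseteq> Xcar X \<Longrightarrow>
   tensor_inner X (\<xi> # \<xi>s) (\<eta> # \<eta>s) = (\<lambda>v. l2ip (F.fb v) (tcoord (\<xi> # \<xi>s)) (tcoord (\<eta> # \<eta>s)))"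
proof (induction \<xi>s arbitrary: \<xi> \<eta> \<eta>s)
  case Nil
  show ?case
  proof
    fix v
    have R: "l2ip (F.fb v) (tcoord [\<xi>]) (tcoord (\<eta> # \<eta>s)) =
        l2ip (F.fb v) vac (\<lambda>p. l2ip (A.fb (prng G p)) (vec \<xi>) (vec \<eta>) * tcoord \<eta>s p)"
      using Nil by (simp add: lcr_inner vec_K vac_l2 tcoord_l2)
    show "tensor_inner X [\<xi>] (\<eta> # \<eta>s) v = l2ip (F.fb v) (tcoord [\<xi>]) (tcoord (\<eta> # \<eta>s))"
    proof (cases "v \<in> verts G")
      case False
      then show ?thesis
        using Nil by (cases \<eta>s) (simp_all add: F.fb_outside A.fb_outside l2ip_def vec_inner)
    next
      case True
      have "l2ip (F.fb v) (tcoord [\<xi>]) (tcoord (\<eta> # \<eta>s)) = l2ip (A.fb v) (vec \<xi>) (vec \<eta>) * tcoord \<eta>s (v, [])"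
        unfolding R l2ip_vac[OF True] by simp
      then show ?thesis using Nil True by (cases \<eta>s) (simp_all add: vec_inner vac_def)
    qed
  qed
next
  case (Cons \<xi>' \<xi>s)
  show ?case
  proof (cases \<eta>s)
    case Nil
    have "l2ip (F.fb v) (tcoord (\<xi> # \<xi>' # \<xi>s)) (tcoord [\<eta>]) = 0" for v
    proof -
      have "l2ip (F.fb v) (tcoord (\<xi> # \<xi>' # \<xi>s)) (tcoord [\<eta>]) =
          l2ip (F.fb v) (tcoord (\<xi>' # \<xi>s)) (\<lambda>p. l2ip (A.fb (prng G p)) (vec \<xi>) (vec \<eta>) * vac p)"
        using Cons.prems tcoord_l2[of "\<xi>' # \<xi>s" v] by (simp add: lcr_inner vec_K vac_l2)
      also have "\<dots> = 0"
        unfolding l2ip_def[of "F.fb v"]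
        by (rule infsum_0) (auto simp: vac_def lcr_def)
      finally show ?thesis .
    qed
    then show ?thesis using Nil by (auto simp: fun_eq_iff)
  next
    case (Cons \<eta>' \<eta>s')
    let ?a = "Xinner X \<xi> \<eta>"
    have a: "?a \<in> Acar (c0 (verts G))" using XI.inner A.inner_c0 Cons.prems vec_K by (simp add: vec_inner)
    have in': "\<xi>' \<in> Xcar X" "\<eta>' \<in> Xcar X" "set \<xi>s \<subseteq> Xcar X" "set \<eta>s' \<subseteq> Xcar X"
      using Cons.prems Cons by auto
    have "tensor_inner X (\<xi> # \<xi>' # \<xi>s) (\<eta> # \<eta>s) = tensor_inner X (\<xi>' # \<xi>s) (Xleft X ?a \<eta>' # \<eta>s')"
      by (simp add: Cons)
    also have "\<dots> = (\<lambda>v. l2ip (F.fb v) (tcoord (\<xi>' # \<xi>s)) (tcoord (Xleft X ?a \<eta>' # \<eta>s')))"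
      using in' vec_left(1)[OF in'(2) a] by (intro Cons.IH) auto
    also have "\<dots> = (\<lambda>v. l2ip (F.fb v) (tcoord (\<xi> # \<xi>' # \<xi>s)) (tcoord (\<eta> # \<eta>s)))"
    proof
      fix v
      have "tcoord (Xleft X ?a \<eta>' # \<eta>s') = (\<lambda>p. l2ip (A.fb (prng G p)) (vec \<xi>) (vec \<eta>) * tcoord (\<eta>' # \<eta>s') p)"
      proof
        fix p
        show "tcoord (Xleft X ?a \<eta>' # \<eta>s') p = l2ip (A.fb (prng G p)) (vec \<xi>) (vec \<eta>) * tcoord (\<eta>' # \<eta>s') p"
          by (cases p rule: path_cases)
            (use Cons.prems vec_left(2)[OF in'(2) a] in \<open>auto simp: lcr_def vec_inner\<close>)
      qed
      then show "l2ip (F.fb v) (tcoord (\<xi>' # \<xi>s)) (tcoord (Xleft X ?a \<eta>' # \<eta>s')) =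
          l2ip (F.fb v) (tcoord (\<xi> # \<xi>' # \<xi>s)) (tcoord (\<eta> # \<eta>s))"
        using lcr_inner[OF vec_K vec_K tcoord_l2 tcoord_l2, of \<xi> \<eta> "\<xi>' # \<xi>s" "\<eta>' # \<eta>s'" v] Cons.prems Cons by simp
    qed
    finally show ?thesis .
  qed
qed

fun gcoord :: "('v \<Rightarrow> complex, (nat \<Rightarrow> 'e \<Rightarrow>\<^sub>0 complex) set) fock_gen \<Rightarrow> 'v \<times> 'e list \<Rightarrow> complex" where
  "gcoord (Coeff a) = (\<lambda>p. if snd p = [] then a (fst p) else 0)"
| "gcoord (Tensor \<xi> \<xi>s) = tcoord (\<xi> # \<xi>s)"

lemma gens_cases:
  assumes "w \<in> fock_gens X"
  obtains a where "a \<in> Acar (c0 (verts G))" "w = Coeff a"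
  | \<xi> \<xi>s where "\<xi> \<in> Xcar X" "set \<xi>s \<subseteq> Xcar X" "w = Tensor \<xi> \<xi>s"
  using assms by (auto simp: fock_gens_def)

lemma gcoord_coeff_l2n:
  assumes "v \<in> verts G"
  shows "gcoord (Coeff a) \<in> l2 (F.fb v)" "l2n (F.fb v) (gcoord (Coeff a)) = cmod (a v)"
    "l2ip (F.fb v) (gcoord (Coeff a)) y = cnj (a v) * y (v, [])"
proof -
  have sub: "{p \<in> F.fb v. gcoord (Coeff a) p \<noteq> 0} \<subseteq> {(v, [])}" by (auto simp: fib_def split: if_splits)
  show l2: "gcoord (Coeff a) \<in> l2 (F.fb v)"
    by (rule l2_finite_support(1)) (rule finite_subset[OF sub], simp)
  show ip: "l2ip (F.fb v) (gcoord (Coeff a)) y = cnj (a v) * y (v, [])" for y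
  proof -
    have "l2ip (F.fb v) (gcoord (Coeff a)) y = (\<Sum>\<^sub>\<infinity>p\<in>{(v, [])}. cnj (a v) * y p)"
      unfolding l2ip_def by (rule infsum_cong_neutral) (use assms in \<open>auto simp: fib_def prod_eq_iff\<close>)
    then show ?thesis by simp
  qed
  have "complex_of_real ((l2n (F.fb v) (gcoord (Coeff a)))\<^sup>2) = complex_of_real ((cmod (a v))\<^sup>2)"
    unfolding l2ip_self[OF l2, symmetric] ip using complex_norm_square[of "a v"] by (simp add: mult.commute)
  then show "l2n (F.fb v) (gcoord (Coeff a)) = cmod (a v)"
    by (simp only: of_real_eq_iff) simp
qed

lemma gcoord_K: "w \<in> fock_gens X \<Longrightarrow> gcoord w \<in> F.K"
proof (erule gens_cases)
  fix a assume a: "a \<in> Acar (c0 (verts G))" "w = Coeff a"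
  have "{v \<in> verts G. \<epsilon> \<le> l2n (F.fb v) (gcoord (Coeff a))} = {v \<in> verts G. \<epsilon> \<le> cmod (a v)}" for \<epsilon>
    by (intro Collect_cong conj_cong refl) (simp only: gcoord_coeff_l2n)
  moreover have "gcoord (Coeff a) p = 0" if "p \<notin> paths G" for p
    using that c0_outside[OF a(1), of "fst p"] by (cases p) auto
  ultimately have "gcoord (Coeff a) \<in> F.K"
    using a(1) gcoord_coeff_l2n(1)[of _ a] unfolding hcar_def in_c0_iff
    by (simp only: mem_Collect_eq) blast
  then show "gcoord w \<in> F.K" by (simp only: a)
qed (simp add: tcoord_K del: tcoord.simps)

lemma gen_inner_coord:
  assumes "w \<in> fock_gens X" "w' \<in> fock_gens X"
  shows "gen_inner X w w' = (\<lambda>v. l2ip (F.fb v) (gcoord w) (gcoord w'))"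
  using assms(1)
proof (cases rule: gens_cases)
  case (1 a)
  show ?thesis
  proof
    fix v
    show "gen_inner X w w' v = l2ip (F.fb v) (gcoord w) (gcoord w')"
    proof (cases "v \<in> verts G")
      case False
      show ?thesis using assms(2)
        by (cases rule: gens_cases)
          (simp_all add: 1(2) F.fb_outside[OF False] l2ip_def c0_outside[OF 1(1) False])
    next
      case True
      show ?thesis unfolding 1(2) gcoord_coeff_l2n(3)[OF True]
        using assms(2) by (cases rule: gens_cases) simp_all
    qed
  qed
next
  case (2 \<xi> \<xi>s)
  show ?thesis using assms(2)
  proof (cases rule: gens_cases)
    case (1 b)
    have "l2ip (F.fb v) (gcoord w) (gcoord w') = 0" for v
      unfolding l2ip_def 1 2 by (rule infsum_0) (auto simp: lcr_def)
    then show ?thesis using 1 2 by (auto simp: fun_eq_iff)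
  next
    case (2 \<eta> \<eta>s)
    then show ?thesis using \<open>w = Tensor \<xi> \<xi>s\<close> \<open>\<xi> \<in> Xcar X\<close> \<open>set \<xi>s \<subseteq> Xcar X\<close>
      using tensor_inner_coord[of \<xi> \<eta> \<xi>s \<eta>s] by simp
  qed
qed

end

lemma keys_sum_single: "Poly_Mapping.keys (\<Sum>w\<in>F. Poly_Mapping.single (h w) (z w)) \<subseteq> h ` F"
proof (cases "finite F")
  case True
  then show ?thesis
  proof (induction F)
    case (insert w F)
    then have "Poly_Mapping.keys (Poly_Mapping.single (h w) (z w) + (\<Sum>w\<in>F. Poly_Mapping.single (h w) (z w)))
        \<subseteq> {h w} \<union> h ` F"
      using keys_add[of "Poly_Mapping.single (h w) (z w)" "\<Sum>w\<in>F. Poly_Mapping.single (h w) (z w)"]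
      by (auto split: if_splits)
    then show ?case using insert by simp
  qed simp
qed simp

lemma keys_linear_ext: "Poly_Mapping.keys (linear_ext h f) \<subseteq> h ` Poly_Mapping.keys f"
  unfolding linear_ext_def by (rule keys_sum_single)

section \<open>Formal combinations of tensors in path coordinates\<close>

context graph
begin

definition fcoord :: "(('v \<Rightarrow> complex, (nat \<Rightarrow> 'e \<Rightarrow>\<^sub>0 complex) set) fock_gen \<Rightarrow>\<^sub>0 complex)
    \<Rightarrow> 'v \<times> 'e list \<Rightarrow> complex" where
  "fcoord f = (\<lambda>p. \<Sum>w\<in>Poly_Mapping.keys f. Poly_Mapping.lookup f w * gcoord w p)"

lemma fcoord_superset:
  assumes "finite S" "Poly_Mapping.keys f \<subseteq> S"
  shows "fcoord f p = (\<Sum>w\<in>S. Poly_Mapping.lookup f w * gcoord w p)"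
  unfolding fcoord_def by (rule sum.mono_neutral_left) (use assms in \<open>auto simp: in_keys_iff\<close>)

lemma fcoord_add: "fcoord (f + g) = (\<lambda>p. fcoord f p + fcoord g p)"
proof
  fix p
  let ?S = "Poly_Mapping.keys f \<union> Poly_Mapping.keys g"
  have "fcoord (f + g) p = (\<Sum>w\<in>?S. Poly_Mapping.lookup (f + g) w * gcoord w p)"
    by (rule fcoord_superset[OF _ keys_add]) simp
  also have "\<dots> = fcoord f p + fcoord g p"
    using fcoord_superset[of ?S f p] fcoord_superset[of ?S g p]
    by (simp add: lookup_add distrib_right sum.distrib)
  finally show "fcoord (f + g) p = fcoord f p + fcoord g p" .
qed

lemma fcoord_zero: "fcoord 0 = (\<lambda>_. 0)"
  by (simp add: fcoord_def)

lemma fcoord_scale: "fcoord (Poly_Mapping.mapp (\<lambda>_ z. c * z) f) = (\<lambda>p. c * fcoord f p)"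
proof
  fix p
  have "fcoord (Poly_Mapping.mapp (\<lambda>_ z. c * z) f) p =
      (\<Sum>w\<in>Poly_Mapping.keys f. Poly_Mapping.lookup (Poly_Mapping.mapp (\<lambda>_ z. c * z) f) w * gcoord w p)"
    by (rule fcoord_superset[OF finite_keys keys_mapp_subset])
  also have "\<dots> = c * fcoord f p"
    by (simp add: fcoord_def lookup_mapp sum_distrib_left mult.assoc)
  finally show "fcoord (Poly_Mapping.mapp (\<lambda>_ z. c * z) f) p = c * fcoord f p" .
qed

lemma fcoord_single: "fcoord (Poly_Mapping.single w z) = (\<lambda>p. z * gcoord w p)"
  by (simp add: fcoord_def fun_eq_iff)

lemma fcoord_linear_ext:
  "fcoord (linear_ext h f) = (\<lambda>p. \<Sum>w\<in>Poly_Mapping.keys f. Poly_Mapping.lookup f w * gcoord (h w) p)"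
proof -
  have "fcoord (\<Sum>w\<in>S. Poly_Mapping.single (h w) (z w)) = (\<lambda>p. \<Sum>w\<in>S. z w * gcoord (h w) p)"
    if "finite S" for S z
    using that by (induction S) (simp_all add: fcoord_zero fcoord_add fcoord_single)
  then show ?thesis by (simp add: linear_ext_def)
qed

lemma gcoord_left:
  assumes w: "w \<in> fock_gens X" and a: "a \<in> Acar (c0 (verts G))"
  shows "gen_left X a w \<in> fock_gens X" "gcoord (gen_left X a w) = (\<lambda>p. a (prng G p) * gcoord w p)"
proof -
  show "gen_left X a w \<in> fock_gens X"
    using w by (cases rule: gens_cases) (auto simp: fock_gens_def c0_mult a vec_left)
  show "gcoord (gen_left X a w) = (\<lambda>p. a (prng G p) * gcoord w p)"
  proof
    fix p
    show "gcoord (gen_left X a w) p = a (prng G p) * gcoord w p"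
      using w by (cases rule: gens_cases; cases p rule: path_cases) (auto simp: vec_left(2) a lcr_def)
  qed
qed

text \<open>The right action on the last factor multiplies by the value at the source of the last
  edge, which is the source of the whole path.\<close>

lemma tcoord_right:
  assumes a: "a \<in> Acar (c0 (verts G))"
  shows "\<xi> \<in> Xcar X \<Longrightarrow> tcoord (\<xi>s @ [Xright X \<xi> a]) p = tcoord (\<xi>s @ [\<xi>]) p * a (fst p)"
proof (induction \<xi>s arbitrary: p)
  case Nil
  show ?case
  proof (cases p rule: path_cases)
    case (2 q e)
    show ?thesis
    proof (cases "p \<in> paths G")
      case True
      then have pp: "cons_path q e \<in> paths G" and t: "tail G e = prng G q"
        using 2 by (simp_all add: cons_path_paths)
      \<comment> \<open>The vacuum is concentrated on empty paths, for which range and source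
        agree.\<close>
      have "vac q * a (tail G e) = vac q * a (fst q)"
        using t by (cases q rule: path_cases) auto
      then have "vec \<xi> e * (vac q * a (tail G e)) = vec \<xi> e * (vac q * a (fst q))" by (simp only:)
      then show ?thesis using vec_right(2)[OF Nil a] by (simp add: 2 lcr_cons[OF pp] mult_ac)
    qed (simp add: lcr_def)
  qed simp
next
  case (Cons \<xi>' \<xi>s)
  then show ?case by (auto simp: lcr_def)
qed

lemma gcoord_right:
  assumes w: "w \<in> fock_gens X" and a: "a \<in> Acar (c0 (verts G))"
  shows "gen_right X w a \<in> fock_gens X" "gcoord (gen_right X w a) = (\<lambda>p. gcoord w p * a (fst p))"
proof -
  show "gen_right X w a \<in> fock_gens X"
    using w
  proof (cases rule: gens_cases)
    case (2 \<xi> \<xi>s)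
    then show ?thesis
    proof (cases \<xi>s)
      case (Cons \<eta> \<eta>s)
      have "set (butlast \<xi>s) \<subseteq> Xcar X" "last \<xi>s \<in> Xcar X"
        using 2 Cons in_set_butlastD by fastforce+
      then show ?thesis using 2 Cons vec_right(1)[OF _ a] by (simp add: fock_gens_def)
    qed (use vec_right(1)[OF _ a] in \<open>simp add: fock_gens_def\<close>)
  qed (simp add: fock_gens_def c0_mult a)
  show "gcoord (gen_right X w a) = (\<lambda>p. gcoord w p * a (fst p))"
    using w
  proof (cases rule: gens_cases)
    case (2 \<xi> \<xi>s)
    show ?thesis
    proof (cases \<xi>s)
      case Nil
      then show ?thesis using tcoord_right[OF a 2(1), of "[]"] 2 by auto
    next
      case (Cons \<eta> \<eta>s)
      have l: "last \<xi>s \<in> Xcar X" using 2 Cons by (metis last_in_set list.discI subsetD)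
      have "gen_right X w a = Tensor \<xi> (butlast \<xi>s @ [Xright X (last \<xi>s) a])" using 2 Cons by simp
      then have "gcoord (gen_right X w a) p = tcoord (\<xi> # butlast \<xi>s @ [last \<xi>s]) p * a (fst p)" for p
        using tcoord_right[OF a l, of "\<xi> # butlast \<xi>s" p] by simp
      moreover have "butlast \<xi>s @ [last \<xi>s] = \<xi>s" using Cons by simp
      ultimately show ?thesis using 2 by auto
    qed
  qed auto
qed

lemma gcoord_create:
  assumes w: "w \<in> fock_gens X" and \<xi>: "\<xi> \<in> Xcar X"
  shows "gen_create X \<xi> w \<in> fock_gens X" "gcoord (gen_create X \<xi> w) = lcr G (vec \<xi>) (gcoord w)"
proof -
  show "gen_create X \<xi> w \<in> fock_gens X"
    using w by (cases rule: gens_cases) (auto simp: fock_gens_def vec_right(1) \<xi>)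
  show "gcoord (gen_create X \<xi> w) = lcr G (vec \<xi>) (gcoord w)"
    using w
  proof (cases rule: gens_cases)
    case (1 a)
    show ?thesis
    proof
      fix p
      show "gcoord (gen_create X \<xi> w) p = lcr G (vec \<xi>) (gcoord w) p"
      proof (cases p rule: path_cases)
        case (2 q e)
        show ?thesis
        proof (cases "p \<in> paths G")
          case True
          then have pp: "cons_path q e \<in> paths G" and t: "tail G e = prng G q" "q \<in> paths G"
            using 2 by (simp_all add: cons_path_paths)
          have "vac q * a (tail G e) = gcoord (Coeff a) q"
            using t by (cases q rule: path_cases) (auto simp: vac_def)
          then have "vec \<xi> e * (vac q * a (tail G e)) = vec \<xi> e * gcoord (Coeff a) q" by (simp only:)
          then show ?thesis using vec_right(2)[OF \<xi> 1(1)]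
            by (simp add: 1 2 lcr_cons[OF pp] mult_ac)
        qed (simp add: lcr_def 1)
      qed (simp add: 1)
    qed
  qed simp
qed

text \<open>Tensors of point masses reach every path of positive length; this supplies the density
  demanded by \<open>coords\<close>.\<close>

lemma tcoord_delta:
  "(v, es) \<in> paths G \<Longrightarrow> es \<noteq> [] \<Longrightarrow> tcoord (map (\<lambda>e. C.cls (delta e)) es) = delta (v, es)"
proof (induction es)
  case (Cons e es)
  then have e: "e \<in> arcs G" "(v, es) \<in> paths G" "tail G e = prng G (v, es)" by (simp_all add: paths_Cons)
  then have ve: "vec (C.cls (delta e)) = delta e" by (simp add: A.K_delta)
  show ?case
  proof
    fix p
    show "tcoord (map (\<lambda>e. C.cls (delta e)) (e # es)) p = delta (v, e # es) p"
    proof (cases p rule: path_cases)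
      case (2 q f)
      show ?thesis
      proof (cases "es = []")
        case True
        then show ?thesis using e 2 by (cases q) (auto simp: ve lcr_def delta_apply paths_Cons vac_def)
      next
        case False
        define t where "t = tcoord (map (\<lambda>e. C.cls (delta e)) es)"
        have "t q = delta (v, es) q" using Cons.IH[OF e(2) False] by (simp add: t_def)
        moreover have "tcoord (map (\<lambda>e. C.cls (delta e)) (e # es)) = lcr G (delta e) t" by (simp add: t_def ve)
        ultimately show ?thesis using e 2
          by (cases q) (auto simp: lcr_def delta_apply paths_Cons)
      qed
    qed (simp add: delta_def)
  qed
qed simp

end

text \<open>Because the inner product of formal combinations is that of their coordinates,
  multilinearity and the balancing relations need no separate treatment: the completion divides out
  exactly the kernel of \<open>fcoord\<close>.\<close>

sublocale graph \<subseteq> D: coords "verts G" "paths G" fst "prng G" "fock_precorr (graph_corr G)" fcoord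
proof
  let ?P = "fock_precorr (graph_corr G)"
  have car: "Xcar ?P = {f. Poly_Mapping.keys f \<subseteq> fock_gens X}" by (simp add: fock_precorr_def)
  show "coeff ?P = c0 (verts G)" by (simp add: fock_precorr_def)
  show "Xzero ?P \<in> Xcar ?P" "fcoord (Xzero ?P) = (\<lambda>_. 0)" by (simp_all add: fock_precorr_def fcoord_zero)
  show "\<exists>f\<in>Xcar ?P. fcoord f = delta p" if p: "p \<in> paths G" for p
  proof (cases "snd p = []")
    case True
    let ?w = "Coeff (delta (fst p)) :: ('v \<Rightarrow> complex, (nat \<Rightarrow> 'e \<Rightarrow>\<^sub>0 complex) set) fock_gen"
    have "fst p \<in> verts G" using F.s_in p by blast
    then have "Poly_Mapping.single ?w 1 \<in> Xcar ?P" by (simp add: car fock_gens_def c0_delta)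
    moreover have "fcoord (Poly_Mapping.single ?w 1) = delta p"
      using True by (auto simp: fcoord_single fun_eq_iff delta_def prod_eq_iff)
    ultimately show ?thesis by blast
  next
    case False
    then obtain e es where es: "snd p = e # es" by (cases "snd p") auto
    let ?d = "\<lambda>e. C.cls (delta e)"
    have arcs: "set es' \<subseteq> arcs G" if "path_ok G v es'" for v es' using that by (induction es') auto
    have "set (snd p) \<subseteq> arcs G" using p by (cases p) (simp add: paths_def arcs)
    then have d: "?d ` set (snd p) \<subseteq> Xcar X" using A.K_delta X_car by blast
    let ?w = "Tensor (?d e) (map ?d es)"
    have "Poly_Mapping.single ?w 1 \<in> Xcar ?P" using d es by (auto simp: car fock_gens_def)
    moreover have "fcoord (Poly_Mapping.single ?w 1) = delta p"
    proof -
      have pe: "(fst p, e # es) = p" using es by (simp add: prod_eq_iff)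
      have "tcoord (map ?d (e # es)) = delta (fst p, e # es)"
        by (rule tcoord_delta) (use p pe in simp_all)
      then show ?thesis by (simp add: fcoord_single pe)
    qed
    ultimately show ?thesis by blast
  qed
  fix f assume "f \<in> Xcar ?P"
  then have k: "Poly_Mapping.keys f \<subseteq> fock_gens X" by (simp add: car)
  have kk: "w \<in> fock_gens X" if "w \<in> Poly_Mapping.keys f" for w using k that by blast
  have sumK: "(\<lambda>p. \<Sum>w\<in>S. z w * gcoord w p) \<in> F.K" if "finite S" "S \<subseteq> fock_gens X" for S z
    using that by (induction S) (simp_all add: F.K_zero F.K_add F.K_scale gcoord_K)
  show "fcoord f \<in> F.K" unfolding fcoord_def by (rule sumK[OF finite_keys k])
  show "Xscale ?P z f \<in> Xcar ?P" for z
    using k keys_mapp_subset[of "\<lambda>_ x. z * x" f] by (auto simp: fock_precorr_def)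
  show "fcoord (Xscale ?P z f) = (\<lambda>i. z * fcoord f i)" for z
    by (simp add: fock_precorr_def fcoord_scale)
  show "Xright ?P f a \<in> Xcar ?P" if "a \<in> Acar (c0 (verts G))" for a
    using k keys_linear_ext[of "\<lambda>w. gen_right X w a" f] gcoord_right(1)[OF _ that]
    by (auto simp: fock_precorr_def)
  show "fcoord (Xright ?P f a) = (\<lambda>i. fcoord f i * a (fst i))" if "a \<in> Acar (c0 (verts G))" for a
  proof -
    have "fcoord (Xright ?P f a) = (\<lambda>p. \<Sum>w\<in>Poly_Mapping.keys f. Poly_Mapping.lookup f w * (gcoord w p * a (fst p)))"
      by (simp add: fock_precorr_def fcoord_linear_ext gcoord_right(2)[OF kk that] cong: sum.cong)
    then show ?thesis by (simp add: fcoord_def sum_distrib_right mult.assoc)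
  qed
  show "Xleft ?P a f \<in> Xcar ?P" if "a \<in> Acar (c0 (verts G))" for a
    using k keys_linear_ext[of "gen_left X a" f] gcoord_left(1)[OF _ that]
    by (auto simp: fock_precorr_def)
  show "fcoord (Xleft ?P a f) = (\<lambda>i. a (prng G i) * fcoord f i)" if "a \<in> Acar (c0 (verts G))" for a
  proof -
    have "fcoord (Xleft ?P a f) = (\<lambda>p. \<Sum>w\<in>Poly_Mapping.keys f. Poly_Mapping.lookup f w * (a (prng G p) * gcoord w p))"
      by (simp add: fock_precorr_def fcoord_linear_ext gcoord_left(2)[OF kk that] cong: sum.cong)
    then show ?thesis by (simp add: fcoord_def sum_distrib_left mult.left_commute)
  qed
  fix g assume "g \<in> Xcar ?P"
  then have kg: "Poly_Mapping.keys g \<subseteq> fock_gens X" by (simp add: car)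
  show "Xadd ?P f g \<in> Xcar ?P" using k kg keys_add[of f g] by (auto simp: fock_precorr_def)
  show "fcoord (Xadd ?P f g) = (\<lambda>i. fcoord f i + fcoord g i)" by (simp add: fock_precorr_def fcoord_add)
  show "Xinner ?P f g = (\<lambda>v. l2ip (F.fb v) (fcoord f) (fcoord g))"
  proof
    fix v
    have lsum: "(\<lambda>p. \<Sum>w\<in>S. z w * gcoord w p) \<in> l2 (F.fb v)" if "finite S" "S \<subseteq> fock_gens X" for S z
      by (rule F.K_l2[OF sumK[OF that]])
    have right: "l2ip (F.fb v) x (\<lambda>p. \<Sum>w\<in>S. z w * gcoord w p) = (\<Sum>w\<in>S. z w * l2ip (F.fb v) x (gcoord w))"
      if "finite S" "S \<subseteq> fock_gens X" and x: "x \<in> l2 (F.fb v)" for S z x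
      using that(1,2)
    proof (induction S)
      case (insert w S)
      have "l2ip (F.fb v) x (\<lambda>p. z w * gcoord w p + (\<Sum>w\<in>S. z w * gcoord w p)) =
          l2ip (F.fb v) x (\<lambda>p. z w * gcoord w p) + l2ip (F.fb v) x (\<lambda>p. \<Sum>w\<in>S. z w * gcoord w p)"
        using insert.prems insert.hyps
        by (intro l2ip_add_right x lsum l2_scale(1) F.K_l2 gcoord_K) auto
      then show ?case using insert by (simp add: l2ip_scale_right)
    qed (simp add: l2ip_def)
    have left: "l2ip (F.fb v) (\<lambda>p. \<Sum>w\<in>S. z w * gcoord w p) x = (\<Sum>w\<in>S. cnj (z w) * l2ip (F.fb v) (gcoord w) x)"
      if "finite S" "S \<subseteq> fock_gens X" and x: "x \<in> l2 (F.fb v)" for S z x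
      using arg_cong[OF right[OF that, of z], of cnj] by (simp add: l2ip_cnj)
    have "l2ip (F.fb v) (fcoord f) (fcoord g) = (\<Sum>w\<in>Poly_Mapping.keys f. cnj (Poly_Mapping.lookup f w) *
        (\<Sum>w'\<in>Poly_Mapping.keys g. Poly_Mapping.lookup g w' * l2ip (F.fb v) (gcoord w) (gcoord w')))"
      unfolding fcoord_def left[OF finite_keys k lsum[OF finite_keys kg]]
      using k by (intro sum.cong refl arg_cong2[of _ _ _ _ "(*)"] right[OF finite_keys kg] F.K_l2 gcoord_K) auto
    also have "\<dots> = (\<Sum>w\<in>Poly_Mapping.keys f. \<Sum>w'\<in>Poly_Mapping.keys g.
        cnj (Poly_Mapping.lookup f w) * Poly_Mapping.lookup g w' * gen_inner X w w' v)"
      unfolding sum_distrib_left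
    proof (intro sum.cong refl)
      fix w w' assume "w \<in> Poly_Mapping.keys f" "w' \<in> Poly_Mapping.keys g"
      then have "gen_inner X w w' v = l2ip (F.fb v) (gcoord w) (gcoord w')"
        using gen_inner_coord[OF subsetD[OF k] subsetD[OF kg]] by simp
      then show "cnj (Poly_Mapping.lookup f w) * (Poly_Mapping.lookup g w' * l2ip (F.fb v) (gcoord w) (gcoord w')) =
        cnj (Poly_Mapping.lookup f w) * Poly_Mapping.lookup g w' * gen_inner X w w' v" by simp
    qed
    also have "\<dots> = Xinner ?P f g v"
    proof -
      have ap: "sum h S v = (\<Sum>w\<in>S. h w v)" for h :: "'z \<Rightarrow> 'v \<Rightarrow> complex" and S
        by (induction S rule: infinite_finite_induct) auto
      show ?thesis by (simp add: fock_precorr_def ap)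
    qed
    finally show "Xinner ?P f g v = l2ip (F.fb v) (fcoord f) (fcoord g)" ..
  qed
qed

section \<open>The Toeplitz and tensor algebras on the path space\<close>

context graph
begin

lemma fock_iso: "corr_iso F.H (fock_corr X) D.cls (\<lambda>a. a)"
  using D.completion_iso by (simp add: fock_corr_def)

interpretation W: corr_iso F.H "fock_corr X" D.cls "\<lambda>a. a"
  by (rule fock_iso)

abbreviation "AdW \<equiv> conj_op F.H (fock_corr X) D.cls"

text \<open>\<open>lop a\<close> is the copy of \<open>\<iota>(a)\<close> on the path space, and
  \<open>cop \<xi>\<close> below that of \<open>T\<^sub>\<xi>\<close>; both are cut down to the
  carrier because operators are extensional.\<close>

definition lop :: "('v \<Rightarrow> complex) \<Rightarrow> ('v \<times> 'e list \<Rightarrow> complex) \<Rightarrow> 'v \<times> 'e list \<Rightarrow> complex" where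
  "lop a = (\<lambda>x\<in>F.K. \<lambda>p. a (prng G p) * x p)"

definition cop :: "('e \<Rightarrow> complex) \<Rightarrow> ('v \<times> 'e list \<Rightarrow> complex) \<Rightarrow> 'v \<times> 'e list \<Rightarrow> complex" where
  "cop \<xi> = (\<lambda>x\<in>F.K. lcr G \<xi> x)"

lemma lop_adjointable:
  assumes "a \<in> Acar (c0 (verts G))"
  shows "lop a \<in> adjointable F.H" "op_adj F.H (lop a) = lop (\<lambda>v. cnj (a v))"
proof -
  have E: "lop b \<in> F.K \<rightarrow>\<^sub>E F.K" if "b \<in> Acar (c0 (verts G))" for b
    unfolding lop_def by (rule PiE_I) (simp_all add: F.K_left that)
  have adj: "is_adjoint F.H (lop a) (lop (\<lambda>v. cnj (a v)))"
    unfolding F.is_adjoint_iff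
    by (simp add: lop_def l2ip_def mult.assoc mult.left_commute)
  show "lop a \<in> adjointable F.H" by (rule F.adjointableI[OF E[OF assms] E[OF c0_star[OF assms]] adj])
  show "op_adj F.H (lop a) = lop (\<lambda>v. cnj (a v))" by (rule F.op_adj_eqI[OF E[OF c0_star[OF assms]] adj])
qed

lemma cop_adjointable:
  assumes "\<xi> \<in> A.K"
  shows "cop \<xi> \<in> adjointable F.H" "op_adj F.H (cop \<xi>) = (\<lambda>x\<in>F.K. lan G \<xi> x)"
proof -
  have E: "cop \<xi> \<in> F.K \<rightarrow>\<^sub>E F.K" unfolding cop_def by (rule PiE_I) (simp_all add: lcr_K assms)
  have E': "(\<lambda>x\<in>F.K. lan G \<xi> x) \<in> F.K \<rightarrow>\<^sub>E F.K" by (rule PiE_I) (simp_all add: lan_K assms)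
  have adj: "is_adjoint F.H (cop \<xi>) (\<lambda>x\<in>F.K. lan G \<xi> x)"
    unfolding F.is_adjoint_iff by (simp add: cop_def lcr_lan_adjoint assms F.K_l2)
  show "cop \<xi> \<in> adjointable F.H" by (rule F.adjointableI[OF E E' adj])
  show "op_adj F.H (cop \<xi>) = (\<lambda>x\<in>F.K. lan G \<xi> x)" by (rule F.op_adj_eqI[OF E' adj])
qed

text \<open>The prefix \<open>p\<close> marks copies on the path space: of the base algebra, of the
  generators, and of the two algebras that they generate.\<close>

definition "pbase = lop ` Acar (c0 (verts G))"
definition "pgens = pbase \<union> cop ` A.K"
definition "ptoep = generated_cstar F.H pgens"
definition "ptens = generated_algebra F.H pgens"

lemma pgens_adjointable: "pgens \<subseteq> adjointable F.H"
  using lop_adjointable(1) cop_adjointable(1) by (auto simp: pgens_def pbase_def)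

lemma ptoep_closed: "closed_star_subalgebra F.H ptoep"
  unfolding ptoep_def by (rule generated_cstar_closed[OF F.closed_star_adjointable pgens_adjointable])

lemma ptens_closed: "closed_subalgebra F.H ptens"
  unfolding ptens_def by (rule generated_algebra_closed[OF F.closed_adjointable pgens_adjointable])

lemma ptoep_adjointable: "ptoep \<subseteq> adjointable F.H"
  using ptoep_closed closed_subalgebraD(1) by (auto simp: closed_star_subalgebra_def)

lemma ptens_adjointable: "ptens \<subseteq> adjointable F.H"
  using closed_subalgebraD(1)[OF ptens_closed] .

lemma pgens_ptoep: "pgens \<subseteq> ptoep" and pgens_ptens: "pgens \<subseteq> ptens"
  unfolding ptoep_def ptens_def by (rule generated_cstar_base generated_algebra_base)+

lemma Ad_lop:
  assumes "a \<in> Acar (c0 (verts G))"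
  shows "AdW (lop a) = fock_iota X a"
proof (rule W.op_eqI[OF W.Ad_ext])
  show "fock_iota X a \<in> extensional (Xcar (fock_corr X))" by (simp add: fock_iota_def)
  fix x assume x: "x \<in> Xcar F.H"
  then have "AdW (lop a) (D.cls x) = D.cls (\<lambda>p. a (prng G p) * x p)" by (simp only: W.Ad_apply) (simp add: lop_def)
  also have "\<dots> = Xleft (fock_corr X) a (D.cls x)" using W.map_left[OF x, of a] assms by simp
  also have "\<dots> = fock_iota X a (D.cls x)" using W.W_in[OF x] by (simp add: fock_iota_def)
  finally show "AdW (lop a) (D.cls x) = fock_iota X a (D.cls x)" .
qed

text \<open>On coordinates the linear extension of \<open>gen_create\<close> acts by
  \<open>lcr\<close>, which is Lipschitz with the norm of \<open>vec \<xi>\<close> as constant;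
  \<open>extend_cls\<close> then evaluates the termwise extension.\<close>

lemma Ad_cop:
  assumes \<xi>: "\<xi> \<in> Xcar X"
  shows "AdW (cop (vec \<xi>)) = creation X \<xi>"
proof (rule W.op_eqI[OF W.Ad_ext])
  show "creation X \<xi> \<in> extensional (Xcar (fock_corr X))" by (simp add: creation_def)
  fix x assume x: "x \<in> Xcar F.H"
  then have xK: "x \<in> F.K" by simp
  have "extend (fock_precorr X) (linear_ext (gen_create X \<xi>)) (D.cls x) = D.cls (lcr G (vec \<xi>) x)"
  proof (rule D.extend_cls[OF xK, where C="A.hn (vec \<xi>)"])
    fix f assume "f \<in> Xcar (fock_precorr X)"
    then have k: "Poly_Mapping.keys f \<subseteq> fock_gens X" by (simp add: fock_precorr_def)
    show "linear_ext (gen_create X \<xi>) f \<in> Xcar (fock_precorr X)"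
      using k keys_linear_ext[of "gen_create X \<xi>" f] gcoord_create(1)[OF _ \<xi>]
      by (auto simp: fock_precorr_def)
    have "fcoord (linear_ext (gen_create X \<xi>) f) =
        (\<lambda>p. \<Sum>w\<in>Poly_Mapping.keys f. Poly_Mapping.lookup f w * lcr G (vec \<xi>) (gcoord w) p)"
      by (simp add: fcoord_linear_ext gcoord_create(2)[OF subsetD[OF k] \<xi>] cong: sum.cong)
    also have "\<dots> = lcr G (vec \<xi>) (fcoord f)"
      by (auto simp: lcr_def fcoord_def fun_eq_iff sum_distrib_left mult.left_commute)
    finally show "fcoord (linear_ext (gen_create X \<xi>) f) = lcr G (vec \<xi>) (fcoord f)" .
  next
    fix y z assume "y \<in> F.K" "z \<in> F.K"
    then show "F.hn (\<lambda>i. lcr G (vec \<xi>) y i - lcr G (vec \<xi>) z i) \<le> A.hn (vec \<xi>) * F.hn (\<lambda>i. y i - z i)"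
      using lcr_K(2)[OF vec_K[OF \<xi>] F.K_diff] by (simp add: lcr_linear)
  qed (simp add: lcr_K vec_K \<xi>)
  then have "creation X \<xi> (D.cls x) = D.cls (lcr G (vec \<xi>) x)"
    using W.W_in[OF x] by (simp add: creation_def)
  then show "AdW (cop (vec \<xi>)) (D.cls x) = creation X \<xi> (D.cls x)"
    using x by (simp only: W.Ad_apply) (simp add: cop_def)
qed

lemma Ad_base: "AdW ` pbase = base_alg X"
  unfolding pbase_def base_alg_def image_image by (rule image_cong) (simp_all add: Ad_lop)

lemma vec_image: "vec ` Xcar X = A.K"
  using vec_K by (auto simp: X_car intro!: rev_image_eqI)

lemma Ad_gens: "AdW ` pgens = base_alg X \<union> creation X ` Xcar X"
proof -
  have "AdW ` cop ` A.K = creation X ` Xcar X"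
    unfolding vec_image[symmetric] image_image by (rule image_cong) (simp_all add: Ad_cop)
  then show ?thesis by (simp add: pgens_def image_Un Ad_base)
qed

lemma Ad_toeplitz: "AdW ` ptoep = toeplitz X"
  unfolding toeplitz_def ptoep_def Ad_gens[symmetric]
  by (rule generated_cstar_Ad[OF fock_iso _ F.closed_star_adjointable pgens_adjointable, symmetric]) simp

lemma Ad_tensor: "AdW ` ptens = tensor_alg X"
  unfolding tensor_alg_def ptens_def Ad_gens[symmetric]
  by (rule generated_algebra_Ad[OF fock_iso _ F.closed_adjointable pgens_adjointable, symmetric]) simp

end

section \<open>The gauge action\<close>

text \<open>The operators on which \<psi> and \<phi> agree form a star subalgebra containing
  \<open>S\<close>. It is norm closed because both maps are contractive, the two limits being
  compared coordinate by coordinate.\<close>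

lemma (in fibred) star_iso_unique:
  assumes S: "S \<subseteq> adjointable H" and C: "C \<subseteq> adjointable H" "C' \<subseteq> adjointable H"
    and \<psi>: "star_iso H (generated_cstar H S) H C \<psi>" and \<phi>: "star_iso H (generated_cstar H S) H C' \<phi>"
    and eq: "\<And>T. T \<in> S \<Longrightarrow> \<psi> T = \<phi> T" and T: "T \<in> generated_cstar H S"
  shows "\<psi> T = \<phi> T"
proof -
  let ?B = "generated_cstar H S"
  have B: "closed_star_subalgebra H ?B" by (rule generated_cstar_closed[OF closed_star_adjointable S])
  then have Bc: "closed_subalgebra H ?B" by (simp add: closed_star_subalgebra_def)
  note cl = closed_subalgebraD[OF Bc]
  have hom: "f (op_add H U U') = op_add H (f U) (f U')" "f (op_mult H U U') = op_mult H (f U) (f U')"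
    "f (op_scale H c U) = op_scale H c (f U)" "f (op_adj H U) = op_adj H (f U)"
    if "star_iso H ?B H D f" "U \<in> ?B" "U' \<in> ?B" for f D U U' c
    using that by (simp_all add: star_iso_def algebra_iso_def)
  have im: "f U \<in> adjointable H" if "star_iso H ?B H D f" "D \<subseteq> adjointable H" "U \<in> ?B" for f D U
    using that unfolding star_iso_def algebra_iso_def by (blast dest: bij_betwE)
  have lim: "(\<lambda>n. f (t n) x i) \<longlonglongrightarrow> f U x i"
    if f: "star_iso H ?B H D f" "D \<subseteq> adjointable H" and t: "\<And>n::nat. t n \<in> ?B" and U: "U \<in> ?B" and x: "x \<in> K"
      and l: "(\<lambda>n. op_norm H (op_add H (t n) (op_scale H (- 1) U))) \<longlonglongrightarrow> 0" for f D t U x i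
  proof (rule op_norm_limit_pointwise[OF im[OF f t] im[OF f U] _ x])
    have d: "op_add H (t n) (op_scale H (- 1) U) \<in> ?B" for n by (intro cl(2) cl(4) t U)
    have e: "op_add H (f (t n)) (op_scale H (- 1) (f U)) = f (op_add H (t n) (op_scale H (- 1) U))" for n
      using hom(1)[OF f(1) t cl(4)[OF U]] hom(3)[OF f(1) U U] by simp
    have a: "op_add H (f (t n)) (op_scale H (- 1) (f U)) \<in> adjointable H" for n
      unfolding e by (rule im[OF f d])
    show "(\<lambda>n. op_norm H (op_add H (f (t n)) (op_scale H (- 1) (f U)))) \<longlonglongrightarrow> 0"
    proof (rule tendsto_sandwich[OF _ _ tendsto_const l]; intro always_eventually allI)
      fix n
      show "0 \<le> op_norm H (op_add H (f (t n)) (op_scale H (- 1) (f U)))" by (rule op_norm_nonneg_bound(1)[OF a])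
      show "op_norm H (op_add H (f (t n)) (op_scale H (- 1) (f U))) \<le> op_norm H (op_add H (t n) (op_scale H (- 1) U))"
        unfolding e by (rule star_iso_op_norm_le[OF B f(2,1) d])
    qed
  qed
  have "closed_star_subalgebra H {U \<in> ?B. \<psi> U = \<phi> U}"
    unfolding closed_star_subalgebra_def closed_subalgebra_def
  proof (intro conjI ballI allI impI)
    show "{U \<in> ?B. \<psi> U = \<phi> U} \<subseteq> adjointable H" using cl(1) by blast
  next
    fix U U' assume "U \<in> {U \<in> ?B. \<psi> U = \<phi> U}" "U' \<in> {U \<in> ?B. \<psi> U = \<phi> U}"
    then show "op_add H U U' \<in> {U \<in> ?B. \<psi> U = \<phi> U}" "op_mult H U U' \<in> {U \<in> ?B. \<psi> U = \<phi> U}"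
      using cl(2,3) hom(1,2)[OF \<psi>] hom(1,2)[OF \<phi>] by simp_all
  next
    fix U c assume "U \<in> {U \<in> ?B. \<psi> U = \<phi> U}"
    then have U: "U \<in> ?B" "\<psi> U = \<phi> U" by simp_all
    then show "op_scale H c U \<in> {U \<in> ?B. \<psi> U = \<phi> U}"
      using cl(4)[OF U(1)] hom(3)[OF \<psi> U(1,1)] hom(3)[OF \<phi> U(1,1)] by simp
  next
    fix U assume "U \<in> {U \<in> ?B. \<psi> U = \<phi> U}"
    then have U: "U \<in> ?B" "\<psi> U = \<phi> U" by simp_all
    then show "op_adj H U \<in> {U \<in> ?B. \<psi> U = \<phi> U}"
      using B hom(4)[OF \<psi> U(1,1)] hom(4)[OF \<phi> U(1,1)] by (simp add: closed_star_subalgebra_def)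
  next
    fix t :: "nat \<Rightarrow> _" and U
    assume U: "U \<in> adjointable H" and t: "(\<forall>n. t n \<in> {U \<in> ?B. \<psi> U = \<phi> U}) \<and>
      (\<lambda>n. op_norm H (op_add H (t n) (op_scale H (- 1) U))) \<longlonglongrightarrow> 0"
    have tB: "t n \<in> ?B" "\<psi> (t n) = \<phi> (t n)" for n using t by simp_all
    have UB: "U \<in> ?B" by (rule closed_subalgebra_limit[OF Bc U tB(1) conjunct2[OF t]])
    have "\<psi> U = \<phi> U"
    proof (rule op_ext[OF adjointable_E[OF im[OF \<psi> C(1) UB]] adjointable_E[OF im[OF \<phi> C(2) UB]]])
      fix x assume x: "x \<in> K"
      show "\<psi> U x = \<phi> U x"
      proof
        fix i
        have "(\<lambda>n. \<psi> (t n) x i) \<longlonglongrightarrow> \<psi> U x i" by (rule lim[OF \<psi> C(1) tB(1) UB x conjunct2[OF t]])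
        moreover have "(\<lambda>n. \<psi> (t n) x i) \<longlonglongrightarrow> \<phi> U x i"
          unfolding tB(2) by (rule lim[OF \<phi> C(2) tB(1) UB x conjunct2[OF t]])
        ultimately show "\<psi> U x i = \<phi> U x i" by (rule LIMSEQ_unique)
      qed
    qed
    then show "U \<in> {U \<in> ?B. \<psi> U = \<phi> U}" using UB by simp
  qed
  moreover have "S \<subseteq> {U \<in> ?B. \<psi> U = \<phi> U}" using eq generated_cstar_base[of S H] by blast
  ultimately have "?B \<subseteq> {U \<in> ?B. \<psi> U = \<phi> U}" by (rule generated_cstar_least)
  then show ?thesis using T by blast
qed

section \<open>The gauge action on the path space\<close>

context graph
begin

interpretation W: corr_iso F.H "fock_corr X" D.cls "\<lambda>a. a"
  by (rule fock_iso)

definition gz :: "complex \<Rightarrow> ('v \<times> 'e list \<Rightarrow> complex) \<Rightarrow> 'v \<times> 'e list \<Rightarrow> complex" where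
  "gz z x = (\<lambda>p. z ^ length (snd p) * x p)"

lemma gz_K: "cmod z = 1 \<Longrightarrow> x \<in> F.K \<Longrightarrow> gz z x \<in> F.K"
  unfolding gz_def by (rule F.K_mult_bounded[of _ _ 1]) (simp_all add: norm_power)

lemma gz_inverse:
  assumes "cmod z = 1" shows "gz z (gz (inverse z) x) = x" "gz (inverse z) (gz z x) = x"
proof -
  have "z \<noteq> 0" using assms by auto
  then show "gz z (gz (inverse z) x) = x" "gz (inverse z) (gz z x) = x"
    by (simp_all add: gz_def fun_eq_iff mult.assoc[symmetric] power_mult_distrib[symmetric])
qed

lemma gauge_iso:
  assumes z: "cmod z = 1"
  shows "corr_iso F.H F.H (gz z) (\<lambda>a. a)"
proof -
  have z': "cmod (inverse z) = 1" using z by (simp add: norm_inverse)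
  have zz: "cnj (z ^ n) * z ^ n = 1" for n
    using complex_norm_square[of "z ^ n"] z by (simp add: norm_power mult.commute)
  interpret I: corr_iso F.H F.H "\<lambda>x. x" "\<lambda>a. a" by (rule F.id_iso)
  show ?thesis
  proof
    show "bij_betw (gz z) (Xcar F.H) (Xcar F.H)"
      by (rule bij_betw_byWitness[where f'="gz (inverse z)"])
        (use gz_inverse[OF z] gz_K[OF z] gz_K[OF z'] in auto)
    show "coeff_iso (coeff F.H) (coeff F.H) (\<lambda>a. a)" by (rule I.coeff)
    show "x = y" if "x \<in> Xcar F.H" "y \<in> Xcar F.H" "\<And>z. z \<in> Xcar F.H \<Longrightarrow> Xinner F.H z x = Xinner F.H z y" for x y
      by (rule I.nondegenerate[OF that])
    show "Xinner F.H (gz z x) (gz z y) = Xinner F.H x y" for x y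
    proof -
      have "cnj (z ^ n * a) * (z ^ n * b) = (cnj (z ^ n) * z ^ n) * (cnj a * b)" for n a b by simp
      then have "cnj (z ^ n * a) * (z ^ n * b) = cnj a * b" for n a b unfolding zz by simp
      then show ?thesis by (simp only: hmod_simps gz_def l2ip_def)
    qed
  qed (use I.inner_in I.coeff_add_in I.coeff_zero_in I.zero_in I.add_in I.scale_in I.right_in I.left_in in
      \<open>simp_all add: gz_def fun_eq_iff algebra_simps\<close>)
qed

abbreviation "AdU z \<equiv> conj_op F.H F.H (gz z)"

lemma AdU_apply: "cmod z = 1 \<Longrightarrow> x \<in> F.K \<Longrightarrow> AdU z T (gz z x) = gz z (T x)"
  using corr_iso.Ad_apply[OF gauge_iso] by simp

lemma AdU_lop:
  assumes z: "cmod z = 1" and a: "a \<in> Acar (c0 (verts G))"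
  shows "AdU z (lop a) = lop a"
proof (rule corr_iso.op_eqI[OF gauge_iso[OF z] corr_iso.Ad_ext[OF gauge_iso[OF z]]])
  show "lop a \<in> extensional (Xcar F.H)" by (simp add: lop_def)
  fix x assume "x \<in> Xcar F.H"
  then have x: "x \<in> F.K" by simp
  show "AdU z (lop a) (gz z x) = lop a (gz z x)"
    using x gz_K[OF z x] by (simp add: AdU_apply z lop_def) (simp add: gz_def mult.left_commute)
qed

lemma AdU_cop:
  assumes z: "cmod z = 1" and \<xi>: "\<xi> \<in> A.K"
  shows "AdU z (cop \<xi>) = op_scale F.H z (cop \<xi>)" "AdU z (cop \<xi>) = cop (\<lambda>e. z * \<xi> e)"
proof -
  show *: "AdU z (cop \<xi>) = op_scale F.H z (cop \<xi>)"
  proof (rule corr_iso.op_eqI[OF gauge_iso[OF z] corr_iso.Ad_ext[OF gauge_iso[OF z]]])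
    show "op_scale F.H z (cop \<xi>) \<in> extensional (Xcar F.H)" by (simp add: op_scale_def)
    fix x assume "x \<in> Xcar F.H"
    then have x: "x \<in> F.K" by simp
    have "gz z (lcr G \<xi> x) p = z * lcr G \<xi> (gz z x) p" for p
      by (cases p rule: path_cases) (auto simp: gz_def lcr_def)
    then show "AdU z (cop \<xi>) (gz z x) = op_scale F.H z (cop \<xi>) (gz z x)"
      using x gz_K[OF z x] by (simp add: AdU_apply z cop_def F.op_simps fun_eq_iff)
  qed
  show "AdU z (cop \<xi>) = cop (\<lambda>e. z * \<xi> e)"
    unfolding * by (auto simp: op_scale_def cop_def lcr_def fun_eq_iff)
qed

lemma AdU_gens:
  assumes z: "cmod z = 1"
  shows "AdU z ` pgens = pgens"
proof -
  have z0: "z \<noteq> 0" using z by auto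
  have "AdU z ` pbase = pbase"
    unfolding pbase_def image_image by (rule image_cong) (simp_all add: AdU_lop[OF z])
  moreover have "AdU z ` cop ` A.K = cop ` A.K"
  proof (intro equalityI subsetI)
    fix T assume "T \<in> AdU z ` cop ` A.K"
    then obtain \<xi> where "\<xi> \<in> A.K" "T = AdU z (cop \<xi>)" by blast
    then show "T \<in> cop ` A.K" using AdU_cop(2)[OF z] A.K_scale[of \<xi> z] by simp
  next
    fix T assume "T \<in> cop ` A.K"
    then obtain \<xi> where \<xi>: "\<xi> \<in> A.K" "T = cop \<xi>" by blast
    have k: "(\<lambda>e. inverse z * \<xi> e) \<in> A.K" by (rule A.K_scale[OF \<xi>(1)])
    have "AdU z (cop (\<lambda>e. inverse z * \<xi> e)) = T"
      unfolding AdU_cop(2)[OF z k] \<xi>(2) using z0 by (simp add: mult.assoc[symmetric])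
    then show "T \<in> AdU z ` cop ` A.K" using k by blast
  qed
  ultimately show ?thesis by (simp add: pgens_def image_Un)
qed

lemma AdU_ptoep: "cmod z = 1 \<Longrightarrow> AdU z ` ptoep = ptoep"
  unfolding ptoep_def
  using generated_cstar_Ad[OF gauge_iso _ F.closed_star_adjointable pgens_adjointable, of z] AdU_gens
  by simp

lemma AdU_star_iso:
  assumes "cmod z = 1" shows "star_iso F.H ptoep F.H ptoep (AdU z)"
  using corr_iso.star_iso_Ad[OF gauge_iso[OF assms] ptoep_adjointable] AdU_ptoep[OF assms] by simp

definition "AdV = conj_op (fock_corr X) F.H W.W'"

lemma inv_iso: "corr_iso (fock_corr X) F.H W.W' W.\<rho>'"
  by (rule corr_iso_sym[OF fock_iso]) simp

lemma AdV_AdW: "T \<in> adjointable F.H \<Longrightarrow> AdV (AdW T) = T"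
  unfolding AdV_def by (rule W.Ad_sym) (simp add: adjointable_def)

lemma AdV_image: "B \<subseteq> adjointable F.H \<Longrightarrow> AdV ` AdW ` B = B"
  unfolding image_image by (rule trans[OF image_cong[OF refl] image_ident]) (use AdV_AdW in blast)

lemma AdW_adjointable: "B \<subseteq> adjointable F.H \<Longrightarrow> AdW ` B \<subseteq> adjointable (fock_corr X)"
  using W.Ad_adjointable by blast

lemma AdW_star_iso: "star_iso F.H ptoep (fock_corr X) (toeplitz X) AdW"
  using W.star_iso_Ad[OF ptoep_adjointable] by (simp add: Ad_toeplitz)

lemma AdV_star_iso: "star_iso (fock_corr X) (toeplitz X) F.H ptoep AdV"
  using corr_iso.star_iso_Ad[OF inv_iso AdW_adjointable[OF ptoep_adjointable]]
    AdV_image[OF ptoep_adjointable] by (simp add: Ad_toeplitz AdV_def[symmetric] del: hmod_simps)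

lemma gauge_exists: "is_gauge_action X (\<lambda>z. AdW \<circ> AdU z \<circ> AdV)"
  unfolding is_gauge_action_def
proof (intro allI impI conjI ballI)
  fix z :: complex assume z: "cmod z = 1"
  show "star_iso (fock_corr X) (toeplitz X) (fock_corr X) (toeplitz X) (AdW \<circ> AdU z \<circ> AdV)"
    by (rule star_iso_trans[OF AdV_star_iso star_iso_trans[OF AdU_star_iso[OF z] AdW_star_iso]])
  show "(AdW \<circ> AdU z \<circ> AdV) (fock_iota X a) = fock_iota X a" if "a \<in> Acar (coeff X)" for a
    using that by (simp add: Ad_lop[symmetric] AdV_AdW lop_adjointable AdU_lop z)
  show "(AdW \<circ> AdU z \<circ> AdV) (creation X \<xi>) = op_scale (fock_corr X) z (creation X \<xi>)" if "\<xi> \<in> Xcar X" for \<xi>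
  proof -
    have "cop (vec \<xi>) \<in> Xcar F.H \<rightarrow>\<^sub>E Xcar F.H"
      using F.adjointable_E[OF cop_adjointable(1)[OF vec_K[OF that]]] by simp
    then show ?thesis using vec_K[OF that]
      by (simp add: Ad_cop[OF that, symmetric] AdV_AdW cop_adjointable AdU_cop(1) z W.Ad_scale)
  qed
qed

text \<open>The chosen action satisfies its specification because conjugation by \<open>gz\<close>
  does. Pulled back to the path space the two agree on generators, hence on the whole algebra by
  \<open>star_iso_unique\<close>.\<close>

lemma gauge_action_eq:
  assumes z: "cmod z = 1" and T: "T \<in> ptoep"
  shows "gauge_action X z (AdW T) = AdW (AdU z T)"
proof -
  have "is_gauge_action X (gauge_action X)"
    unfolding gauge_action_def by (rule someI[of "is_gauge_action X", OF gauge_exists])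
  from mp[OF spec[OF this[unfolded is_gauge_action_def], of z] z] have g0: "star_iso (fock_corr X) (toeplitz X) (fock_corr X) (toeplitz X) (gauge_action X z) \<and>
     (\<forall>a \<in> Acar (coeff X). gauge_action X z (fock_iota X a) = fock_iota X a) \<and>
     (\<forall>\<xi> \<in> Xcar X. gauge_action X z (creation X \<xi>) = op_scale (fock_corr X) z (creation X \<xi>))"
    .
  have g: "star_iso (fock_corr X) (toeplitz X) (fock_corr X) (toeplitz X) (gauge_action X z)"
    "\<And>a. a \<in> Acar (coeff X) \<Longrightarrow> gauge_action X z (fock_iota X a) = fock_iota X a"
    "\<And>\<xi>. \<xi> \<in> Xcar X \<Longrightarrow> gauge_action X z (creation X \<xi>) = op_scale (fock_corr X) z (creation X \<xi>)"
    by (rule conjunct1[OF g0], rule bspec[OF conjunct1[OF conjunct2[OF g0]]], assumption,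
        rule bspec[OF conjunct2[OF conjunct2[OF g0]]], assumption)
  let ?\<theta> = "AdV \<circ> gauge_action X z \<circ> AdW"
  have \<theta>: "star_iso F.H (generated_cstar F.H pgens) F.H ptoep ?\<theta>"
    using star_iso_trans[OF AdW_star_iso star_iso_trans[OF g(1) AdV_star_iso]]
    by (simp add: ptoep_def comp_assoc)
  have "?\<theta> T = AdU z T"
  proof (rule F.star_iso_unique[OF pgens_adjointable ptoep_adjointable ptoep_adjointable \<theta>])
    show "star_iso F.H (generated_cstar F.H pgens) F.H ptoep (AdU z)"
      using AdU_star_iso[OF z] by (simp add: ptoep_def)
    show "T \<in> generated_cstar F.H pgens" using T by (simp add: ptoep_def)
    fix U assume "U \<in> pgens"
    then consider a where "a \<in> Acar (c0 (verts G))" "U = lop a" | \<xi> where "\<xi> \<in> A.K" "U = cop \<xi>"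
      by (auto simp: pgens_def pbase_def)
    then show "?\<theta> U = AdU z U"
    proof cases
      case (1 a)
      then have "gauge_action X z (AdW U) = AdW U" using g(2)[of a] by (simp add: Ad_lop)
      then show ?thesis using 1 by (simp add: AdV_AdW lop_adjointable AdU_lop z)
    next
      case (2 \<xi>)
      then obtain x where x: "x \<in> Xcar X" "\<xi> = vec x" using vec_image by blast
      have E: "cop \<xi> \<in> Xcar F.H \<rightarrow>\<^sub>E Xcar F.H"
        using F.adjointable_E[OF cop_adjointable(1)[OF 2(1)]] by simp
      have "gauge_action X z (AdW U) = op_scale (fock_corr X) z (AdW U)"
        using g(3)[OF x(1)] x 2 by (simp add: Ad_cop)
      also have "\<dots> = AdW (op_scale F.H z U)" using W.Ad_scale[OF E] 2 by simp
      finally show ?thesis using 2 AdU_cop(1)[OF z 2(1)]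
        by (simp add: AdV_AdW F.adjointable_ops(2)[OF cop_adjointable(1) cop_adjointable(1)])
    qed
  qed
  then have 1: "AdW (AdV (gauge_action X z (AdW T))) = AdW (AdU z T)" by simp
  have 2: "gauge_action X z (AdW T) \<in> AdW ` ptoep"
  proof -
    have "bij_betw (gauge_action X z) (toeplitz X) (toeplitz X)"
      using g(1) by (simp add: star_iso_def algebra_iso_def)
    then show ?thesis unfolding Ad_toeplitz by (rule bij_betw_apply) (use T Ad_toeplitz in blast)
  qed
  have 3: "AdW (AdV U) = U" if U: "U \<in> AdW ` ptoep" for U
  proof -
    obtain T' where T': "U = AdW T'" "T' \<in> ptoep" by (rule imageE[OF U])
    show ?thesis unfolding T'(1) AdV_AdW[OF subsetD[OF ptoep_adjointable T'(2)]] ..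
  qed
  show ?thesis by (rule trans[OF 3[OF 2, symmetric] 1])
qed

definition pdeg :: "int \<Rightarrow> (('v \<times> 'e list \<Rightarrow> complex) \<Rightarrow> 'v \<times> 'e list \<Rightarrow> complex) set" where
  "pdeg n = {T \<in> ptoep. \<forall>z. cmod z = 1 \<longrightarrow> AdU z T = op_scale F.H (z powi n) T}"

lemma Ad_degree: "AdW ` pdeg n = toeplitz_degree X n"
proof -
  have "gauge_action X z (AdW T) = op_scale (fock_corr X) (z powi n) (AdW T) \<longleftrightarrow>
      AdU z T = op_scale F.H (z powi n) T" if z: "cmod z = 1" and T: "T \<in> ptoep" for z T
  proof -
    have TA: "T \<in> adjointable F.H" using T ptoep_adjointable by blast
    then have E: "T \<in> Xcar F.H \<rightarrow>\<^sub>E Xcar F.H" by (simp add: adjointable_def)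
    have "AdU z T \<in> ptoep" using AdU_ptoep[OF z] T by blast
    then have "AdU z T \<in> Xcar F.H \<rightarrow>\<^sub>E Xcar F.H" using ptoep_adjointable by (auto simp: adjointable_def)
    moreover have "op_scale F.H (z powi n) T \<in> Xcar F.H \<rightarrow>\<^sub>E Xcar F.H"
      using F.adjointable_ops(2)[OF TA TA] by (simp add: adjointable_def)
    ultimately show ?thesis
      using inj_on_eq_iff[OF W.Ad_inj] by (simp add: gauge_action_eq[OF z T] W.Ad_scale[OF E, symmetric])
  qed
  then have iff: "(\<forall>z. cmod z = 1 \<longrightarrow> gauge_action X z (AdW T) = op_scale (fock_corr X) (z powi n) (AdW T)) \<longleftrightarrow>
      (\<forall>z. cmod z = 1 \<longrightarrow> AdU z T = op_scale F.H (z powi n) T)" if "T \<in> ptoep" for T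
    using that by (intro all_cong1 imp_cong refl)
  show ?thesis
  proof (intro equalityI subsetI)
    fix S assume "S \<in> AdW ` pdeg n"
    then obtain T where T: "T \<in> pdeg n" "S = AdW T" by blast
    then have "T \<in> ptoep" "\<forall>z. cmod z = 1 \<longrightarrow> AdU z T = op_scale F.H (z powi n) T"
      unfolding pdeg_def by blast+
    then show "S \<in> toeplitz_degree X n"
      unfolding toeplitz_degree_def Ad_toeplitz[symmetric] T(2) iff[OF \<open>T \<in> ptoep\<close>, symmetric] by blast
  next
    fix S assume S: "S \<in> toeplitz_degree X n"
    then obtain T where T: "T \<in> ptoep" "S = AdW T"
      unfolding toeplitz_degree_def Ad_toeplitz[symmetric] by blast
    have "\<forall>z. cmod z = 1 \<longrightarrow> gauge_action X z (AdW T) = op_scale (fock_corr X) (z powi n) (AdW T)"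
      using S unfolding toeplitz_degree_def T(2) by blast
    then have "T \<in> pdeg n" unfolding iff[OF T(1)] pdeg_def using T(1) by blast
    then show "S \<in> AdW ` pdeg n" using T(2) by blast
  qed
qed

lemma Ad_tensor_degree: "AdW ` (pdeg (int n) \<inter> ptens) = tensor_degree X n"
proof -
  have "pdeg (int n) \<subseteq> Xcar F.H \<rightarrow>\<^sub>E Xcar F.H" "ptens \<subseteq> Xcar F.H \<rightarrow>\<^sub>E Xcar F.H"
    using ptoep_adjointable ptens_adjointable by (auto simp: pdeg_def adjointable_def)
  then show ?thesis
    unfolding tensor_degree_def Ad_degree[symmetric] Ad_tensor[symmetric]
    by (rule inj_on_image_Int[OF W.Ad_inj])
qed

lemma pdeg_ptoep: "pdeg n \<subseteq> ptoep"
  by (auto simp: pdeg_def)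

lemma lop_pdeg: "a \<in> Acar (c0 (verts G)) \<Longrightarrow> lop a \<in> pdeg 0"
proof -
  assume a: "a \<in> Acar (c0 (verts G))"
  then have "lop a \<in> ptoep" using pgens_ptoep unfolding pgens_def pbase_def by blast
  moreover have "op_scale F.H 1 (lop a) = lop a" by (auto simp: op_scale_def lop_def fun_eq_iff)
  ultimately show ?thesis using a by (simp add: pdeg_def AdU_lop)
qed

lemma cop_pdeg: "\<xi> \<in> A.K \<Longrightarrow> cop \<xi> \<in> pdeg 1"
proof -
  assume \<xi>: "\<xi> \<in> A.K"
  then have "cop \<xi> \<in> ptoep" using pgens_ptoep unfolding pgens_def by blast
  then show ?thesis using \<xi> by (simp add: pdeg_def AdU_cop(1))
qed

text \<open>A nonzero entry whose length shift misses \<open>n\<close> by \<open>k\<close> would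
  have to be fixed under multiplication by \<open>z powi k\<close> for every \<open>z\<close> on the
  circle. A \<open>z\<close> with \<open>z powi k = - 1\<close> excludes this.\<close>

lemma pdeg_matrix:
  assumes T: "T \<in> pdeg n" and p: "p \<in> paths G" and ne: "T (delta p) q \<noteq> 0"
  shows "int (length (snd q)) = int (length (snd p)) + n"
proof (rule ccontr)
  define k where "k = int (length (snd q)) - int (length (snd p)) - n"
  assume "\<not> ?thesis"
  then have k: "k \<noteq> 0" by (simp add: k_def)
  define z where "z = cis (pi / of_int k)"
  have z: "cmod z = 1" "z \<noteq> 0" by (simp_all add: z_def)
  have zk: "z powi k = - 1" using k by (simp add: z_def cis_power_int)
  note d = F.K_delta[OF p]
  have TA: "T \<in> adjointable F.H" using T pdeg_ptoep ptoep_adjointable by blast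
  have gd: "gz z (delta p) = (\<lambda>q. z ^ length (snd p) * delta p q)"
    by (auto simp: gz_def delta_def fun_eq_iff)
  have "z ^ length (snd q) * T (delta p) q = gz z (T (delta p)) q" by (simp add: gz_def)
  also have "\<dots> = AdU z T (gz z (delta p)) q" using AdU_apply[OF z(1) d] by simp
  also have "\<dots> = z powi n * T (gz z (delta p)) q"
    using T z(1) gz_K[OF z(1) d] by (simp add: pdeg_def F.op_simps)
  also have "T (gz z (delta p)) = (\<lambda>q. z ^ length (snd p) * T (delta p) q)"
    unfolding gd by (rule F.adjointable_linear(2)[OF TA d d])
  finally have "z powi int (length (snd q)) = z powi n * z powi int (length (snd p))"
    using ne by simp
  then have "z powi int (length (snd q)) = z powi (n + int (length (snd p)))" using z(2) by (simp add: power_int_add)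
  moreover have "z powi int (length (snd q)) = z powi k * z powi (n + int (length (snd p)))"
    using z(2) by (simp add: k_def power_int_add[symmetric])
  ultimately show False using zk z(2) by simp
qed

end

section \<open>Isomorphic graphs have isomorphic algebras\<close>

definition push :: "'i set \<Rightarrow> 'j set \<Rightarrow> ('i \<Rightarrow> 'j) \<Rightarrow> ('i \<Rightarrow> complex) \<Rightarrow> 'j \<Rightarrow> complex" where
  "push A B f x = (\<lambda>j. if j \<in> B then x (inv_into A f j) else 0)"

lemma push_apply:
  assumes "bij_betw f A B" "i \<in> A" shows "push A B f x (f i) = x i"
  using assms by (auto simp: push_def bij_betw_def)

lemma push_eqI:
  assumes f: "bij_betw f A B" and "\<And>i. i \<in> A \<Longrightarrow> y (f i) = x i" "\<And>j. j \<notin> B \<Longrightarrow> y j = 0"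
  shows "push A B f x = y"
proof
  fix j
  show "push A B f x j = y j"
  proof (cases "j \<in> B")
    case True
    then obtain i where "i \<in> A" "j = f i" using f by (auto simp: bij_betw_def)
    then show ?thesis using push_apply[OF f] assms by simp
  qed (simp add: push_def assms)
qed

locale fibre_map =
  fixes V :: "'v set" and I :: "'i set" and s :: "'i \<Rightarrow> 'v" and V' :: "'w set" and I' :: "'j set"
    and s' :: "'j \<Rightarrow> 'w" and \<sigma> :: "'v \<Rightarrow> 'w" and \<tau> :: "'i \<Rightarrow> 'j"
  assumes s_V: "i \<in> I \<Longrightarrow> s i \<in> V"
    and \<sigma>: "bij_betw \<sigma> V V'" and \<tau>: "bij_betw \<tau> I I'"
    and s\<tau>: "i \<in> I \<Longrightarrow> s' (\<tau> i) = \<sigma> (s i)"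
begin

lemma fib_bij:
  assumes v: "v \<in> V" shows "bij_betw \<tau> (fib I s v) (fib I' s' (\<sigma> v))"
proof -
  have "\<tau> ` fib I s v = fib I' s' (\<sigma> v)"
  proof (intro equalityI subsetI)
    fix j assume "j \<in> \<tau> ` fib I s v"
    then show "j \<in> fib I' s' (\<sigma> v)" using \<tau> s\<tau> by (auto simp: fib_def bij_betw_def)
  next
    fix j assume j: "j \<in> fib I' s' (\<sigma> v)"
    then obtain i where i: "i \<in> I" "j = \<tau> i" using \<tau> by (auto simp: fib_def bij_betw_def)
    then have "\<sigma> (s i) = \<sigma> v" using j s\<tau> by (simp add: fib_def)
    then have "s i = v" using \<sigma> v s_V[OF i(1)] by (auto simp: bij_betw_def inj_on_eq_iff)
    then show "j \<in> \<tau> ` fib I s v" using i by (auto simp: fib_def)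
  qed
  moreover have "inj_on \<tau> (fib I s v)" using \<tau> by (auto simp: bij_betw_def fib_def inj_on_def)
  ultimately show ?thesis by (simp add: bij_betw_def)
qed

lemma push_fib: "i \<in> fib I s v \<Longrightarrow> push I I' \<tau> x (\<tau> i) = x i"
  using push_apply[OF \<tau>] by (auto simp: fib_def)

lemma push_l2:
  assumes v: "v \<in> V"
  shows "push I I' \<tau> x \<in> l2 (fib I' s' (\<sigma> v)) \<longleftrightarrow> x \<in> l2 (fib I s v)"
    and "l2n (fib I' s' (\<sigma> v)) (push I I' \<tau> x) = l2n (fib I s v) x"
    and "l2ip (fib I' s' (\<sigma> v)) (push I I' \<tau> x) (push I I' \<tau> y) = l2ip (fib I s v) x y"
proof -
  note b = fib_bij[OF v]
  show "push I I' \<tau> x \<in> l2 (fib I' s' (\<sigma> v)) \<longleftrightarrow> x \<in> l2 (fib I s v)"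
    unfolding l2_def mem_Collect_eq summable_on_reindex_bij_betw[OF b, symmetric]
    by (rule summable_on_cong) (simp add: push_fib)
  show "l2n (fib I' s' (\<sigma> v)) (push I I' \<tau> x) = l2n (fib I s v) x"
    unfolding l2n_def infsum_reindex_bij_betw[OF b, symmetric]
    by (intro arg_cong[of _ _ sqrt] infsum_cong) (simp add: push_fib)
  show "l2ip (fib I' s' (\<sigma> v)) (push I I' \<tau> x) (push I I' \<tau> y) = l2ip (fib I s v) x y"
    unfolding l2ip_def infsum_reindex_bij_betw[OF b, symmetric]
    by (intro infsum_cong) (simp add: push_fib)
qed

lemma finite_level_sets:
  assumes "\<And>v. v \<in> V \<Longrightarrow> g (\<sigma> v) = f v"
  shows "finite {w \<in> V'. (\<epsilon>::real) \<le> g w} \<longleftrightarrow> finite {v \<in> V. \<epsilon> \<le> f v}"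
proof -
  have "{w \<in> V'. \<epsilon> \<le> g w} = \<sigma> ` {v \<in> V. \<epsilon> \<le> f v}"
    using \<sigma> assms by (auto simp: bij_betw_def)
  moreover have "inj_on \<sigma> {v \<in> V. \<epsilon> \<le> f v}" using \<sigma> by (auto simp: bij_betw_def inj_on_def)
  ultimately show ?thesis by (simp add: finite_image_iff)
qed

lemma push_c0: "a \<in> Acar (c0 V) \<Longrightarrow> push V V' \<sigma> a \<in> Acar (c0 V')"
  using finite_level_sets[of "\<lambda>w. cmod (push V V' \<sigma> a w)" "\<lambda>v. cmod (a v)"] push_apply[OF \<sigma>]
  by (simp add: in_c0_iff) (simp add: push_def)

lemma push_c0_norm: "Anorm (c0 V') (push V V' \<sigma> a) = Anorm (c0 V) a"
proof -
  have "(\<lambda>w. cmod (push V V' \<sigma> a w)) ` V' = (\<lambda>v. cmod (a v)) ` V"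
  proof -
    have "V' = \<sigma> ` V" using \<sigma> by (simp add: bij_betw_def)
    then have "(\<lambda>w. cmod (push V V' \<sigma> a w)) ` V' = (\<lambda>v. cmod (push V V' \<sigma> a (\<sigma> v))) ` V"
      by (simp add: image_image)
    also have "\<dots> = (\<lambda>v. cmod (a v)) ` V" by (rule image_cong) (simp_all add: push_apply[OF \<sigma>])
    finally show ?thesis .
  qed
  then show ?thesis by (simp add: c0_def)
qed

lemma push_hcar: "x \<in> hcar V I s \<Longrightarrow> push I I' \<tau> x \<in> hcar V' I' s'"
  using finite_level_sets[of "\<lambda>w. l2n (fib I' s' w) (push I I' \<tau> x)" "\<lambda>v. l2n (fib I s v) x"] push_l2 \<sigma>
  by (simp add: hcar_def bij_betw_def) (auto simp: push_def)

lemma fibre_map_sym: "fibre_map V' I' s' V I s (inv_into V \<sigma>) (inv_into I \<tau>)"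
proof
  fix j assume "j \<in> I'"
  then obtain i where i: "i \<in> I" "j = \<tau> i" using \<tau> by (auto simp: bij_betw_def)
  then have sv: "s i \<in> V" "s' j = \<sigma> (s i)" by (simp_all add: s_V s\<tau>)
  then show "s' j \<in> V'" using \<sigma> by (auto simp: bij_betw_def)
  show "s (inv_into I \<tau> j) = inv_into V \<sigma> (s' j)"
    using i sv \<sigma> \<tau> by (auto simp: bij_betw_def)
qed (rule bij_betw_inv_into[OF \<sigma>], rule bij_betw_inv_into[OF \<tau>])

lemma push_bij: "bij_betw (push I I' \<tau>) (hcar V I s) (hcar V' I' s')"
proof (rule bij_betw_byWitness[where f'="push I' I (inv_into I \<tau>)"])
  interpret inv: fibre_map V' I' s' V I s "inv_into V \<sigma>" "inv_into I \<tau>" by (rule fibre_map_sym)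
  show "push I I' \<tau> ` hcar V I s \<subseteq> hcar V' I' s'" using push_hcar by blast
  show "push I' I (inv_into I \<tau>) ` hcar V' I' s' \<subseteq> hcar V I s" using inv.push_hcar by blast
  show "\<forall>x\<in>hcar V I s. push I' I (inv_into I \<tau>) (push I I' \<tau> x) = x"
  proof
    fix x assume x: "x \<in> hcar V I s"
    show "push I' I (inv_into I \<tau>) (push I I' \<tau> x) = x"
      by (rule push_eqI[OF inv.\<tau>]) (use x in \<open>auto simp: push_def hcar_def\<close>)
  qed
  show "\<forall>y\<in>hcar V' I' s'. push I I' \<tau> (push I' I (inv_into I \<tau>) y) = y"
  proof
    fix y assume y: "y \<in> hcar V' I' s'"
    show "push I I' \<tau> (push I' I (inv_into I \<tau>) y) = y"
    proof (rule push_eqI[OF \<tau>])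
      fix i assume i: "i \<in> I"
      then have "\<tau> i \<in> I'" "inv_into I \<tau> (\<tau> i) = i" using \<tau> by (auto simp: bij_betw_def)
      then show "y (\<tau> i) = push I' I (inv_into I \<tau>) y i" using push_apply[OF inv.\<tau>, of "\<tau> i"] by simp
    qed (use y in \<open>simp add: hcar_def\<close>)
  qed
qed

lemma push_c0_bij: "bij_betw (push V V' \<sigma>) (Acar (c0 V)) (Acar (c0 V'))"
proof (rule bij_betw_byWitness[where f'="push V' V (inv_into V \<sigma>)"])
  interpret inv: fibre_map V' I' s' V I s "inv_into V \<sigma>" "inv_into I \<tau>" by (rule fibre_map_sym)
  show "push V V' \<sigma> ` Acar (c0 V) \<subseteq> Acar (c0 V')" using push_c0 by blast
  show "push V' V (inv_into V \<sigma>) ` Acar (c0 V') \<subseteq> Acar (c0 V)" using inv.push_c0 by blast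
  show "\<forall>x\<in>Acar (c0 V). push V' V (inv_into V \<sigma>) (push V V' \<sigma> x) = x"
  proof
    fix x assume x: "x \<in> Acar (c0 V)"
    show "push V' V (inv_into V \<sigma>) (push V V' \<sigma> x) = x"
      by (rule push_eqI[OF inv.\<sigma>]) (use c0_outside[OF x] in \<open>auto simp: push_def\<close>)
  qed
  show "\<forall>y\<in>Acar (c0 V'). push V V' \<sigma> (push V' V (inv_into V \<sigma>) y) = y"
  proof
    fix y assume y: "y \<in> Acar (c0 V')"
    show "push V V' \<sigma> (push V' V (inv_into V \<sigma>) y) = y"
    proof (rule push_eqI[OF \<sigma>])
      fix v assume v: "v \<in> V"
      then have "\<sigma> v \<in> V'" "inv_into V \<sigma> (\<sigma> v) = v" using \<sigma> by (auto simp: bij_betw_def)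
      then show "y (\<sigma> v) = push V' V (inv_into V \<sigma>) y v" using push_apply[OF inv.\<sigma>, of "\<sigma> v"] by simp
    qed (use c0_outside[OF y] in simp)
  qed
qed

text \<open>A relabelling of indices that covers a bijection of the base points is unitary. It is
  applied both to edges and to paths, with their range maps as \<open>r\<close> and
  \<open>r'\<close>.\<close>

lemma push_iso:
  assumes r: "\<And>i. i \<in> I \<Longrightarrow> r i \<in> V" "\<And>i. i \<in> I \<Longrightarrow> r' (\<tau> i) = \<sigma> (r i)"
  shows "corr_iso (hmod V I s r) (hmod V' I' s' r') (push I I' \<tau>) (push V V' \<sigma>)"
proof -
  interpret fibred V I s r by unfold_locales (rule s_V)
  interpret I: corr_iso H H "\<lambda>x. x" "\<lambda>a. a" by (rule id_iso)
  have pV: "push V V' \<sigma> a (s' (\<tau> i)) = a (s i)" "push V V' \<sigma> a (r' (\<tau> i)) = a (r i)" if "i \<in> I" for a i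
    using that push_apply[OF \<sigma>] s_V r by (simp_all add: s\<tau>)
  have 0: "\<tau> i \<in> I'" if "i \<in> I" for i using that \<tau> by (auto simp: bij_betw_def)
  have out: "push I I' \<tau> x j = 0" if "j \<notin> I'" for x j using that by (simp add: push_def)
  have iso: "coeff_iso (c0 V) (c0 V') (push V V' \<sigma>)"
    unfolding coeff_iso_def using push_c0_bij by (auto simp: push_def fun_eq_iff)
  show ?thesis
  proof
    show "bij_betw (push I I' \<tau>) (Xcar H) (Xcar (hmod V' I' s' r'))" using push_bij by simp
    show "coeff_iso (coeff H) (coeff (hmod V' I' s' r')) (push V V' \<sigma>)" using iso by simp
    show "x = y" if "x \<in> Xcar H" "y \<in> Xcar H" "\<And>z. z \<in> Xcar H \<Longrightarrow> Xinner H z x = Xinner H z y" for x y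
      by (rule I.nondegenerate[OF that])
    show "Anorm (coeff (hmod V' I' s' r')) (push V V' \<sigma> a) = Anorm (coeff H) a" for a
      by (simp add: push_c0_norm)
    show "Xinner (hmod V' I' s' r') (push I I' \<tau> x) (push I I' \<tau> y) = push V V' \<sigma> (Xinner H x y)" for x y
    proof (rule push_eqI[OF \<sigma>, symmetric])
      show "Xinner (hmod V' I' s' r') (push I I' \<tau> x) (push I I' \<tau> y) (\<sigma> v) = Xinner H x y v" if "v \<in> V" for v
        using push_l2(3)[OF that] by simp
      show "Xinner (hmod V' I' s' r') (push I I' \<tau> x) (push I I' \<tau> y) w = 0" if "w \<notin> V'" for w
      proof -
        interpret inv: fibre_map V' I' s' V I s "inv_into V \<sigma>" "inv_into I \<tau>" by (rule fibre_map_sym)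
        have "fib I' s' w = {}" using that inv.s_V by (auto simp: fib_def)
        then show ?thesis by (simp add: l2ip_def)
      qed
    qed
    show "push I I' \<tau> (Xright H x a) = Xright (hmod V' I' s' r') (push I I' \<tau> x) (push V V' \<sigma> a)" for x a
      by (rule push_eqI[OF \<tau>]) (simp_all add: pV push_apply[OF \<tau>] out)
    show "push I I' \<tau> (Xleft H a x) = Xleft (hmod V' I' s' r') (push V V' \<sigma> a) (push I I' \<tau> x)" for x a
      by (rule push_eqI[OF \<tau>]) (simp_all add: pV push_apply[OF \<tau>] out)
  qed (use I.inner_in I.coeff_add_in I.coeff_zero_in I.zero_in I.add_in I.scale_in I.right_in I.left_in in
      \<open>simp_all add: push_def fun_eq_iff\<close>)
qed

end

context graph
begin

lemma completely_isometric_AdW: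
  "completely_isometric_iso F.H ptens (fock_corr X) (tensor_alg X) AdW"
proof -
  have "ptens \<subseteq> Xcar F.H \<rightarrow>\<^sub>E Xcar F.H" using ptens_adjointable by (auto simp: adjointable_def)
  from corr_iso.completely_isometric_iso_Ad[OF fock_iso this] show ?thesis by (simp only: Ad_tensor)
qed

lemma completely_isometric_AdV:
  "completely_isometric_iso (fock_corr X) (tensor_alg X) F.H ptens AdV"
proof -
  have "AdW ` ptens \<subseteq> Xcar (fock_corr X) \<rightarrow>\<^sub>E Xcar (fock_corr X)"
    using AdW_adjointable[OF ptens_adjointable] unfolding adjointable_def by blast
  from corr_iso.completely_isometric_iso_Ad[OF inv_iso this, folded AdV_def]
  show ?thesis unfolding AdV_image[OF ptens_adjointable] unfolding Ad_tensor .
qed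

lemma AdV_base: "AdV ` base_alg X = pbase"
  unfolding Ad_base[symmetric]
  by (rule AdV_image) (use pgens_adjointable in \<open>simp add: pgens_def\<close>)

lemma AdV_degree: "AdV ` toeplitz_degree X n = pdeg n"
  unfolding Ad_degree[symmetric]
  by (rule AdV_image) (use pdeg_ptoep ptoep_adjointable in blast)

lemma AdV_tensor_degree: "AdV ` tensor_degree X n = pdeg (int n) \<inter> ptens"
  unfolding Ad_tensor_degree[symmetric]
  by (rule AdV_image) (use ptens_adjointable in blast)

end

section \<open>Isomorphisms of algebras induced by an isomorphism of graphs\<close>

locale graph_iso = G1: graph G + G2: graph G'
  for G :: "('v, 'e) pre_digraph" and G' :: "('w, 'f) pre_digraph" +
  fixes \<sigma> :: "'v \<Rightarrow> 'w" and \<tau> :: "'e \<Rightarrow> 'f"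
  assumes \<sigma>: "bij_betw \<sigma> (verts G) (verts G')" and \<tau>: "bij_betw \<tau> (arcs G) (arcs G')"
    and tail_map: "e \<in> arcs G \<Longrightarrow> tail G' (\<tau> e) = \<sigma> (tail G e)"
    and head_map: "e \<in> arcs G \<Longrightarrow> head G' (\<tau> e) = \<sigma> (head G e)"
begin

definition "pmap = (\<lambda>p. (\<sigma> (fst p), map \<tau> (snd p)))"

lemma prng_pmap: "p \<in> paths G \<Longrightarrow> prng G' (pmap p) = \<sigma> (prng G p)"
  by (cases p rule: path_cases) (auto simp: pmap_def cons_path_def cons_path_paths[unfolded cons_path_def] head_map)

lemma pmap_cons: "pmap (cons_path p e) = cons_path (pmap p) (\<tau> e)"
  by (simp add: pmap_def cons_path_def)

lemma pmap_bij: "bij_betw pmap (paths G) (paths G')"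
proof -
  have inj: "inj_on pmap (paths G)"
  proof (rule inj_onI)
    fix p q assume pq: "p \<in> paths G" "q \<in> paths G" "pmap p = pmap q"
    have arcs: "set es \<subseteq> arcs G" if "path_ok G v es" for v es using that by (induction es) auto
    have "fst p \<in> verts G" "fst q \<in> verts G" using pq G1.F.s_in by blast+
    then have 1: "fst p = fst q" using pq(3) \<sigma> by (auto simp: pmap_def bij_betw_def inj_on_eq_iff)
    have "set (snd p) \<union> set (snd q) \<subseteq> arcs G"
      using pq(1,2) arcs by (cases p; cases q) (auto simp: paths_def)
    then have "inj_on \<tau> (set (snd p) \<union> set (snd q))" using \<tau> by (auto simp: bij_betw_def intro: inj_on_subset)
    then have "snd p = snd q" using pq(3) map_inj_on[of \<tau> "snd p" "snd q"] by (simp add: pmap_def)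
    then show "p = q" using 1 by (simp add: prod_eq_iff)
  qed
  have 1: "pmap (v, es) \<in> paths G'" if "(v, es) \<in> paths G" for v es
    using that
  proof (induction es)
    case Nil
    then show ?case using \<sigma> by (auto simp: pmap_def bij_betw_def)
  next
    case (Cons e es)
    then have e: "e \<in> arcs G" "(v, es) \<in> paths G" "tail G e = prng G (v, es)" by (simp_all add: paths_Cons)
    have "\<tau> e \<in> arcs G'" using \<tau> e by (auto simp: bij_betw_def)
    then show ?case using Cons.IH e pmap_cons[of "(v, es)" e] prng_pmap[OF e(2)]
      by (simp add: cons_path_paths tail_map)
  qed
  have 2: "(w, fs) \<in> pmap ` paths G" if "(w, fs) \<in> paths G'" for w fs
    using that
  proof (induction fs)
    case Nil
    then obtain v where "v \<in> verts G" "w = \<sigma> v" using \<sigma> by (auto simp: bij_betw_def)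
    then show ?case by (intro image_eqI[of _ _ "(v, [])"]) (auto simp: pmap_def)
  next
    case (Cons f fs)
    then have f: "f \<in> arcs G'" "(w, fs) \<in> paths G'" "tail G' f = prng G' (w, fs)" by (simp_all add: paths_Cons)
    then obtain p where p: "p \<in> paths G" "(w, fs) = pmap p" using Cons.IH by blast
    obtain e where e: "e \<in> arcs G" "f = \<tau> e" using \<tau> f(1) by (auto simp: bij_betw_def)
    have "\<sigma> (tail G e) = \<sigma> (prng G p)" using f(3) p e by (simp add: tail_map prng_pmap)
    then have "tail G e = prng G p"
      using \<sigma> G1.tail_in[OF e(1)] G1.prng_in[OF p(1)] by (auto simp: bij_betw_def inj_on_eq_iff)
    then have "cons_path p e \<in> paths G" using p e by (simp add: cons_path_paths)
    moreover have "(w, f # fs) = pmap (cons_path p e)" using p(2)[symmetric] e by (simp add: pmap_cons)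
    ultimately show ?case by blast
  qed
  have "pmap ` paths G = paths G'" using 1 2 by auto
  then show ?thesis using inj by (simp add: bij_betw_def)
qed

sublocale PA: fibre_map "verts G" "arcs G" "tail G" "verts G'" "arcs G'" "tail G'" \<sigma> \<tau>
  by unfold_locales (use G1.tail_in \<sigma> \<tau> tail_map in auto)

sublocale PP: fibre_map "verts G" "paths G" fst "verts G'" "paths G'" fst \<sigma> pmap
  by unfold_locales (use G1.F.s_in \<sigma> pmap_bij in \<open>auto simp: pmap_def\<close>)

abbreviation "pa \<equiv> push (arcs G) (arcs G') \<tau>"
abbreviation "pp \<equiv> push (paths G) (paths G') pmap"
abbreviation "pv \<equiv> push (verts G) (verts G') \<sigma>"

lemma arcs_iso: "corr_iso G1.A.H G2.A.H pa pv"
  by (rule PA.push_iso) (simp_all add: G1.head_in head_map)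

lemma paths_iso: "corr_iso G1.F.H G2.F.H pp pv"
  by (rule PP.push_iso) (simp_all add: G1.prng_in prng_pmap)

interpretation P: corr_iso G1.F.H G2.F.H pp pv
  by (rule paths_iso)

abbreviation "AdP \<equiv> conj_op G1.F.H G2.F.H pp"

lemma AdP_lop:
  assumes a: "a \<in> Acar (c0 (verts G))"
  shows "AdP (G1.lop a) = G2.lop (pv a)"
proof (rule P.op_eqI[OF P.Ad_ext])
  show "G2.lop (pv a) \<in> extensional (Xcar G2.F.H)" by (simp add: G2.lop_def)
  fix x assume x: "x \<in> Xcar G1.F.H"
  have "AdP (G1.lop a) (pp x) = pp (Xleft G1.F.H a x)"
    using x by (simp only: P.Ad_apply) (simp add: G1.lop_def)
  also have "\<dots> = Xleft G2.F.H (pv a) (pp x)" by (rule P.map_left[OF x]) (simp add: a)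
  also have "\<dots> = G2.lop (pv a) (pp x)" using P.W_in[OF x] by (simp add: G2.lop_def)
  finally show "AdP (G1.lop a) (pp x) = G2.lop (pv a) (pp x)" .
qed

lemma pp_lcr: "pp (lcr G \<xi> x) = lcr G' (pa \<xi>) (pp x)"
proof (rule push_eqI[OF pmap_bij])
  fix p assume p: "p \<in> paths G"
  show "lcr G' (pa \<xi>) (pp x) (pmap p) = lcr G \<xi> x p"
  proof (cases p rule: path_cases)
    case (1 v)
    then show ?thesis by (simp add: pmap_def)
  next
    case (2 q e)
    then have q: "q \<in> paths G" "e \<in> arcs G" using p by (simp_all add: cons_path_paths)
    have "cons_path (pmap q) (\<tau> e) \<in> paths G'"
      using p pmap_bij 2 pmap_cons by (metis bij_betw_apply)
    then have "lcr G' (pa \<xi>) (pp x) (pmap p) = pa \<xi> (\<tau> e) * pp x (pmap q)"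
      unfolding 2 pmap_cons by (rule lcr_cons)
    also have "\<dots> = lcr G \<xi> x p"
      using p q by (simp add: push_apply[OF \<tau>] push_apply[OF pmap_bij] 2 lcr_cons)
    finally show ?thesis .
  qed
qed (simp add: lcr_def)

lemma AdP_cop:
  assumes \<xi>: "\<xi> \<in> G1.A.K"
  shows "AdP (G1.cop \<xi>) = G2.cop (pa \<xi>)"
proof (rule P.op_eqI[OF P.Ad_ext])
  show "G2.cop (pa \<xi>) \<in> extensional (Xcar G2.F.H)" by (simp add: G2.cop_def)
  fix x assume x: "x \<in> Xcar G1.F.H"
  have "AdP (G1.cop \<xi>) (pp x) = pp (lcr G \<xi> x)"
    using x by (simp only: P.Ad_apply) (simp add: G1.cop_def)
  also have "\<dots> = G2.cop (pa \<xi>) (pp x)" using P.W_in[OF x] by (simp add: G2.cop_def pp_lcr)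
  finally show "AdP (G1.cop \<xi>) (pp x) = G2.cop (pa \<xi>) (pp x)" .
qed

lemma AdP_base: "AdP ` G1.pbase = G2.pbase"
proof -
  have "pv ` Acar (c0 (verts G)) = Acar (c0 (verts G'))" using PA.push_c0_bij by (simp add: bij_betw_def)
  then have "G2.pbase = (\<lambda>a. G2.lop (pv a)) ` Acar (c0 (verts G))"
    unfolding G2.pbase_def by (metis image_image)
  then show ?thesis unfolding G1.pbase_def image_image using image_cong[OF refl AdP_lop] by simp
qed

lemma AdP_gens: "AdP ` G1.pgens = G2.pgens"
proof -
  have "pa ` G1.A.K = G2.A.K" using PA.push_bij by (simp add: bij_betw_def)
  then have "G2.cop ` G2.A.K = (\<lambda>\<xi>. G2.cop (pa \<xi>)) ` G1.A.K" by (metis image_image)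
  then have "AdP ` G1.cop ` G1.A.K = G2.cop ` G2.A.K"
    unfolding image_image using image_cong[OF refl AdP_cop] by simp
  then show ?thesis by (simp add: G1.pgens_def G2.pgens_def image_Un AdP_base)
qed

lemma AdP_ptoep: "AdP ` G1.ptoep = G2.ptoep"
  unfolding G1.ptoep_def G2.ptoep_def AdP_gens[symmetric]
  by (rule generated_cstar_Ad[OF paths_iso _ G1.F.closed_star_adjointable G1.pgens_adjointable, symmetric]) simp

lemma AdP_ptens: "AdP ` G1.ptens = G2.ptens"
  unfolding G1.ptens_def G2.ptens_def AdP_gens[symmetric]
  by (rule generated_algebra_Ad[OF paths_iso _ G1.F.closed_adjointable G1.pgens_adjointable, symmetric]) simp

lemma gz_pp: "G2.gz z (pp x) = pp (G1.gz z x)"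
proof (rule push_eqI[OF pmap_bij, symmetric])
  fix p assume "p \<in> paths G"
  then show "G2.gz z (pp x) (pmap p) = G1.gz z x p"
    by (simp add: G2.gz_def G1.gz_def push_apply[OF pmap_bij]) (simp add: pmap_def)
qed (simp add: G2.gz_def push_def)

lemma AdU_AdP:
  assumes z: "cmod z = 1" and T: "T \<in> Xcar G1.F.H \<rightarrow>\<^sub>E Xcar G1.F.H"
  shows "G2.AdU z (AdP T) = AdP (G1.AdU z T)"
proof -
  have "G2.gz z \<circ> pp = pp \<circ> G1.gz z" by (auto simp: gz_pp)
  then show ?thesis
    using Ad_trans[OF paths_iso G2.gauge_iso[OF z] T] Ad_trans[OF G1.gauge_iso[OF z] paths_iso T] by simp
qed

text \<open>Relabelling preserves the length of a path and so commutes with the gauge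
  unitaries.\<close>

lemma AdP_pdeg: "AdP ` G1.pdeg n = G2.pdeg n"
proof -
  have iff: "AdP T \<in> G2.pdeg n \<longleftrightarrow> T \<in> G1.pdeg n" if T: "T \<in> G1.ptoep" for T
  proof -
    have TA: "T \<in> adjointable G1.F.H" using T G1.ptoep_adjointable by blast
    then have E: "T \<in> Xcar G1.F.H \<rightarrow>\<^sub>E Xcar G1.F.H" by (simp add: adjointable_def)
    have "G2.AdU z (AdP T) = op_scale G2.F.H (z powi n) (AdP T) \<longleftrightarrow>
        G1.AdU z T = op_scale G1.F.H (z powi n) T" if z: "cmod z = 1" for z
    proof -
      have "G1.AdU z T \<in> G1.ptoep" using G1.AdU_ptoep[OF z] T by blast
      then have "G1.AdU z T \<in> Xcar G1.F.H \<rightarrow>\<^sub>E Xcar G1.F.H"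
        using G1.ptoep_adjointable by (auto simp: adjointable_def)
      moreover have "op_scale G1.F.H (z powi n) T \<in> Xcar G1.F.H \<rightarrow>\<^sub>E Xcar G1.F.H"
        using G1.F.adjointable_ops(2)[OF TA TA] by (simp add: adjointable_def)
      ultimately show ?thesis
        unfolding AdU_AdP[OF z E] P.Ad_scale[OF E, symmetric] by (rule inj_on_eq_iff[OF P.Ad_inj])
    qed
    moreover have "AdP T \<in> G2.ptoep" using T AdP_ptoep by blast
    ultimately show ?thesis unfolding G1.pdeg_def G2.pdeg_def using T by simp
  qed
  show ?thesis
  proof (intro equalityI subsetI)
    fix S assume "S \<in> AdP ` G1.pdeg n"
    then show "S \<in> G2.pdeg n" using iff G1.pdeg_ptoep by blast
  next
    fix S assume S: "S \<in> G2.pdeg n"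
    then have "S \<in> AdP ` G1.ptoep" using G2.pdeg_ptoep AdP_ptoep by blast
    then obtain T where "S = AdP T" "T \<in> G1.ptoep" by (rule imageE)
    then show "S \<in> AdP ` G1.pdeg n" using S iff[of T] by blast
  qed
qed

lemma unitarily_isomorphic_corr: "unitarily_isomorphic (graph_corr G) (graph_corr G')"
proof -
  have "corr_iso (graph_corr G) G1.A.H (inv_into (Xcar G1.A.H) G1.C.cls) (inv_into (Acar (coeff G1.A.H)) (\<lambda>a. a))"
    by (rule corr_iso_sym[OF G1.X_iso]) simp
  from corr_iso_trans[OF corr_iso_trans[OF this arcs_iso] G2.X_iso] show ?thesis
    by (rule corr_iso_imp_unitarily_isomorphic)
qed

lemma graded_completely_isometric_corr: "graded_completely_isometric (graph_corr G) (graph_corr G')"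
  unfolding graded_completely_isometric_def
proof (intro exI conjI allI)
  have E: "G1.ptens \<subseteq> Xcar G1.F.H \<rightarrow>\<^sub>E Xcar G1.F.H"
    using G1.ptens_adjointable by (auto simp: adjointable_def)
  show "completely_isometric_iso (fock_corr (graph_corr G)) (tensor_alg (graph_corr G))
      (fock_corr (graph_corr G')) (tensor_alg (graph_corr G')) (G2.AdW \<circ> (AdP \<circ> G1.AdV))"
    by (rule completely_isometric_iso_trans[OF completely_isometric_iso_trans[OF G1.completely_isometric_AdV
          P.completely_isometric_iso_Ad[OF E, unfolded AdP_ptens]] G2.completely_isometric_AdW])
  fix n
  have "AdP ` (G1.pdeg (int n) \<inter> G1.ptens) = G2.pdeg (int n) \<inter> G2.ptens"
    using inj_on_image_Int[OF P.Ad_inj _ E, of "G1.pdeg (int n)"] G1.pdeg_ptoep G1.ptoep_adjointable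
    by (simp add: AdP_pdeg AdP_ptens adjointable_def) blast
  then show "(G2.AdW \<circ> (AdP \<circ> G1.AdV)) ` tensor_degree (graph_corr G) n = tensor_degree (graph_corr G') n"
    by (simp only: image_comp[symmetric] G1.AdV_tensor_degree G2.Ad_tensor_degree)
qed

lemma base_preserving_graded_isomorphic_corr:
  "base_preserving_graded_isomorphic (graph_corr G) (graph_corr G')"
  unfolding base_preserving_graded_isomorphic_def
proof (intro exI conjI allI)
  show "star_iso (fock_corr (graph_corr G)) (toeplitz (graph_corr G))
      (fock_corr (graph_corr G')) (toeplitz (graph_corr G')) (G2.AdW \<circ> (AdP \<circ> G1.AdV))"
    by (rule star_iso_trans[OF star_iso_trans[OF G1.AdV_star_iso
          P.star_iso_Ad[OF G1.ptoep_adjointable, unfolded AdP_ptoep]] G2.AdW_star_iso])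
  show "(G2.AdW \<circ> (AdP \<circ> G1.AdV)) ` base_alg (graph_corr G) = base_alg (graph_corr G')"
    by (simp only: image_comp[symmetric] G1.AdV_base AdP_base G2.Ad_base)
  show "(G2.AdW \<circ> (AdP \<circ> G1.AdV)) ` toeplitz_degree (graph_corr G) n = toeplitz_degree (graph_corr G') n" for n
    by (simp only: image_comp[symmetric] G1.AdV_degree AdP_pdeg G2.Ad_degree)
qed

end

section \<open>Recovering the graph\<close>

text \<open>Hilbert space dimension is monotone: an orthonormal family indexed by \<open>A\<close> in
  \<open>\<ell>\<^sup>2(B)\<close> forces \<open>|A| \<le> |B|\<close>. For infinite \<open>B\<close>, by Bessel each \<open>f \<in> B\<close> lies in the support of only
  countably many members.\<close>

lemma orthonormal_family_inj:
  fixes u :: "'e \<Rightarrow> 'f \<Rightarrow> complex"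
  assumes l2: "\<And>e. e \<in> A \<Longrightarrow> u e \<in> l2 B"
    and norm: "\<And>F c. finite F \<Longrightarrow> F \<subseteq> A \<Longrightarrow>
      (l2n B (\<lambda>f. \<Sum>e\<in>F. c e * u e f))\<^sup>2 = (\<Sum>e\<in>F. (cmod (c e))\<^sup>2)"
  shows "\<exists>g. inj_on g A \<and> g ` A \<subseteq> B"
proof -
  have comb: "(\<lambda>f. \<Sum>e\<in>F. c e * u e f) \<in> l2 B" if "finite F" "F \<subseteq> A" for F c
    using that
  proof (induction F)
    case empty
    show ?case by (simp add: l2_def)
  next
    case (insert e F)
    then show ?case using l2_add(1)[OF l2_scale(1)[OF l2[of e]], of "\<lambda>f. \<Sum>e\<in>F. c e * u e f" "c e"] by simp
  qed
  have bessel: "(\<Sum>e\<in>F. (cmod (u e f))\<^sup>2) \<le> 1" if F: "finite F" "F \<subseteq> A" and f: "f \<in> B" for F f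
  proof -
    let ?s = "\<Sum>e\<in>F. (cmod (u e f))\<^sup>2"
    \<comment> \<open>The test vector for Bessel: its value at \<open>f\<close> and its square norm
      are both \<open>?s\<close>, whence \<open>?s\<^sup>2 \<le> ?s\<close>.\<close>
    let ?x = "\<lambda>f'. \<Sum>e\<in>F. cnj (u e f) * u e f'"
    have "?x f = (\<Sum>e\<in>F. complex_of_real ((cmod (u e f))\<^sup>2))"
      by (rule sum.cong) (simp_all only: complex_norm_square mult.commute)
    then have xf: "?x f = complex_of_real ?s" by simp
    have s0: "0 \<le> ?s" by (simp add: sum_nonneg)
    have "cmod (?x f) \<le> l2n B ?x" by (rule l2_coord_le[OF comb[OF F] f])
    then have "(cmod (?x f))\<^sup>2 \<le> (l2n B ?x)\<^sup>2" by (rule power_mono) simp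
    also have "\<dots> = ?s" using norm[OF F, of "\<lambda>e. cnj (u e f)"] by simp
    finally have "?s\<^sup>2 \<le> ?s" unfolding xf norm_of_real power2_abs .
    then show ?thesis using s0 by (cases "?s = 0") (simp_all add: power2_eq_square mult_le_cancel_right2)
  qed
  have unit: "(l2n B (u e))\<^sup>2 = 1" if "e \<in> A" for e
    using norm[of "{e}" "\<lambda>_. 1"] that by simp
  show ?thesis
  proof (cases "finite B")
    case True
    \<comment> \<open>Double counting: summed over \<open>B\<close> first, the squares of all
      entries give \<open>card F\<close>; summed over \<open>F\<close> first, Bessel bounds them by
      \<open>card B\<close>.\<close>
    have "card F \<le> card B" if F: "F \<subseteq> A" "finite F" for F
    proof -
      have "real (card F) = (\<Sum>e\<in>F. (l2n B (u e))\<^sup>2)"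
        using F unit by (simp add: subset_iff)
      also have "\<dots> = (\<Sum>e\<in>F. \<Sum>f\<in>B. (cmod (u e f))\<^sup>2)" by (simp add: l2n_sq True)
      also have "\<dots> = (\<Sum>f\<in>B. \<Sum>e\<in>F. (cmod (u e f))\<^sup>2)" by (rule sum.swap)
      also have "\<dots> \<le> (\<Sum>f\<in>B. 1)" by (rule sum_mono) (rule bessel[OF F(2,1)])
      finally show ?thesis by simp
    qed
    then have "finite A \<and> card A \<le> card B" using finite_if_finite_subsets_card_bdd by blast
    then obtain g where "g ` A \<subseteq> B" "inj_on g A" using card_le_inj[OF _ True] by blast
    then show ?thesis by blast
  next
    case False
    have cover: "A \<subseteq> (\<Union>f\<in>B. {e \<in> A. u e f \<noteq> 0})"
    proof
      fix e assume e: "e \<in> A"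
      have "\<exists>f\<in>B. u e f \<noteq> 0"
      proof (rule ccontr)
        assume "\<not> ?thesis"
        then have "l2n B (u e) = 0" using l2n_eq_0_iff[OF l2[OF e]] by blast
        then show False using unit[OF e] by simp
      qed
      then show "e \<in> (\<Union>f\<in>B. {e \<in> A. u e f \<noteq> 0})" using e by blast
    qed
    have small: "(card_of {e \<in> A. u e f \<noteq> 0}, card_of B) \<in> ordLeq" if f: "f \<in> B" for f
    proof -
      have "(\<lambda>e. (cmod (u e f))\<^sup>2) summable_on A"
        by (rule nonneg_bdd_above_summable_on) (auto intro!: bdd_aboveI2[where M=1] bessel f)
      then have "(\<lambda>e. (cmod (u e f))\<^sup>2) abs_summable_on A" by simp
      then have "countable {e \<in> A. (cmod (u e f))\<^sup>2 \<noteq> 0}" by (rule abs_summable_countable)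
      then have "countable {e \<in> A. u e f \<noteq> 0}" by simp
      then obtain h :: "'e \<Rightarrow> nat" where "inj_on h {e \<in> A. u e f \<noteq> 0}" unfolding countable_def by blast
      then have "(card_of {e \<in> A. u e f \<noteq> 0}, card_of (UNIV :: nat set)) \<in> ordLeq"
        by (rule card_of_ordLeqI) simp
      moreover have "(card_of (UNIV :: nat set), card_of B) \<in> ordLeq"
        using False infinite_iff_card_of_nat by blast
      ultimately show ?thesis by (rule ordLeq_transitive)
    qed
    have "(card_of A, card_of (\<Union>f\<in>B. {e \<in> A. u e f \<noteq> 0})) \<in> ordLeq"
      by (rule card_of_mono1[OF cover])
    moreover have "(card_of (\<Union>f\<in>B. {e \<in> A. u e f \<noteq> 0}), card_of B) \<in> ordLeq"
      by (rule card_of_UNION_ordLeq_infinite[OF False]) (auto intro: small card_of_mono1)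
    ultimately have "(card_of A, card_of B) \<in> ordLeq" by (rule ordLeq_transitive)
    then show ?thesis using card_of_ordLeq by blast
  qed
qed

definition edges_between :: "('v, 'e) pre_digraph \<Rightarrow> 'v \<Rightarrow> 'v \<Rightarrow> 'e set" where
  "edges_between G v w = {e \<in> arcs G. tail G e = v \<and> head G e = w}"

definition edges_le :: "('v, 'e) pre_digraph \<Rightarrow> ('w, 'f) pre_digraph \<Rightarrow> ('v \<Rightarrow> 'w) \<Rightarrow> bool" where
  "edges_le G G' \<sigma> \<longleftrightarrow> (\<forall>v\<in>verts G. \<forall>w\<in>verts G. \<exists>g. inj_on g (edges_between G v w) \<and>
     g ` edges_between G v w \<subseteq> edges_between G' (\<sigma> v) (\<sigma> w))"

text \<open>The bijections between edge sets with fixed endpoints glue to a single one, since the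
  endpoints of an edge tell which of them to use.\<close>

lemma edges_le_imp_iso:
  assumes G: "wf_digraph G" and G': "wf_digraph G'" and \<sigma>: "bij_betw \<sigma> (verts G) (verts G')"
    and le: "edges_le G G' \<sigma>" and ge: "edges_le G' G (inv_into (verts G) \<sigma>)"
  shows "digraph_iso G G'"
proof -
  interpret G: wf_digraph G by fact
  interpret G': wf_digraph G' by fact
  have "\<exists>h. bij_betw h (edges_between G v w) (edges_between G' (\<sigma> v) (\<sigma> w))"
    if vw: "v \<in> verts G" "w \<in> verts G" for v w
  proof -
    have s: "\<sigma> v \<in> verts G'" "\<sigma> w \<in> verts G'" "inv_into (verts G) \<sigma> (\<sigma> v) = v" "inv_into (verts G) \<sigma> (\<sigma> w) = w"
      using \<sigma> vw by (auto simp: bij_betw_def)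
    obtain f where "inj_on f (edges_between G v w)" "f ` edges_between G v w \<subseteq> edges_between G' (\<sigma> v) (\<sigma> w)"
      using le vw unfolding edges_le_def by blast
    moreover obtain g where "inj_on g (edges_between G' (\<sigma> v) (\<sigma> w))"
      "g ` edges_between G' (\<sigma> v) (\<sigma> w) \<subseteq> edges_between G v w"
      using ge s unfolding edges_le_def by metis
    ultimately show ?thesis by (rule Schroeder_Bernstein)
  qed
  then obtain h where h: "\<And>v w. v \<in> verts G \<Longrightarrow> w \<in> verts G \<Longrightarrow>
      bij_betw (h v w) (edges_between G v w) (edges_between G' (\<sigma> v) (\<sigma> w))" by metis
  define \<tau> where "\<tau> e = h (tail G e) (head G e) e" for e
  have \<tau>: "\<tau> e \<in> arcs G' \<and> tail G' (\<tau> e) = \<sigma> (tail G e) \<and> head G' (\<tau> e) = \<sigma> (head G e)" if e: "e \<in> arcs G" for e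
  proof -
    have "e \<in> edges_between G (tail G e) (head G e)" using e by (simp add: edges_between_def)
    then have "\<tau> e \<in> edges_between G' (\<sigma> (tail G e)) (\<sigma> (head G e))"
      using h[of "tail G e" "head G e"] e unfolding \<tau>_def by (auto simp: bij_betw_def)
    then show ?thesis by (simp add: edges_between_def)
  qed
  have inj: "inj_on \<tau> (arcs G)"
  proof (rule inj_onI)
    fix e f assume ef: "e \<in> arcs G" "f \<in> arcs G" "\<tau> e = \<tau> f"
    then have "\<sigma> (tail G e) = \<sigma> (tail G f)" "\<sigma> (head G e) = \<sigma> (head G f)" using \<tau> by metis+
    then have eq: "tail G e = tail G f" "head G e = head G f"
    proof -
      have inj\<sigma>: "inj_on \<sigma> (verts G)" using \<sigma> by (simp add: bij_betw_def)
      show "\<sigma> (tail G e) = \<sigma> (tail G f) \<Longrightarrow> tail G e = tail G f"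
        by (rule inj_onD[OF inj\<sigma>]) (simp_all add: ef)
      show "\<sigma> (head G e) = \<sigma> (head G f) \<Longrightarrow> head G e = head G f"
        by (rule inj_onD[OF inj\<sigma>]) (simp_all add: ef)
    qed
    have "inj_on (h (tail G e) (head G e)) (edges_between G (tail G e) (head G e))"
      using h ef by (simp add: bij_betw_def)
    then show "e = f" using ef eq by (simp add: \<tau>_def inj_on_eq_iff edges_between_def)
  qed
  have surj: "\<tau> ` arcs G = arcs G'"
  proof (intro equalityI subsetI)
    fix f assume f: "f \<in> arcs G'"
    obtain v w where vw: "v \<in> verts G" "w \<in> verts G" "tail G' f = \<sigma> v" "head G' f = \<sigma> w"
      using \<sigma> G'.tail_in_verts[OF f] G'.head_in_verts[OF f] unfolding bij_betw_def by blast
    then have "f \<in> h v w ` edges_between G v w"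
      using h[OF vw(1,2)] f by (simp add: bij_betw_def edges_between_def)
    then obtain e where "e \<in> edges_between G v w" "f = h v w e" by blast
    then have "e \<in> arcs G" "\<tau> e = f" by (simp_all add: edges_between_def \<tau>_def)
    then show "f \<in> \<tau> ` arcs G" by blast
  qed (use \<tau> in blast)
  \<comment> \<open>The new endpoint maps are those of \<open>G'\<close>, so that the image of
    \<open>G\<close> is literally equal to \<open>G'\<close>.\<close>
  let ?f = "\<lparr>iso_verts = \<sigma>, iso_arcs = \<tau>, iso_head = head G', iso_tail = tail G'\<rparr>"
  have "pre_digraph.digraph_isomorphism G ?f"
    unfolding pre_digraph.digraph_isomorphism_def using G \<sigma> inj \<tau> by (simp add: bij_betw_def)
  moreover have "G' = app_iso ?f G"
    using \<sigma> surj by (simp add: app_iso_def bij_betw_def)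
  ultimately show ?thesis unfolding digraph_iso_def by blast
qed

lemma iso_imp_graph_iso:
  assumes "wf_digraph G'" "digraph_iso G G'"
  obtains \<sigma> \<tau> where "graph_iso G G' \<sigma> \<tau>"
proof -
  obtain f where f: "pre_digraph.digraph_isomorphism G f" "G' = app_iso f G"
    using assms(2) unfolding digraph_iso_def by blast
  then have f': "wf_digraph G" "inj_on (iso_verts f) (verts G)" "inj_on (iso_arcs f) (arcs G)"
    "\<And>a. a \<in> arcs G \<Longrightarrow> iso_verts f (tail G a) = iso_tail f (iso_arcs f a)"
    "\<And>a. a \<in> arcs G \<Longrightarrow> iso_verts f (head G a) = iso_head f (iso_arcs f a)"
    by (simp_all add: pre_digraph.digraph_isomorphism_def)
  interpret G: wf_digraph G by (rule f'(1))
  interpret G': wf_digraph G' by fact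
  have "graph_iso G G' (iso_verts f) (iso_arcs f)"
    by unfold_locales
      (use f' f(2) G.tail_in_verts G.head_in_verts G'.tail_in_verts G'.head_in_verts in \<open>simp_all add: bij_betw_def\<close>)
  then show ?thesis using that by blast
qed

text \<open>Right creation by \<open>f\<close>. The tensor algebra commutes with it, so its elements are determined by
  their values on the vectors \<open>\<delta>\<^sub>v\<close>.\<close>

definition rcr :: "('v, 'e) pre_digraph \<Rightarrow> 'e \<Rightarrow> ('v \<times> 'e list \<Rightarrow> complex) \<Rightarrow> ('v \<times> 'e list \<Rightarrow> complex)" where
  "rcr G f x = (\<lambda>p. if p \<in> paths G \<and> snd p \<noteq> [] \<and> last (snd p) = f then x (head G f, butlast (snd p)) else 0)"

section \<open>Right creation and the tensor algebra\<close>

context graph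
begin

lemma path_last:
  "(v, es) \<in> paths G \<Longrightarrow> es \<noteq> [] \<Longrightarrow> v = tail G (last es) \<and> (head G (last es), butlast es) \<in> paths G \<and>
    prng G (head G (last es), butlast es) = prng G (v, es)"
proof (induction es)
  case (Cons e es)
  show ?case
  proof (cases "es = []")
    case True
    then show ?thesis using Cons.prems by (simp add: paths_Cons head_in)
  next
    case False
    then have "v = tail G (last es) \<and> (head G (last es), butlast es) \<in> paths G \<and>
      prng G (head G (last es), butlast es) = prng G (v, es)"
      using Cons by (simp add: paths_Cons)
    then show ?thesis using Cons.prems False by (simp add: paths_Cons)
  qed
qed simp

lemma path_snoc:
  "(head G f, es) \<in> paths G \<Longrightarrow> f \<in> arcs G \<Longrightarrow> (tail G f, es @ [f]) \<in> paths G \<and>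
    prng G (tail G f, es @ [f]) = prng G (head G f, es)"
proof (induction es)
  case (Cons e es)
  then show ?case by (simp add: paths_Cons)
qed (simp add: paths_Cons tail_in)

text \<open>Appending \<open>f\<close> maps the fibre over \<open>head G f\<close> bijectively onto
  the paths over \<open>tail G f\<close> that end in \<open>f\<close>, so the square sums agree; the
  function vanishes on all other fibres.\<close>

lemma rcr_K:
  assumes f: "f \<in> arcs G" and x: "x \<in> F.K"
  shows "rcr G f x \<in> F.K"
proof -
  let ?S = "{p \<in> F.fb (tail G f). snd p \<noteq> [] \<and> last (snd p) = f}"
  have bij: "bij_betw (\<lambda>p. (head G f, butlast (snd p))) ?S (F.fb (head G f))"
  proof (rule bij_betw_byWitness[where f'="\<lambda>p. (tail G f, snd p @ [f])"])
    show "\<forall>p\<in>?S. (tail G f, snd (head G f, butlast (snd p)) @ [f]) = p"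
      by (auto simp: fib_def append_butlast_last_id)
    show "(\<lambda>p. (head G f, butlast (snd p))) ` ?S \<subseteq> F.fb (head G f)"
      using path_last by (fastforce simp: fib_def)
    show "(\<lambda>p. (tail G f, snd p @ [f])) ` F.fb (head G f) \<subseteq> ?S"
      using path_snoc[OF _ f] by (fastforce simp: fib_def)
  qed (auto simp: fib_def)
  have "(\<lambda>q. (cmod (x q))\<^sup>2) summable_on F.fb (head G f)" using F.K_l2[OF x] by (simp add: l2_def)
  then have "(\<lambda>p. (cmod (x (head G f, butlast (snd p))))\<^sup>2) summable_on ?S"
    unfolding summable_on_reindex_bij_betw[OF bij, symmetric] .
  moreover have "(\<lambda>p. (cmod (x (head G f, butlast (snd p))))\<^sup>2) summable_on ?S \<longleftrightarrow>
      (\<lambda>p. (cmod (rcr G f x p))\<^sup>2) summable_on F.fb (tail G f)"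
    by (rule summable_on_cong_neutral) (auto simp: rcr_def fib_def)
  ultimately have 1: "rcr G f x \<in> l2 (F.fb (tail G f))" by (simp add: l2_def)
  have 0: "\<forall>p\<in>F.fb v. rcr G f x p = 0" if "v \<noteq> tail G f" for v
    using that path_last by (auto simp: rcr_def fib_def)
  have z: "rcr G f x \<in> l2 (F.fb v)" "l2n (F.fb v) (rcr G f x) = 0" if "v \<noteq> tail G f" for v
  proof -
    show "rcr G f x \<in> l2 (F.fb v)"
      by (rule l2_finite_support(1)) (use 0[OF that] in \<open>simp add: Collect_conv_if2 cong: conj_cong\<close>)
    then show "l2n (F.fb v) (rcr G f x) = 0" using 0[OF that] l2n_eq_0_iff by blast
  qed
  have "finite {v \<in> verts G. \<epsilon> \<le> l2n (F.fb v) (rcr G f x)}" if "\<epsilon> > 0" for \<epsilon>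
  proof (rule finite_subset[of _ "{tail G f}"])
    show "{v \<in> verts G. \<epsilon> \<le> l2n (F.fb v) (rcr G f x)} \<subseteq> {tail G f}" using z(2) that by force
  qed simp
  moreover have "rcr G f x \<in> l2 (F.fb v)" for v using 1 z by (cases "v = tail G f") auto
  moreover have "rcr G f x p = 0" if "p \<notin> paths G" for p using that by (simp add: rcr_def)
  ultimately show ?thesis by (simp add: hcar_def)
qed

text \<open>Deleting the last edge keeps the range of a path. This includes the path consisting of
  \<open>f\<close> alone, since the empty path that remains sits at \<open>head G f\<close>.\<close>

lemma rcr_left: "rcr G f (\<lambda>p. a (prng G p) * x p) = (\<lambda>p. a (prng G p) * rcr G f x p)"
proof
  fix p
  show "rcr G f (\<lambda>p. a (prng G p) * x p) p = a (prng G p) * rcr G f x p"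
    using path_last[of "fst p" "snd p"] by (auto simp: rcr_def)
qed

text \<open>The first and the last edge are handled independently; on a path of length one they
  coincide, and there both sides vanish.\<close>

lemma rcr_lcr: "rcr G f (lcr G \<xi> x) = lcr G \<xi> (rcr G f x)"
proof
  fix p
  show "rcr G f (lcr G \<xi> x) p = lcr G \<xi> (rcr G f x) p"
  proof (cases p rule: path_cases)
    case (2 q e)
    show ?thesis
    proof (cases "p \<in> paths G \<and> snd q \<noteq> []")
      case True
      then have p: "(fst q, e # snd q) \<in> paths G" "(fst q, snd q) \<in> paths G" "snd q \<noteq> []"
        using 2 by (auto simp: cons_path_def cons_path_paths paths_Cons)
      from path_last[OF p(1)] p(3) have "(head G (last (snd q)), e # butlast (snd q)) \<in> paths G" by simp
      then show ?thesis using p 2 True by (auto simp: rcr_def lcr_def cons_path_def)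
    next
      case False
      then show ?thesis using 2 by (auto simp: rcr_def lcr_def cons_path_def)
    qed
  qed (simp add: rcr_def)
qed

lemma rcr_delta:
  assumes "f \<in> arcs G" "(head G f, es) \<in> paths G"
  shows "rcr G f (delta (head G f, es)) = delta (tail G f, es @ [f])"
proof
  fix p
  have eq: "p = (tail G f, es @ [f])" if "p \<in> paths G" "snd p \<noteq> []" "last (snd p) = f" "butlast (snd p) = es"
  proof (rule prod_eqI)
    show "fst p = fst (tail G f, es @ [f])" using path_last[of "fst p" "snd p"] that by simp
    have "snd p = es @ [f]" using append_butlast_last_id[OF that(2)] unfolding that(3,4) by (rule sym)
    then show "snd p = snd (tail G f, es @ [f])" by simp
  qed
  show "rcr G f (delta (head G f, es)) p = delta (tail G f, es @ [f]) p"
  proof (cases "p = (tail G f, es @ [f])")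
    case True
    then show ?thesis using path_snoc[OF assms(2,1)] by (simp add: rcr_def delta_apply)
  next
    case False
    then show ?thesis using eq by (simp add: rcr_def delta_apply) blast
  qed
qed

text \<open>The commutant of right creation is a norm closed algebra containing the generators. It
  is in general not closed under adjoints, because removing the first edge of a path of length one
  also removes the last. This confines the argument to the tensor algebra.\<close>

lemma ptens_commutes:
  assumes f: "f \<in> arcs G" and T: "T \<in> ptens" and x: "x \<in> F.K"
  shows "T (rcr G f x) = rcr G f (T x)"
proof -
  let ?B = "{T \<in> adjointable F.H. \<forall>x\<in>F.K. T (rcr G f x) = rcr G f (T x)}"
  have lin: "rcr G f (\<lambda>p. y p + z p) = (\<lambda>p. rcr G f y p + rcr G f z p)" "rcr G f (\<lambda>p. c * y p) = (\<lambda>p. c * rcr G f y p)" for y z c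
    by (auto simp: rcr_def fun_eq_iff)
  have "closed_subalgebra F.H ?B"
    unfolding closed_subalgebra_def
  proof (intro conjI ballI allI impI)
    fix S T assume "S \<in> ?B" "T \<in> ?B"
    then have S: "S \<in> adjointable F.H" "\<And>x. x \<in> F.K \<Longrightarrow> S (rcr G f x) = rcr G f (S x)"
      and T: "T \<in> adjointable F.H" "\<And>x. x \<in> F.K \<Longrightarrow> T (rcr G f x) = rcr G f (T x)" by blast+
    show "op_add F.H S T \<in> ?B" "op_mult F.H S T \<in> ?B"
      using F.adjointable_ops(1,3)[OF S(1) T(1)]
      by (simp_all add: F.op_simps rcr_K f S(2) T(2) lin F.adjointable_K[OF T(1)])
  next
    fix T c assume "T \<in> ?B"
    then have T: "T \<in> adjointable F.H" "\<And>x. x \<in> F.K \<Longrightarrow> T (rcr G f x) = rcr G f (T x)" by blast+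
    show "op_scale F.H c T \<in> ?B"
      using F.adjointable_ops(2)[OF T(1,1)] by (simp add: F.op_simps rcr_K f T(2) lin)
  next
    fix t :: "nat \<Rightarrow> _" and T
    assume T: "T \<in> adjointable F.H" and t: "(\<forall>n. t n \<in> ?B) \<and>
      (\<lambda>n. op_norm F.H (op_add F.H (t n) (op_scale F.H (- 1) T))) \<longlonglongrightarrow> 0"
    have tA: "t n \<in> adjointable F.H" "\<And>x. x \<in> F.K \<Longrightarrow> t n (rcr G f x) = rcr G f (t n x)" for n using t by blast+
    note lim = F.op_norm_limit_pointwise[OF tA(1) T conjunct2[OF t]]
    have "T (rcr G f x) = rcr G f (T x)" if x: "x \<in> F.K" for x
    proof
      fix p
      have "(\<lambda>n. rcr G f (t n x) p) \<longlonglongrightarrow> T (rcr G f x) p"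
        using lim[OF rcr_K[OF f x], of p] by (simp add: tA(2)[OF x])
      moreover have "(\<lambda>n. rcr G f (t n x) p) \<longlonglongrightarrow> rcr G f (T x) p"
        unfolding rcr_def using lim[OF x] by auto
      ultimately show "T (rcr G f x) p = rcr G f (T x) p" by (rule LIMSEQ_unique)
    qed
    then show "T \<in> ?B" using T by blast
  qed blast
  moreover have "pgens \<subseteq> ?B"
  proof
    fix T assume "T \<in> pgens"
    then consider a where "a \<in> Acar (c0 (verts G))" "T = lop a" | \<xi> where "\<xi> \<in> A.K" "T = cop \<xi>"
      unfolding pgens_def pbase_def by blast
    then show "T \<in> ?B"
    proof cases
      case (1 a)
      then show ?thesis using lop_adjointable(1) rcr_K[OF f] by (simp add: lop_def rcr_left)
    next
      case (2 \<xi>)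
      then show ?thesis using cop_adjointable(1) rcr_K[OF f] by (simp add: cop_def rcr_lcr)
    qed
  qed
  ultimately have "ptens \<subseteq> ?B" unfolding ptens_def by (rule generated_algebra_least)
  then show ?thesis using T x by blast
qed

text \<open>A path ending in \<open>f\<close> arises from a shorter one by right creation, so
  induction from the right end reduces every path to a vacuum. \<open>D\<close> stands for the
  expected form of \<open>T\<close>: a creation operator or a multiplication.\<close>

lemma ptens_determined:
  assumes T: "T \<in> ptens" and D: "\<And>f x. D (rcr G f x) = rcr G f (D x)"
    and vac: "\<And>v. v \<in> verts G \<Longrightarrow> T (delta (v, [])) = D (delta (v, []))"
  shows "(v, es) \<in> paths G \<Longrightarrow> T (delta (v, es)) = D (delta (v, es))"
proof (induction es arbitrary: v rule: rev_induct)
  case Nil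
  then show ?case using vac by simp
next
  case (snoc f es)
  from path_last[OF snoc.prems] have 1: "v = tail G f" "(head G f, es) \<in> paths G" by simp_all
  have f: "f \<in> arcs G"
  proof -
    have "set es' \<subseteq> arcs G" if "path_ok G v es'" for es' using that by (induction es') auto
    from this[of "es @ [f]"] show ?thesis using snoc.prems by (simp add: paths_def)
  qed
  have d: "delta (v, es @ [f]) = rcr G f (delta (head G f, es))"
    unfolding rcr_delta[OF f 1(2)] 1(1) ..
  show ?case
    unfolding d ptens_commutes[OF f T F.K_delta[OF 1(2)]] snoc.IH[OF 1(2)] D ..
qed

end

text \<open>The row of the matrix at \<open>j\<close> is paired only with the fibre over
  \<open>s j\<close>, so an adjointable operator cannot move anything between fibres.\<close>

lemma (in fibred) fibre_support:
  assumes T: "T \<in> adjointable H" and i: "i \<in> I" and ne: "T (delta i) j \<noteq> 0"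
  shows "j \<in> I" "s j = s i"
proof -
  show j: "j \<in> I" using K_outside[OF adjointable_K[OF T K_delta[OF i]]] ne by blast
  show "s j = s i"
  proof (rule ccontr)
    assume "s j \<noteq> s i"
    then have "l2ip (fb (s j)) (\<lambda>k. cnj (T (delta k) j)) (delta i) = 0"
      unfolding l2ip_def by (intro infsum_0) (auto simp: fib_def delta_apply)
    then show False using adjointable_matrix[OF T K_delta[OF i] j] ne by simp
  qed
qed

lemma (in fibred) single_fibre_K:
  assumes "\<And>i. x i \<noteq> 0 \<Longrightarrow> i \<in> I \<and> s i = v" and "x \<in> l2 (fb v)"
  shows "x \<in> K" "hn x = l2n (fb v) x"
proof -
  have z: "x \<in> l2 (fb w) \<and> l2n (fb w) x = 0" if "w \<noteq> v" for w
  proof -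
    have 0: "\<forall>i\<in>fb w. x i = 0" using assms(1) that by (auto simp: fib_def)
    have "{i \<in> fb w. x i \<noteq> 0} = {}" using 0 by blast
    then have "finite {i \<in> fb w. x i \<noteq> 0}" by (rule ssubst) simp
    then have "x \<in> l2 (fb w)" by (rule l2_finite_support(1))
    then show ?thesis using 0 l2n_eq_0_iff by blast
  qed
  have "finite {w \<in> V. \<epsilon> \<le> l2n (fb w) x}" if "\<epsilon> > 0" for \<epsilon>
  proof (rule finite_subset[of _ "{v}"])
    show "{w \<in> V. \<epsilon> \<le> l2n (fb w) x} \<subseteq> {v}" using z that by force
  qed simp
  moreover have "x \<in> l2 (fb w)" for w using assms(2) z by (cases "w = v") auto
  moreover have "x i = 0" if "i \<notin> I" for i using that assms(1) by blast
  ultimately show k: "x \<in> K" by (simp add: hcar_def)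
  have "l2n (fb w) x \<le> l2n (fb v) x" for w using z[of w] by (cases "w = v") auto
  then have "hn x \<le> l2n (fb v) x" by (subst hn_le_iff[OF k]) simp
  then show "hn x = l2n (fb v) x" using l2n_le_hn[OF k, of v] by simp
qed

lemma (in fibred) delta_norm:
  assumes "i \<in> I" shows "hn (delta i) = 1" "l2n (fb (s i)) (delta i) = 1"
proof -
  have l: "delta i \<in> l2 (fb (s i))" by (rule K_l2[OF K_delta[OF assms]])
  have "complex_of_real ((l2n (fb (s i)) (delta i))\<^sup>2) = 1"
    unfolding l2ip_self[OF l, symmetric] inner_delta[OF assms] by (simp add: delta_apply)
  then have "(l2n (fb (s i)) (delta i))\<^sup>2 = 1" by (simp only: of_real_eq_1_iff)
  then show 1: "l2n (fb (s i)) (delta i) = 1" using l2n_nonneg[of "fb (s i)" "delta i"] by (simp add: power2_eq_1_iff)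
  have "hn (delta i) = l2n (fb (s i)) (delta i)"
    by (rule single_fibre_K(2)[OF _ l]) (auto simp: delta_apply assms split: if_splits)
  then show "hn (delta i) = 1" using 1 by simp
qed

section \<open>Elements of degree one and their norms\<close>

context graph
begin

lemma cop_linear:
  "cop (\<lambda>e. \<xi> e + \<eta> e) = op_add F.H (cop \<xi>) (cop \<eta>)" "cop (\<lambda>e. c * \<xi> e) = op_scale F.H c (cop \<xi>)"
  by (auto simp: cop_def op_add_def op_scale_def lcr_def fun_eq_iff algebra_simps)

lemma lop_delta: "p \<in> paths G \<Longrightarrow> lop a (delta p) = (\<lambda>q. a (prng G p) * delta p q)"
proof -
  assume "p \<in> paths G"
  then have "lop a (delta p) = (\<lambda>q. a (prng G q) * delta p q)" by (simp add: lop_def F.K_delta)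
  also have "\<dots> = (\<lambda>q. a (prng G p) * delta p q)" by (auto simp: delta_apply fun_eq_iff)
  finally show ?thesis .
qed

lemma lop_cop:
  assumes \<xi>: "\<xi> \<in> A.K" and supp: "\<And>e. \<xi> e \<noteq> 0 \<Longrightarrow> head G e = w"
  shows "op_mult F.H (lop (delta w)) (cop \<xi>) = cop \<xi>"
proof (rule F.op_ext)
  show E: "cop \<xi> \<in> F.K \<rightarrow>\<^sub>E F.K" using F.adjointable_E[OF cop_adjointable(1)[OF \<xi>]] .
  show "op_mult F.H (lop (delta w)) (cop \<xi>) \<in> F.K \<rightarrow>\<^sub>E F.K"
  proof (cases "w \<in> verts G")
    case True
    then show ?thesis
      using F.op_in_E(3)[OF F.adjointable_E[OF lop_adjointable(1)[OF c0_delta]] E] by blast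
  next
    case False
    \<comment> \<open>When \<open>w\<close> is no vertex, no edge ends there, and \<xi> has nothing
      to live on.\<close>
    have "\<xi> e = 0" for e using supp[of e] A.K_outside[OF \<xi>, of e] head_in[of e] False by metis
    then have "cop \<xi> x = (\<lambda>_. 0)" if "x \<in> F.K" for x using that by (auto simp: cop_def lcr_def)
    then have "op_mult F.H (lop (delta w)) (cop \<xi>) x = (\<lambda>_. 0)" if "x \<in> F.K" for x
      using that by (simp add: F.op_simps lop_def F.K_zero)
    then show ?thesis by (intro PiE_I) (simp_all add: F.K_zero op_mult_def compose_def)
  qed
  fix x assume x: "x \<in> F.K"
  have "delta w (prng G p) * lcr G \<xi> x p = lcr G \<xi> x p" for p
    using supp by (cases p rule: path_cases) (auto simp: lcr_def delta_apply)
  then have "(\<lambda>p. delta w (prng G p) * lcr G \<xi> x p) = lcr G \<xi> x" by (rule ext)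
  then show "op_mult F.H (lop (delta w)) (cop \<xi>) x = cop \<xi> x"
    using x by (simp add: F.op_simps lop_def cop_def lcr_K \<xi>)
qed

lemma cop_lop:
  assumes \<xi>: "\<xi> \<in> A.K" and v: "v \<in> verts G" and supp: "\<And>e. \<xi> e \<noteq> 0 \<Longrightarrow> tail G e = v"
  shows "op_mult F.H (cop \<xi>) (lop (delta v)) = cop \<xi>"
proof (rule F.op_ext)
  note E = F.adjointable_E[OF cop_adjointable(1)[OF \<xi>]] F.adjointable_E[OF lop_adjointable(1)[OF c0_delta[OF v]]]
  show "cop \<xi> \<in> F.K \<rightarrow>\<^sub>E F.K" "op_mult F.H (cop \<xi>) (lop (delta v)) \<in> F.K \<rightarrow>\<^sub>E F.K"
    by (rule E(1), rule F.op_in_E(3)[OF E])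
  fix x assume x: "x \<in> F.K"
  have "lcr G \<xi> (\<lambda>p. delta v (prng G p) * x p) p = lcr G \<xi> x p" for p
  proof (cases p rule: path_cases)
    case (2 q e)
    show ?thesis
    proof (cases "p \<in> paths G")
      case True
      then have pp: "cons_path q e \<in> paths G" and t: "tail G e = prng G q"
        using 2 by (simp_all add: cons_path_paths)
      show ?thesis unfolding 2 lcr_cons[OF pp] using supp[of e] t by (auto simp: delta_apply)
    qed (simp add: lcr_def)
  qed simp
  then show "op_mult F.H (cop \<xi>) (lop (delta v)) x = cop \<xi> x"
    using x F.K_left[OF x c0_delta[OF v]] by (simp add: F.op_simps lop_def cop_def fun_eq_iff)
qed

lemma l2n_lcr_delta:
  assumes \<eta>: "\<eta> \<in> A.K" and v: "v \<in> verts G"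
  shows "l2n (F.fb v) (lcr G \<eta> (delta (v, []))) = l2n (A.fb v) \<eta>"
proof -
  have "(l2n (F.fb v) (lcr G \<eta> (delta (v, []))))\<^sup>2 =
      (\<Sum>\<^sub>\<infinity>p\<in>F.fb v. (l2n (A.fb (prng G p)) \<eta>)\<^sup>2 * (cmod (delta (v, []) p))\<^sup>2)"
    using v by (intro lcr_l2(2)[OF \<eta>] F.K_l2 F.K_delta) simp
  also have "\<dots> = (\<Sum>\<^sub>\<infinity>p\<in>{(v, [] :: 'e list)}. (l2n (A.fb v) \<eta>)\<^sup>2)"
    by (rule infsum_cong_neutral) (use v in \<open>auto simp: delta_apply fib_def\<close>)
  finally show ?thesis by (simp add: power2_eq_iff_nonneg)
qed

text \<open>Creation is bounded by the norm of \<eta>, and the bound is attained at the unit vector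
  \<open>\<delta>\<^sub>v\<close> because \<eta> lives on edges starting at
  \<open>v\<close>.\<close>

lemma op_norm_cop:
  assumes \<eta>: "\<eta> \<in> A.K" and v: "v \<in> verts G" and supp: "\<And>e. \<eta> e \<noteq> 0 \<Longrightarrow> tail G e = v"
  shows "op_norm F.H (cop \<eta>) = l2n (A.fb v) \<eta>"
proof (rule antisym)
  have h: "A.hn \<eta> = l2n (A.fb v) \<eta>"
    by (rule A.single_fibre_K(2)[OF _ A.K_l2[OF \<eta>]]) (use supp A.K_outside[OF \<eta>] in blast)
  show "op_norm F.H (cop \<eta>) \<le> l2n (A.fb v) \<eta>"
    by (rule F.op_norm_le) (simp_all add: cop_def lcr_K(2)[OF \<eta>] h[symmetric] A.hn_nonneg[OF \<eta>])
  have p: "(v, []) \<in> paths G" using v by simp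
  note d = F.K_delta[OF p]
  have "l2n (A.fb v) \<eta> = l2n (F.fb v) (cop \<eta> (delta (v, [])))"
    using l2n_lcr_delta[OF \<eta> v] d by (simp add: cop_def)
  also have "\<dots> \<le> F.hn (cop \<eta> (delta (v, [])))"
    by (rule F.l2n_le_hn[OF F.adjointable_K[OF cop_adjointable(1)[OF \<eta>] d]])
  also have "\<dots> \<le> op_norm F.H (cop \<eta>) * F.hn (delta (v, []))"
    by (rule F.op_norm_nonneg_bound(2)[OF cop_adjointable(1)[OF \<eta>] d])
  finally show "l2n (A.fb v) \<eta> \<le> op_norm F.H (cop \<eta>)" using F.delta_norm(1)[OF p] by simp
qed

text \<open>Degree one and preservation of fibres confine \<open>T \<delta>\<^sub>v\<close> to
  single edges starting at \<open>v\<close>, and its coordinates there define \<eta>. The relation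
  \<open>Tv\<close> annihilates the other vacua, and an element of the tensor algebra is determined
  by its values on vacua.\<close>

lemma degree_one_eq_cop:
  assumes T: "T \<in> ptens" "T \<in> pdeg 1" and v: "v \<in> verts G"
    and Tv: "op_mult F.H T (lop (delta v)) = T"
  obtains \<eta> where "\<eta> \<in> A.K" "\<And>e. \<eta> e \<noteq> 0 \<Longrightarrow> tail G e = v" "T = cop \<eta>"
proof -
  have TA: "T \<in> adjointable F.H" using T(1) ptens_adjointable by blast
  have pv: "(u, []) \<in> paths G" if "u \<in> verts G" for u using that by simp
  define y where "y = T (delta (v, []))"
  define \<eta> where "\<eta> f = (if f \<in> arcs G \<and> tail G f = v then y (v, [f]) else 0)" for f
  have supp: "\<eta> f \<noteq> 0 \<Longrightarrow> f \<in> arcs G \<and> tail G f = v" for f by (simp add: \<eta>_def split: if_splits)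
  have yl: "y \<in> l2 (F.fb v)"
    unfolding y_def by (rule F.K_l2[OF F.adjointable_K[OF TA F.K_delta[OF pv[OF v]]]])
  have "\<eta> \<in> l2 (A.fb v)"
  proof -
    have "(\<lambda>f. (v, [f])) ` A.fb v \<subseteq> F.fb v" using v by (auto simp: fib_def paths_Cons)
    then have "(\<lambda>p. (cmod (y p))\<^sup>2) summable_on (\<lambda>f. (v, [f])) ` A.fb v"
      using yl unfolding l2_def mem_Collect_eq by (rule summable_on_subset_banach[rotated])
    then have "((\<lambda>p. (cmod (y p))\<^sup>2) \<circ> (\<lambda>f. (v, [f]))) summable_on A.fb v"
      by (subst (asm) summable_on_reindex) (auto simp: inj_on_def)
    then have "(\<lambda>f. (cmod (y (v, [f])))\<^sup>2) summable_on A.fb v" by (simp add: o_def)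
    moreover have "(\<lambda>f. (cmod (y (v, [f])))\<^sup>2) summable_on A.fb v \<longleftrightarrow> (\<lambda>f. (cmod (\<eta> f))\<^sup>2) summable_on A.fb v"
      by (rule summable_on_cong) (simp add: \<eta>_def fib_def)
    ultimately show ?thesis by (simp add: l2_def)
  qed
  note \<eta> = A.single_fibre_K(1)[OF supp this]
  have vac: "T (delta (u, [])) = lcr G \<eta> (delta (u, []))" if u: "u \<in> verts G" for u
  proof
    fix q
    show "T (delta (u, [])) q = lcr G \<eta> (delta (u, [])) q"
    proof (cases "u = v")
      case False
      have "T (delta (u, [])) = T (lop (delta v) (delta (u, [])))"
        using fun_cong[OF Tv, of "delta (u, [])"] F.K_delta[OF pv[OF u]] by (simp add: F.op_simps)
      also have "lop (delta v) (delta (u, [])) = (\<lambda>_. 0)"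
        using lop_delta[OF pv[OF u]] False by (simp add: delta_apply)
      finally have "T (delta (u, [])) q = 0" by (simp add: F.adjointable_zero[OF TA])
      moreover have "lcr G \<eta> (delta (u, [])) q = 0"
        using False supp by (cases q rule: path_cases) (auto simp: lcr_def delta_apply cons_path_paths)
      ultimately show ?thesis by simp
    next
      case True
      show ?thesis
      proof (cases "\<exists>f. q = (v, [f]) \<and> q \<in> paths G")
        case True
        then obtain f where f: "q = (v, [f])" "q \<in> paths G" by blast
        then have "f \<in> arcs G" "tail G f = v" by (simp_all add: paths_Cons)
        then show ?thesis using f \<open>u = v\<close> by (simp add: lcr_def \<eta>_def y_def delta_apply)
      next
        case False
        have "T (delta (u, [])) q = 0"
        proof (rule ccontr)
          assume ne: "T (delta (u, [])) q \<noteq> 0"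
          note s = F.fibre_support[OF TA pv[OF u] ne] pdeg_matrix[OF T(2) pv[OF u] ne]
          then have "length (snd q) = 1" by simp
          then obtain f where "snd q = [f]" by (auto simp: length_Suc_conv)
          then have "q = (v, [f])" using s \<open>u = v\<close> by (simp add: prod_eq_iff)
          then show False using False s by blast
        qed
        moreover have "lcr G \<eta> (delta (u, [])) q = 0"
          using False \<open>u = v\<close> by (cases q rule: path_cases) (auto simp: lcr_def delta_apply cons_path_def)
        ultimately show ?thesis by simp
      qed
    qed
  qed
  have "T = cop \<eta>"
  proof (rule F.adjointable_eqI[OF TA cop_adjointable(1)[OF \<eta>]])
    fix p assume p: "p \<in> paths G"
    have "T (delta (fst p, snd p)) = lcr G \<eta> (delta (fst p, snd p))"
      by (rule ptens_determined[OF T(1) rcr_lcr[symmetric] vac]) (use p in simp_all)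
    then show "T (delta p) = cop \<eta> (delta p)" using F.K_delta[OF p] by (simp add: cop_def)
  qed
  then show ?thesis using that \<eta> supp by blast
qed

text \<open>A substitute for the relation involving the adjoint of \<open>T\<close>, which may lie
  outside the tensor algebra: a quantity preserved by isometries is expressed through the value at
  one vector.\<close>

lemma op_norm_degree_one:
  assumes T: "T \<in> ptens" "T \<in> pdeg 1" and v: "v \<in> verts G"
    and Tv: "op_mult F.H T (lop (delta v)) = T"
  shows "op_norm F.H T = l2n (F.fb v) (T (delta (v, [])))"
proof -
  obtain \<eta> where \<eta>: "\<eta> \<in> A.K" "\<And>e. \<eta> e \<noteq> 0 \<Longrightarrow> tail G e = v" "T = cop \<eta>"
    using degree_one_eq_cop[OF T v Tv] by blast
  have "delta (v, []) \<in> F.K" by (rule F.K_delta) (simp add: v)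
  then show ?thesis
    using op_norm_cop[OF \<eta>(1) v \<eta>(2)] l2n_lcr_delta[OF \<eta>(1) v] by (simp add: \<eta>(3) cop_def)
qed

section \<open>Diagonal operators and vertex projections\<close>

text \<open>The entry depends only on the range of the path, and no decay is asked of
  \<open>t\<close>. The base algebra and the degree 0 part of the tensor algebra can thus be treated
  alike, with no need to show that a degree 0 element comes from
  \<open>c\<^sub>0(V)\<close>.\<close>

definition diag :: "(('v \<times> 'e list \<Rightarrow> complex) \<Rightarrow> 'v \<times> 'e list \<Rightarrow> complex) \<Rightarrow> bool" where
  "diag T \<longleftrightarrow> T \<in> adjointable F.H \<and> (\<exists>t. \<forall>p\<in>paths G. T (delta p) = (\<lambda>q. t (prng G p) * delta p q))"

lemma lop_diag: "a \<in> Acar (c0 (verts G)) \<Longrightarrow> diag (lop a)"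
  unfolding diag_def using lop_adjointable(1) lop_delta by blast

text \<open>Degree and fibre make each vacuum an eigenvector. Multiplication by \<open>t\<close> of
  the range commutes with right creation, so the eigenvalues propagate from the vacua to all
  paths.\<close>

lemma degree_zero_diag:
  assumes T: "T \<in> ptens" "T \<in> pdeg 0"
  shows "diag T"
proof -
  have TA: "T \<in> adjointable F.H" using T(1) ptens_adjointable by blast
  define t where "t v = T (delta (v, [])) (v, [])" for v
  have vac: "T (delta (v, [])) = (\<lambda>p. t (prng G p) * delta (v, []) p)" if v: "v \<in> verts G" for v
  proof
    fix q
    have p: "(v, []) \<in> paths G" using v by simp
    show "T (delta (v, [])) q = t (prng G q) * delta (v, []) q"
    proof (cases "q = (v, [])")
      case True
      then show ?thesis by (simp add: t_def delta_apply)
    next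
      case False
      have "T (delta (v, [])) q = 0"
      proof (rule ccontr)
        assume ne: "T (delta (v, [])) q \<noteq> 0"
        show False using F.fibre_support[OF TA p ne] pdeg_matrix[OF T(2) p ne] False by (simp add: prod_eq_iff)
      qed
      then show ?thesis using False by (simp add: delta_apply)
    qed
  qed
  have "T (delta p) = (\<lambda>q. t (prng G p) * delta p q)" if p: "p \<in> paths G" for p
  proof -
    have "T (delta (fst p, snd p)) = (\<lambda>q. t (prng G q) * delta (fst p, snd p) q)"
      by (rule ptens_determined[OF T(1) rcr_left[symmetric] vac]) (use p in simp_all)
    then show ?thesis by (auto simp: delta_apply fun_eq_iff)
  qed
  then show ?thesis unfolding diag_def using TA by blast
qed

text \<open>Only paths with range \<open>v\<close> survive the compression, and on all of them
  \<open>T\<close> has the same entry. This is the minimality of \<open>\<delta>\<^sub>v\<close> in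
  the form that an isomorphism transports.\<close>

lemma diag_compress:
  assumes T: "diag T" and v: "v \<in> verts G"
  shows "\<exists>c. op_mult F.H (lop (delta v)) (op_mult F.H T (lop (delta v))) = op_scale F.H c (lop (delta v))"
proof -
  obtain t where t: "\<And>p. p \<in> paths G \<Longrightarrow> T (delta p) = (\<lambda>q. t (prng G p) * delta p q)"
    and TA: "T \<in> adjointable F.H" using T unfolding diag_def by blast
  note L = lop_adjointable(1)[OF c0_delta[OF v]]
  have "op_mult F.H (lop (delta v)) (op_mult F.H T (lop (delta v))) = op_scale F.H (t v) (lop (delta v))"
  proof (rule F.adjointable_eqI)
    show "op_mult F.H (lop (delta v)) (op_mult F.H T (lop (delta v))) \<in> adjointable F.H"
      by (rule F.adjointable_ops(3)[OF L F.adjointable_ops(3)[OF TA L]])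
    show "op_scale F.H (t v) (lop (delta v)) \<in> adjointable F.H" by (rule F.adjointable_ops(2)[OF L L])
    fix p assume p: "p \<in> paths G"
    note d = F.K_delta[OF p]
    define c where "c = delta v (prng G p)"
    have l: "lop (delta v) (\<lambda>q. z * delta p q) = (\<lambda>q. z * (c * delta p q))" for z
      using F.adjointable_linear(2)[OF L d d, of z] by (simp add: lop_delta[OF p] c_def)
    have "op_mult F.H (lop (delta v)) (op_mult F.H T (lop (delta v))) (delta p) =
        lop (delta v) (T (lop (delta v) (delta p)))"
      using d by (simp add: F.op_simps)
    also have "lop (delta v) (delta p) = (\<lambda>q. c * delta p q)" unfolding c_def by (rule lop_delta[OF p])
    also have "T (\<lambda>q. c * delta p q) = (\<lambda>q. (c * t (prng G p)) * delta p q)"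
      unfolding F.adjointable_linear(2)[OF TA d d] t[OF p] by (simp add: mult.assoc)
    also have "lop (delta v) \<dots> = (\<lambda>q. (c * t (prng G p)) * (c * delta p q))" by (rule l)
    also have "\<dots> = (\<lambda>q. t v * (c * delta p q))" by (auto simp: c_def delta_apply fun_eq_iff)
    also have "\<dots> = op_scale F.H (t v) (lop (delta v)) (delta p)"
      using d by (simp add: F.op_simps lop_delta[OF p] c_def)
    finally show "op_mult F.H (lop (delta v)) (op_mult F.H T (lop (delta v))) (delta p) =
        op_scale F.H (t v) (lop (delta v)) (delta p)" .
  qed
  then show ?thesis by blast
qed

text \<open>The vertex projections are the minimal idempotents among the diagonal operators.\<close>

lemma diag_minimal:
  assumes q: "diag q" and idem: "op_mult F.H q q = q" and nz: "q \<noteq> op_scale F.H 0 q"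
    and min: "\<And>u. u \<in> verts G \<Longrightarrow> \<exists>c. op_mult F.H q (op_mult F.H (lop (delta u)) q) = op_scale F.H c q"
  shows "\<exists>u\<in>verts G. q = lop (delta u)"
proof -
  obtain t where t: "\<And>p. p \<in> paths G \<Longrightarrow> q (delta p) = (\<lambda>i. t (prng G p) * delta p i)"
    and qA: "q \<in> adjointable F.H" using q unfolding diag_def by blast
  have lin: "q (\<lambda>i. c * delta p i) = (\<lambda>i. c * (t (prng G p) * delta p i))" if "p \<in> paths G" for c p
    using F.adjointable_linear(2)[OF qA F.K_delta[OF that] F.K_delta[OF that], of c] t[OF that] by simp
  have "\<exists>u\<in>verts G. t u \<noteq> 0"
  proof (rule ccontr)
    assume neg: "\<not> ?thesis"
    have "q = op_scale F.H 0 q"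
    proof (rule F.adjointable_eqI[OF qA F.adjointable_ops(2)[OF qA qA]])
      fix p assume p: "p \<in> paths G"
      then have "t (prng G p) = 0" using neg prng_in by blast
      then show "q (delta p) = op_scale F.H 0 q (delta p)"
        using t[OF p] F.K_delta[OF p] by (simp add: F.op_simps)
    qed
    then show False using nz by blast
  qed
  then obtain u where u: "u \<in> verts G" "t u \<noteq> 0" by blast
  have tt: "t w * t w = t w" if w: "w \<in> verts G" for w
  proof -
    have p: "(w, []) \<in> paths G" using w by simp
    have "op_mult F.H q q (delta (w, [])) (w, []) = q (delta (w, [])) (w, [])" using idem by simp
    moreover have "op_mult F.H q q (delta (w, [])) = (\<lambda>i. t w * (t w * delta (w, []) i))"
      using F.K_delta[OF p] lin[OF p, of "t w"] by (simp add: F.op_simps t[OF p])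
    ultimately show ?thesis by (simp add: t[OF p] delta_apply)
  qed
  then have tu: "t u = 1" using u by (metis mult_cancel_right1)
  obtain c where c: "op_mult F.H q (op_mult F.H (lop (delta u)) q) = op_scale F.H c q" using min[OF u(1)] by blast
  \<comment> \<open>The relation \<open>q \<delta>\<^sub>u q = c q\<close> is read off at the vacuum
    of \<open>w\<close>: at \<open>u\<close> it gives \<open>c = 1\<close>, and elsewhere it then
    forces \<open>t w = 0\<close>.\<close>
  have key: "t w * delta u w * t w = c * t w" if w: "w \<in> verts G" for w
  proof -
    have p: "(w, []) \<in> paths G" using w by simp
    note d = F.K_delta[OF p]
    have "op_mult F.H q (op_mult F.H (lop (delta u)) q) (delta (w, [])) (w, []) = op_scale F.H c q (delta (w, [])) (w, [])"
      unfolding c ..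
    moreover have "lop (delta u) (\<lambda>i. t w * delta (w, []) i) = (\<lambda>i. t w * (delta u w * delta (w, []) i))"
      using F.adjointable_linear(2)[OF lop_adjointable(1)[OF c0_delta[OF u(1)]] d d, of "t w"] lop_delta[OF p, of "delta u"]
      by simp
    moreover have "q (\<lambda>i. t w * (delta u w * delta (w, []) i)) = (\<lambda>i. t w * delta u w * (t w * delta (w, []) i))"
      using lin[OF p, of "t w * delta u w"] by (simp add: mult.assoc)
    ultimately show ?thesis using d by (simp add: F.op_simps t[OF p] delta_apply[of "(w, [])"])
  qed
  have "c = 1" using key[OF u(1)] tu by (simp add: delta_apply)
  then have tw: "t w = delta u w" if "w \<in> verts G" for w
    using key[OF that] tu by (cases "w = u") (simp_all add: delta_apply)
  have "q = lop (delta u)"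
  proof (rule F.adjointable_eqI[OF qA lop_adjointable(1)[OF c0_delta[OF u(1)]]])
    fix p assume p: "p \<in> paths G"
    show "q (delta p) = lop (delta u) (delta p)" using t[OF p] lop_delta[OF p] tw[OF prng_in[OF p]] by simp
  qed
  then show ?thesis using u(1) by blast
qed

lemma lop_delta_inj:
  assumes "v \<in> verts G" "lop (delta v) = lop (delta w)" shows "v = w"
proof -
  have p: "(v, []) \<in> paths G" using assms(1) by simp
  have "lop (delta v) (delta (v, [])) (v, []) = lop (delta w) (delta (v, [])) (v, [])" using assms(2) by simp
  then show ?thesis using p by (simp add: lop_delta delta_apply split: if_splits)
qed

lemma lop_delta_nonzero:
  assumes "v \<in> verts G" shows "lop (delta v) \<noteq> op_scale F.H 0 (lop (delta v))"
proof
  have p: "(v, []) \<in> paths G" using assms(1) by simp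
  assume "lop (delta v) = op_scale F.H 0 (lop (delta v))"
  then have "lop (delta v) (delta (v, [])) (v, []) = op_scale F.H 0 (lop (delta v)) (delta (v, [])) (v, [])" by simp
  then show False using p F.K_delta[OF p] by (simp add: F.op_simps lop_delta delta_apply)
qed

lemma lop_delta_idem:
  assumes "v \<in> verts G" shows "op_mult F.H (lop (delta v)) (lop (delta v)) = lop (delta v)"
proof (rule F.adjointable_eqI)
  note L = lop_adjointable(1)[OF c0_delta[OF assms]]
  show "lop (delta v) \<in> adjointable F.H" "op_mult F.H (lop (delta v)) (lop (delta v)) \<in> adjointable F.H"
    by (rule L, rule F.adjointable_ops(3)[OF L L])
  fix p assume p: "p \<in> paths G"
  note d = F.K_delta[OF p]
  show "op_mult F.H (lop (delta v)) (lop (delta v)) (delta p) = lop (delta v) (delta p)"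
    using d F.adjointable_linear(2)[OF L d d] by (simp add: F.op_simps lop_delta[OF p]) (auto simp: delta_apply fun_eq_iff)
qed

end

text \<open>The point masses of edges from \<open>v\<close> to \<open>w\<close> are orthonormal in
  the fibre over \<open>v\<close>. By linearity the norms of all their finite combinations are
  preserved, which is the form of orthonormality that the dimension argument takes.\<close>

lemma (in graph) isometry_edges_inj:
  assumes add: "\<And>\<xi> \<eta>. \<xi> \<in> A.K \<Longrightarrow> \<eta> \<in> A.K \<Longrightarrow> Y (\<lambda>e. \<xi> e + \<eta> e) = (\<lambda>f. Y \<xi> f + Y \<eta> f)"
    and scale: "\<And>\<xi> c. \<xi> \<in> A.K \<Longrightarrow> Y (\<lambda>e. c * \<xi> e) = (\<lambda>f. c * Y \<xi> f)"
    and l2: "\<And>\<xi>. \<xi> \<in> A.K \<Longrightarrow> (\<And>e. \<xi> e \<noteq> 0 \<Longrightarrow> e \<in> edges_between G v w) \<Longrightarrow> Y \<xi> \<in> l2 B"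
    and norm: "\<And>\<xi>. \<xi> \<in> A.K \<Longrightarrow> (\<And>e. \<xi> e \<noteq> 0 \<Longrightarrow> e \<in> edges_between G v w) \<Longrightarrow>
      l2n B (Y \<xi>) = l2n (A.fb v) \<xi>"
  shows "\<exists>g. inj_on g (edges_between G v w) \<and> g ` edges_between G v w \<subseteq> B"
proof (rule orthonormal_family_inj[where u="\<lambda>e. Y (delta e)"])
  let ?A = "edges_between G v w"
  have dK: "delta e \<in> A.K" "\<And>e'. delta e e' \<noteq> 0 \<Longrightarrow> e' \<in> ?A" if "e \<in> ?A" for e
    using that A.K_delta by (auto simp: edges_between_def delta_apply split: if_splits)
  show "Y (delta e) \<in> l2 B" if "e \<in> ?A" for e by (rule l2[OF dK[OF that]])
  define comb where "comb F c = (\<lambda>e. if e \<in> F then c e else 0)" for F and c :: "'e \<Rightarrow> complex"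
  have combK: "comb F c \<in> A.K" if "finite F" "F \<subseteq> ?A" for F c
  proof (rule A.K_finite_support)
    show "finite {e. comb F c e \<noteq> 0}" by (rule finite_subset[OF _ that(1)]) (auto simp: comb_def)
    show "{e. comb F c e \<noteq> 0} \<subseteq> arcs G" using that(2) by (auto simp: comb_def edges_between_def)
  qed
  have Ycomb: "Y (comb F c) = (\<lambda>f. \<Sum>e\<in>F. c e * Y (delta e) f)" if "finite F" "F \<subseteq> ?A" for F c
    using that
  proof (induction F)
    case empty
    show ?case using scale[OF A.K_zero, of 0] by (simp add: comb_def)
  next
    case (insert e F)
    then have e: "e \<in> ?A" "F \<subseteq> ?A" by auto
    have "comb (insert e F) c = (\<lambda>e'. c e * delta e e' + comb F c e')"
      using insert.hyps by (auto simp: comb_def delta_apply fun_eq_iff)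
    then show ?case
      using add[OF A.K_scale[OF dK(1)[OF e(1)]] combK[OF insert.hyps(1) e(2)]] scale[OF dK(1)[OF e(1)]] insert e by simp
  qed
  fix F c assume F: "finite F" "F \<subseteq> ?A"
  have s: "e \<in> ?A" if "comb F c e \<noteq> 0" for e using that F(2) by (auto simp: comb_def split: if_splits)
  have "l2n B (\<lambda>f. \<Sum>e\<in>F. c e * Y (delta e) f) = l2n (A.fb v) (comb F c)"
    using norm[OF combK[OF F] s] by (simp only: Ycomb[OF F])
  moreover have "(l2n (A.fb v) (comb F c))\<^sup>2 = (\<Sum>e\<in>F. (cmod (c e))\<^sup>2)"
  proof -
    have sub: "{e \<in> A.fb v. comb F c e \<noteq> 0} \<subseteq> F" by (auto simp: comb_def)
    have "(l2n (A.fb v) (comb F c))\<^sup>2 = (\<Sum>e | e \<in> A.fb v \<and> comb F c e \<noteq> 0. (cmod (comb F c e))\<^sup>2)"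
      by (rule l2_finite_support(2)) (rule finite_subset[OF sub F(1)])
    also have "\<dots> = (\<Sum>e\<in>F. (cmod (c e))\<^sup>2)"
      by (rule sum.mono_neutral_cong_left[OF F(1) sub])
        (use F(2) in \<open>auto simp: comb_def fib_def edges_between_def\<close>)
    finally show ?thesis .
  qed
  ultimately show "(l2n B (\<lambda>f. \<Sum>e\<in>F. c e * Y (delta e) f))\<^sup>2 = (\<Sum>e\<in>F. (cmod (c e))\<^sup>2)" by simp
qed

lemma algebra_isoD:
  assumes "algebra_iso X B Y C \<psi>"
  shows "bij_betw \<psi> B C" "T \<in> B \<Longrightarrow> \<psi> T \<in> C"
    and "S \<in> B \<Longrightarrow> T \<in> B \<Longrightarrow> \<psi> (op_add X S T) = op_add Y (\<psi> S) (\<psi> T)"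
    and "S \<in> B \<Longrightarrow> T \<in> B \<Longrightarrow> \<psi> (op_mult X S T) = op_mult Y (\<psi> S) (\<psi> T)"
    and "T \<in> B \<Longrightarrow> \<psi> (op_scale X c T) = op_scale Y c (\<psi> T)"
proof -
  show b: "bij_betw \<psi> B C" using assms by (simp add: algebra_iso_def)
  show "T \<in> B \<Longrightarrow> \<psi> T \<in> C" by (rule bij_betw_apply[OF b])
qed (use assms in \<open>simp_all add: algebra_iso_def\<close>)

lemma inv_into_hom:
  assumes "bij_betw \<psi> B C" "T \<in> B" "\<psi> T = S"
  shows "inv_into B \<psi> S = T"
  using assms by (auto simp: bij_betw_def)

lemma algebra_iso_inv:
  assumes iso: "algebra_iso X B Y C \<psi>" and B: "closed_subalgebra X B"
  shows "algebra_iso Y C X B (inv_into B \<psi>)"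
proof -
  note \<psi> = algebra_isoD[OF iso] and cl = closed_subalgebraD[OF B]
  let ?i = "inv_into B \<psi>"
  have i: "?i S \<in> B" "\<psi> (?i S) = S" if "S \<in> C" for S
    using \<psi>(1) that by (auto simp: bij_betw_def inv_into_into f_inv_into_f)
  show ?thesis unfolding algebra_iso_def
  proof (intro conjI ballI allI)
    show "bij_betw ?i C B" by (rule bij_betw_inv_into[OF \<psi>(1)])
    fix S T assume S: "S \<in> C" and T: "T \<in> C"
    show "?i (op_add Y S T) = op_add X (?i S) (?i T)"
      by (rule inv_into_hom[OF \<psi>(1) cl(2)[OF i(1)[OF S] i(1)[OF T]]]) (simp add: \<psi>(3) i S T)
    show "?i (op_mult Y S T) = op_mult X (?i S) (?i T)"
      by (rule inv_into_hom[OF \<psi>(1) cl(3)[OF i(1)[OF S] i(1)[OF T]]]) (simp add: \<psi>(4) i S T)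
  next
    fix S c assume S: "S \<in> C"
    show "?i (op_scale Y c S) = op_scale X c (?i S)"
      by (rule inv_into_hom[OF \<psi>(1) cl(4)[OF i(1)[OF S]]]) (simp add: \<psi>(5) i S)
  qed
qed

lemma star_iso_inv:
  assumes iso: "star_iso X B Y C \<psi>" and B: "closed_star_subalgebra X B"
  shows "star_iso Y C X B (inv_into B \<psi>)"
proof -
  have a: "algebra_iso X B Y C \<psi>" using iso by (simp add: star_iso_def)
  note \<psi> = algebra_isoD[OF a]
  have i: "inv_into B \<psi> S \<in> B" "\<psi> (inv_into B \<psi> S) = S" if "S \<in> C" for S
    using \<psi>(1) that by (auto simp: bij_betw_def inv_into_into f_inv_into_f)
  have "inv_into B \<psi> (op_adj Y S) = op_adj X (inv_into B \<psi> S)" if S: "S \<in> C" for S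
  proof (rule inv_into_hom[OF \<psi>(1)])
    show "op_adj X (inv_into B \<psi> S) \<in> B" using B i(1)[OF S] by (simp add: closed_star_subalgebra_def)
    show "\<psi> (op_adj X (inv_into B \<psi> S)) = op_adj Y S" using iso i[OF S] by (simp add: star_iso_def)
  qed
  moreover have "algebra_iso Y C X B (inv_into B \<psi>)"
    by (rule algebra_iso_inv[OF a]) (use B in \<open>simp add: closed_star_subalgebra_def\<close>)
  ultimately show ?thesis by (simp add: star_iso_def)
qed

lemma inv_into_image:
  assumes "bij_betw \<psi> B C" "D \<subseteq> B" "\<psi> ` D = E"
  shows "inv_into B \<psi> ` E = D"
  unfolding assms(3)[symmetric] using assms(1,2) by (simp add: bij_betw_def inv_into_image_cancel)

section \<open>Comparison of two graphs\<close>

locale two_graphs = G1: graph G + G2: graph G'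
  for G :: "('v, 'e) pre_digraph" and G' :: "('w, 'f) pre_digraph"
begin

text \<open>\<open>D1\<close> and \<open>D2\<close> stand for the base algebras or for the degree 0
  parts. The image of \<open>\<delta>\<^sub>v\<close> is a nonzero idempotent, and it is minimal
  because each vertex projection of the second graph comes from \<open>D1\<close>, where compression
  by \<open>\<delta>\<^sub>v\<close> yields a multiple of \<open>\<delta>\<^sub>v\<close>.\<close>

lemma vertex_map:
  assumes iso: "algebra_iso G1.F.H B1 G2.F.H B2 \<psi>" and D: "D1 \<subseteq> B1" "\<psi> ` D1 = D2"
    and cl: "closed_subalgebra G1.F.H B1" and D1: "\<And>T. T \<in> D1 \<Longrightarrow> G1.diag T" and D2: "\<And>T. T \<in> D2 \<Longrightarrow> G2.diag T"
    and lop1: "\<And>v. v \<in> verts G \<Longrightarrow> G1.lop (delta v) \<in> D1" and lop2: "\<And>w. w \<in> verts G' \<Longrightarrow> G2.lop (delta w) \<in> D2"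
    and v: "v \<in> verts G"
  shows "\<exists>w\<in>verts G'. \<psi> (G1.lop (delta v)) = G2.lop (delta w)"
proof (rule G2.diag_minimal)
  note \<psi> = algebra_isoD[OF iso]
  have L: "G1.lop (delta v) \<in> B1" using lop1[OF v] D(1) by blast
  show "G2.diag (\<psi> (G1.lop (delta v)))" using D2 lop1[OF v] D(2) by blast
  show "op_mult G2.F.H (\<psi> (G1.lop (delta v))) (\<psi> (G1.lop (delta v))) = \<psi> (G1.lop (delta v))"
    unfolding \<psi>(4)[OF L L, symmetric] G1.lop_delta_idem[OF v] ..
  show "\<psi> (G1.lop (delta v)) \<noteq> op_scale G2.F.H 0 (\<psi> (G1.lop (delta v)))"
  proof
    assume "\<psi> (G1.lop (delta v)) = op_scale G2.F.H 0 (\<psi> (G1.lop (delta v)))"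
    then have "\<psi> (G1.lop (delta v)) = \<psi> (op_scale G1.F.H 0 (G1.lop (delta v)))" using \<psi>(5)[OF L] by simp
    then have "G1.lop (delta v) = op_scale G1.F.H 0 (G1.lop (delta v))"
      by (rule inj_onD[OF bij_betw_imp_inj_on[OF \<psi>(1)] _ L closed_subalgebraD(4)[OF cl L]])
    then show False using G1.lop_delta_nonzero[OF v] by blast
  qed
  fix w assume w: "w \<in> verts G'"
  obtain S where S: "S \<in> D1" "G2.lop (delta w) = \<psi> S" using lop2[OF w] D(2) by blast
  have SB: "S \<in> B1" using S(1) D(1) by blast
  obtain c where c: "op_mult G1.F.H (G1.lop (delta v)) (op_mult G1.F.H S (G1.lop (delta v))) =
      op_scale G1.F.H c (G1.lop (delta v))"
    using G1.diag_compress[OF D1[OF S(1)] v] by blast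
  have "op_mult G2.F.H (\<psi> (G1.lop (delta v))) (op_mult G2.F.H (G2.lop (delta w)) (\<psi> (G1.lop (delta v)))) =
      op_scale G2.F.H c (\<psi> (G1.lop (delta v)))"
    unfolding S(2) \<psi>(4)[OF SB L, symmetric] \<psi>(4)[OF L closed_subalgebraD(3)[OF cl SB L], symmetric] c
    by (rule \<psi>(5)[OF L])
  then show "\<exists>c. op_mult G2.F.H (\<psi> (G1.lop (delta v))) (op_mult G2.F.H (G2.lop (delta w)) (\<psi> (G1.lop (delta v)))) =
      op_scale G2.F.H c (\<psi> (G1.lop (delta v)))" by blast
qed

text \<open>The images \<open>\<psi>(T\<^sub>e) \<delta>\<^sub>\<sigma>\<^sub>v\<close> for edges \<open>e\<close> from \<open>v\<close> to \<open>w\<close> are supported on edges from \<open>\<sigma> v\<close> to \<open>\<sigma> w\<close>,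
  and orthonormal.\<close>

lemma edges_leI:
  assumes iso: "algebra_iso G1.F.H B1 G2.F.H B2 \<psi>" and gens: "G1.pgens \<subseteq> B1" and cl: "closed_subalgebra G1.F.H B1"
    and adj2: "B2 \<subseteq> adjointable G2.F.H"
    and deg: "\<And>\<xi>. \<xi> \<in> G1.A.K \<Longrightarrow> \<psi> (G1.cop \<xi>) \<in> G2.pdeg 1"
    and \<sigma>: "\<And>v. v \<in> verts G \<Longrightarrow> \<sigma> v \<in> verts G'"
    and vert: "\<And>v. v \<in> verts G \<Longrightarrow> \<psi> (G1.lop (delta v)) = G2.lop (delta (\<sigma> v))"
    and norm: "\<And>v \<xi>. v \<in> verts G \<Longrightarrow> \<xi> \<in> G1.A.K \<Longrightarrow> (\<And>e. \<xi> e \<noteq> 0 \<Longrightarrow> tail G e = v) \<Longrightarrow>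
      l2n (G2.F.fb (\<sigma> v)) (\<psi> (G1.cop \<xi>) (delta (\<sigma> v, []))) = l2n (G1.A.fb v) \<xi>"
  shows "edges_le G G' \<sigma>"
  unfolding edges_le_def
proof (intro ballI)
  fix v w assume v: "v \<in> verts G" and w: "w \<in> verts G"
  note \<psi> = algebra_isoD[OF iso]
  let ?A = "edges_between G v w" and ?B = "edges_between G' (\<sigma> v) (\<sigma> w)"
  let ?\<Omega> = "delta (\<sigma> v, []) :: 'w \<times> 'f list \<Rightarrow> complex"
  have p: "(\<sigma> v, []) \<in> paths G'" using \<sigma>[OF v] by simp
  note \<Omega> = G2.F.K_delta[OF p]
  have cB: "G1.cop \<xi> \<in> B1" if "\<xi> \<in> G1.A.K" for \<xi> using gens that unfolding G1.pgens_def by blast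
  have LB: "G1.lop (delta u) \<in> B1" if "u \<in> verts G" for u
    using gens c0_delta[OF that] unfolding G1.pgens_def G1.pbase_def by blast
  have TA: "\<psi> (G1.cop \<xi>) \<in> adjointable G2.F.H" if "\<xi> \<in> G1.A.K" for \<xi> using \<psi>(2)[OF cB[OF that]] adj2 by blast
  define Y where "Y \<xi> = \<psi> (G1.cop \<xi>) ?\<Omega>" for \<xi>
  have YK: "Y \<xi> \<in> G2.F.K" if "\<xi> \<in> G1.A.K" for \<xi> unfolding Y_def by (rule G2.F.adjointable_K[OF TA[OF that] \<Omega>])
  \<comment> \<open>Preservation of fibres fixes the source, the degree fixes the length, and
    multiplication from the left by the projection of \<open>\<sigma> w\<close> fixes the
    range.\<close>
  have supp: "\<exists>f\<in>?B. q = (\<sigma> v, [f])" if \<xi>: "\<xi> \<in> G1.A.K" "\<And>e. \<xi> e \<noteq> 0 \<Longrightarrow> e \<in> ?A" and ne: "Y \<xi> q \<noteq> 0" for \<xi> q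
  proof -
    note s = G2.F.fibre_support[OF TA[OF \<xi>(1)] p ne[unfolded Y_def]]
    have "length (snd q) = 1" using G2.pdeg_matrix[OF deg[OF \<xi>(1)] p ne[unfolded Y_def]] by simp
    then obtain f where f: "snd q = [f]" by (auto simp: length_Suc_conv)
    have q: "q = (\<sigma> v, [f])" using f s by (simp add: prod_eq_iff)
    have e: "f \<in> arcs G'" "tail G' f = \<sigma> v" using s(1) unfolding q by (simp_all add: paths_Cons)
    have "op_mult G1.F.H (G1.lop (delta w)) (G1.cop \<xi>) = G1.cop \<xi>"
      by (rule G1.lop_cop[OF \<xi>(1)]) (use \<xi>(2) in \<open>simp add: edges_between_def\<close>)
    then have "\<psi> (G1.cop \<xi>) = op_mult G2.F.H (G2.lop (delta (\<sigma> w))) (\<psi> (G1.cop \<xi>))"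
      using \<psi>(4)[OF LB[OF w] cB[OF \<xi>(1)]] vert[OF w] by simp
    then have "Y \<xi> q = G2.lop (delta (\<sigma> w)) (Y \<xi>) q"
      unfolding Y_def using \<Omega> by (metis G2.F.op_simps(3))
    also have "\<dots> = delta (\<sigma> w) (prng G' q) * Y \<xi> q" using YK[OF \<xi>(1)] by (simp add: G2.lop_def)
    finally have "head G' f = \<sigma> w" using ne q by (simp add: delta_apply split: if_splits)
    then show ?thesis using e q by (auto simp: edges_between_def)
  qed
  have Yl2: "(\<lambda>f. Y \<xi> (\<sigma> v, [f])) \<in> l2 ?B" "l2n ?B (\<lambda>f. Y \<xi> (\<sigma> v, [f])) = l2n (G1.A.fb v) \<xi>"
    if \<xi>: "\<xi> \<in> G1.A.K" "\<And>e. \<xi> e \<noteq> 0 \<Longrightarrow> e \<in> ?A" for \<xi>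
  proof -
    let ?h = "\<lambda>f. (\<sigma> v, [f])" and ?y = "\<lambda>q. (cmod (Y \<xi> q))\<^sup>2"
    have inj: "inj_on ?h ?B" by (auto simp: inj_on_def)
    have sub: "?h ` ?B \<subseteq> G2.F.fb (\<sigma> v)" using \<sigma>[OF v] by (auto simp: fib_def paths_Cons edges_between_def)
    have "?y summable_on ?h ` ?B"
      by (rule summable_on_subset_banach[OF _ sub]) (use G2.F.K_l2[OF YK[OF \<xi>(1)]] in \<open>simp add: l2_def\<close>)
    then show "(\<lambda>f. Y \<xi> (\<sigma> v, [f])) \<in> l2 ?B"
      unfolding summable_on_reindex[OF inj] by (simp add: l2_def o_def)
    \<comment> \<open>By \<open>supp\<close> the fibre over \<open>\<sigma> v\<close> contributes
      only through single edges in \<open>?B\<close>, so no part of the norm is lost.\<close>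
    have "infsum ?y (G2.F.fb (\<sigma> v)) = infsum ?y (?h ` ?B)"
    proof (rule infsum_cong_neutral)
      fix q assume "q \<in> G2.F.fb (\<sigma> v) - ?h ` ?B"
      then have "\<not> (\<exists>f\<in>?B. q = ?h f)" by blast
      then have "Y \<xi> q = 0" using supp[OF \<xi>] by blast
      then show "?y q = 0" by simp
    qed (use sub in auto)
    also have "\<dots> = infsum (?y \<circ> ?h) ?B" by (rule infsum_reindex[OF inj])
    finally have "l2n ?B (\<lambda>f. Y \<xi> (\<sigma> v, [f])) = l2n (G2.F.fb (\<sigma> v)) (Y \<xi>)" by (simp add: l2n_def o_def)
    also have "\<dots> = l2n (G1.A.fb v) \<xi>"
      unfolding Y_def by (rule norm[OF v \<xi>(1)]) (use \<xi>(2) in \<open>simp add: edges_between_def\<close>)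
    finally show "l2n ?B (\<lambda>f. Y \<xi> (\<sigma> v, [f])) = l2n (G1.A.fb v) \<xi>" .
  qed
  show "\<exists>g. inj_on g ?A \<and> g ` ?A \<subseteq> ?B"
  proof (rule G1.isometry_edges_inj[where Y="\<lambda>\<xi> f. Y \<xi> (\<sigma> v, [f])", OF _ _ Yl2])
    fix \<xi> \<eta> :: "'e \<Rightarrow> complex" and c
    assume \<xi>: "\<xi> \<in> G1.A.K"
    show "(\<lambda>f. Y (\<lambda>e. c * \<xi> e) (\<sigma> v, [f])) = (\<lambda>f. c * Y \<xi> (\<sigma> v, [f]))"
      using \<Omega> by (simp add: Y_def G1.cop_linear(2) \<psi>(5)[OF cB[OF \<xi>]] G2.F.op_simps)
    assume \<eta>: "\<eta> \<in> G1.A.K"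
    show "(\<lambda>f. Y (\<lambda>e. \<xi> e + \<eta> e) (\<sigma> v, [f])) = (\<lambda>f. Y \<xi> (\<sigma> v, [f]) + Y \<eta> (\<sigma> v, [f]))"
      using \<Omega> by (simp add: Y_def G1.cop_linear(1) \<psi>(3)[OF cB[OF \<xi>] cB[OF \<eta>]] G2.F.op_simps)
  qed
qed

text \<open>For \<xi> on edges starting at \<open>v\<close>,
  \<open>T\<^sub>\<xi>\<^sup>*T\<^sub>\<xi>\<close> is
  \<open>\<parallel>\<xi>\<parallel>\<^sup>2\<close> times \<open>\<delta>\<^sub>v\<close>. A star
  isomorphism carries this relation over, and pairing it with the vacuum at
  \<open>\<sigma> v\<close> gives the norm identity.\<close>

lemma star_iso_edges_le:
  assumes iso: "star_iso G1.F.H G1.ptoep G2.F.H G2.ptoep \<psi>" and deg: "\<psi> ` G1.pdeg 1 = G2.pdeg 1"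
    and \<sigma>: "\<And>v. v \<in> verts G \<Longrightarrow> \<sigma> v \<in> verts G'"
    and vert: "\<And>v. v \<in> verts G \<Longrightarrow> \<psi> (G1.lop (delta v)) = G2.lop (delta (\<sigma> v))"
  shows "edges_le G G' \<sigma>"
proof (rule edges_leI)
  show a: "algebra_iso G1.F.H G1.ptoep G2.F.H G2.ptoep \<psi>" using iso by (simp add: star_iso_def)
  show cl: "closed_subalgebra G1.F.H G1.ptoep" using G1.ptoep_closed by (simp add: closed_star_subalgebra_def)
  show "\<psi> (G1.cop \<xi>) \<in> G2.pdeg 1" if "\<xi> \<in> G1.A.K" for \<xi> using deg G1.cop_pdeg[OF that] by blast
  note \<psi> = algebra_isoD[OF a]
  fix v \<xi> assume v: "v \<in> verts G" and \<xi>: "\<xi> \<in> G1.A.K" and supp: "\<And>e. \<xi> e \<noteq> 0 \<Longrightarrow> tail G e = v"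
  let ?T = "\<psi> (G1.cop \<xi>)" and ?\<Omega> = "delta (\<sigma> v, []) :: 'w \<times> 'f list \<Rightarrow> complex"
  define c where "c = complex_of_real ((l2n (G1.A.fb v) \<xi>)\<^sup>2)"
  have CB: "G1.cop \<xi> \<in> G1.ptoep" using G1.pgens_ptoep \<xi> unfolding G1.pgens_def by blast
  have LB: "G1.lop (delta v) \<in> G1.ptoep"
    using G1.pgens_ptoep c0_delta[OF v] unfolding G1.pgens_def G1.pbase_def by blast
  have C'B: "op_adj G1.F.H (G1.cop \<xi>) \<in> G1.ptoep" using G1.ptoep_closed CB by (simp add: closed_star_subalgebra_def)
  have TA: "?T \<in> adjointable G2.F.H" using \<psi>(2)[OF CB] G2.ptoep_adjointable by blast
  have "op_mult G1.F.H (op_adj G1.F.H (G1.cop \<xi>)) (G1.cop \<xi>) = op_scale G1.F.H c (G1.lop (delta v))"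
  proof (rule G1.F.op_ext)
    have A: "op_mult G1.F.H (op_adj G1.F.H (G1.cop \<xi>)) (G1.cop \<xi>) \<in> G1.ptoep"
      by (rule closed_subalgebraD(3)[OF cl C'B CB])
    have B: "op_scale G1.F.H c (G1.lop (delta v)) \<in> G1.ptoep" by (rule closed_subalgebraD(4)[OF cl LB])
    show "op_mult G1.F.H (op_adj G1.F.H (G1.cop \<xi>)) (G1.cop \<xi>) \<in> G1.F.K \<rightarrow>\<^sub>E G1.F.K"
      "op_scale G1.F.H c (G1.lop (delta v)) \<in> G1.F.K \<rightarrow>\<^sub>E G1.F.K"
      using A B G1.ptoep_adjointable G1.F.adjointable_E by blast+
    fix x assume x: "x \<in> G1.F.K"
    have "lan G \<xi> (lcr G \<xi> x) p = c * (delta v (prng G p) * x p)" for p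
    proof (cases "p \<in> paths G")
      case True
      have "l2ip (G1.A.fb (prng G p)) \<xi> \<xi> = c * delta v (prng G p)"
      proof (cases "prng G p = v")
        case True
        then show ?thesis using l2ip_self[OF G1.A.K_l2[OF \<xi>, of v]] by (simp add: c_def delta_apply)
      next
        case False
        then have "l2ip (G1.A.fb (prng G p)) \<xi> \<xi> = 0"
          unfolding l2ip_def using supp by (intro infsum_0) (fastforce simp: fib_def)
        then show ?thesis using False by (simp add: delta_apply)
      qed
      then show ?thesis using G1.lan_lcr[OF True, of \<xi> \<xi> x] by simp
    next
      case False
      then show ?thesis using G1.F.K_outside[OF x] by (simp add: lan_def)
    qed
    then have "lan G \<xi> (lcr G \<xi> x) = (\<lambda>p. c * (delta v (prng G p) * x p))" by (rule ext)
    then show "op_mult G1.F.H (op_adj G1.F.H (G1.cop \<xi>)) (G1.cop \<xi>) x = op_scale G1.F.H c (G1.lop (delta v)) x"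
      unfolding G1.cop_adjointable(2)[OF \<xi>] G1.F.op_simps(2,3)[OF x]
      using x G1.lcr_K(1)[OF \<xi> x] by (simp add: G1.cop_def G1.lop_def)
  qed
  then have "op_mult G2.F.H (op_adj G2.F.H ?T) ?T = op_scale G2.F.H c (G2.lop (delta (\<sigma> v)))"
    using \<psi>(4)[OF C'B CB] \<psi>(5)[OF LB] vert[OF v] iso CB by (simp add: star_iso_def)
  moreover have p: "(\<sigma> v, []) \<in> paths G'" using \<sigma>[OF v] by simp
  note \<Omega> = G2.F.K_delta[OF p]
  ultimately have TT: "op_adj G2.F.H ?T (?T ?\<Omega>) = (\<lambda>q. c * ?\<Omega> q)"
    using G2.lop_delta[OF p, of "delta (\<sigma> v)"] by (metis (no_types, lifting) G2.F.op_simps(2,3) delta_apply mult_1 prng.simps(1))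
  have "complex_of_real ((l2n (G2.F.fb (\<sigma> v)) (?T ?\<Omega>))\<^sup>2) = l2ip (G2.F.fb (\<sigma> v)) (?T ?\<Omega>) (?T ?\<Omega>)"
    by (rule l2ip_self[OF G2.F.K_l2[OF G2.F.adjointable_K[OF TA \<Omega>]], symmetric])
  also have "\<dots> = l2ip (G2.F.fb (\<sigma> v)) ?\<Omega> (\<lambda>q. c * ?\<Omega> q)"
    unfolding G2.F.is_adjointD[OF G2.F.adjointable_op_adj(2)[OF TA] \<Omega> G2.F.adjointable_K[OF TA \<Omega>]] TT ..
  also have "\<dots> = c * ?\<Omega> (\<sigma> v, [])" using G2.F.inner_delta[OF p, of ?\<Omega>] by (simp only: l2ip_scale_right fst_conv)
  also have "\<dots> = c" by (simp add: delta_apply)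
  finally have "(l2n (G2.F.fb (\<sigma> v)) (?T ?\<Omega>))\<^sup>2 = (l2n (G1.A.fb v) \<xi>)\<^sup>2"
    unfolding c_def by (simp only: of_real_eq_iff)
  then show "l2n (G2.F.fb (\<sigma> v)) (?T ?\<Omega>) = l2n (G1.A.fb v) \<xi>" by (simp add: power2_eq_iff_nonneg)
qed (rule G1.pgens_ptoep G2.ptoep_adjointable \<sigma> vert; assumption?)+

text \<open>The relation \<open>T\<^sub>\<xi> \<delta>\<^sub>v = T\<^sub>\<xi>\<close> is carried
  over and fixes the source of the image. As an element of degree one the image then has its norm
  attained at the vacuum of \<open>\<sigma> v\<close>, and this norm is that of
  \<open>T\<^sub>\<xi>\<close>.\<close>

lemma isometric_iso_edges_le:
  assumes iso: "algebra_iso G1.F.H G1.ptens G2.F.H G2.ptens \<psi>"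
    and isom: "\<And>T. T \<in> G1.ptens \<Longrightarrow> op_norm G2.F.H (\<psi> T) = op_norm G1.F.H T"
    and deg: "\<psi> ` (G1.pdeg 1 \<inter> G1.ptens) = G2.pdeg 1 \<inter> G2.ptens"
    and \<sigma>: "\<And>v. v \<in> verts G \<Longrightarrow> \<sigma> v \<in> verts G'"
    and vert: "\<And>v. v \<in> verts G \<Longrightarrow> \<psi> (G1.lop (delta v)) = G2.lop (delta (\<sigma> v))"
  shows "edges_le G G' \<sigma>"
proof (rule edges_leI[OF iso G1.pgens_ptens G1.ptens_closed G2.ptens_adjointable _ \<sigma> vert])
  note \<psi> = algebra_isoD[OF iso]
  have CB: "G1.cop \<xi> \<in> G1.ptens" if "\<xi> \<in> G1.A.K" for \<xi> using G1.pgens_ptens that unfolding G1.pgens_def by blast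
  have D: "\<psi> (G1.cop \<xi>) \<in> G2.pdeg 1 \<inter> G2.ptens" if "\<xi> \<in> G1.A.K" for \<xi>
    using deg G1.cop_pdeg[OF that] CB[OF that] by blast
  then show "\<psi> (G1.cop \<xi>) \<in> G2.pdeg 1" if "\<xi> \<in> G1.A.K" for \<xi> using that by blast
  fix v \<xi> assume v: "v \<in> verts G" and \<xi>: "\<xi> \<in> G1.A.K" and supp: "\<And>e. \<xi> e \<noteq> 0 \<Longrightarrow> tail G e = v"
  have LB: "G1.lop (delta v) \<in> G1.ptens"
    using G1.pgens_ptens c0_delta[OF v] unfolding G1.pgens_def G1.pbase_def by blast
  have cl: "op_mult G1.F.H (G1.cop \<xi>) (G1.lop (delta v)) = G1.cop \<xi>" by (rule G1.cop_lop[OF \<xi> v]) (rule supp)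
  have on: "op_norm G1.F.H (G1.cop \<xi>) = l2n (G1.A.fb v) \<xi>" by (rule G1.op_norm_cop[OF \<xi> v]) (rule supp)
  have "op_mult G2.F.H (\<psi> (G1.cop \<xi>)) (G2.lop (delta (\<sigma> v))) = \<psi> (G1.cop \<xi>)"
    unfolding vert[OF v, symmetric] \<psi>(4)[OF CB[OF \<xi>] LB, symmetric] cl ..
  then have "op_norm G2.F.H (\<psi> (G1.cop \<xi>)) = l2n (G2.F.fb (\<sigma> v)) (\<psi> (G1.cop \<xi>) (delta (\<sigma> v, [])))"
    using D[OF \<xi>] by (intro G2.op_norm_degree_one \<sigma>[OF v]) auto
  then show "l2n (G2.F.fb (\<sigma> v)) (\<psi> (G1.cop \<xi>) (delta (\<sigma> v, []))) = l2n (G1.A.fb v) \<xi>"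
    using isom[OF CB[OF \<xi>]] on by metis
qed

end

text \<open>The forward condition defines \<sigma>, injectivity of \<phi> and \<open>P\<close> makes
  it injective, and the backward condition makes it surjective. The last conclusion allows the
  comparison of edges to be repeated for the inverse isomorphism with the inverse vertex
  map.\<close>

lemma induced_bij:
  assumes \<phi>: "inj_on \<phi> B" and P: "inj_on P V" "P ` V \<subseteq> B" and Q: "inj_on Q V'" "Q ` V' \<subseteq> \<phi> ` B"
    and fw: "\<And>v. v \<in> V \<Longrightarrow> \<exists>w\<in>V'. \<phi> (P v) = Q w"
    and bw: "\<And>w. w \<in> V' \<Longrightarrow> \<exists>v\<in>V. inv_into B \<phi> (Q w) = P v"
  obtains \<sigma> where "bij_betw \<sigma> V V'" "\<And>v. v \<in> V \<Longrightarrow> \<phi> (P v) = Q (\<sigma> v)"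
    "\<And>w. w \<in> V' \<Longrightarrow> inv_into B \<phi> (Q w) = P (inv_into V \<sigma> w)"
proof -
  obtain \<sigma> where \<sigma>: "\<And>v. v \<in> V \<Longrightarrow> \<sigma> v \<in> V'" "\<And>v. v \<in> V \<Longrightarrow> \<phi> (P v) = Q (\<sigma> v)" using fw by metis
  have inj: "inj_on \<sigma> V"
  proof (rule inj_onI)
    fix v v' assume v: "v \<in> V" "v' \<in> V" "\<sigma> v = \<sigma> v'"
    then have "\<phi> (P v) = \<phi> (P v')" using \<sigma>(2) by simp
    then have "P v = P v'" by (rule inj_onD[OF \<phi>]) (use P v in blast)+
    then show "v = v'" by (rule inj_onD[OF P(1)]) (use v in blast)+
  qed
  have surj: "\<exists>v\<in>V. w = \<sigma> v" if w: "w \<in> V'" for w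
  proof -
    obtain v where v: "v \<in> V" "inv_into B \<phi> (Q w) = P v" using bw[OF w] by blast
    have "Q w \<in> \<phi> ` B" using Q(2) w by blast
    then have "Q w = \<phi> (P v)" using v(2) by (metis f_inv_into_f)
    then have "Q w = Q (\<sigma> v)" using \<sigma>(2)[OF v(1)] by simp
    then have "w = \<sigma> v" by (rule inj_onD[OF Q(1) _ w \<sigma>(1)[OF v(1)]])
    then show ?thesis using v(1) by blast
  qed
  have "inv_into B \<phi> (Q w) = P (inv_into V \<sigma> w)" if "w \<in> V'" for w
  proof -
    obtain v where v: "v \<in> V" "w = \<sigma> v" using surj[OF \<open>w \<in> V'\<close>] by blast
    have "P v \<in> B" using P(2) v(1) by blast
    then show ?thesis using v \<sigma>(2)[OF v(1), symmetric] inv_into_f_f[OF \<phi>] inv_into_f_f[OF inj v(1)] by simp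
  qed
  moreover have "bij_betw \<sigma> V V'" unfolding bij_betw_def using inj surj \<sigma>(1) by blast
  ultimately show ?thesis using that \<sigma>(2) by blast
qed

section \<open>Unitary isomorphisms of the graph correspondences\<close>

text \<open>Gives names to the witnesses hidden in \<open>unitarily_isomorphic\<close>, so that they
  can be composed and inverted.\<close>

definition corr_unitary ::
    "('a::ring, 'x) corr \<Rightarrow> ('b::ring, 'y) corr \<Rightarrow> ('x \<Rightarrow> 'y) \<Rightarrow> ('a \<Rightarrow> 'b) \<Rightarrow> bool" where
  "corr_unitary X Y U \<rho> \<longleftrightarrow> U ` Xcar X = Xcar Y \<and>
     (\<forall>x\<in>Xcar X. Xnorm Y (U x) = Xnorm X x) \<and>
     (\<forall>x\<in>Xcar X. \<forall>y\<in>Xcar X. U (Xadd X x y) = Xadd Y (U x) (U y)) \<and>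
     (\<forall>x\<in>Xcar X. \<forall>c. U (Xscale X c x) = Xscale Y c (U x)) \<and>
     coeff_iso (coeff X) (coeff Y) \<rho> \<and>
     (\<forall>a\<in>Acar (coeff X). \<forall>b\<in>Acar (coeff X). \<forall>x\<in>Xcar X.
        U (Xright X (Xleft X a x) b) = Xright Y (Xleft Y (\<rho> a) (U x)) (\<rho> b))"

lemma unitarily_isomorphic_iff: "unitarily_isomorphic X Y \<longleftrightarrow> (\<exists>U \<rho>. corr_unitary X Y U \<rho>)"
  unfolding unitarily_isomorphic_def corr_unitary_def ..

lemma unitarily_isomorphic_trans:
  assumes "unitarily_isomorphic X Y" "unitarily_isomorphic Y Z"
  shows "unitarily_isomorphic X Z"
proof -
  obtain U \<rho> U' \<rho>' where U: "corr_unitary X Y U \<rho>" and U': "corr_unitary Y Z U' \<rho>'"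
    using assms unfolding unitarily_isomorphic_iff by blast
  have car: "U x \<in> Xcar Y" if "x \<in> Xcar X" for x using U that unfolding corr_unitary_def by blast
  have rcar: "\<rho> a \<in> Acar (coeff Y)" if "a \<in> Acar (coeff X)" for a
    using U that unfolding corr_unitary_def coeff_iso_def by (metis bij_betw_apply)
  have "coeff_iso (coeff X) (coeff Z) (\<rho>' \<circ> \<rho>)"
    using U U' rcar unfolding corr_unitary_def coeff_iso_def by (auto intro: bij_betw_trans)
  moreover have "(U' \<circ> U) ` Xcar X = Xcar Z"
    using U U' unfolding corr_unitary_def by (metis image_comp)
  ultimately have "corr_unitary X Z (U' \<circ> U) (\<rho>' \<circ> \<rho>)"
    using U U' car rcar unfolding corr_unitary_def by simp
  then show ?thesis unfolding unitarily_isomorphic_iff by blast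
qed

context two_graphs
begin

text \<open>Applied to a difference, linearity and isometry make \<open>U\<close> injective; with
  surjectivity the inverse exists, and it satisfies each law because \<open>U\<close> does.\<close>

lemma corr_unitary_inv:
  assumes U: "corr_unitary G1.A.H G2.A.H U \<rho>"
  shows "corr_unitary G2.A.H G1.A.H (inv_into G1.A.K U) (inv_into (Acar (c0 (verts G))) \<rho>)"
proof -
  let ?i = "inv_into G1.A.K U" and ?j = "inv_into (Acar (c0 (verts G))) \<rho>"
  have u: "U ` G1.A.K = G2.A.K" "\<And>x. x \<in> G1.A.K \<Longrightarrow> G2.A.hn (U x) = G1.A.hn x"
    "\<And>x y. x \<in> G1.A.K \<Longrightarrow> y \<in> G1.A.K \<Longrightarrow> U (\<lambda>e. x e + y e) = (\<lambda>f. U x f + U y f)"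
    "\<And>x c. x \<in> G1.A.K \<Longrightarrow> U (\<lambda>e. c * x e) = (\<lambda>f. c * U x f)"
    "coeff_iso (c0 (verts G)) (c0 (verts G')) \<rho>"
    "\<And>a b x. a \<in> Acar (c0 (verts G)) \<Longrightarrow> b \<in> Acar (c0 (verts G)) \<Longrightarrow> x \<in> G1.A.K \<Longrightarrow>
      U (\<lambda>e. a (head G e) * x e * b (tail G e)) = (\<lambda>f. \<rho> a (head G' f) * U x f * \<rho> b (tail G' f))"
    using U by (simp_all add: corr_unitary_def)
  have inj: "inj_on U G1.A.K"
  proof (rule inj_onI)
    fix x y assume x: "x \<in> G1.A.K" and y: "y \<in> G1.A.K" and eq: "U x = U y"
    have "U (\<lambda>e. x e - y e) = (\<lambda>_. 0)"
      using u(3)[OF x G1.A.K_scale[OF y, of "-1"]] u(4)[OF y, of "-1"] eq by simp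
    then have "G1.A.hn (\<lambda>e. x e - y e) = 0"
      using u(2)[OF G1.A.K_diff[OF x y]] by (simp add: G2.A.hn_zero)
    then have "(\<lambda>e. x e - y e) = (\<lambda>_. 0)" by (rule G1.A.hn_eq_0[OF G1.A.K_diff[OF x y]])
    then show "x = y" by (simp add: fun_eq_iff)
  qed
  have i: "?i y \<in> G1.A.K" "U (?i y) = y" if "y \<in> G2.A.K" for y
    using that by (simp_all add: u(1)[symmetric] inv_into_into f_inv_into_f)
  have j: "?j b \<in> Acar (c0 (verts G))" "\<rho> (?j b) = b" if "b \<in> Acar (c0 (verts G'))" for b
    using that u(5) by (auto simp: coeff_iso_def bij_betw_def inv_into_into f_inv_into_f)
  have hom: "?i y = x" if "x \<in> G1.A.K" "U x = y" for x y using inj that by auto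
  show ?thesis unfolding corr_unitary_def hmod_simps
  proof (intro conjI ballI allI coeff_iso_inv u(5))
    show "?i ` G2.A.K = G1.A.K" unfolding u(1)[symmetric] by (rule inv_into_image_cancel[OF inj order_refl])
    fix y assume "y \<in> G2.A.K"
    note y = i[OF this]
    show "G1.A.hn (?i y) = G2.A.hn y" using u(2)[OF y(1)] y(2) by simp
    show "?i (\<lambda>f. c * y f) = (\<lambda>e. c * ?i y e)" for c
      by (rule hom[OF G1.A.K_scale[OF y(1)]]) (simp add: u(4) y)
  next
    fix x y assume "x \<in> G2.A.K" "y \<in> G2.A.K"
    note x = i[OF this(1)] and y = i[OF this(2)]
    show "?i (\<lambda>f. x f + y f) = (\<lambda>e. ?i x e + ?i y e)"
      by (rule hom[OF G1.A.K_add[OF x(1) y(1)]]) (simp add: u(3) x y)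
  next
    fix a b x assume "a \<in> Acar (c0 (verts G'))" "b \<in> Acar (c0 (verts G'))" "x \<in> G2.A.K"
    note a = j[OF this(1)] and b = j[OF this(2)] and x = i[OF this(3)]
    show "?i (\<lambda>f. a (head G' f) * x f * b (tail G' f)) = (\<lambda>e. ?j a (head G e) * ?i x e * ?j b (tail G e))"
      by (rule hom[OF G1.A.K_right[OF G1.A.K_left[OF x(1) a(1)] b(1)]]) (simp add: u(6) a b x)
  qed
qed

text \<open>For \<open>x\<close> on edges from \<open>v\<close> to \<open>w\<close> one has
  \<open>\<delta>\<^sub>w x \<delta>\<^sub>v = x\<close>, and the image of this relation confines
  \<open>U x\<close> to edges from \<open>\<sigma> v\<close> to \<open>\<sigma> w\<close>. On a
  single fibre the module norm is the \<open>\<ell>\<^sup>2\<close> norm, so preservation of norms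
  is enough and no inner products are compared.\<close>

lemma corr_unitary_edges_le:
  assumes U: "corr_unitary G1.A.H G2.A.H U \<rho>"
    and \<sigma>: "\<And>v. v \<in> verts G \<Longrightarrow> \<sigma> v \<in> verts G'"
    and vert: "\<And>v. v \<in> verts G \<Longrightarrow> \<rho> (delta v) = delta (\<sigma> v)"
  shows "edges_le G G' \<sigma>"
  unfolding edges_le_def
proof (intro ballI)
  fix v w assume v: "v \<in> verts G" and w: "w \<in> verts G"
  let ?A = "edges_between G v w" and ?B = "edges_between G' (\<sigma> v) (\<sigma> w)"
  have u: "\<And>x. x \<in> G1.A.K \<Longrightarrow> U x \<in> G2.A.K" "\<And>x. x \<in> G1.A.K \<Longrightarrow> G2.A.hn (U x) = G1.A.hn x"
    "\<And>x y. x \<in> G1.A.K \<Longrightarrow> y \<in> G1.A.K \<Longrightarrow> U (\<lambda>e. x e + y e) = (\<lambda>f. U x f + U y f)"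
    "\<And>x c. x \<in> G1.A.K \<Longrightarrow> U (\<lambda>e. c * x e) = (\<lambda>f. c * U x f)"
    "\<And>a b x. a \<in> Acar (c0 (verts G)) \<Longrightarrow> b \<in> Acar (c0 (verts G)) \<Longrightarrow> x \<in> G1.A.K \<Longrightarrow>
      U (\<lambda>e. a (head G e) * x e * b (tail G e)) = (\<lambda>f. \<rho> a (head G' f) * U x f * \<rho> b (tail G' f))"
    using U by (auto simp: corr_unitary_def)
  have supp: "f \<in> ?B" if x: "x \<in> G1.A.K" "\<And>e. x e \<noteq> 0 \<Longrightarrow> e \<in> ?A" and ne: "U x f \<noteq> 0" for x f
  proof -
    have eq: "(\<lambda>e. delta w (head G e) * x e * delta v (tail G e)) = x"
      using x(2) by (fastforce simp: delta_apply edges_between_def fun_eq_iff)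
    have "U x f = delta (\<sigma> w) (head G' f) * U x f * delta (\<sigma> v) (tail G' f)"
      using fun_cong[OF u(5)[OF c0_delta[OF w] c0_delta[OF v] x(1)], of f]
      by (simp only: eq vert[OF v] vert[OF w])
    then have "head G' f = \<sigma> w" "tail G' f = \<sigma> v" using ne by (auto simp: delta_apply split: if_splits)
    moreover have "f \<in> arcs G'" using G2.A.K_outside[OF u(1)[OF x(1)]] ne by blast
    ultimately show ?thesis by (simp add: edges_between_def)
  qed
  have restrict: "y \<in> l2 ?B" "l2n ?B y = G2.A.hn y" if y: "y \<in> G2.A.K" "\<And>f. y f \<noteq> 0 \<Longrightarrow> f \<in> ?B" for y
  proof -
    have sub: "?B \<subseteq> G2.A.fb (\<sigma> v)" by (auto simp: edges_between_def fib_def)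
    have l: "y \<in> l2 (G2.A.fb (\<sigma> v))" by (rule G2.A.K_l2[OF y(1)])
    show "y \<in> l2 ?B" using l summable_on_subset_banach[OF _ sub] by (simp add: l2_def)
    have "infsum (\<lambda>f. (cmod (y f))\<^sup>2) ?B = infsum (\<lambda>f. (cmod (y f))\<^sup>2) (G2.A.fb (\<sigma> v))"
      by (rule infsum_cong_neutral) (use sub y(2) in auto)
    moreover have "G2.A.hn y = l2n (G2.A.fb (\<sigma> v)) y"
      by (rule G2.A.single_fibre_K(2)[OF _ l]) (use y(2) in \<open>auto simp: edges_between_def\<close>)
    ultimately show "l2n ?B y = G2.A.hn y" by (simp add: l2n_def)
  qed
  show "\<exists>g. inj_on g ?A \<and> g ` ?A \<subseteq> ?B"
  proof (rule G1.isometry_edges_inj[OF u(3,4)])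
    fix x assume x: "x \<in> G1.A.K" "\<And>e. x e \<noteq> 0 \<Longrightarrow> e \<in> ?A"
    note r = restrict[OF u(1)[OF x(1)] supp[OF x]]
    show "U x \<in> l2 ?B" by (rule r(1))
    have "G1.A.hn x = l2n (G1.A.fb v) x"
      by (rule G1.A.single_fibre_K(2)[OF _ G1.A.K_l2[OF x(1)]]) (use x(2) in \<open>auto simp: edges_between_def\<close>)
    then show "l2n ?B (U x) = l2n (G1.A.fb v) x" using r(2) u(2)[OF x(1)] by simp
  qed
qed

end

lemma (in graph) unitarily_isomorphic_coordinates:
  "unitarily_isomorphic A.H X" "unitarily_isomorphic X A.H"
proof -
  show "unitarily_isomorphic A.H X" by (rule corr_iso_imp_unitarily_isomorphic[OF X_iso])
  show "unitarily_isomorphic X A.H"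
    by (rule corr_iso_imp_unitarily_isomorphic[OF corr_iso_sym[OF X_iso]]) simp
qed

lemma delta_inj: "inj_on (delta :: 'i \<Rightarrow> 'i \<Rightarrow> complex) S"
  by (rule inj_onI) (metis delta_apply zero_neq_one)

section \<open>Recovering the isomorphism of graphs\<close>

context two_graphs
begin

sublocale flip: two_graphs G' G ..

lemma unitarily_isomorphic_imp_iso:
  assumes wf: "wf_digraph G" "wf_digraph G'"
    and "unitarily_isomorphic (graph_corr G) (graph_corr G')"
  shows "digraph_iso G G'"
proof -
  have "unitarily_isomorphic G1.A.H G2.A.H"
    by (rule unitarily_isomorphic_trans[OF G1.unitarily_isomorphic_coordinates(1)
          unitarily_isomorphic_trans[OF assms(3) G2.unitarily_isomorphic_coordinates(2)]])
  then obtain U \<rho> where U: "corr_unitary G1.A.H G2.A.H U \<rho>" unfolding unitarily_isomorphic_iff by blast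
  then have \<rho>: "coeff_iso (c0 (verts G)) (c0 (verts G')) \<rho>" by (simp add: corr_unitary_def)
  then have b: "bij_betw \<rho> (Acar (c0 (verts G))) (Acar (c0 (verts G')))" by (simp add: coeff_iso_def)
  have sub: "delta ` verts G \<subseteq> Acar (c0 (verts G))" by (intro image_subsetI c0_delta)
  have "delta ` verts G' \<subseteq> Acar (c0 (verts G'))" by (intro image_subsetI c0_delta)
  then have sub': "delta ` verts G' \<subseteq> \<rho> ` Acar (c0 (verts G))" using b by (simp add: bij_betw_def)
  obtain \<sigma> where \<sigma>: "bij_betw \<sigma> (verts G) (verts G')" "\<And>v. v \<in> verts G \<Longrightarrow> \<rho> (delta v) = delta (\<sigma> v)"
    "\<And>w. w \<in> verts G' \<Longrightarrow> inv_into (Acar (c0 (verts G))) \<rho> (delta w) = delta (inv_into (verts G) \<sigma> w)"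
    by (rule induced_bij[OF bij_betw_imp_inj_on[OF b] delta_inj sub delta_inj sub' coeff_iso_delta[OF \<rho>]
      coeff_iso_delta[OF coeff_iso_inv[OF \<rho>]]]) (assumption, assumption, rule that)
  have le: "edges_le G G' \<sigma>"
    by (rule corr_unitary_edges_le[OF U bij_betw_apply[OF \<sigma>(1)] \<sigma>(2)])
  have ge: "edges_le G' G (inv_into (verts G) \<sigma>)"
    by (rule flip.corr_unitary_edges_le[OF corr_unitary_inv[OF U] bij_betw_apply[OF bij_betw_inv_into[OF \<sigma>(1)]] \<sigma>(3)])
  show ?thesis by (rule edges_le_imp_iso[OF wf \<sigma>(1) le ge])
qed

text \<open>\<open>vertex_map\<close> is used for the isomorphism and, with the graphs exchanged,
  for its inverse, which maps \<open>D2\<close> onto \<open>D1\<close>.\<close>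

lemma algebra_iso_vertex_bij:
  assumes iso: "algebra_iso G1.F.H B1 G2.F.H B2 \<psi>" and D: "D1 \<subseteq> B1" "\<psi> ` D1 = D2"
    and cl: "closed_subalgebra G1.F.H B1" "closed_subalgebra G2.F.H B2"
    and diag: "\<And>T. T \<in> D1 \<Longrightarrow> G1.diag T" "\<And>T. T \<in> D2 \<Longrightarrow> G2.diag T"
    and lop: "\<And>v. v \<in> verts G \<Longrightarrow> G1.lop (delta v) \<in> D1" "\<And>w. w \<in> verts G' \<Longrightarrow> G2.lop (delta w) \<in> D2"
  obtains \<sigma> where "bij_betw \<sigma> (verts G) (verts G')"
    "\<And>v. v \<in> verts G \<Longrightarrow> \<psi> (G1.lop (delta v)) = G2.lop (delta (\<sigma> v))"
    "\<And>w. w \<in> verts G' \<Longrightarrow> inv_into B1 \<psi> (G2.lop (delta w)) = G1.lop (delta (inv_into (verts G) \<sigma> w))"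
proof (rule induced_bij[where P="\<lambda>v. G1.lop (delta v)" and Q="\<lambda>w. G2.lop (delta w)" and V="verts G" and V'="verts G'" and \<phi>=\<psi> and B=B1])
  note b = algebra_isoD(1)[OF iso]
  show "inj_on \<psi> B1" by (rule bij_betw_imp_inj_on[OF b])
  show "inj_on (\<lambda>v. G1.lop (delta v)) (verts G)" by (rule inj_onI) (rule G1.lop_delta_inj)
  show "inj_on (\<lambda>w. G2.lop (delta w)) (verts G')" by (rule inj_onI) (rule G2.lop_delta_inj)
  show "(\<lambda>v. G1.lop (delta v)) ` verts G \<subseteq> B1" using lop(1) D(1) by blast
  show "(\<lambda>w. G2.lop (delta w)) ` verts G' \<subseteq> \<psi> ` B1" using lop(2) D by blast
  show "\<exists>w\<in>verts G'. \<psi> (G1.lop (delta v)) = G2.lop (delta w)" if "v \<in> verts G" for v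
    by (rule vertex_map[OF iso D cl(1) diag lop that])
  have "D2 \<subseteq> B2" using D b by (auto simp: bij_betw_def)
  then show "\<exists>v\<in>verts G. inv_into B1 \<psi> (G2.lop (delta w)) = G1.lop (delta v)" if "w \<in> verts G'" for w
    by (rule flip.vertex_map[OF algebra_iso_inv[OF iso cl(1)] _ inv_into_image[OF b D] cl(2) diag(2,1) lop(2,1) that])
qed (rule that)

lemma base_preserving_graded_isomorphic_imp_iso:
  assumes wf: "wf_digraph G" "wf_digraph G'"
    and "base_preserving_graded_isomorphic (graph_corr G) (graph_corr G')"
  shows "digraph_iso G G'"
proof -
  obtain \<phi> where \<phi>: "star_iso (fock_corr (graph_corr G)) (toeplitz (graph_corr G))
      (fock_corr (graph_corr G')) (toeplitz (graph_corr G')) \<phi>"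
    "\<phi> ` base_alg (graph_corr G) = base_alg (graph_corr G')"
    "\<And>n. \<phi> ` toeplitz_degree (graph_corr G) n = toeplitz_degree (graph_corr G') n"
    using assms(3) unfolding base_preserving_graded_isomorphic_def by blast
  define \<psi> where "\<psi> = G2.AdV \<circ> (\<phi> \<circ> G1.AdW)"
  have iso: "star_iso G1.F.H G1.ptoep G2.F.H G2.ptoep \<psi>"
    unfolding \<psi>_def by (rule star_iso_trans[OF star_iso_trans[OF G1.AdW_star_iso \<phi>(1)] G2.AdV_star_iso])
  have base: "\<psi> ` G1.pbase = G2.pbase"
    unfolding \<psi>_def by (simp only: image_comp[symmetric] G1.Ad_base \<phi>(2) G2.AdV_base)
  have deg: "\<psi> ` G1.pdeg 1 = G2.pdeg 1"
    unfolding \<psi>_def by (simp only: image_comp[symmetric] G1.Ad_degree \<phi>(3) G2.AdV_degree)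
  have a: "algebra_iso G1.F.H G1.ptoep G2.F.H G2.ptoep \<psi>" using iso by (simp add: star_iso_def)
  note b = algebra_isoD(1)[OF a]
  have cl: "closed_subalgebra G1.F.H G1.ptoep" "closed_subalgebra G2.F.H G2.ptoep"
    using G1.ptoep_closed G2.ptoep_closed by (simp_all add: closed_star_subalgebra_def)
  have sub: "G1.pbase \<subseteq> G1.ptoep" using G1.pgens_ptoep by (simp add: G1.pgens_def)
  obtain \<sigma> where \<sigma>: "bij_betw \<sigma> (verts G) (verts G')"
    "\<And>v. v \<in> verts G \<Longrightarrow> \<psi> (G1.lop (delta v)) = G2.lop (delta (\<sigma> v))"
    "\<And>w. w \<in> verts G' \<Longrightarrow> inv_into G1.ptoep \<psi> (G2.lop (delta w)) = G1.lop (delta (inv_into (verts G) \<sigma> w))"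
    by (rule algebra_iso_vertex_bij[OF a sub base cl])
      (auto simp: G1.pbase_def G2.pbase_def intro: G1.lop_diag G2.lop_diag c0_delta)
  have le: "edges_le G G' \<sigma>" by (rule star_iso_edges_le[OF iso deg bij_betw_apply[OF \<sigma>(1)] \<sigma>(2)])
  have ge: "edges_le G' G (inv_into (verts G) \<sigma>)"
    by (rule flip.star_iso_edges_le[OF star_iso_inv[OF iso G1.ptoep_closed] inv_into_image[OF b G1.pdeg_ptoep deg]
          bij_betw_apply[OF bij_betw_inv_into[OF \<sigma>(1)]] \<sigma>(3)])
  show ?thesis by (rule edges_le_imp_iso[OF wf \<sigma>(1) le ge])
qed

end

text \<open>The amplification of order one is the module itself, with vectors written as families of
  one element. This extracts preservation of operator norms from complete isometry.\<close>

lemma (in fibred) op_norm_amplification_one: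
  assumes T: "T \<in> K \<rightarrow>\<^sub>E K"
  shows "op_norm (amplification 1 H) (matrix_op 1 H (\<lambda>_ _. T)) = op_norm H T"
proof (rule op_norm_transport[where W="\<lambda>x. \<lambda>i\<in>{..<1::nat}. x"])
  have TK: "T x \<in> K" if "x \<in> K" for x using T that by (rule PiE_mem)
  have car: "Xcar (amplification 1 H) = {..<1::nat} \<rightarrow>\<^sub>E K" by (simp add: amplification_def)
  show "(\<lambda>x. \<lambda>i\<in>{..<1::nat}. x) ` Xcar H = Xcar (amplification 1 H)"
  proof (intro equalityI subsetI)
    fix y assume "y \<in> Xcar (amplification 1 H)"
    then have y: "y \<in> {..<1::nat} \<rightarrow>\<^sub>E K" unfolding car .
    have "y = (\<lambda>i\<in>{..<1::nat}. y 0)"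
      using y by (intro extensionalityI[of _ "{..<1::nat}"]) (auto simp: PiE_def)
    moreover have "y 0 \<in> K" using y by (rule PiE_mem) simp
    ultimately show "y \<in> (\<lambda>x. \<lambda>i\<in>{..<1::nat}. x) ` Xcar H" by (metis hmod_simps(2) imageI)
  next
    fix y assume "y \<in> (\<lambda>x. \<lambda>i\<in>{..<1::nat}. x) ` Xcar H"
    then show "y \<in> Xcar (amplification 1 H)" unfolding car by auto
  qed
  fix x assume "x \<in> Xcar H"
  then have x: "x \<in> K" by simp
  show "Xnorm (amplification 1 H) (\<lambda>i\<in>{..<1::nat}. x) = Xnorm H x"
    by (simp add: Xnorm_def amplification_def)
  show "T x \<in> Xcar H" using TK[OF x] by simp
  have "(\<lambda>i\<in>{..<1::nat}. x) \<in> Xcar (amplification 1 H)" unfolding car using x by (intro PiE_I) auto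
  then show "matrix_op 1 H (\<lambda>_ _. T) (\<lambda>i\<in>{..<1::nat}. x) = (\<lambda>i\<in>{..<1::nat}. T x)"
    by (simp add: matrix_op_def)
qed

context two_graphs
begin

lemma graded_completely_isometric_imp_iso:
  assumes wf: "wf_digraph G" "wf_digraph G'"
    and "graded_completely_isometric (graph_corr G) (graph_corr G')"
  shows "digraph_iso G G'"
proof -
  obtain \<phi> where \<phi>: "completely_isometric_iso (fock_corr (graph_corr G)) (tensor_alg (graph_corr G))
      (fock_corr (graph_corr G')) (tensor_alg (graph_corr G')) \<phi>"
    "\<And>n. \<phi> ` tensor_degree (graph_corr G) n = tensor_degree (graph_corr G') n"
    using assms(3) unfolding graded_completely_isometric_def by blast
  define \<psi> where "\<psi> = G2.AdV \<circ> (\<phi> \<circ> G1.AdW)"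
  have ci: "completely_isometric_iso G1.F.H G1.ptens G2.F.H G2.ptens \<psi>"
    unfolding \<psi>_def
    by (rule completely_isometric_iso_trans[OF completely_isometric_iso_trans[OF G1.completely_isometric_AdW \<phi>(1)]
          G2.completely_isometric_AdV])
  have deg: "\<psi> ` (G1.pdeg (int n) \<inter> G1.ptens) = G2.pdeg (int n) \<inter> G2.ptens" for n
    unfolding \<psi>_def by (simp only: image_comp[symmetric] G1.Ad_tensor_degree \<phi>(2) G2.AdV_tensor_degree)
  \<comment> \<open>Degree 0 provides the vertex projections and degree 1 the edges.\<close>
  note deg0 = deg[of 0, simplified] and deg1 = deg[of 1, simplified]
  have a: "algebra_iso G1.F.H G1.ptens G2.F.H G2.ptens \<psi>" using ci by (simp add: completely_isometric_iso_def)
  note b = algebra_isoD(1)[OF a]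
  have isom: "op_norm G2.F.H (\<psi> T) = op_norm G1.F.H T" if T: "T \<in> G1.ptens" for T
  proof -
    have "T \<in> G1.F.K \<rightarrow>\<^sub>E G1.F.K" "\<psi> T \<in> G2.F.K \<rightarrow>\<^sub>E G2.F.K"
      using T algebra_isoD(2)[OF a T] G1.ptens_adjointable G2.ptens_adjointable G1.F.adjointable_E G2.F.adjointable_E
      by blast+
    note n = G1.F.op_norm_amplification_one[OF this(1)] G2.F.op_norm_amplification_one[OF this(2)]
    have "op_norm (amplification 1 G2.F.H) (matrix_op 1 G2.F.H (\<lambda>_ _. \<psi> T)) =
        op_norm (amplification 1 G1.F.H) (matrix_op 1 G1.F.H (\<lambda>_ _. T))"
      by (rule ci[unfolded completely_isometric_iso_def, THEN conjunct2, rule_format, of 1 "\<lambda>_ _. T"]) (rule T)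
    then show ?thesis unfolding n .
  qed
  have isom': "op_norm G1.F.H (inv_into G1.ptens \<psi> S) = op_norm G2.F.H S" if "S \<in> G2.ptens" for S
    using isom[of "inv_into G1.ptens \<psi> S"] that b by (auto simp: bij_betw_def inv_into_into f_inv_into_f)
  have lopB: "G1.lop (delta v) \<in> G1.pdeg 0 \<inter> G1.ptens" if "v \<in> verts G" for v
    using G1.lop_pdeg[OF c0_delta[OF that]] G1.pgens_ptens c0_delta[OF that]
    unfolding G1.pgens_def G1.pbase_def by blast
  have lopB': "G2.lop (delta v) \<in> G2.pdeg 0 \<inter> G2.ptens" if "v \<in> verts G'" for v
    using G2.lop_pdeg[OF c0_delta[OF that]] G2.pgens_ptens c0_delta[OF that]
    unfolding G2.pgens_def G2.pbase_def by blast
  obtain \<sigma> where \<sigma>: "bij_betw \<sigma> (verts G) (verts G')"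
    "\<And>v. v \<in> verts G \<Longrightarrow> \<psi> (G1.lop (delta v)) = G2.lop (delta (\<sigma> v))"
    "\<And>w. w \<in> verts G' \<Longrightarrow> inv_into G1.ptens \<psi> (G2.lop (delta w)) = G1.lop (delta (inv_into (verts G) \<sigma> w))"
    by (rule algebra_iso_vertex_bij[OF a Int_lower2 deg0 G1.ptens_closed G2.ptens_closed _ _ lopB lopB'])
      (auto intro: G1.degree_zero_diag G2.degree_zero_diag)
  have le: "edges_le G G' \<sigma>" by (rule isometric_iso_edges_le[OF a isom deg1 bij_betw_apply[OF \<sigma>(1)] \<sigma>(2)])
  have ge: "edges_le G' G (inv_into (verts G) \<sigma>)"
    by (rule flip.isometric_iso_edges_le[OF algebra_iso_inv[OF a G1.ptens_closed] isom'
          inv_into_image[OF b Int_lower2 deg1] bij_betw_apply[OF bij_betw_inv_into[OF \<sigma>(1)]] \<sigma>(3)])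
  show ?thesis by (rule edges_le_imp_iso[OF wf \<sigma>(1) le ge])
qed

end

theorem theorem6p2:
  fixes G :: "('v, 'e) pre_digraph" and G' :: "('w, 'f) pre_digraph"
  assumes "wf_digraph G" and "wf_digraph G'"
  shows
    "(digraph_iso G G' \<longleftrightarrow> unitarily_isomorphic (graph_corr G) (graph_corr G')) \<and>
     (unitarily_isomorphic (graph_corr G) (graph_corr G') \<longleftrightarrow>
        graded_completely_isometric (graph_corr G) (graph_corr G')) \<and>
     (graded_completely_isometric (graph_corr G) (graph_corr G') \<longleftrightarrow>
        base_preserving_graded_isomorphic (graph_corr G) (graph_corr G'))"
proof -
  interpret G: wf_digraph G by fact
  interpret G': wf_digraph G' by fact
  interpret two_graphs G G' by unfold_locales simp_all
  note assms
  moreover have "unitarily_isomorphic (graph_corr G) (graph_corr G') \<and>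
    graded_completely_isometric (graph_corr G) (graph_corr G') \<and>
    base_preserving_graded_isomorphic (graph_corr G) (graph_corr G')" if iso: "digraph_iso G G'"
  proof -
    obtain \<sigma> \<tau> where "graph_iso G G' \<sigma> \<tau>" using iso_imp_graph_iso[OF assms(2) iso] .
    then interpret graph_iso G G' \<sigma> \<tau> .
    show ?thesis
      using unitarily_isomorphic_corr graded_completely_isometric_corr base_preserving_graded_isomorphic_corr by blast
  qed
  \<comment> \<open>Each of the three conditions has been compared with \<open>digraph_iso\<close>
    in both directions; the chain of equivalences is then propositional.\<close>
  ultimately show ?thesis
    using unitarily_isomorphic_imp_iso graded_completely_isometric_imp_iso base_preserving_graded_isomorphic_imp_iso
    by blast
qed

end
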